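(* Let $m\ge 0$ be an integer. The sequence of $\mathcal{D}$-modules $$\cdots\longrightarrow \frac{\mathcal V_{2m+4}}{(x_0^-)^{(2)}\mathcal V_{2m+8}}\longrightarrow \frac{\mathcal V_{2m+2}}{(x_0^-)^{(2)}\mathcal V_{2m+6}}\longrightarrow \frac{\mathcal V_{2m}}{(x_0^-)^{(2)}\mathcal V_{2m+4}}\longrightarrow A_{2m}\longrightarrow 0,$$ in which the maps between consecutive quotients are induced by $x_0^-$ and the last map is the natural projection, is a resolution of $A_{2m}$ by free $\mathcal{D}$-modules; its terms are isomorphic to $\mathcal{D}\otimes_{\mathbb C} W_{2n}$, i.e. $\mathcal V_{2n}/(x_0^-)^{(2)}\mathcal V_{2n+4}\simeq \mathcal D\otimes W_{2n}$ for $n\ge m$, so that the resolution has the form $$\cdots\longrightarrow \mathcal D\otimes W_{2m+2}\longrightarrow \mathcal D\otimes W_{2m}\longrightarrow A_{2m}\longrightarrow 0 .$$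
   Context: Let $q$ be an indeterminate, $A=\mathbb{C}[q,q^{-1}]$, and for $m\in\mathbb Z$ let $V_A(\Lambda_0)_{2m}=A[b_n\mid n<0]\,\mathrm e^{\Lambda_0+m\alpha_1}$ (free $A$-module, formal symbols $\mathrm e^{\Lambda_0+m\alpha_1}$). On $\bigoplus_m V_A(\Lambda_0)_{2m}$ (and on its extension of scalars to $\mathbb C(q)$) let $b_n$ ($n<0$) act by multiplication, $b_n=n(q^n+q^{-n})\,\partial/\partial b_{-n}$ for $n>0$, let $\mathrm e^{-\alpha_1}$ send $P\mathrm e^{\Lambda_0+m\alpha_1}$ to $P\mathrm e^{\Lambda_0+(m-1)\alpha_1}$, and let $\partial$ act on $V_A(\Lambda_0)_{2m}$ by the scalar $2m$. Define operators $x_n^-$ by $$\sum_{n\in\mathbb Z}x_n^-z^{-n-1}=\exp\Big(-\sum_{n\ge1}\tfrac{b_{-n}}{n}(qz)^n\Big)\exp\Big(\sum_{n\ge1}\tfrac{b_n}{n}z^{-n}\Big)\mathrm e^{-\alpha_1}z^{-\partial}.$$ The operators $x_0^-$ and $(x_0^-)^{(2)}=(x_0^-)^2/(q+q^{-1})$ preserve the $A$-lattice. Put $\mathcal V_{2m}=\big(A/(q-\sqrt{-1})A\big)\otimes_A V_A(\Lambda_0)_{2m}=\mathbb C[b_{-1},b_{-2},\dots]\mathrm e^{\Lambda_0+m\alpha_1}$, and denote again by $x_0^-:\mathcal V_{2m}\to\mathcal V_{2m-2}$ and $(x_0^-)^{(2)}:\mathcal V_{2m}\to\mathcal V_{2m-4}$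 the specialized operators. They commute with each other, $(x_0^-)^2=0$ on the specialization, and both commute with multiplication by $b_{-1},b_{-3},\dots$. Let $\mathcal D=\mathbb C[b_{-1},b_{-3},b_{-5},\dots]$, acting on $\mathcal V_{2m}$ by multiplication, and for $m\ge 0$ let $$A_{2m}=\frac{\mathcal V_{2m}}{x_0^-\mathcal V_{2m+2}+(x_0^-)^{(2)}\mathcal V_{2m+4}},$$ a $\mathcal D$-module. Fermionic Fock space: let $\tilde\psi_{2n},\tilde\psi_{2n}^*$ ($n\in\mathbb Z$) satisfy $[\tilde\psi_{2k},\tilde\psi_{2l}]_+=[\tilde\psi^*_{2k},\tilde\psi^*_{2l}]_+=0$, $[\tilde\psi_{2k},\tilde\psi^*_{2l}]_+=\delta_{k,l}$, and let $|0\rangle$ be the vacuum with $\tilde\psi_{2n}|0\rangle=0$ for $n>0$ and $\tilde\psi^*_{2n}|0\rangle=0$ for $n\le0$. For $m\in\mathbb Z$, $\tilde H_{2m}$ is the complex vector space with basis $\tilde\psi_{2r_1}\cdots\tilde\psi_{2r_k}\tilde\psi^*_{2s_1}\cdots\tilde\psi^*_{2s_{k+m}}|0\rangle$, $r_1<\dots<r_k\le0<s_1<\dots<s_{k+m}$ ($k\ge\max(0,-m)$). Let $\omega=-\sum_{n\ge1}\tilde\psi_{-2(n-1)}\tilde\psi_{2n}$, so $\omega:\tilde H_{2n+4}\to\tilde H_{2n}$, and $W_{2n}=\tilde H_{2n}/\omega\tilde H_{2n+4}$. *)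

theory Defs
  imports
    Complex_Main
    "HOL-Library.Poly_Mapping"
    "HOL-Computational_Algebra.Fraction_Field"
    "HOL-Algebra.AbelCoset"
    "HOL-Algebra.Module"
    "HOL-Algebra.Free_Abelian_Groups"
begin

section \<open>Quotients, exactness, freeness and tensor products of modules\<close>

text \<open>Where a module is not a ring, the fields \<open>mult\<close> and \<open>one\<close> of the record are unused and are
  left undefined.\<close>

definition mod_hom ::
  "('r, 'i) ring_scheme \<Rightarrow> ('r, 'a, 'j) module_scheme \<Rightarrow> ('r, 'b, 'k) module_scheme \<Rightarrow> ('a \<Rightarrow> 'b) set"
  where "mod_hom R M N =
    {h \<in> carrier M \<rightarrow> carrier N.
       (\<forall>x\<in>carrier M. \<forall>y\<in>carrier M. h (x \<oplus>\<^bsub>M\<^esub> y) = h x \<oplus>\<^bsub>N\<^esub> h y) \<and>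
       (\<forall>r\<in>carrier R. \<forall>x\<in>carrier M. h (r \<odot>\<^bsub>M\<^esub> x) = r \<odot>\<^bsub>N\<^esub> h x)}"

definition mod_iso ::
  "('r, 'i) ring_scheme \<Rightarrow> ('r, 'a, 'j) module_scheme \<Rightarrow> ('r, 'b, 'k) module_scheme \<Rightarrow> ('a \<Rightarrow> 'b) set"
  where "mod_iso R M N = {h \<in> mod_hom R M N. bij_betw h (carrier M) (carrier N)}"

definition quot_module :: "('r, 'a, 'j) module_scheme \<Rightarrow> 'a set \<Rightarrow> ('r, 'a set) module"
  where "quot_module M N =
    \<lparr>carrier = a_rcosets\<^bsub>M\<^esub> N, monoid.mult = undefined, monoid.one = undefined, ring.zero = N, add = set_add M,
     smult = (\<lambda>r X. \<Union>x\<in>X. N +>\<^bsub>M\<^esub> (r \<odot>\<^bsub>M\<^esub> x))\<rparr>"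

text \<open>The map \<open>M/N \<rightarrow> M'/N'\<close> induced by \<open>f\<close> with \<open>f N \<subseteq> N'\<close>: the union below is then the single
  coset \<open>N' + f x\<close>, for any \<open>x\<close> in the coset \<open>X\<close> of \<open>N\<close>.\<close>

definition induced_map :: "('r, 'b, 'k) module_scheme \<Rightarrow> 'b set \<Rightarrow> ('a \<Rightarrow> 'b) \<Rightarrow> 'a set \<Rightarrow> 'b set"
  where "induced_map M' N' f X = (\<Union>x\<in>X. N' +>\<^bsub>M'\<^esub> f x)"

text \<open>\<open>\<dots> \<rightarrow> P 2 \<rightarrow> P 1 \<rightarrow> P 0 \<rightarrow> A \<rightarrow> 0\<close> is an exact sequence of \<open>R\<close>-modules, with
  \<open>d k : P (k + 1) \<rightarrow> P k\<close> and augmentation \<open>\<epsilon>\<close>.\<close>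

definition resolution ::
  "('r, 'i) ring_scheme \<Rightarrow> (nat \<Rightarrow> ('r, 'a, 'j) module_scheme) \<Rightarrow> (nat \<Rightarrow> 'a \<Rightarrow> 'a)
    \<Rightarrow> ('a \<Rightarrow> 'b) \<Rightarrow> ('r, 'b, 'k) module_scheme \<Rightarrow> bool"
  where "resolution R P d \<epsilon> A \<longleftrightarrow>
    (\<forall>k. Module.module R (P k)) \<and> Module.module R A \<and>
    (\<forall>k. d k \<in> mod_hom R (P (Suc k)) (P k)) \<and> \<epsilon> \<in> mod_hom R (P 0) A \<and>
    \<epsilon> ` carrier (P 0) = carrier A \<and>
    a_kernel (P 0) A \<epsilon> = d 0 ` carrier (P 1) \<and>
    (\<forall>k. a_kernel (P (Suc k)) (P k) (d k) = d (Suc k) ` carrier (P (Suc (Suc k))))"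

definition is_basis :: "('r, 'i) ring_scheme \<Rightarrow> ('r, 'a, 'j) module_scheme \<Rightarrow> 'a set \<Rightarrow> bool"
  where "is_basis R M B \<longleftrightarrow> B \<subseteq> carrier M \<and>
    (\<forall>x\<in>carrier M. \<exists>!c. c \<in> B \<rightarrow> carrier R \<and> (\<forall>b. b \<notin> B \<longrightarrow> c b = \<zero>\<^bsub>R\<^esub>) \<and>
       finite {b. c b \<noteq> \<zero>\<^bsub>R\<^esub>} \<and> x = (\<Oplus>\<^bsub>M\<^esub>b\<in>{b. c b \<noteq> \<zero>\<^bsub>R\<^esub>}. c b \<odot>\<^bsub>M\<^esub> b))"

definition free_module :: "('r, 'i) ring_scheme \<Rightarrow> ('r, 'a, 'j) module_scheme \<Rightarrow> bool"
  where "free_module R M \<longleftrightarrow> Module.module R M \<and> (\<exists>B. is_basis R M B)"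

definition free_resolution ::
  "('r, 'i) ring_scheme \<Rightarrow> (nat \<Rightarrow> ('r, 'a, 'j) module_scheme) \<Rightarrow> (nat \<Rightarrow> 'a \<Rightarrow> 'a)
    \<Rightarrow> ('a \<Rightarrow> 'b) \<Rightarrow> ('r, 'b, 'k) module_scheme \<Rightarrow> bool"
  where "free_resolution R P d \<epsilon> A \<longleftrightarrow> resolution R P d \<epsilon> A \<and> (\<forall>k. free_module R (P k))"

text \<open>The tensor product \<open>D \<otimes>\<^sub>K W\<close> of a commutative \<open>K\<close>-algebra \<open>D\<close> with a \<open>K\<close>-module \<open>W\<close>, as a
  \<open>D\<close>-module: the free abelian group on \<open>D \<times> W\<close> modulo the subgroup generated by the usual
  relations. The record \<open>tensor_pre\<close> is that free abelian group with the action
  \<open>d \<cdot> (a, w) = (d a, w)\<close>; it satisfies the module laws only after passing to the quotient.\<close>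

definition tensor_pre ::
  "('k, 'd, 'i) module_scheme \<Rightarrow> ('k, 'w, 'j) module_scheme \<Rightarrow> ('d, ('d \<times> 'w) \<Rightarrow>\<^sub>0 int) module"
  where "tensor_pre D W =
    \<lparr>carrier = carrier (free_Abelian_group (carrier D \<times> carrier W)),
     monoid.mult = undefined, monoid.one = undefined, ring.zero = 0, add = (+),
     smult = (\<lambda>d. frag_extend (\<lambda>(a, w). frag_of (d \<otimes>\<^bsub>D\<^esub> a, w)))\<rparr>"

definition tensor_rels ::
  "('k, 'l) ring_scheme \<Rightarrow> ('k, 'd, 'i) module_scheme \<Rightarrow> ('k, 'w, 'j) module_scheme
    \<Rightarrow> (('d \<times> 'w) \<Rightarrow>\<^sub>0 int) set"
  where "tensor_rels K D W =
    {frag_of (a \<oplus>\<^bsub>D\<^esub> b, w) - frag_of (a, w) - frag_of (b, w) | a b w.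
       a \<in> carrier D \<and> b \<in> carrier D \<and> w \<in> carrier W} \<union>
    {frag_of (a, v \<oplus>\<^bsub>W\<^esub> w) - frag_of (a, v) - frag_of (a, w) | a v w.
       a \<in> carrier D \<and> v \<in> carrier W \<and> w \<in> carrier W} \<union>
    {frag_of (c \<odot>\<^bsub>D\<^esub> a, w) - frag_of (a, c \<odot>\<^bsub>W\<^esub> w) | c a w.
       c \<in> carrier K \<and> a \<in> carrier D \<and> w \<in> carrier W}"

definition tensor_module ::
  "('k, 'l) ring_scheme \<Rightarrow> ('k, 'd, 'i) module_scheme \<Rightarrow> ('k, 'w, 'j) module_scheme
    \<Rightarrow> ('d, (('d \<times> 'w) \<Rightarrow>\<^sub>0 int) set) module"
  where "tensor_module K D W =
    quot_module (tensor_pre D W) (generate (add_monoid (tensor_pre D W)) (tensor_rels K D W))"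

section \<open>The scalars\<close>

text \<open>The Laurent polynomial ring \<open>A = \<complex>[q, q\<^sup>-\<^sup>1]\<close> is the group algebra of the integers; \<open>\<complex>(q)\<close> is
  its field of fractions.\<close>

type_synonym laurent = "int \<Rightarrow>\<^sub>0 complex"
type_synonym ratq = "laurent fract"

definition of_laurent :: "laurent \<Rightarrow> ratq"
  where "of_laurent a = Fract a 1"

definition qq :: ratq
  where "qq = of_laurent (Poly_Mapping.single 1 1)"

definition laurent_eval :: "complex \<Rightarrow> laurent \<Rightarrow> complex"
  where "laurent_eval z a = (\<Sum>k\<in>Poly_Mapping.keys a. Poly_Mapping.lookup a k * (z powi k))"

section \<open>Polynomials in the bosonic variables\<close>

text \<open>\<open>'k bpoly\<close> is the polynomial ring over \<open>'k\<close> in the variables \<open>b\<^bsub>-1\<^esub>, b\<^bsub>-2\<^esub>, \<dots>\<close>; the variable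
  with index \<open>j :: nat\<close> is \<open>b\<^bsub>-(j+1)\<^esub>\<close>. The element \<open>P e\<^bsup>\<Lambda>\<^sub>0 + m \<alpha>\<^sub>1\<^esup>\<close> is \<open>single m P :: 'k charged\<close>, so
  \<open>'k charged\<close> is the direct sum over all integers \<open>m\<close>. Its ring structure (that of the group
  algebra of the integers over \<open>'k bpoly\<close>) is used only to write multiplication by polynomials and
  the shift of \<open>m\<close>.\<close>

type_synonym 'k bpoly = "(nat \<Rightarrow>\<^sub>0 nat) \<Rightarrow>\<^sub>0 'k"
type_synonym 'k charged = "int \<Rightarrow>\<^sub>0 'k bpoly"

text \<open>In the following definitions \<open>n \<ge> 1\<close>: \<open>bvar n\<close> is the variable \<open>b\<^bsub>-n\<^esub>\<close> and \<open>bderiv n\<close> is the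
  partial derivative with respect to it.\<close>

definition bvar :: "nat \<Rightarrow> 'k::comm_ring_1 bpoly"
  where "bvar n = Poly_Mapping.single (Poly_Mapping.single (n - 1) 1) 1"

definition bderiv :: "nat \<Rightarrow> 'k::comm_ring_1 bpoly \<Rightarrow> 'k bpoly"
  where "bderiv n p = (\<Sum>M\<in>Poly_Mapping.keys p.
    Poly_Mapping.single (M - Poly_Mapping.single (n - 1) 1)
      (of_nat (Poly_Mapping.lookup M (n - 1)) * Poly_Mapping.lookup p M))"

definition poly_mult :: "'k::comm_ring_1 bpoly \<Rightarrow> 'k charged \<Rightarrow> 'k charged"
  where "poly_mult p v = Poly_Mapping.single 0 p * v"

definition scalar_mult :: "'k::comm_ring_1 \<Rightarrow> 'k charged \<Rightarrow> 'k charged"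
  where "scalar_mult c v = poly_mult (Poly_Mapping.single 0 c) v"

section \<open>The operators over \<open>\<complex>(q)\<close>\<close>

text \<open>The operators \<open>b\<^bsub>-n\<^esub>\<close> and \<open>b\<^bsub>n\<^esub>\<close> for \<open>n \<ge> 1\<close>.\<close>

definition b_neg :: "nat \<Rightarrow> ratq charged \<Rightarrow> ratq charged"
  where "b_neg n v = poly_mult (bvar n) v"

definition b_pos :: "nat \<Rightarrow> ratq charged \<Rightarrow> ratq charged"
  where "b_pos n v = scalar_mult (of_nat n * (qq ^ n + inverse qq ^ n)) (Poly_Mapping.map (bderiv n) v)"

definition e_neg_alpha :: "ratq charged \<Rightarrow> ratq charged"
  where "e_neg_alpha v = Poly_Mapping.single (-1) 1 * v"

text \<open>A formal series \<open>\<Sum>\<^sub>k F\<^sub>k z\<^sup>k\<close>, \<open>k \<in> \<int>\<close>, of operators is the family \<open>F\<close> of its coefficients. Products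
  and exponentials are computed coefficientwise; for the series used below all these sums have
  only finitely many nonzero terms on each vector.\<close>

type_synonym opser = "int \<Rightarrow> ratq charged \<Rightarrow> ratq charged"

definition ser_mult :: "opser \<Rightarrow> opser \<Rightarrow> opser"
  where "ser_mult F G = (\<lambda>k v. Sum_any (\<lambda>i. F i (G (k - i) v)))"

definition ser_const :: "(ratq charged \<Rightarrow> ratq charged) \<Rightarrow> opser"
  where "ser_const T = (\<lambda>k v. if k = 0 then T v else 0)"

primrec ser_pow :: "opser \<Rightarrow> nat \<Rightarrow> opser"
  where
    "ser_pow F 0 = ser_const (\<lambda>v. v)"
  | "ser_pow F (Suc j) = ser_mult F (ser_pow F j)"

definition ser_exp :: "opser \<Rightarrow> opser"
  where "ser_exp F = (\<lambda>k v. Sum_any (\<lambda>j. scalar_mult (inverse (of_nat (fact j))) (ser_pow F j k v)))"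

text \<open>\<open>-\<Sum>\<^bsub>n\<ge>1\<^esub> (b\<^bsub>-n\<^esub>/n) (q z)\<^sup>n\<close>\<close>

definition creation_ser :: opser
  where "creation_ser = (\<lambda>k v.
    if k > 0 then scalar_mult (- (qq ^ nat k) / of_nat (nat k)) (b_neg (nat k) v) else 0)"

text \<open>\<open>\<Sum>\<^bsub>n\<ge>1\<^esub> (b\<^bsub>n\<^esub>/n) z\<^sup>-\<^sup>n\<close>\<close>

definition annihilation_ser :: opser
  where "annihilation_ser = (\<lambda>k v.
    if k < 0 then scalar_mult (1 / of_nat (nat (-k))) (b_pos (nat (-k)) v) else 0)"

text \<open>\<open>z\<^sup>-\<^sup>\<partial>\<close>, where \<open>\<partial>\<close> is the scalar \<open>2m\<close> on the component with index \<open>m\<close>\<close>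

definition z_neg_partial :: opser
  where "z_neg_partial = (\<lambda>k v.
    \<Sum>m\<in>Poly_Mapping.keys v. if k = - (2 * m) then Poly_Mapping.single m (Poly_Mapping.lookup v m) else 0)"

definition x_minus_ser :: opser
  where "x_minus_ser =
    ser_mult (ser_exp creation_ser)
      (ser_mult (ser_exp annihilation_ser)
        (ser_mult (ser_const e_neg_alpha) z_neg_partial))"

text \<open>\<open>\<Sum>\<^sub>n x\<^sub>n\<^sup>- z\<^bsup>-n-1\<^esup> = x_minus_ser\<close>\<close>

definition x_minus :: "int \<Rightarrow> ratq charged \<Rightarrow> ratq charged"
  where "x_minus n = x_minus_ser (- n - 1)"

definition x_minus0_div2 :: "ratq charged \<Rightarrow> ratq charged"
  where "x_minus0_div2 v = scalar_mult (inverse (qq + inverse qq)) (x_minus 0 (x_minus 0 v))"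

section \<open>Specialization at \<open>q = \<surd>-1\<close>\<close>

text \<open>\<open>embed_fock\<close> is \<open>v \<mapsto> 1 \<otimes> v\<close>, with values in the \<open>A\<close>-lattice of vectors all of whose
  coefficients lie in the range of \<open>of_laurent\<close>; \<open>spec_fock\<close> is reduction of the \<open>A\<close>-lattice modulo
  \<open>q - \<surd>-1\<close>, with \<open>A/(q - \<surd>-1)A\<close> identified with \<open>\<complex>\<close> by evaluation (it is only meaningful on the
  lattice). For an \<open>A\<close>-linear \<open>T\<close> preserving the lattice, \<open>specialize T\<close> is the induced operator on
  the reduction, computed on the representative \<open>embed_fock v\<close> of \<open>v\<close>.\<close>

definition map_coeffs :: "('k::zero \<Rightarrow> 'l::zero) \<Rightarrow> 'k charged \<Rightarrow> 'l charged"
  where "map_coeffs f = Poly_Mapping.map (Poly_Mapping.map f)"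

definition embed_fock :: "complex charged \<Rightarrow> ratq charged"
  where "embed_fock = map_coeffs (\<lambda>c. of_laurent (Poly_Mapping.single 0 c))"

definition spec_fock :: "ratq charged \<Rightarrow> complex charged"
  where "spec_fock = map_coeffs (\<lambda>c. laurent_eval \<i> (inv_into UNIV of_laurent c))"

definition specialize :: "(ratq charged \<Rightarrow> ratq charged) \<Rightarrow> complex charged \<Rightarrow> complex charged"
  where "specialize T v = spec_fock (T (embed_fock v))"

definition x0 :: "complex charged \<Rightarrow> complex charged"
  where "x0 = specialize (x_minus 0)"

definition x0_2 :: "complex charged \<Rightarrow> complex charged"
  where "x0_2 = specialize x_minus0_div2"

section \<open>The \<open>\<D>\<close>-modules\<close>

definition complex_ring :: "complex ring"
  where "complex_ring = \<lparr>carrier = UNIV, monoid.mult = (*), monoid.one = 1, ring.zero = 0, add = (+)\<rparr>"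

text \<open>The algebra \<open>\<D> = \<complex>[b\<^bsub>-1\<^esub>, b\<^bsub>-3\<^esub>, \<dots>]\<close>, as a subalgebra of \<open>complex bpoly\<close>\<close>

definition D_alg :: "(complex, complex bpoly) module"
  where "D_alg =
    \<lparr>carrier = {p. \<forall>M\<in>Poly_Mapping.keys p. \<forall>j\<in>Poly_Mapping.keys M. odd (j + 1)},
     monoid.mult = (*), monoid.one = 1, ring.zero = 0, add = (+), smult = (\<lambda>c p. Poly_Mapping.single 0 c * p)\<rparr>"

text \<open>\<open>V_mod m\<close>, \<open>Q_mod m\<close> and \<open>A_mod m\<close> are \<open>\<V>\<^bsub>2m\<^esub>\<close>, \<open>\<V>\<^bsub>2m\<^esub> / (x\<^sub>0\<^sup>-)\<^bsup>(2)\<^esup> \<V>\<^bsub>2m+4\<^esub>\<close> and \<open>A\<^bsub>2m\<^esub>\<close>.\<close>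

definition V_mod :: "int \<Rightarrow> (complex bpoly, complex charged) module"
  where "V_mod m =
    \<lparr>carrier = range (Poly_Mapping.single m), monoid.mult = undefined, monoid.one = undefined,
     ring.zero = 0, add = (+), smult = poly_mult\<rparr>"

definition Q_sub :: "int \<Rightarrow> complex charged set"
  where "Q_sub m = x0_2 ` carrier (V_mod (m + 2))"

definition A_sub :: "int \<Rightarrow> complex charged set"
  where "A_sub m = x0 ` carrier (V_mod (m + 1)) <+>\<^bsub>V_mod m\<^esub> x0_2 ` carrier (V_mod (m + 2))"

definition Q_mod :: "int \<Rightarrow> (complex bpoly, complex charged set) module"
  where "Q_mod m = quot_module (V_mod m) (Q_sub m)"

definition A_mod :: "int \<Rightarrow> (complex bpoly, complex charged set) module"
  where "A_mod m = quot_module (V_mod m) (A_sub m)"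

text \<open>The map \<open>\<V>\<^bsub>2m+2\<^esub> / (x\<^sub>0\<^sup>-)\<^bsup>(2)\<^esup> \<V>\<^bsub>2m+6\<^esub> \<rightarrow> \<V>\<^bsub>2m\<^esub> / (x\<^sub>0\<^sup>-)\<^bsup>(2)\<^esup> \<V>\<^bsub>2m+4\<^esub>\<close> induced by \<open>x\<^sub>0\<^sup>-\<close>, and the
  natural projection onto \<open>A\<^bsub>2m\<^esub>\<close>\<close>

definition Q_map :: "int \<Rightarrow> complex charged set \<Rightarrow> complex charged set"
  where "Q_map m = induced_map (V_mod m) (Q_sub m) x0"

definition A_proj :: "int \<Rightarrow> complex charged set \<Rightarrow> complex charged set"
  where "A_proj m = induced_map (V_mod m) (A_sub m) (\<lambda>v. v)"

section \<open>The fermionic Fock space\<close>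

text \<open>The basis vector
  \<open>\<psi>\<^bsub>2r\<^sub>1\<^esub> \<cdots> \<psi>\<^bsub>2r\<^sub>k\<^esub> \<psi>\<^sup>*\<^bsub>2s\<^sub>1\<^esub> \<cdots> \<psi>\<^sup>*\<^bsub>2s\<^sub>l\<^esub> |0\<rangle>\<close> with \<open>r\<^sub>1 < \<dots> < r\<^sub>k \<le> 0 < s\<^sub>1 < \<dots> < s\<^sub>l\<close> is encoded by the finite set
  \<open>T = {r\<^sub>1, \<dots>, r\<^sub>k, s\<^sub>1, \<dots>, s\<^sub>l}\<close>: elements \<open>\<le> 0\<close> stand for \<open>\<psi>\<close>'s and elements \<open>> 0\<close> for
  \<open>\<psi>\<^sup>*\<close>'s. Hence \<open>\<psi>\<^bsub>2n\<^esub>\<close> inserts \<open>n\<close> if \<open>n \<le> 0\<close> and deletes it if \<open>n > 0\<close>, conversely for \<open>\<psi>\<^sup>*\<^bsub>2n\<^esub>\<close>, and the sign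
  comes from anticommuting it past the factors with smaller index. Lemmas \<open>psi_psi\<close> to
  \<open>psi_star_basis\<close> below confirm that this is the representation described by the
  anticommutation relations.\<close>

type_synonym fermion = "int set \<Rightarrow>\<^sub>0 complex"

definition fsign :: "int \<Rightarrow> int set \<Rightarrow> complex"
  where "fsign n T = (- 1) ^ card {t \<in> T. t < n}"

definition f_insert :: "int \<Rightarrow> fermion \<Rightarrow> fermion"
  where "f_insert n v = (\<Sum>T\<in>Poly_Mapping.keys v.
    if n \<notin> T then Poly_Mapping.single (insert n T) (fsign n T * Poly_Mapping.lookup v T) else 0)"

definition f_delete :: "int \<Rightarrow> fermion \<Rightarrow> fermion"
  where "f_delete n v = (\<Sum>T\<in>Poly_Mapping.keys v.
    if n \<in> T then Poly_Mapping.single (T - {n}) (fsign n T * Poly_Mapping.lookup v T) else 0)"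

text \<open>\<open>psi n\<close> and \<open>psi_star n\<close> are \<open>\<psi>\<^bsub>2n\<^esub>\<close> and \<open>\<psi>\<^sup>*\<^bsub>2n\<^esub>\<close>.\<close>

definition psi :: "int \<Rightarrow> fermion \<Rightarrow> fermion"
  where "psi n = (if n \<le> 0 then f_insert n else f_delete n)"

definition psi_star :: "int \<Rightarrow> fermion \<Rightarrow> fermion"
  where "psi_star n = (if n \<le> 0 then f_delete n else f_insert n)"

lemma f_insert_single:
  "f_insert n (Poly_Mapping.single T c) =
    (if n \<in> T then 0 else Poly_Mapping.single (insert n T) (fsign n T * c))"
  by (cases "c = 0") (auto simp: f_insert_def)

lemma f_delete_single:
  "f_delete n (Poly_Mapping.single T c) =
    (if n \<in> T then Poly_Mapping.single (T - {n}) (fsign n T * c) else 0)"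
  by (cases "c = 0") (auto simp: f_delete_def)

lemma f_insert_zero: "f_insert n 0 = 0" and f_delete_zero: "f_delete n 0 = 0"
  by (simp_all add: f_insert_def f_delete_def)

lemma fsign_insert:
  assumes "finite T" "k \<notin> T"
  shows "fsign n (insert k T) = (if k < n then - fsign n T else fsign n T)"
proof (cases "k < n")
  case True
  then have "{t \<in> insert k T. t < n} = insert k {t \<in> T. t < n}" by auto
  then show ?thesis using assms True by (simp add: fsign_def)
next
  case False
  then have "{t \<in> insert k T. t < n} = {t \<in> T. t < n}" by auto
  then show ?thesis using False by (simp add: fsign_def)
qed

lemma fsign_remove:
  assumes "finite T" "k \<in> T"
  shows "fsign n (T - {k}) = (if k < n then - fsign n T else fsign n T)"
  using fsign_insert[of "T - {k}" k n] assms by (auto simp: insert_absorb)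

lemma fsign_square: "fsign n T * (fsign n T * c) = c"
  by (simp add: fsign_def flip: mult.assoc power_mult_distrib)

lemmas f_simps = f_insert_single f_delete_single f_insert_zero f_delete_zero
  fsign_insert fsign_remove

lemma f_insert_insert:
  assumes "finite T"
  shows "f_insert k (f_insert l (Poly_Mapping.single T c))
    + f_insert l (f_insert k (Poly_Mapping.single T c)) = 0"
  using assms by (auto simp: f_simps insert_commute mult_ac simp flip: single_add)

lemma f_delete_delete:
  assumes "finite T"
  shows "f_delete k (f_delete l (Poly_Mapping.single T c))
    + f_delete l (f_delete k (Poly_Mapping.single T c)) = 0"
proof -
  have "T - {k} - {l} = T - {l} - {k}" by auto
  then show ?thesis
    using assms by (auto simp: f_simps mult_ac simp flip: single_add)
qed

lemma f_insert_delete: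
  assumes "finite T"
  shows "f_insert k (f_delete l (Poly_Mapping.single T c))
    + f_delete l (f_insert k (Poly_Mapping.single T c))
    = (if k = l then Poly_Mapping.single T c else 0)"
proof (cases "k = l")
  case True
  then show ?thesis using assms by (auto simp: f_simps insert_absorb fsign_square)
next
  case False
  then have "insert k T - {l} = insert k (T - {l})" by auto
  then show ?thesis
    using assms False by (auto simp: f_simps mult_ac simp flip: single_add)
qed

lemma psi_psi:
  assumes "finite T"
  shows "psi k (psi l (Poly_Mapping.single T c)) + psi l (psi k (Poly_Mapping.single T c)) = 0"
  using assms f_insert_insert f_delete_delete f_insert_delete[of T k l c] f_insert_delete[of T l k c]
  by (auto simp: psi_def add.commute split: if_splits)

lemma psi_star_psi_star:
  assumes "finite T"
  shows "psi_star k (psi_star l (Poly_Mapping.single T c))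
    + psi_star l (psi_star k (Poly_Mapping.single T c)) = 0"
  using assms f_insert_insert f_delete_delete f_insert_delete[of T k l c] f_insert_delete[of T l k c]
  by (auto simp: psi_star_def add.commute split: if_splits)

lemma psi_psi_star:
  assumes "finite T"
  shows "psi k (psi_star l (Poly_Mapping.single T c)) + psi_star l (psi k (Poly_Mapping.single T c))
    = (if k = l then Poly_Mapping.single T c else 0)"
  using assms f_insert_insert[of T k l c] f_delete_delete[of T k l c]
    f_insert_delete[of T k l c] f_insert_delete[of T l k c]
  by (auto simp: psi_def psi_star_def add.commute split: if_splits)

lemma psi_vacuum: "n > 0 \<Longrightarrow> psi n (Poly_Mapping.single {} 1) = 0"
  and psi_star_vacuum: "n \<le> 0 \<Longrightarrow> psi_star n (Poly_Mapping.single {} 1) = 0"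
  by (simp_all add: psi_def psi_star_def f_simps)

lemma fsign_least: "\<forall>t\<in>T. n < t \<Longrightarrow> fsign n T = 1"
proof -
  assume "\<forall>t\<in>T. n < t"
  then have "{t \<in> T. t < n} = {}" by auto
  then show ?thesis unfolding fsign_def by (metis card.empty power_0)
qed

lemma psi_basis:
  assumes "r \<le> 0" "\<forall>t\<in>T. r < t"
  shows "psi r (Poly_Mapping.single T 1) = Poly_Mapping.single (insert r T) 1"
  using assms by (auto simp: psi_def f_simps fsign_least)

lemma psi_star_basis:
  assumes "s > 0" "\<forall>t\<in>T. s < t"
  shows "psi_star s (Poly_Mapping.single T 1) = Poly_Mapping.single (insert s T) 1"
  using assms by (auto simp: psi_star_def f_simps fsign_least)

definition charge :: "int set \<Rightarrow> int"
  where "charge T = int (card {s \<in> T. 0 < s}) - int (card {r \<in> T. r \<le> 0})"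

text \<open>\<open>H_mod n\<close> and \<open>W_mod n\<close> are \<open>H\<^bsub>2n\<^esub>\<close> and \<open>W\<^bsub>2n\<^esub>\<close>.\<close>

definition H_mod :: "int \<Rightarrow> (complex, fermion) module"
  where "H_mod n =
    \<lparr>carrier = {v. \<forall>T\<in>Poly_Mapping.keys v. finite T \<and> charge T = n},
     monoid.mult = undefined, monoid.one = undefined, ring.zero = 0, add = (+),
     smult = (\<lambda>c. Poly_Mapping.map ((*) c))\<rparr>"

definition omega :: "fermion \<Rightarrow> fermion"
  where "omega v = - Sum_any (\<lambda>n. if 1 \<le> n then psi (- (n - 1)) (psi n v) else 0)"

definition W_mod :: "int \<Rightarrow> (complex, fermion set) module"
  where "W_mod n = quot_module (H_mod n) (omega ` carrier (H_mod (n + 2)))"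

definition DW_mod :: "int \<Rightarrow> (complex bpoly, ((complex bpoly \<times> fermion set) \<Rightarrow>\<^sub>0 int) set) module"
  where "DW_mod n = tensor_module complex_ring D_alg (W_mod n)"

end

theory Submission
  imports Defs "HOL-Computational_Algebra.Formal_Power_Series"
begin

text \<open>At \<open>q = \<surd>-1\<close> the current \<open>x\<^sup>-(z)\<close> is the product of a series \<open>O(z) = \<Sum> O\<^sub>k z\<^sup>k\<close> over \<open>\<D>\<close> with a fermionic vertex operator
  in the variables of even index, whence \<open>x\<^sub>0\<^sup>- = \<Sum>\<^bsub>n\<ge>1\<^esub> O\<^bsub>2n-1\<^esub> \<psi>\<^bsub>2n\<^esub>\<close>. Since \<open>O(z) O(-z) = 1\<close>, the divided square is
  \<open>\<surd>-1 (\<omega> + \<Sum> \<Gamma>\<^bsub>ab\<^esub> \<psi>\<^bsub>2a+2\<^esub> \<psi>\<^bsub>2b+2\<^esub>)\<close> with \<open>\<Gamma>\<^bsub>ab\<^esub> \<in> \<D>\<close>, and the second summand is absorbed by adding to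
  the creation operators \<open>\<psi>\<^bsub>-2k\<^esub>\<close> a combination of the annihilation operators \<open>\<psi>\<^bsub>2b+2\<^esub>\<close>. The boson-fermion correspondence
  for the modified fermions identifies \<open>\<V>\<^bsub>2m\<^esub>\<close> with \<open>\<D> \<otimes> H\<^bsub>2m\<^esub>\<close> so that \<open>(x\<^sub>0\<^sup>-)\<^bsup>(2)\<^esup>\<close> becomes \<open>\<surd>-1 \<omega>\<close> and, the \<open>O\<^bsub>2n-1\<^esub>\<close>
  being free generators of \<open>\<D>\<close>, \<open>x\<^sub>0\<^sup>-\<close> becomes the differential \<open>\<kappa>\<close> of a Koszul complex.

  In positive charge \<open>\<kappa>\<close> is exact by the usual homotopy and \<open>\<omega>\<close> is injective because it is the lowering operator of an
  \<open>sl\<^sub>2\<close>-triple with the charge as Cartan element. As both commute, the quotients by \<open>\<omega>\<close> are exact under \<open>\<kappa>\<close>. Finally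
  \<open>\<omega>\<close> acts on the second tensor factor only, so a basis of a complement of \<open>\<omega> H\<^bsub>2n+4\<^esub>\<close> in \<open>H\<^bsub>2n\<^esub>\<close> is a \<open>\<D>\<close>-basis of the
  quotient, which is therefore \<open>\<D> \<otimes> W\<^bsub>2n\<^esub>\<close>.\<close>

text \<open>After specialization x_0^- squares to 0, so its divided square has to be computed over
  C(q) first. There the exchange factor of x^-(z) with itself is (1 - x)(1 - q^2 x), and the
  symmetry of normal ordering splits off 1 + q^2, which cancels the denominator and leaves a formula
  that can be evaluated. The Gamma term is the obstacle: the odd series enters as the kernel 1 + x
  S(x) S(y) - C(x) C(y), which is not 0 but vanishes for x = y. Dividing by x - y gives Gamma, and
  the factor x - y turns normally ordered products into products of two annihilation operators.
  These can be absorbed without changing psi_{2n} for n > 0, so that the formula for x_0^- survives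
  the modification. The coefficients of x_0^- are not the variables of D but other generators.
  Letting a polynomial ring act through the change of generators \<open>iot\<close>, with inverse
  \<open>eta\<close> on D, makes them variables, so that the Koszul homotopy by partial derivatives
  is available. The hypothesis m >= 0 enters in the exactness chase: for index n, injectivity of
  omega is applied in charge n + 1, which has to be positive.\<close>

abbreviation coef :: "('a \<Rightarrow>\<^sub>0 'b::zero) \<Rightarrow> 'a \<Rightarrow> 'b" where "coef \<equiv> Poly_Mapping.lookup"
abbreviation sg :: "'a \<Rightarrow> 'b::zero \<Rightarrow> 'a \<Rightarrow>\<^sub>0 'b" where "sg \<equiv> Poly_Mapping.single"
abbreviation keys :: "('a \<Rightarrow>\<^sub>0 'b::zero) \<Rightarrow> 'a set" where "keys \<equiv> Poly_Mapping.keys"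
abbreviation Cst :: "'k::comm_ring_1 \<Rightarrow> 'k bpoly" where "Cst c \<equiv> Poly_Mapping.single 0 c"

section \<open>Finitely supported functions\<close>

lemma sum_single: "(\<Sum>k\<in>keys p. sg k (coef p k)) = p"
  by (rule poly_mapping_eqI) (simp add: lookup_sum lookup_single when_def in_keys_iff)

lemma pm_induct [case_names zero single add]:
  assumes "P 0" "\<And>k c. P (sg k c)" "\<And>x y. P x \<Longrightarrow> P y \<Longrightarrow> P (x + y)"
  shows "P (p :: 'a \<Rightarrow>\<^sub>0 'b::comm_monoid_add)"
proof -
  have "P (\<Sum>k\<in>A. sg k (coef p k))" if "finite A" for A
    using that by induction (auto intro: assms)
  then show ?thesis using sum_single[of p] by (metis finite_keys)
qed

lemma keys_sum_superset:
  assumes "finite A" "keys p \<subseteq> A" "\<And>k. g k 0 = 0"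
  shows "(\<Sum>k\<in>keys p. g k (coef p k)) = (\<Sum>k\<in>A. g k (coef p k))"
  by (rule sum.mono_neutral_left) (use assms in \<open>auto simp: in_keys_iff\<close>)

text \<open>Linear maps are defined below as sums over the support of the argument; this is the
  common source of their additivity, with the union of two supports as joint index set.\<close>

lemma keys_sum_add:
  assumes "\<And>k. g k 0 = 0" "\<And>k a b. g k (a + b) = g k a + (g k b :: 'c::comm_monoid_add)"
  shows "(\<Sum>k\<in>keys (p + q). g k (coef (p + q) k)) =
    (\<Sum>k\<in>keys p. g k (coef p k)) + (\<Sum>k\<in>keys q. g k (coef q k))"
  by (subst (1 2 3) keys_sum_superset[of "keys p \<union> keys q"])
    (use keys_add[of p q] in \<open>auto simp: assms lookup_add sum.distrib\<close>)

lemma keys_sum_single: "g k 0 = 0 \<Longrightarrow> (\<Sum>j\<in>keys (sg k c). g j (coef (sg k c) j)) = g k c"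
  by (cases "c = 0") auto

lemma additive_sum:
  fixes f :: "'a::ab_group_add \<Rightarrow> 'b::ab_group_add"
  assumes "\<And>x y. f (x + y) = f x + f y"
  shows "f 0 = 0" "f (- x) = - f x" "f (x - y) = f x - f y" "f (sum g A) = (\<Sum>a\<in>A. f (g a))"
proof -
  interpret additive f by standard (rule assms)
  show "f 0 = 0" "f (- x) = - f x" "f (x - y) = f x - f y" "f (sum g A) = (\<Sum>a\<in>A. f (g a))"
    by (simp_all add: zero minus diff sum)
qed

lemma pm_ext_additive:
  fixes f g :: "('a \<Rightarrow>\<^sub>0 'b::ab_group_add) \<Rightarrow> 'c::ab_group_add"
  assumes "\<And>x y. f (x + y) = f x + f y" "\<And>x y. g (x + y) = g x + g y"
    "\<And>k c. f (sg k c) = g (sg k c)"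
  shows "f p = g p"
  by (induction p rule: pm_induct)
    (auto simp: assms additive_sum(1)[of f, OF assms(1)] additive_sum(1)[of g, OF assms(2)])

section \<open>Polynomials and derivations\<close>

lemma Cst_add: "Cst (a + b) = Cst a + Cst b" and Cst_mult: "Cst (a * b) = Cst a * Cst b"
  by (simp_all add: single_add mult_single)

lemma Cst_sum: "Cst (sum f A) = (\<Sum>a\<in>A. Cst (f a))"
  by (rule additive_sum(4)) (rule Cst_add)

lemma coef_Cst_mult: "coef (Cst c * p) M = c * coef p M"
  by (subst mult_map_scale_conv_mult[symmetric]) (simp add: Poly_Mapping.map.rep_eq when_def)

lemma bpoly_induct [case_names const var add mult]:
  assumes "\<And>c. P (Cst c)" "\<And>n. n \<ge> 1 \<Longrightarrow> P (bvar n)" "\<And>x y. P x \<Longrightarrow> P y \<Longrightarrow> P (x + y)"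
    "\<And>x y. P x \<Longrightarrow> P y \<Longrightarrow> P (x * y)"
  shows "P (p :: 'k::comm_ring_1 bpoly)"
proof (induction p rule: pm_induct)
  case zero
  then show ?case using assms(1)[of 0] by simp
next
  case (single M c)
  have var: "P (sg (sg j n) 1)" for j n
  proof (induction n)
    case 0
    then show ?case using assms(1)[of 1] by simp
  next
    case (Suc n)
    have "sg (sg j (Suc n)) 1 = (bvar (Suc j) * sg (sg j n) 1 :: 'k bpoly)"
      by (simp add: bvar_def mult_single flip: single_add)
    then show ?case using assms(4) assms(2)[of "Suc j"] Suc by simp
  qed
  have "P (sg M 1)" for M
  proof (induction M rule: pm_induct)
    case zero
    then show ?case using assms(1)[of 1] by simp
  next
    case (single k c)
    then show ?case by (rule var)
  next
    case (add x y)
    then show ?case using assms(4)[of "sg x 1" "sg y 1"] by (simp add: mult_single)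
  qed
  then show ?case using assms(4)[of "Cst c" "sg M 1"] assms(1) by (simp add: mult_single)
next
  case (add x y)
  then show ?case by (rule assms(3))
qed

lemma bderiv_add: "bderiv n (p + q) = bderiv n p + bderiv n q"
  unfolding bderiv_def
  by (rule keys_sum_add) (auto simp: distrib_left single_add)

lemma bderiv_single: "bderiv n (sg M c) = sg (M - sg (n - 1) 1) (of_nat (coef M (n - 1)) * c)"
  unfolding bderiv_def by (rule keys_sum_single) auto

lemma bderiv_mult_single:
  "bderiv n (sg M c * sg N d) = bderiv n (sg M c) * sg N d + sg M c * bderiv n (sg N d)"
proof -
  let ?e = "sg (n - 1) 1 :: nat \<Rightarrow>\<^sub>0 nat"
  \<comment> \<open>Subtraction of exponents is truncated. It is compatible with addition only if
    the exponent to be lowered is positive; otherwise the coefficient is 0 and removes the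
    term.\<close>
  have *: "(B + A) - ?e = (B - ?e) + A" if "coef B (n - 1) > 0" for A B :: "nat \<Rightarrow>\<^sub>0 nat"
    by (rule poly_mapping_eqI) (use that in \<open>auto simp: lookup_add lookup_minus lookup_single when_def\<close>)
  have M: "of_nat (coef M (n - 1)) * (c * d) = 0 \<or> (M + N) - ?e = (M - ?e) + N"
    using *[of M N] by (cases "coef M (n - 1) = 0") (simp_all add: add.commute)
  have N: "of_nat (coef N (n - 1)) * (c * d) = 0 \<or> (M + N) - ?e = M + (N - ?e)"
    using *[of N M] by (cases "coef N (n - 1) = 0") (simp_all add: add.commute)
  have "bderiv n (sg M c * sg N d) =
      sg ((M + N) - ?e) (of_nat (coef M (n - 1)) * (c * d)) +
      sg ((M + N) - ?e) (of_nat (coef N (n - 1)) * (c * d))"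
    by (simp add: mult_single bderiv_single lookup_add distrib_right flip: single_add)
  also have "sg ((M + N) - ?e) (of_nat (coef M (n - 1)) * (c * d)) = bderiv n (sg M c) * sg N d"
    using M by (auto simp: mult_single bderiv_single mult.assoc)
  also have "sg ((M + N) - ?e) (of_nat (coef N (n - 1)) * (c * d)) = sg M c * bderiv n (sg N d)"
    using N by (auto simp: mult_single bderiv_single mult_ac)
  finally show ?thesis .
qed

lemma bderiv_mult: "bderiv n (p * q) = bderiv n p * q + p * bderiv n (q :: 'k::comm_ring_1 bpoly)"
proof (induction p rule: pm_induct)
  case zero
  then show ?case by (simp add: bderiv_def)
next
  case (single M c)
  show ?case
    by (induction q rule: pm_induct)
      (simp_all add: bderiv_mult_single bderiv_add distrib_left bderiv_def[of n 0] add_ac)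
next
  case (add x y)
  then show ?case by (simp add: bderiv_add algebra_simps)
qed

lemma bderiv_Cst [simp]: "bderiv n (Cst c) = 0"
  by (simp add: bderiv_single)

lemma bderiv_zero [simp]: "bderiv n 0 = 0" and bderiv_one [simp]: "bderiv n 1 = 0"
  using bderiv_Cst[of n 0] bderiv_Cst[of n 1] by simp_all

lemma bderiv_of_nat [simp]: "bderiv n (of_nat k) = 0"
  using bderiv_Cst[of n "of_nat k"] by simp

lemma bderiv_Cst_mult: "bderiv n (Cst c * p) = Cst c * bderiv n p"
  by (simp add: bderiv_mult)

lemma bderiv_of_nat_mult: "bderiv n (of_nat c * p) = of_nat c * bderiv n p"
  by (simp add: bderiv_mult)

lemma bderiv_bvar: "n \<ge> 1 \<Longrightarrow> m \<ge> 1 \<Longrightarrow> bderiv n (bvar m) = (if n = m then 1 else 0)"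
  by (auto simp: bvar_def bderiv_single lookup_single when_def)

lemma bderiv_commute: "bderiv n (bderiv m p) = bderiv m (bderiv n (p :: 'k::comm_ring_1 bpoly))"
proof (induction p rule: bpoly_induct)
  case (var k)
  then show ?case
    by (cases "n - 1 = k - 1"; cases "m - 1 = k - 1")
      (simp_all add: bvar_def bderiv_single lookup_single when_def)
qed (auto simp: bderiv_add bderiv_mult algebra_simps)

lemma bderiv_sum: "bderiv n (sum f A) = (\<Sum>a\<in>A. bderiv n (f a))"
  by (rule additive_sum(4)) (rule bderiv_add)

section \<open>Exponentials of series of operators\<close>

text \<open>\<open>eop G k\<close> is the coefficient of \<open>z\<^sup>k\<close> in \<open>exp (\<Sum>\<^bsub>n\<ge>1\<^esub> G n z\<^sup>n)\<close> for commuting operators \<open>G n\<close>,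
  computed from the logarithmic derivative.\<close>

fun eop :: "(nat \<Rightarrow> 'k::field_char_0 bpoly \<Rightarrow> 'k bpoly) \<Rightarrow> nat \<Rightarrow> 'k bpoly \<Rightarrow> 'k bpoly" where
  "eop G 0 P = P"
| "eop G (Suc k) P = Cst (inverse (of_nat (Suc k))) *
     (\<Sum>n\<le>k. of_nat (Suc n) * G (Suc n) (eop G (k - n) P))"

declare eop.simps(2) [simp del]

lemma of_nat_Cst_inverse:
  "k > 0 \<Longrightarrow> of_nat k * (Cst (inverse (of_nat k)) * p) = (p :: 'k::field_char_0 bpoly)"
  by (simp add: mult_single flip: mult.assoc single_of_nat)

lemma of_nat_cancel: "k > 0 \<Longrightarrow> of_nat k * p = of_nat k * q \<Longrightarrow> p = (q :: 'k::field_char_0 bpoly)"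
  using of_nat_Cst_inverse[of k p] of_nat_Cst_inverse[of k q] by (simp add: mult.left_commute)

lemma eop_rec: "of_nat k * eop G k P = (\<Sum>n=1..k. of_nat n * G n (eop G (k - n) P))"
proof (cases k)
  case (Suc j)
  have "(\<Sum>n=1..k. of_nat n * G n (eop G (k - n) P)) =
      (\<Sum>n\<le>j. of_nat (Suc n) * G (Suc n) (eop G (j - n) P))"
    by (simp add: Suc sum.atLeast1_atMost_eq lessThan_Suc_atMost del: of_nat_Suc sum.cl_ivl_Suc)
  then show ?thesis
    unfolding Suc eop.simps(2) of_nat_Cst_inverse[OF zero_less_Suc] by (rule sym)
qed simp

text \<open>In characteristic 0 the factor k can be cancelled, so the recursion of the logarithmic
  derivative has one solution with given initial value. Identities between exponentials are proved
  by checking the recursion for the other side.\<close>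

lemma eop_unique:
  assumes "f 0 = P" "\<And>k. k \<ge> 1 \<Longrightarrow> of_nat k * f k = (\<Sum>n=1..k. of_nat n * G n (f (k - n)))"
  shows "f k = eop G k P"
proof (induction k rule: less_induct)
  case (less k)
  show ?case
  proof (cases "k = 0")
    case False
    then have "of_nat k * f k = of_nat k * eop G k P"
      unfolding eop_rec using assms(2)[of k] by (auto intro!: sum.cong simp: less.IH)
    then show ?thesis using False of_nat_cancel[of k] by simp
  qed (simp add: assms)
qed

lemma eop_commute:
  assumes "\<And>x y. A (x + y) = A x + A y" "\<And>c x. A (Cst c * x) = Cst c * A x"
    "\<And>n x. A (G n x) = G n (A x)"
  shows "A (eop G k P) = eop G k (A P)"
proof -
  have nat: "A (of_nat n * x) = of_nat n * A x" for n x
    using assms(2)[of "of_nat n"] by simp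
  have "of_nat k * A (eop G k P) = (\<Sum>n=1..k. of_nat n * G n (A (eop G (k - n) P)))" for k
  proof -
    have "of_nat k * A (eop G k P) = A (of_nat k * eop G k P)" by (simp add: nat)
    also have "\<dots> = (\<Sum>n=1..k. of_nat n * G n (A (eop G (k - n) P)))"
      by (simp add: eop_rec nat assms additive_sum(4)[of A])
    finally show ?thesis .
  qed
  then show ?thesis by (intro eop_unique) auto
qed

lemma eop_add:
  assumes "\<And>n x y. G n (x + y) = G n x + G n y"
  shows "eop G k (P + Q) = eop G k P + eop G k Q"
  by (rule eop_unique[symmetric])
    (auto simp: distrib_left eop_rec assms sum.distrib)

lemma eop_cong: "(\<And>n x. n \<ge> 1 \<Longrightarrow> G n x = G' n x) \<Longrightarrow> eop G k P = eop G' k P"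
  by (rule eop_unique) (auto simp: eop_rec)

lemma sum_shift_triangle:
  "(\<Sum>a\<le>k. \<Sum>n=1..a. f n (a - n) (k - a)) = (\<Sum>n=1..k. \<Sum>a\<le>k - n. f n a (k - n - a))"
  for f :: "nat \<Rightarrow> nat \<Rightarrow> nat \<Rightarrow> 'a::comm_monoid_add"
proof -
  have "(\<Sum>(a, n)\<in>(SIGMA a:{..k}. {1..a}). f n (a - n) (k - a)) =
      (\<Sum>(n, a)\<in>(SIGMA n:{1..k}. {..k - n}). f n a (k - n - a))"
    by (rule sum.reindex_bij_witness[where i = "\<lambda>(n, a). (a + n, n)" and j = "\<lambda>(a, n). (n, a - n)"])
      auto
  then show ?thesis by (simp add: sum.Sigma)
qed

lemma sum_swap_triangle:
  "(\<Sum>a\<le>k. \<Sum>n=1..k - a. f a n) = (\<Sum>n=1..k. \<Sum>a\<le>k - n. f a n)"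
  for f :: "nat \<Rightarrow> nat \<Rightarrow> 'a::comm_monoid_add"
proof -
  have "(\<Sum>(a, n)\<in>(SIGMA a:{..k}. {1..k - a}). f a n) = (\<Sum>(n, a)\<in>(SIGMA n:{1..k}. {..k - n}). f a n)"
    by (rule sum.reindex_bij_witness[where i = "\<lambda>(n, a). (a, n)" and j = "\<lambda>(a, n). (n, a)"]) auto
  then show ?thesis by (simp add: sum.Sigma)
qed

text \<open>Differentiating the product by the Leibniz rule and moving G' past exp(G) gives the
  recursion of G + G', whence exp(G) exp(G') = exp(G + G').\<close>

lemma eop_conv:
  assumes "\<And>n x y. G n (x + y) = G n x + G n y" "\<And>n c x. G n (Cst c * x) = Cst c * G n x"
    and "\<And>n x y. G' n (x + y) = G' n x + G' n y" "\<And>n c x. G' n (Cst c * x) = Cst c * G' n x"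
    and "\<And>n m x. G' n (G m x) = G m (G' n x)"
  shows "(\<Sum>a\<le>k. eop G a (eop G' (k - a) P)) = eop (\<lambda>n x. G n x + G' n x) k P"
proof (rule eop_unique)
  fix k :: nat
  have Ge: "G' n (eop G a x) = eop G a (G' n x)" for n a x
    by (rule eop_commute) (simp_all add: assms)
  have e_nat: "eop G a (of_nat m * x) = of_nat m * eop G a x" for a m x
    using assms(2)[of _ "of_nat m"]
    by (intro eop_commute[symmetric]) (simp_all add: distrib_left mult.left_commute)
  note Gadd = additive_sum(4)[of "G n" for n, OF assms(1)] additive_sum(4)[of "G' n" for n, OF assms(3)]
  note esum = additive_sum(4)[of "eop G k" for k, OF eop_add[of G, OF assms(1)]]
  \<comment> \<open>The factor k is split as a + (k - a), one part for each of the two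
    recursions.\<close>
  have "of_nat k * (\<Sum>a\<le>k. eop G a (eop G' (k - a) P)) =
      (\<Sum>a\<le>k. of_nat a * eop G a (eop G' (k - a) P)) +
      (\<Sum>a\<le>k. eop G a (of_nat (k - a) * eop G' (k - a) P))"
    unfolding sum_distrib_left sum.distrib[symmetric]
    by (intro sum.cong refl) (auto simp: e_nat simp del: of_nat_diff simp flip: distrib_right of_nat_add)
  also have "(\<Sum>a\<le>k. of_nat a * eop G a (eop G' (k - a) P)) =
      (\<Sum>a\<le>k. \<Sum>n=1..a. of_nat n * G n (eop G (a - n) (eop G' (k - a) P)))"
    by (simp add: eop_rec)
  also have "\<dots> = (\<Sum>n=1..k. \<Sum>a\<le>k - n. of_nat n * G n (eop G a (eop G' (k - n - a) P)))"
    by (rule sum_shift_triangle)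
  also have "(\<Sum>a\<le>k. eop G a (of_nat (k - a) * eop G' (k - a) P)) =
      (\<Sum>a\<le>k. \<Sum>n=1..k - a. of_nat n * G' n (eop G a (eop G' (k - a - n) P)))"
    by (simp add: eop_rec esum e_nat Ge del: of_nat_diff)
  also have "\<dots> = (\<Sum>n=1..k. \<Sum>a\<le>k - n. of_nat n * G' n (eop G a (eop G' (k - n - a) P)))"
    by (subst sum_swap_triangle) (simp add: add.commute)
  finally show "of_nat k * (\<Sum>a\<le>k. eop G a (eop G' (k - a) P)) = (\<Sum>n=1..k. of_nat n *
      (G n (\<Sum>a\<le>k - n. eop G a (eop G' (k - n - a) P)) + G' n (\<Sum>a\<le>k - n. eop G a (eop G' (k - n - a) P))))"
    by (simp add: Gadd sum_distrib_left distrib_left sum.distrib)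
qed simp

lemma eop_zero: "eop (\<lambda>n x. 0) k P = (if k = 0 then P else 0)"
  by (rule eop_unique[symmetric]) auto

text \<open>If the exponent contains only even powers of z, the recursion links indices of equal
  parity only. On even indices both sides carry a factor 2, so halving the indices gives the
  recursion in z^2.\<close>

lemma eop_even:
  assumes "\<And>n x. odd n \<Longrightarrow> G n x = 0" "\<And>n. G n 0 = 0"
  shows "eop G (2 * k) P = eop (\<lambda>n. G (2 * n)) k P" "odd j \<Longrightarrow> eop G j P = 0"
proof -
  have main: "eop G j P = (if even j then eop (\<lambda>n. G (2 * n)) (j div 2) P else 0)" for j
  proof (rule eop_unique[symmetric])
    fix k :: nat
    let ?f = "\<lambda>j. if even j then eop (\<lambda>n. G (2 * n)) (j div 2) P else 0"
    show "of_nat k * ?f k = (\<Sum>n=1..k. of_nat n * G n (?f (k - n)))"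
    proof (cases "even k")
      case True
      then obtain j where j: "k = 2 * j" by blast
      have "(\<Sum>n=1..k. of_nat n * G n (?f (k - n))) =
          (\<Sum>n\<in>(\<lambda>n. 2 * n) ` {1..j}. of_nat n * G n (?f (k - n)))"
        by (rule sum.mono_neutral_right) (auto simp: assms j image_iff elim!: evenE)
      also have "\<dots> = (\<Sum>n=1..j. of_nat (2 * n) * G (2 * n) (eop (\<lambda>n. G (2 * n)) (j - n) P))"
        by (subst sum.reindex) (auto simp: inj_on_def j simp flip: diff_mult_distrib2)
      also have "\<dots> = 2 * (of_nat j * eop (\<lambda>n. G (2 * n)) j P)"
        by (simp add: eop_rec sum_distrib_left mult.assoc)
      finally show ?thesis by (simp add: j)
    next
      case False
      have "of_nat n * G n (?f (k - n)) = 0" if "n \<in> {1..k}" for n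
        by (cases "even n") (use False that in \<open>auto simp: assms\<close>)
      then have "(\<Sum>n=1..k. of_nat n * G n (?f (k - n))) = 0" by (meson sum.neutral)
      then show ?thesis using False by simp
    qed
  qed simp
  show "eop G (2 * k) P = eop (\<lambda>n. G (2 * n)) k P" "odd j \<Longrightarrow> eop G j P = 0"
    by (simp_all add: main)
qed

text \<open>The recursion says z f' = T f with T = sum of n z^n G_n. Both z d/dz and T are
  derivations of the power series ring, so the equation passes from two series to their product: the
  exponential of a derivation is multiplicative.\<close>

lemma eop_Leibniz:
  assumes add: "\<And>n x y. G n (x + y) = G n x + G n y"
    and mult: "\<And>n x y. G n (x * y) = G n x * y + x * G n y"
  shows "eop G k (P * Q) = (\<Sum>a\<le>k. eop G a P * eop G (k - a) Q)"
proof (rule eop_unique[symmetric])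
  fix N :: nat
  define E where "E = (\<lambda>P. Abs_fps (\<lambda>k. eop G k P))"
  define M where "M = (\<lambda>n f. Abs_fps (\<lambda>k. G n (fps_nth f k)))"
  \<comment> \<open>Truncation at N keeps T a finite sum; only coefficients up to index N are
    compared.\<close>
  define T where "T = (\<lambda>f. \<Sum>n=1..N. of_nat n * fps_X ^ n * M n f)"
  have Mmult: "M n (f * g) = M n f * g + f * M n g" for n f g
    by (rule fps_ext) (simp add: M_def fps_mult_nth additive_sum(4)[of "G n", OF add] mult sum.distrib)
  have Tmult: "T (f * g) = T f * g + f * T g" for f g
    by (simp add: T_def Mmult sum_distrib_left sum_distrib_right sum.distrib[symmetric] algebra_simps)
  have Tnth: "fps_nth (T f) k = (\<Sum>n=1..k. of_nat n * G n (fps_nth f (k - n)))" if "k \<le> N" for k f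
  proof -
    have "fps_nth (T f) k = (\<Sum>n=1..N. if k < n then 0 else of_nat n * G n (fps_nth f (k - n)))"
      by (simp add: T_def fps_sum_nth M_def mult.assoc fps_X_power_mult_nth fps_mult_of_nat_nth
          if_distrib cong: if_cong)
    also have "\<dots> = (\<Sum>n=1..k. of_nat n * G n (fps_nth f (k - n)))"
      by (rule sum.mono_neutral_cong_right) (use that in auto)
    finally show ?thesis .
  qed
  have th: "fps_nth (fps_X * fps_deriv f) k = of_nat k * fps_nth f k" for f :: "'a bpoly fps" and k
    by (cases k) (simp_all add: fps_X_mult_nth del: of_nat_Suc)
  have E: "fps_nth (fps_X * fps_deriv (E P)) k = fps_nth (T (E P)) k" if "k \<le> N" for k P
    unfolding th Tnth[OF that] by (simp add: E_def eop_rec)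
  have "fps_nth (fps_X * fps_deriv (E P * E Q)) N = fps_nth (T (E P * E Q)) N"
  proof -
    have eq: "fps_X * fps_deriv (E P * E Q) = (fps_X * fps_deriv (E P)) * E Q + E P * (fps_X * fps_deriv (E Q))"
      by (simp add: algebra_simps)
    show ?thesis
      unfolding Tmult eq fps_add_nth fps_mult_nth[of "fps_X * fps_deriv (E P)"]
        fps_mult_nth[of _ "fps_X * fps_deriv (E Q)"] fps_mult_nth[of "T (E P)"] fps_mult_nth[of _ "T (E Q)"]
      by (intro arg_cong2[where f = "(+)"] sum.cong refl) (simp_all only: E atLeastAtMost_iff diff_le_self)
  qed
  then have "of_nat N * fps_nth (E P * E Q) N = (\<Sum>n=1..N. of_nat n * G n (fps_nth (E P * E Q) (N - n)))"
    unfolding th by (simp add: Tnth)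
  then show "of_nat N * (\<Sum>a\<le>N. eop G a P * eop G (N - a) Q) =
      (\<Sum>n=1..N. of_nat n * G n (\<Sum>a\<le>N - n. eop G a P * eop G (N - n - a) Q))"
    by (simp add: E_def fps_mult_nth atMost_atLeast0)
qed simp

section \<open>Vertex operators\<close>

text \<open>\<open>cf \<gamma> \<phi> k\<close> is the coefficient of \<open>z\<^sup>k\<close> in \<open>exp (\<Sum>\<^bsub>n\<ge>1\<^esub> \<gamma> n b\<^bsub>-\<phi> n\<^esub> z\<^sup>n)\<close> and \<open>sh s \<phi> k\<close> that of \<open>z\<^bsup>-k\<^esup>\<close> in
  \<open>exp (\<Sum>\<^bsub>n\<ge>1\<^esub> s n \<partial>/\<partial>b\<^bsub>-\<phi> n\<^esub> z\<^bsup>-n\<^esup>)\<close>.\<close>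

definition cf :: "(nat \<Rightarrow> 'k::field_char_0) \<Rightarrow> (nat \<Rightarrow> nat) \<Rightarrow> nat \<Rightarrow> 'k bpoly"
  where "cf \<gamma> \<phi> k = eop (\<lambda>n P. Cst (\<gamma> n) * bvar (\<phi> n) * P) k 1"

definition sh :: "(nat \<Rightarrow> 'k::field_char_0) \<Rightarrow> (nat \<Rightarrow> nat) \<Rightarrow> nat \<Rightarrow> 'k bpoly \<Rightarrow> 'k bpoly"
  where "sh s \<phi> k = eop (\<lambda>n P. Cst (s n) * bderiv (\<phi> n) P) k"

definition ci :: "(nat \<Rightarrow> 'a::zero) \<Rightarrow> int \<Rightarrow> 'a"
  where "ci c A = (if A < 0 then 0 else c (nat A))"

lemma ci_of_nat [simp]: "ci c (int n) = c n" and ci_neg: "A < 0 \<Longrightarrow> ci c A = 0"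
  by (simp_all add: ci_def)

lemma eop_mult: "eop (\<lambda>n P. Cst (\<gamma> n) * bvar (\<phi> n) * P) k P = cf \<gamma> \<phi> k * P"
proof -
  have "eop (\<lambda>n P. Cst (\<gamma> n) * bvar (\<phi> n) * P) k 1 * P = eop (\<lambda>n P. Cst (\<gamma> n) * bvar (\<phi> n) * P) k (1 * P)"
    by (rule eop_commute) (simp_all add: algebra_simps)
  then show ?thesis by (simp add: cf_def)
qed

lemma cf_0 [simp]: "cf \<gamma> \<phi> 0 = 1"
  by (simp add: cf_def)

lemma cf_rec: "of_nat k * cf \<gamma> \<phi> k = (\<Sum>n=1..k. of_nat n * (Cst (\<gamma> n) * bvar (\<phi> n) * cf \<gamma> \<phi> (k - n)))"
  by (simp add: cf_def eop_rec)

lemma cf_unique: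
  assumes "f 0 = 1"
    "\<And>k. k \<ge> 1 \<Longrightarrow> of_nat k * f k = (\<Sum>n=1..k. of_nat n * (Cst (\<gamma> n) * bvar (\<phi> n) * f (k - n)))"
  shows "f k = cf \<gamma> \<phi> k"
  unfolding cf_def by (rule eop_unique) (use assms in auto)

lemma sh_0 [simp]: "sh s \<phi> 0 P = P"
  by (simp add: sh_def)

lemma sh_unique:
  assumes "f 0 = P"
    "\<And>k. k \<ge> 1 \<Longrightarrow> of_nat k * f k = (\<Sum>n=1..k. of_nat n * (Cst (s n) * bderiv (\<phi> n) (f (k - n))))"
  shows "f k = sh s \<phi> k P"
  unfolding sh_def by (rule eop_unique) (use assms in auto)

lemma sh_add: "sh s \<phi> k (P + Q) = sh s \<phi> k P + sh s \<phi> k Q"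
  unfolding sh_def by (rule eop_add) (simp add: bderiv_add distrib_left)

lemma sh_zero [simp]: "sh s \<phi> k 0 = 0"
  and sh_sum: "sh s \<phi> k (sum f A) = (\<Sum>a\<in>A. sh s \<phi> k (f a))"
  using additive_sum[of "sh s \<phi> k", OF sh_add] by auto

lemma sh_mult: "sh s \<phi> k (P * Q) = (\<Sum>a\<le>k. sh s \<phi> a P * sh s \<phi> (k - a) Q)"
  unfolding sh_def by (rule eop_Leibniz) (simp_all add: bderiv_add bderiv_mult algebra_simps)

lemma sh_Cst_mult: "sh s \<phi> k (Cst c * P) = Cst c * sh s \<phi> k P"
  unfolding sh_def
  by (rule eop_commute[symmetric]) (simp_all add: bderiv_mult algebra_simps)

lemma sh_commute: "sh s \<phi> k (sh t \<psi> l P) = sh t \<psi> l (sh s \<phi> k P)"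
proof -
  have *: "bderiv j (sh t \<psi> l x) = sh t \<psi> l (bderiv j x)" for j x
    unfolding sh_def
    by (rule eop_commute) (simp_all add: bderiv_add bderiv_mult bderiv_commute[of j])
  show ?thesis
    unfolding sh_def[of s]
    by (rule eop_commute[symmetric]) (simp_all add: sh_add sh_Cst_mult * )
qed

lemma sh_fixed:
  assumes "\<And>n. n \<ge> 1 \<Longrightarrow> s n = 0 \<or> bderiv (\<phi> n) P = 0"
  shows "sh s \<phi> k P = (if k = 0 then P else 0)"
proof (rule sh_unique[symmetric])
  fix k :: nat assume "k \<ge> 1"
  have "of_nat n * (Cst (s n) * bderiv (\<phi> n) (if k - n = 0 then P else 0)) = 0" if "n \<in> {1..k}" for n
    using assms[of n] that by auto
  then show "of_nat k * (if k = 0 then P else 0) =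
      (\<Sum>n=1..k. of_nat n * (Cst (s n) * bderiv (\<phi> n) (if k - n = 0 then P else 0)))"
    using \<open>k \<ge> 1\<close> by (simp add: sum.neutral)
qed simp

lemma sh_one: "sh s \<phi> k 1 = (if k = 0 then 1 else 0)"
  by (rule sh_fixed) simp

lemma sh_mult_fixed:
  assumes "\<And>n. n \<ge> 1 \<Longrightarrow> s n = 0 \<or> bderiv (\<phi> n) d = 0"
  shows "sh s \<phi> k (d * P) = d * sh s \<phi> k P"
proof -
  have "sh s \<phi> k (d * P) = (\<Sum>a\<le>k. if a = 0 then d * sh s \<phi> k P else 0)"
    unfolding sh_mult by (rule sum.cong) (auto simp: sh_fixed[OF assms])
  then show ?thesis by simp
qed

lemma sh_bvar:
  assumes "\<And>n. n \<ge> 1 \<Longrightarrow> \<phi> n \<ge> n" "m \<ge> 1"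
  shows "sh s \<phi> k (bvar m) = (if k = 0 then bvar m else if \<phi> k = m then Cst (s k) else 0)"
proof (rule sh_unique[symmetric])
  fix k :: nat assume k: "k \<ge> 1"
  let ?f = "\<lambda>k. if k = 0 then bvar m else if \<phi> k = m then Cst (s k) else 0"
  have "(\<Sum>n=1..k. of_nat n * (Cst (s n) * bderiv (\<phi> n) (?f (k - n)))) =
      (\<Sum>n=1..k. if n = k then of_nat k * ?f k else 0)"
    by (rule sum.cong) (use assms(1)[of k] assms(2) k in \<open>auto simp: bderiv_bvar\<close>)
  then show "of_nat k * ?f k = (\<Sum>n=1..k. of_nat n * (Cst (s n) * bderiv (\<phi> n) (?f (k - n))))"
    using k by simp
qed simp

text \<open>Since \<open>\<phi> n\<close> is at least n, a given variable is met by finitely many of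
  the derivations. For a product, if k > N + N' then one of a and k - a is beyond its bound. All
  infinite sums in the vertex operators become finite by this.\<close>

lemma sh_finite:
  assumes "\<And>n. n \<ge> 1 \<Longrightarrow> \<phi> n \<ge> n"
  shows "\<exists>N. \<forall>k>N. sh s \<phi> k P = 0"
proof (induction P rule: bpoly_induct)
  case (const c)
  then show ?case by (intro exI[of _ 0]) (simp add: sh_fixed)
next
  case (var n)
  have "\<phi> k \<noteq> n" if "k > n" for k using assms[of k] that by auto
  then show ?case by (intro exI[of _ n]) (auto simp: sh_bvar[OF assms var])
next
  case (add x y)
  then obtain N N' where "\<forall>k>N. sh s \<phi> k x = 0" "\<forall>k>N'. sh s \<phi> k y = 0" by blast
  then show ?case by (intro exI[of _ "max N N'"]) (simp add: sh_add)
next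
  case (mult x y)
  then obtain N N' where N: "\<forall>k>N. sh s \<phi> k x = 0" "\<forall>k>N'. sh s \<phi> k y = 0" by blast
  have "sh s \<phi> k (x * y) = 0" if "k > N + N'" for k
    unfolding sh_mult
  proof (rule sum.neutral, safe)
    fix a assume "a \<le> k"
    show "sh s \<phi> a x * sh s \<phi> (k - a) y = 0"
      using N that by (cases "a > N") auto
  qed
  then show ?case by blast
qed

text \<open>The derivative of an exponential brings down the coefficient of the variable in the
  exponent. As the coefficients are known through their recursion only, it is the recursion that is
  differentiated.\<close>

lemma bderiv_cf:
  assumes "inj_on \<phi> {1..}" "\<And>n. n \<ge> 1 \<Longrightarrow> \<phi> n \<ge> n" "n \<ge> 1"
  shows "bderiv (\<phi> n) (cf \<gamma> \<phi> j) = (if n \<le> j then Cst (\<gamma> n) * cf \<gamma> \<phi> (j - n) else 0)"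
proof (induction j rule: less_induct)
  case (less j)
  show ?case
  proof (cases "j = 0")
    case True
    then show ?thesis using assms(3) by simp
  next
    case False
    let ?c = "cf \<gamma> \<phi>"
    have d: "bderiv (\<phi> n) (bvar (\<phi> m)) = (if m = n then 1 else 0 :: 'a bpoly)" if "m \<ge> 1" for m
      using that assms by (subst bderiv_bvar) (auto simp: inj_on_def intro: order_trans)
    have "of_nat j * bderiv (\<phi> n) (?c j) = bderiv (\<phi> n) (of_nat j * ?c j)"
      by (simp add: bderiv_of_nat_mult)
    also have "\<dots> = (\<Sum>m=1..j. (if m = n then of_nat n * (Cst (\<gamma> n) * ?c (j - n)) else 0) +
        of_nat m * (Cst (\<gamma> m) * bvar (\<phi> m) * bderiv (\<phi> n) (?c (j - m))))"
      unfolding cf_rec bderiv_sum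
      by (rule sum.cong) (auto simp: bderiv_mult d algebra_simps)
    also have "\<dots> = (if n \<le> j then of_nat n * (Cst (\<gamma> n) * ?c (j - n)) else 0) +
        (\<Sum>m=1..j. of_nat m * (Cst (\<gamma> m) * bvar (\<phi> m) * bderiv (\<phi> n) (?c (j - m))))"
      using assms(3) by (simp add: sum.distrib)
    also have "(\<Sum>m=1..j. of_nat m * (Cst (\<gamma> m) * bvar (\<phi> m) * bderiv (\<phi> n) (?c (j - m)))) =
        (\<Sum>m=1..j. if m \<le> j - n \<and> n \<le> j then Cst (\<gamma> n) * (of_nat m * (Cst (\<gamma> m) * bvar (\<phi> m) * ?c (j - n - m))) else 0)"
      by (rule sum.cong) (auto simp: less.IH diff_commute algebra_simps)
    also have "\<dots> = (if n \<le> j then \<Sum>m=1..j-n. Cst (\<gamma> n) * (of_nat m * (Cst (\<gamma> m) * bvar (\<phi> m) * ?c (j - n - m))) else 0)"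
      by (cases "n \<le> j") (auto intro!: sum.mono_neutral_cong_right)
    also have "(\<Sum>m=1..j-n. Cst (\<gamma> n) * (of_nat m * (Cst (\<gamma> m) * bvar (\<phi> m) * ?c (j - n - m)))) =
        Cst (\<gamma> n) * (of_nat (j - n) * ?c (j - n))"
      unfolding cf_rec by (simp add: sum_distrib_left)
    also have "(if n \<le> j then of_nat n * (Cst (\<gamma> n) * ?c (j - n)) else 0) +
        (if n \<le> j then Cst (\<gamma> n) * (of_nat (j - n) * ?c (j - n)) else 0) =
        of_nat j * (if n \<le> j then Cst (\<gamma> n) * ?c (j - n) else 0)"
      by (simp add: of_nat_diff algebra_simps)
    finally show ?thesis using False of_nat_cancel[of j] by simp
  qed
qed

text \<open>The exponential of constant coefficient derivations translates the variables. It
  therefore multiplies the exponential of a linear form by a scalar series, exp of the sum of s_n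
  gamma_n x^n, whose coefficients are the \<open>\<kappa> r\<close>.\<close>

lemma sh_cf:
  assumes \<phi>: "inj_on \<phi> {1..}" "\<And>n. n \<ge> 1 \<Longrightarrow> \<phi> n \<ge> n"
    and \<kappa>: "\<kappa> 0 = 1" "\<And>k. k \<ge> 1 \<Longrightarrow> of_nat k * \<kappa> k = (\<Sum>n=1..k. of_nat n * (s n * \<gamma> n) * \<kappa> (k - n))"
  shows "sh s \<phi> r (ci (cf \<gamma> \<phi>) A) = Cst (\<kappa> r) * ci (cf \<gamma> \<phi>) (A - int r)"
proof (cases "A < 0")
  case False
  then obtain j where j: "A = int j" by (metis nonneg_int_cases not_less)
  let ?c = "cf \<gamma> \<phi>"
  have d: "bderiv (\<phi> n) (ci ?c B) = Cst (\<gamma> n) * ci ?c (B - int n)" if n: "n \<ge> 1" for n B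
  proof (cases "B < 0")
    case False
    then obtain i where i: "B = int i" by (metis nonneg_int_cases not_less)
    then show ?thesis using bderiv_cf[OF \<phi> n, of \<gamma> i]
      by (cases "n \<le> i") (simp_all add: ci_def nat_diff_distrib)
  qed (simp add: ci_neg)
  show ?thesis
  proof (rule sh_unique[symmetric])
    fix k :: nat assume k: "k \<ge> 1"
    have "(\<Sum>n=1..k. of_nat n * (Cst (s n) * bderiv (\<phi> n) (Cst (\<kappa> (k - n)) * ci ?c (A - int (k - n))))) =
        (\<Sum>n=1..k. Cst (of_nat n * (s n * \<gamma> n) * \<kappa> (k - n)) * ci ?c (A - int k))"
      by (rule sum.cong) (auto simp: bderiv_Cst_mult d of_nat_diff Cst_mult single_of_nat algebra_simps)
    also have "\<dots> = Cst (of_nat k * \<kappa> k) * ci ?c (A - int k)"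
      unfolding \<kappa>(2)[OF k] Cst_sum sum_distrib_right ..
    finally show "of_nat k * (Cst (\<kappa> k) * ci ?c (A - int k)) = (\<Sum>n=1..k. of_nat n *
        (Cst (s n) * bderiv (\<phi> n) (Cst (\<kappa> (k - n)) * ci ?c (A - int (k - n)))))"
      by (simp add: Cst_mult single_of_nat mult.assoc)
  qed (simp add: \<kappa>)
qed (simp add: ci_neg)

text \<open>\<open>vop c S A\<close> is the coefficient of \<open>z\<^sup>A\<close> in \<open>(\<Sum> c j z\<^sup>j) (\<Sum> S k z\<^bsup>-k\<^esup>)\<close>, and \<open>vop2\<close> is the normally ordered
  product of two such operators.\<close>

definition vop :: "(nat \<Rightarrow> 'a) \<Rightarrow> (nat \<Rightarrow> 'a \<Rightarrow> 'a::comm_ring_1) \<Rightarrow> int \<Rightarrow> 'a \<Rightarrow> 'a"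
  where "vop c S A P = Sum_any (\<lambda>k. ci c (int k + A) * S k P)"

definition vop2 :: "(nat \<Rightarrow> 'a) \<Rightarrow> (nat \<Rightarrow> 'a \<Rightarrow> 'a::comm_ring_1) \<Rightarrow> (nat \<Rightarrow> 'a) \<Rightarrow> (nat \<Rightarrow> 'a \<Rightarrow> 'a)
    \<Rightarrow> int \<Rightarrow> int \<Rightarrow> 'a \<Rightarrow> 'a"
  where "vop2 c S c' S' A B P = Sum_any (\<lambda>(k, l). ci c (int k + A) * ci c' (int l + B) * S k (S' l P))"

lemma vop_eq: "\<forall>k>N. S k P = 0 \<Longrightarrow> vop c S A P = (\<Sum>k\<le>N. ci c (int k + A) * S k P)"
  unfolding vop_def by (rule Sum_any.expand_superset) (auto simp: not_less[symmetric])

lemma vop2_eq: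
  assumes "\<forall>l>N. S' l P = 0" "\<forall>l. \<forall>k>N. S k (S' l P) = 0" "\<And>k. S k 0 = 0"
  shows "vop2 c S c' S' A B P = (\<Sum>k\<le>N. \<Sum>l\<le>N. ci c (int k + A) * ci c' (int l + B) * S k (S' l P))"
proof -
  have "vop2 c S c' S' A B P = (\<Sum>(k, l)\<in>{..N} \<times> {..N}. ci c (int k + A) * ci c' (int l + B) * S k (S' l P))"
    unfolding vop2_def by (rule Sum_any.expand_superset) (use assms in \<open>auto simp: not_less[symmetric]\<close>)
  then show ?thesis by (simp add: sum.cartesian_product)
qed

lemma sh_finite2:
  assumes "\<And>n. n \<ge> 1 \<Longrightarrow> \<phi> n \<ge> n" "\<And>n. n \<ge> 1 \<Longrightarrow> \<psi> n \<ge> n"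
  shows "\<exists>N. (\<forall>l>N. sh t \<psi> l P = 0) \<and> (\<forall>l. \<forall>k>N. sh s \<phi> k (sh t \<psi> l P) = 0)"
proof -
  obtain N where N: "\<forall>l>N. sh t \<psi> l P = 0" using sh_finite[of \<psi>, OF assms(2)] by blast
  obtain M where M: "\<forall>l>M. sh s \<phi> l P = 0" using sh_finite[of \<phi>, OF assms(1)] by blast
  show ?thesis
    using N M by (intro exI[of _ "max N M"]) (simp add: sh_commute[of s])
qed

text \<open>The exchange relation of the two series multiplies the normally ordered product by
  \<open>\<Sum>\<^sub>r \<kappa>\<^sub>r (z\<^sub>2/z\<^sub>1)\<^sup>r\<close>.\<close>

lemma vop_vop:
  fixes c c' :: "nat \<Rightarrow> 'k::field_char_0 bpoly"
  assumes \<phi>: "\<And>n. n \<ge> 1 \<Longrightarrow> \<phi> n \<ge> n" and \<psi>: "\<And>n. n \<ge> 1 \<Longrightarrow> \<psi> n \<ge> n"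
    and ex: "\<And>r A. sh s \<phi> r (ci c' A) = Cst (\<kappa> r) * ci c' (A - int r)"
    and N: "\<forall>l>N. sh t \<psi> l P = 0" "\<forall>l. \<forall>k>N. sh s \<phi> k (sh t \<psi> l P) = 0"
    and R: "int R \<ge> int N + B"
  shows "vop c (sh s \<phi>) A (vop c' (sh t \<psi>) B P) =
    (\<Sum>r\<le>R. Cst (\<kappa> r) * vop2 c (sh s \<phi>) c' (sh t \<psi>) (A + int r) (B - int r) P)"
proof -
  let ?S = "sh s \<phi>" and ?T = "sh t \<psi>"
  let ?Q = "vop c' ?T B P"
  define g where "g = (\<lambda>k r. \<Sum>l\<le>N. Cst (\<kappa> r) * ci c' (int l + B - int r) * ?S k (?T l P))"
  have Q: "?Q = (\<Sum>l\<le>N. ci c' (int l + B) * ?T l P)"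
    by (rule vop_eq) (use N in auto)
  have SQ: "?S k ?Q = (\<Sum>r\<le>k. g (k - r) r)" for k
    unfolding Q sh_sum sh_mult ex g_def by (subst sum.swap) simp
  \<comment> \<open>For r > R the index l + B - r is negative; this is the origin of the bound on
    R.\<close>
  have g0: "g k r = 0" if "k > N \<or> r > R" for k r
    unfolding g_def using that N R by (intro sum.neutral) (auto simp: ci_neg)
  have fin: "?S k ?Q = 0" if "k > N + R" for k
    unfolding SQ
  proof (rule sum.neutral, safe)
    fix r assume "r \<le> k"
    show "g (k - r) r = 0" using that by (cases "r > R") (auto intro!: g0)
  qed
  have "vop c ?S A ?Q = (\<Sum>k\<le>N + R. \<Sum>r\<le>k. ci c (int k + A) * g (k - r) r)"
    by (subst vop_eq[where N = "N + R"], use fin in blast) (simp add: SQ sum_distrib_left)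
  also have "\<dots> = (\<Sum>(k, r)\<in>(SIGMA k:{..N + R}. {..k}). ci c (int k + A) * g (k - r) r)"
    by (simp add: sum.Sigma)
  \<comment> \<open>Substituting k + r for k turns the triangle into a rectangle; the pairs that
    fall outside it contribute 0.\<close>
  also have "\<dots> = (\<Sum>(r, k)\<in>{..R} \<times> {..N}. ci c (int (k + r) + A) * g k r)"
  proof (rule sum.reindex_bij_witness_not_neutral[where S' = "{(k, r). k \<le> N + R \<and> r \<le> k \<and> (k - r > N \<or> r > R)}"
        and T' = "{}" and i = "\<lambda>(r, k). (k + r, r)" and j = "\<lambda>(k, r). (r, k - r)"])
    show "finite {(k, r). k \<le> N + R \<and> r \<le> k \<and> (k - r > N \<or> r > R)}"
      by (rule finite_subset[of _ "{..N + R} \<times> {..N + R}"]) auto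
  qed (auto simp: g0)
  also have "\<dots> = (\<Sum>r\<le>R. Cst (\<kappa> r) * vop2 c ?S c' ?T (A + int r) (B - int r) P)"
    unfolding sum.cartesian_product[symmetric]
  proof (rule sum.cong)
    fix r
    show "(\<Sum>k\<le>N. ci c (int (k + r) + A) * g k r) =
        Cst (\<kappa> r) * vop2 c ?S c' ?T (A + int r) (B - int r) P"
      by (subst vop2_eq[of N]) (use N in \<open>auto simp: g_def sum_distrib_left algebra_simps intro!: sum.cong\<close>)
  qed simp
  finally show ?thesis .
qed

text \<open>The creation parts commute as polynomials and the annihilation parts as constant
  coefficient differential operators. This symmetry converts exchange factors into commutation
  relations.\<close>

lemma vop2_commute:
  assumes \<phi>: "\<And>n. n \<ge> 1 \<Longrightarrow> \<phi> n \<ge> n" and \<psi>: "\<And>n. n \<ge> 1 \<Longrightarrow> \<psi> n \<ge> n"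
  shows "vop2 c (sh s \<phi>) c' (sh t \<psi>) A B P = vop2 c' (sh t \<psi>) c (sh s \<phi>) B A P"
proof -
  obtain N where N: "\<forall>l>N. sh t \<psi> l P = 0" "\<forall>l. \<forall>k>N. sh s \<phi> k (sh t \<psi> l P) = 0"
    using sh_finite2[of \<phi> \<psi>] \<phi> \<psi> by blast
  obtain M where M: "\<forall>l>M. sh s \<phi> l P = 0" "\<forall>l. \<forall>k>M. sh t \<psi> k (sh s \<phi> l P) = 0"
    using sh_finite2[of \<psi> \<phi>] \<phi> \<psi> by blast
  show ?thesis
    by (subst (1 2) vop2_eq[of "max N M"], use N M in \<open>auto simp: sh_commute[of s \<phi>]\<close>)
      (subst sum.swap, simp add: mult_ac)
qed

lemma vop_add:
  assumes "\<And>n. n \<ge> 1 \<Longrightarrow> \<phi> n \<ge> n"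
  shows "vop c (sh s \<phi>) A (P + Q) = vop c (sh s \<phi>) A P + vop c (sh s \<phi>) A Q"
proof -
  obtain N where N: "\<forall>k>N. sh s \<phi> k P = 0" using sh_finite[of \<phi>, OF assms] by blast
  obtain M where M: "\<forall>k>M. sh s \<phi> k Q = 0" using sh_finite[of \<phi>, OF assms] by blast
  show ?thesis
    using N M by (subst (1 2 3) vop_eq[of "max N M"]) (auto simp: sh_add distrib_left sum.distrib)
qed

text \<open>A factor that is killed by the derivations in the exponent passes through the operator.
  With derivatives in the even variables only, this is the linearity over D.\<close>

lemma vop_mult_fixed:
  assumes "\<And>n. n \<ge> 1 \<Longrightarrow> \<phi> n \<ge> n" "\<And>n. n \<ge> 1 \<Longrightarrow> s n = 0 \<or> bderiv (\<phi> n) d = 0"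
  shows "vop c (sh s \<phi>) A (d * P) = d * vop c (sh s \<phi>) A P"
proof -
  obtain N where N: "\<forall>k>N. sh s \<phi> k P = 0" using sh_finite[of \<phi>, OF assms(1)] by blast
  show ?thesis
    using N by (subst (1 2) vop_eq[of N])
      (auto simp: sh_mult_fixed[OF assms(2)] sum_distrib_left mult.left_commute)
qed

lemma vop_zero [simp]: "vop c (sh s \<phi>) A 0 = 0"
  by (simp add: vop_def)

section \<open>Operators on the charged space\<close>

definition chop :: "int \<Rightarrow> (int \<Rightarrow> 'k::comm_ring_1 bpoly \<Rightarrow> 'k bpoly) \<Rightarrow> 'k charged \<Rightarrow> 'k charged"
  where "chop d f v = (\<Sum>m\<in>keys v. sg (m + d) (f m (coef v m)))"

lemma coef_chop: "(\<And>m. f m 0 = 0) \<Longrightarrow> coef (chop d f v) n = f (n - d) (coef v (n - d))"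
proof -
  assume 0: "\<And>m. f m 0 = 0"
  have "coef (chop d f v) n = (\<Sum>m\<in>keys v. if m = n - d then f m (coef v m) else 0)"
    unfolding chop_def lookup_sum by (rule sum.cong) (auto simp: lookup_single when_def)
  also have "\<dots> = f (n - d) (coef v (n - d))"
    by (simp add: in_keys_iff 0)
  finally show ?thesis .
qed

lemma coef_poly_mult: "coef (poly_mult p v) n = p * coef v n"
  unfolding poly_mult_def
  by (subst mult_map_scale_conv_mult[symmetric]) (simp add: Poly_Mapping.map.rep_eq when_def)

lemma coef_scalar_mult: "coef (scalar_mult c v) n = Cst c * coef v n"
  by (simp add: scalar_mult_def coef_poly_mult)

lemma coef_map: "f 0 = 0 \<Longrightarrow> coef (Poly_Mapping.map f v) n = f (coef v n)"
  by (simp add: Poly_Mapping.map.rep_eq when_def)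

section \<open>The operators over the function field\<close>

instance fract :: ("{idom, ring_char_0}") field_char_0
proof
  show "inj (of_nat :: nat \<Rightarrow> 'a fract)"
    by (rule injI) (simp add: of_nat_fract eq_fract)
qed

text \<open>\<open>pop G j k\<close> is the coefficient of z^k in the j-th power of the sum of G_n
  z^n over n >= 1.\<close>

fun pop :: "(nat \<Rightarrow> 'k::field_char_0 bpoly \<Rightarrow> 'k bpoly) \<Rightarrow> nat \<Rightarrow> nat \<Rightarrow> 'k bpoly \<Rightarrow> 'k bpoly" where
  "pop G 0 k P = (if k = 0 then P else 0)"
| "pop G (Suc j) k P = (\<Sum>n=1..k. G n (pop G j (k - n) P))"

lemma sum_swap_triangle1:
  "(\<Sum>n=1..k. \<Sum>m=1..k - n. f n m) = (\<Sum>m=1..k. \<Sum>n=1..k - m. f n m)"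
  for f :: "nat \<Rightarrow> nat \<Rightarrow> 'a::comm_monoid_add"
proof -
  have "(\<Sum>(n, m)\<in>(SIGMA n:{1..k}. {1..k - n}). f n m) = (\<Sum>(m, n)\<in>(SIGMA m:{1..k}. {1..k - m}). f n m)"
    by (rule sum.reindex_bij_witness[where i = "\<lambda>(n, m). (m, n)" and j = "\<lambda>(n, m). (m, n)"]) auto
  then show ?thesis by (simp add: sum.Sigma)
qed

locale commuting_ops =
  fixes G :: "nat \<Rightarrow> 'k::field_char_0 bpoly \<Rightarrow> 'k bpoly"
  assumes G_add: "G n (x + y) = G n x + G n y"
    and G_Cst: "G n (Cst c * x) = Cst c * G n x"
    and G_comm: "G n (G m x) = G m (G n x)"
begin

lemma G_zero [simp]: "G n 0 = 0" and G_sum: "G n (sum f A) = (\<Sum>a\<in>A. G n (f a))"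
  using additive_sum[of "G n", OF G_add] by auto

lemma G_nat: "G n (of_nat m * x) = of_nat m * G n x"
  using G_Cst[of n "of_nat m"] by simp

lemma pop_0: "j > k \<Longrightarrow> pop G j k P = 0"
  by (induction j arbitrary: k) (auto intro!: sum.neutral)

text \<open>The coefficient form of z d/dz F^(j+1) = (j+1) (z F') F^j; commutativity of the G_n
  collects the differentiated factor in front.\<close>

lemma pop_rec: "of_nat k * pop G (Suc j) k P = of_nat (Suc j) * (\<Sum>n=1..k. of_nat n * G n (pop G j (k - n) P))"
proof (induction j arbitrary: k)
  case 0
  have "of_nat k * G n (if k - n = 0 then P else 0) = of_nat n * G n (if k - n = 0 then P else 0)"
    if "n \<in> {1..k}" for n
    using that by auto
  then have "(\<Sum>n=1..k. of_nat k * G n (if k - n = 0 then P else 0)) =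
      (\<Sum>n=1..k. of_nat n * G n (if k - n = 0 then P else 0))"
    by (intro sum.cong refl)
  then show ?case by (simp only: pop.simps sum_distrib_left of_nat_Suc of_nat_0 add_0_right mult_1_left)
next
  case (Suc j)
  have "of_nat k * pop G (Suc (Suc j)) k P =
      (\<Sum>n=1..k. of_nat n * G n (pop G (Suc j) (k - n) P)) +
      (\<Sum>n=1..k. G n (of_nat (k - n) * pop G (Suc j) (k - n) P))"
    unfolding pop.simps(2)[of G "Suc j"] sum_distrib_left sum.distrib[symmetric] G_nat
    by (intro sum.cong refl) (auto simp del: of_nat_diff pop.simps simp flip: distrib_right of_nat_add)
  also have "(\<Sum>n=1..k. G n (of_nat (k - n) * pop G (Suc j) (k - n) P)) =
      of_nat (Suc j) * (\<Sum>n=1..k. \<Sum>m=1..k - n. of_nat m * G n (G m (pop G j (k - n - m) P)))"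
    unfolding Suc.IH by (simp add: G_nat G_sum sum_distrib_left del: of_nat_Suc)
  also have "(\<Sum>n=1..k. \<Sum>m=1..k - n. of_nat m * G n (G m (pop G j (k - n - m) P))) =
      (\<Sum>m=1..k. of_nat m * G m (pop G (Suc j) (k - m) P))"
    by (subst sum_swap_triangle1)
      (simp add: G_sum sum_distrib_left diff_commute G_comm[of _ "_ :: nat"] add.commute)
  finally show ?case by (simp add: distrib_right)
qed

text \<open>The bridge from the exponential by powers and factorials, as in \<open>ser_exp\<close>,
  to the recursive one: summing the differentiated powers gives the recursion. As F has no constant
  term, only powers up to k reach z^k.\<close>

lemma eop_pop: "eop G k P = (\<Sum>j\<le>k. Cst (inverse (of_nat (fact j))) * pop G j k P)"
proof (rule eop_unique[symmetric])
  fix k :: nat assume k: "k \<ge> 1"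
  let ?c = "\<lambda>j. Cst (inverse (of_nat (fact j))) :: 'k bpoly"
  have c: "of_nat (Suc j) * (?c (Suc j) * x) = ?c j * x" for j x
  proof -
    have "of_nat (Suc j) * inverse (of_nat (fact (Suc j))) = inverse (of_nat (fact j) :: 'k)"
      by (simp only: fact_Suc of_nat_mult of_nat_id inverse_mult_distrib flip: mult.assoc)
        (simp del: of_nat_Suc)
    then have "of_nat (Suc j) * ?c (Suc j) = ?c j"
      by (metis Cst_mult single_of_nat)
    then show ?thesis by (simp flip: mult.assoc)
  qed
  obtain k' where k': "k = Suc k'" using k by (cases k) auto
  have "of_nat k * (\<Sum>j\<le>k. ?c j * pop G j k P) = (\<Sum>j\<le>k'. ?c (Suc j) * (of_nat k * pop G (Suc j) k P))"
    unfolding k' sum.atMost_Suc_shift by (simp add: sum_distrib_left mult.left_commute del: of_nat_Suc pop.simps(2))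
  also have "\<dots> = (\<Sum>j\<le>k'. ?c j * (\<Sum>n=1..k. of_nat n * G n (pop G j (k - n) P)))"
    unfolding pop_rec by (simp only: mult.left_commute[of "Cst _" "of_nat _"] c)
  also have "\<dots> = (\<Sum>n=1..k. of_nat n * G n (\<Sum>j\<le>k'. ?c j * pop G j (k - n) P))"
    by (simp add: G_sum G_Cst sum_distrib_left mult.left_commute, subst sum.swap, rule refl)
  also have "\<dots> = (\<Sum>n=1..k. of_nat n * G n (\<Sum>j\<le>k - n. ?c j * pop G j (k - n) P))"
  proof (intro sum.cong refl)
    fix n assume n: "n \<in> {1..k}"
    have "(\<Sum>j\<le>k'. ?c j * pop G j (k - n) P) = (\<Sum>j\<le>k - n. ?c j * pop G j (k - n) P)"
      by (rule sum.mono_neutral_right) (use n k' in \<open>auto simp: pop_0\<close>)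
    then show "of_nat n * G n (\<Sum>j\<le>k'. ?c j * pop G j (k - n) P) =
        of_nat n * G n (\<Sum>j\<le>k - n. ?c j * pop G j (k - n) P)" by simp
  qed
  finally show "of_nat k * (\<Sum>j\<le>k. ?c j * pop G j k P) =
      (\<Sum>n=1..k. of_nat n * G n (\<Sum>j\<le>k - n. ?c j * pop G j (k - n) P))" .
qed simp

end

text \<open>The sign s treats series in z (s = 1) and in 1/z (s = -1) at the same time.\<close>

lemma coef_ser_pow:
  fixes F :: opser and s :: int
  assumes "commuting_ops G" and s: "s = 1 \<or> s = - 1"
    and F: "\<And>k v n. coef (F k v) n = (if s * k > 0 then G (nat (s * k)) (coef v n) else 0)"
  shows "coef (ser_pow F j k v) n = (if s * k \<ge> 0 then pop G j (nat (s * k)) (coef v n) else 0)"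
proof (induction j arbitrary: k n)
  case 0
  then show ?case using s by (auto simp: ser_const_def)
next
  case (Suc j)
  interpret commuting_ops G by fact
  have F0: "F i 0 = 0" for i by (rule poly_mapping_eqI) (simp add: F)
  have ss: "s * (s * i) = i" for i using s by auto
  have z: "ser_pow F j i v = 0" if "s * i < 0" for i
    by (rule poly_mapping_eqI) (use that in \<open>simp add: Suc.IH\<close>)
  have z': "F i w = 0" if "\<not> s * i > 0" for i w
    by (rule poly_mapping_eqI) (use that in \<open>simp add: F\<close>)
  let ?A = "(\<lambda>n. s * int n) ` {1..nat (s * k)}"
  have supp: "{i. F i (ser_pow F j (k - i) v) \<noteq> 0} \<subseteq> ?A"
  proof safe
    fix i assume i: "F i (ser_pow F j (k - i) v) \<noteq> 0"
    have 1: "s * i > 0" using z' i by blast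
    have 2: "s * (k - i) \<ge> 0" using z i F0 by (metis not_le)
    have "i = s * int (nat (s * i))" using 1 ss by simp
    moreover have "nat (s * i) \<in> {1..nat (s * k)}" using 1 2 by (auto simp: right_diff_distrib)
    ultimately show "i \<in> ?A" by blast
  qed
  have "coef (ser_pow F (Suc j) k v) n = (\<Sum>i\<in>?A. coef (F i (ser_pow F j (k - i) v)) n)"
    by (simp add: ser_mult_def Sum_any.expand_superset[OF _ supp] lookup_sum)
  also have "\<dots> = (\<Sum>i=1..nat (s * k). coef (F (s * int i) (ser_pow F j (k - s * int i) v)) n)"
    by (subst sum.reindex) (use s in \<open>auto simp: inj_on_def\<close>)
  also have "\<dots> = (\<Sum>i=1..nat (s * k). G i (pop G j (nat (s * k) - i) (coef v n)))"
    by (rule sum.cong) (auto simp: F ss Suc.IH right_diff_distrib nat_diff_distrib)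
  finally show ?case by auto
qed

lemma coef_ser_exp:
  fixes F :: opser and s :: int
  assumes G: "commuting_ops G" and s: "s = 1 \<or> s = - 1"
    and F: "\<And>k v n. coef (F k v) n = (if s * k > 0 then G (nat (s * k)) (coef v n) else 0)"
  shows "coef (ser_exp F k v) n = (if s * k \<ge> 0 then eop G (nat (s * k)) (coef v n) else 0)"
proof -
  interpret commuting_ops G by fact
  note pow = coef_ser_pow[of G s F, OF G s F]
  let ?f = "\<lambda>j. scalar_mult (inverse (of_nat (fact j))) (ser_pow F j k v)"
  have "ser_pow F j k v = 0" if "j > nat (s * k)" for j
    by (rule poly_mapping_eqI) (use that in \<open>simp add: pow pop_0\<close>)
  then have "{j. ?f j \<noteq> 0} \<subseteq> {..nat (s * k)}"
    by (auto simp: scalar_mult_def poly_mult_def not_less[symmetric])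
  then have "ser_exp F k v = sum ?f {..nat (s * k)}"
    unfolding ser_exp_def by (intro Sum_any.expand_superset) auto
  then show ?thesis
    by (simp add: lookup_sum coef_scalar_mult pow eop_pop)
qed

text \<open>The coefficients in the exponents of x^-(z): that of b_{-n} z^n, and that of the
  derivative by b_{-n} times z^(-n), where the factor n in the action of b_n cancels 1/n.\<close>

definition \<gamma>q :: "'k::field_char_0 \<Rightarrow> nat \<Rightarrow> 'k" where "\<gamma>q q n = - (q ^ n) / of_nat n"
definition sq :: "'k::field_char_0 \<Rightarrow> nat \<Rightarrow> 'k" where "sq q n = q ^ n + inverse q ^ n"

abbreviation "cq q \<equiv> cf (\<gamma>q q) (\<lambda>n. n)"
abbreviation "\<sigma>q q \<equiv> sh (sq q) (\<lambda>n. n)"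

section \<open>Components of x_0^- and of its divided square over C(q)\<close>

lemma coef_creation:
  "coef (ser_exp creation_ser k v) n = ci (cq qq) k * coef v n"
proof -
  have G: "commuting_ops (\<lambda>n P. Cst (\<gamma>q qq n) * bvar n * P)"
    by standard (simp_all add: algebra_simps)
  have "coef (creation_ser k v) n =
      (if 1 * k > 0 then Cst (\<gamma>q qq (nat (1 * k))) * bvar (nat (1 * k)) * coef v n else 0)" for k v n
  proof (cases "k > 0")
    case True
    then obtain j where "k = int j" by (metis zero_less_imp_eq_int)
    then show ?thesis
      by (simp add: creation_ser_def coef_scalar_mult b_neg_def coef_poly_mult \<gamma>q_def mult.assoc)
  qed (simp add: creation_ser_def)
  from coef_ser_exp[of _ 1, OF G _ this] show ?thesis
    by (simp add: ci_def eop_mult)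
qed

lemma coef_annihilation:
  "coef (ser_exp annihilation_ser k v) n = (if k \<le> 0 then \<sigma>q qq (nat (- k)) (coef v n) else 0)"
proof -
  have G: "commuting_ops (\<lambda>n P. Cst (sq qq n) * bderiv n P)"
    by standard (simp_all add: bderiv_add bderiv_Cst_mult bderiv_commute distrib_left mult.left_commute)
  have *: "Cst (1 / of_nat j) * (Cst (of_nat j * (qq ^ j + inverse qq ^ j)) * x) = Cst (sq qq j) * x"
    if "j > 0" for j x
    using that by (simp add: sq_def mult_single flip: mult.assoc)
  have "coef (annihilation_ser k v) n =
      (if - 1 * k > 0 then Cst (sq qq (nat (- 1 * k))) * bderiv (nat (- 1 * k)) (coef v n) else 0)" for k v n
  proof (cases "k < 0")
    case True
    then obtain j where "k = - int j" "j > 0" by (metis neg_int_cases)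
    then show ?thesis
      by (simp add: annihilation_ser_def coef_scalar_mult b_pos_def coef_map * )
  qed (simp add: annihilation_ser_def)
  from coef_ser_exp[of _ "- 1", OF G _ this] show ?thesis
    by (simp add: sh_def)
qed

lemma coef_e_z:
  "coef (ser_mult (ser_const e_neg_alpha) z_neg_partial k v) n =
    (if k = - 2 * (n + 1) then coef v (n + 1) else 0)"
proof -
  have e: "coef (e_neg_alpha v) n = coef v (n + 1)" for v n
  proof -
    have "coef (sg (- 1) 1 * v) n = coef v (n + 1)"
      by (rule pm_ext_additive[of "\<lambda>v. coef (sg (- 1) 1 * v) n" "\<lambda>v. coef v (n + 1)"])
        (auto simp: lookup_add distrib_left mult_single lookup_single when_def)
    then show ?thesis by (simp add: e_neg_alpha_def)
  qed
  have z: "coef (z_neg_partial k v) n = (if k = - 2 * n then coef v n else 0)" for k v n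
  proof -
    have "coef (z_neg_partial k v) n = (\<Sum>m\<in>keys v. if m = n \<and> k = - 2 * n then coef v n else 0)"
      unfolding z_neg_partial_def lookup_sum
      by (rule sum.cong) (auto simp: lookup_single when_def)
    then show ?thesis by (cases "k = - 2 * n") (simp_all add: in_keys_iff)
  qed
  have "ser_mult (ser_const e_neg_alpha) z_neg_partial k v = e_neg_alpha (z_neg_partial k v)"
    unfolding ser_mult_def
    by (subst Sum_any.expand_superset[of "{0}"]) (auto simp: ser_const_def)
  then show ?thesis by (simp add: e z)
qed

text \<open>x_0^- is the coefficient of z^(-1). On the source component n + 1 the last factor is
  z^(-2n-2), so the two exponentials together have to contribute z^(2n+1).\<close>

lemma coef_x_minus0: "coef (x_minus 0 v) n = vop (cq qq) (\<sigma>q qq) (2 * n + 1) (coef v (n + 1))"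
proof -
  define Z where "Z = ser_mult (ser_const e_neg_alpha) z_neg_partial"
  define AZ where "AZ = ser_mult (ser_exp annihilation_ser) Z"
  have Z: "coef (Z k v) n = (if k = - 2 * (n + 1) then coef v (n + 1) else 0)" for k n
    unfolding Z_def by (rule coef_e_z)
  have A0: "ser_exp annihilation_ser i 0 = 0" for i
    by (rule poly_mapping_eqI) (simp add: coef_annihilation)
  have C0: "ser_exp creation_ser i 0 = 0" for i
    by (rule poly_mapping_eqI) (simp add: coef_creation)
  have AZ: "coef (AZ k v) n = (if k + 2 * (n + 1) \<le> 0 then \<sigma>q qq (nat (- (k + 2 * (n + 1)))) (coef v (n + 1)) else 0)"
    for k n
  proof -
    let ?A = "insert (k + 2 * (n + 1)) ((\<lambda>m. k + 2 * m) ` keys v)"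
    have supp: "{i. ser_exp annihilation_ser i (Z (k - i) v) \<noteq> 0} \<subseteq> ?A"
    proof safe
      fix i assume "ser_exp annihilation_ser i (Z (k - i) v) \<noteq> 0" "i \<notin> (\<lambda>m. k + 2 * m) ` keys v"
      then have "Z (k - i) v \<noteq> 0" using A0 by metis
      then obtain n' where "coef (Z (k - i) v) n' \<noteq> 0" by (metis lookup_zero poly_mapping_eqI)
      then have "k - i = - 2 * (n' + 1)" "n' + 1 \<in> keys v" by (auto simp: Z in_keys_iff split: if_splits)
      then have "i \<in> (\<lambda>m. k + 2 * m) ` keys v" by (intro image_eqI[of _ _ "n' + 1"]) auto
      with \<open>i \<notin> _\<close> show "i = k + 2 * (n + 1)" by blast
    qed
    have "coef (AZ k v) n = (\<Sum>i\<in>?A. coef (ser_exp annihilation_ser i (Z (k - i) v)) n)"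
      unfolding AZ_def ser_mult_def[of _ Z] by (simp add: Sum_any.expand_superset[OF _ supp] lookup_sum)
    also have "\<dots> = (\<Sum>i\<in>?A. if i = k + 2 * (n + 1) then
        (if i \<le> 0 then \<sigma>q qq (nat (- i)) (coef v (n + 1)) else 0) else 0)"
      by (rule sum.cong) (auto simp: coef_annihilation Z)
    also have "\<dots> = (if k + 2 * (n + 1) \<le> 0 then \<sigma>q qq (nat (- (k + 2 * (n + 1)))) (coef v (n + 1)) else 0)"
      by (subst sum.delta) auto
    finally show ?thesis .
  qed
  have "\<exists>N. \<forall>m. \<forall>l>N. \<sigma>q qq l (coef v m) = 0"
  proof -
    have "\<forall>m. \<exists>N. \<forall>l>N. \<sigma>q qq l (coef v m) = 0" using sh_finite[of "\<lambda>n. n"] by blast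
    then obtain N where N: "\<And>m l. l > N m \<Longrightarrow> \<sigma>q qq l (coef v m) = 0" by metis
    have "\<sigma>q qq l (coef v m) = 0" if "l > Max (insert 0 (N ` keys v))" for l m
    proof (cases "m \<in> keys v")
      case True
      then have "l > N m" using that by auto
      then show ?thesis by (rule N)
    qed (simp add: in_keys_iff)
    then show ?thesis by blast
  qed
  then obtain N where N: "\<And>m l. l > N \<Longrightarrow> \<sigma>q qq l (coef v m) = 0" by blast
  let ?k = "- 1 :: int"
  let ?B = "\<lambda>m. (\<lambda>l. ?k + 2 * m + int l) ` {..N}"
  \<comment> \<open>\<open>Sum_any\<close> is formed before the component n is taken, so the finite
    index set has to cover the contributions of all components of v.\<close>
  let ?A = "?B (n + 1) \<union> (\<Union>m\<in>keys v. ?B m)"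
  have supp: "{i. ser_exp creation_ser i (AZ (?k - i) v) \<noteq> 0} \<subseteq> ?A"
  proof
    fix i assume "i \<in> {i. ser_exp creation_ser i (AZ (?k - i) v) \<noteq> 0}"
    then have "AZ (?k - i) v \<noteq> 0" using C0 by (metis (mono_tags) mem_Collect_eq)
    then obtain n' where *: "coef (AZ (?k - i) v) n' \<noteq> 0" by (metis lookup_zero poly_mapping_eqI)
    let ?l = "nat (- (?k - i + 2 * (n' + 1)))"
    from * have l: "?k - i + 2 * (n' + 1) \<le> 0" "\<sigma>q qq ?l (coef v (n' + 1)) \<noteq> 0"
      by (auto simp: AZ split: if_splits)
    then have "?l \<le> N" "n' + 1 \<in> keys v" using N by (auto simp: in_keys_iff not_less[symmetric])
    moreover have "i = ?k + 2 * (n' + 1) + int ?l" using l(1) by simp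
    ultimately show "i \<in> ?A" by blast
  qed
  have "coef (x_minus 0 v) n = (\<Sum>i\<in>?A. coef (ser_exp creation_ser i (AZ (?k - i) v)) n)"
  proof -
    have "x_minus 0 v = Sum_any (\<lambda>i. ser_exp creation_ser i (AZ (?k - i) v))"
      by (simp add: x_minus_def x_minus_ser_def Z_def AZ_def ser_mult_def[of "ser_exp creation_ser"])
    also have "\<dots> = (\<Sum>i\<in>?A. ser_exp creation_ser i (AZ (?k - i) v))"
      by (rule Sum_any.expand_superset[OF _ supp]) simp
    finally show ?thesis by (simp only: lookup_sum)
  qed
  also have "\<dots> = (\<Sum>i\<in>?B (n + 1). coef (ser_exp creation_ser i (AZ (?k - i) v)) n)"
  proof (rule sum.mono_neutral_right)
    show "\<forall>i\<in>?A - ?B (n + 1). coef (ser_exp creation_ser i (AZ (?k - i) v)) n = 0"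
    proof
      fix i assume i: "i \<in> ?A - ?B (n + 1)"
      let ?l = "nat (- (?k - i + 2 * (n + 1)))"
      have "\<sigma>q qq ?l (coef v (n + 1)) = 0" if le: "?k - i + 2 * (n + 1) \<le> 0"
      proof (rule N, rule ccontr)
        assume "\<not> ?l > N"
        moreover have "i = ?k + 2 * (n + 1) + int ?l" using le by simp
        ultimately show False using i by (metis DiffD2 atMost_iff image_eqI not_less)
      qed
      then show "coef (ser_exp creation_ser i (AZ (?k - i) v)) n = 0"
        by (simp add: coef_creation AZ)
    qed
  qed auto
  also have "\<dots> = (\<Sum>l\<le>N. ci (cq qq) (2 * n + 1 + int l) * \<sigma>q qq l (coef v (n + 1)))"
    by (subst sum.reindex) (auto simp: inj_on_def coef_creation AZ algebra_simps intro!: sum.cong)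
  also have "\<dots> = vop (cq qq) (\<sigma>q qq) (2 * n + 1) (coef v (n + 1))"
    by (subst vop_eq[of N]) (use N in \<open>auto simp: add.commute\<close>)
  finally show ?thesis .
qed

text \<open>The coefficients of \<open>(1 - x) (1 - q\<^sup>2 x)\<close>.\<close>

definition \<kappa>q :: "'k::field_char_0 \<Rightarrow> nat \<Rightarrow> 'k"
  where "\<kappa>q q r = (if r = 0 then 1 else if r = 1 then - (1 + q ^ 2) else if r = 2 then q ^ 2 else 0)"

lemma sum_first_terms:
  fixes f :: "nat \<Rightarrow> 'a::comm_ring_1"
  assumes "k \<ge> 3"
  shows "(\<Sum>n=1..k. f n * \<kappa> (k - n)) = (\<Sum>n=1..k-3. f n * \<kappa> (k - n)) + f (k - 2) * \<kappa> 2 + f (k - 1) * \<kappa> 1 + f k * \<kappa> 0"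
proof -
  obtain j where j: "k = j + 3" using assms by (metis add.commute le_iff_add)
  show ?thesis by (simp add: j numeral_3_eq_3 numeral_2_eq_2)
qed

text \<open>Here n s_n gamma_n = -(1 + q^(2n)), and (1 - x)(1 - q^2 x) is the exponential of minus
  the sum of (1 + q^(2n)) x^n / n.\<close>

lemma \<kappa>q_rec:
  fixes q :: "'k::field_char_0"
  assumes "q \<noteq> 0" "k \<ge> 1"
  shows "of_nat k * \<kappa>q q k = (\<Sum>n=1..k. of_nat n * (sq q n * \<gamma>q q n) * \<kappa>q q (k - n))"
proof -
  have e: "of_nat n * (sq q n * \<gamma>q q n) = - (1 + q ^ (2 * n))" if "n \<ge> 1" for n
    using that assms(1) by (simp add: sq_def \<gamma>q_def field_simps power_mult power2_eq_square power_mult_distrib)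
  have sum: "(\<Sum>n=1..k. of_nat n * (sq q n * \<gamma>q q n) * \<kappa>q q (k - n)) = (\<Sum>n=1..k. - (1 + q ^ (2 * n)) * \<kappa>q q (k - n))"
    by (rule sum.cong) (auto simp: e)
  consider "k = 1" | "k = 2" | "k \<ge> 3" using assms(2) by linarith
  then show ?thesis
  proof cases
    case 1
    then show ?thesis unfolding sum by (simp add: \<kappa>q_def)
  next
    case 2
    then show ?thesis unfolding sum
      by (simp add: \<kappa>q_def numeral_2_eq_2) (simp add: algebra_simps power2_eq_square flip: numeral_2_eq_2)
  next
    case 3
    then obtain j where j: "k = j + 3" by (metis add.commute le_iff_add)
    have z: "(\<Sum>n=1..k-3. - (1 + q ^ (2 * n)) * \<kappa>q q (k - n)) = 0"
      by (rule sum.neutral) (use 3 in \<open>auto simp: \<kappa>q_def\<close>)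
    \<comment> \<open>The last three terms of the convolution cancel because 1 + q^(2n) satisfies
      the linear recurrence with characteristic roots 1 and q^2.\<close>
    show ?thesis
      unfolding sum sum_first_terms[OF 3, of "\<lambda>n. - (1 + q ^ (2 * n))" "\<kappa>q q"] z
      by (simp add: \<kappa>q_def j algebra_simps power_add power_mult eval_nat_numeral)
  qed
qed

text \<open>The exchange terms r = 0 and r = 2 have coefficients 1 and q^2 and, by symmetry, the
  same normally ordered product, while r = 1 has coefficient -(1 + q^2). So 1 + q^2 splits off;
  against q + 1/q it leaves q, which is regular at the point of specialization.\<close>

lemma vop_cq_vop_cq:
  fixes q :: "'k::field_char_0"
  assumes "q \<noteq> 0"
  shows "vop (cq q) (\<sigma>q q) A (vop (cq q) (\<sigma>q q) (A + 2) P) =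
    Cst (1 + q ^ 2) * (vop2 (cq q) (\<sigma>q q) (cq q) (\<sigma>q q) A (A + 2) P
      - vop2 (cq q) (\<sigma>q q) (cq q) (\<sigma>q q) (A + 1) (A + 1) P)"
proof -
  let ?E = "\<lambda>A B. vop2 (cq q) (\<sigma>q q) (cq q) (\<sigma>q q) A B P"
  obtain N where N: "\<forall>l>N. \<sigma>q q l P = 0" "\<forall>l. \<forall>k>N. \<sigma>q q k (\<sigma>q q l P) = 0"
    using sh_finite2[of "\<lambda>n. n" "\<lambda>n. n"] by blast
  \<comment> \<open>R satisfies the bound of \<open>vop_vop\<close> for the inner index A + 2 and is
    at least 2, so that all nonzero \<open>\<kappa>q\<close> are in range.\<close>
  define R where "R = nat (int N + A) + 4"
  have ex: "\<sigma>q q r (ci (cq q) B) = Cst (\<kappa>q q r) * ci (cq q) (B - int r)" for r B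
    by (rule sh_cf[OF _ _ _ \<kappa>q_rec[OF assms]]) (auto simp: \<kappa>q_def[of q 0])
  have "vop (cq q) (\<sigma>q q) A (vop (cq q) (\<sigma>q q) (A + 2) P) =
      (\<Sum>r\<le>R. Cst (\<kappa>q q r) * ?E (A + int r) (A + 2 - int r))"
    by (rule vop_vop[OF _ _ ex N]) (auto simp: R_def)
  also have "\<dots> = (\<Sum>r\<in>{0, 1, 2}. Cst (\<kappa>q q r) * ?E (A + int r) (A + 2 - int r))"
    by (rule sum.mono_neutral_right) (auto simp: R_def \<kappa>q_def)
  also have "\<dots> = ?E A (A + 2) - Cst (1 + q ^ 2) * ?E (A + 1) (A + 1) + Cst (q ^ 2) * ?E (A + 2) A"
  proof -
    have "Cst (\<kappa>q q 0) = 1" "Cst (\<kappa>q q 1) = - Cst (1 + q ^ 2)" "Cst (\<kappa>q q 2) = Cst (q ^ 2)"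
      by (simp_all add: \<kappa>q_def flip: single_uminus)
    then show ?thesis by (simp add: add.commute)
  qed
  also have "?E (A + 2) A = ?E A (A + 2)"
    by (rule vop2_commute) auto
  finally show ?thesis by (simp add: Cst_add algebra_simps)
qed

lemma qq_nonzero: "qq \<noteq> 0"
proof -
  have "sg 1 1 \<noteq> (0 :: laurent)"
    by (metis lookup_single_eq lookup_zero zero_neq_one)
  then show ?thesis by (simp add: qq_def of_laurent_def Zero_fract_def eq_fract)
qed

lemma qq_square: "1 + qq ^ 2 \<noteq> 0"
proof -
  have "1 + sg 1 1 ^ 2 \<noteq> (0 :: laurent)"
  proof
    assume "1 + sg 1 1 ^ 2 = (0 :: laurent)"
    then have "coef (1 + sg 1 1 ^ 2 :: laurent) 0 = 0" by simp
    then show False by (simp add: power2_eq_square mult_single lookup_add lookup_single)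
  qed
  moreover have "1 + qq ^ 2 = Fract (1 + sg 1 1 ^ 2) 1"
    by (simp add: qq_def of_laurent_def power2_eq_square One_fract_def)
  ultimately show ?thesis by (simp add: Zero_fract_def eq_fract)
qed

lemma coef_x_minus0_div2: "coef (x_minus0_div2 v) n =
  Cst qq * (vop2 (cq qq) (\<sigma>q qq) (cq qq) (\<sigma>q qq) (2 * n + 1) (2 * n + 3) (coef v (n + 2))
    - vop2 (cq qq) (\<sigma>q qq) (cq qq) (\<sigma>q qq) (2 * n + 2) (2 * n + 2) (coef v (n + 2)))"
proof -
  have c: "Cst (inverse (qq + inverse qq)) * (Cst (1 + qq ^ 2) * x) = Cst qq * x" for x
  proof -
    have "inverse (qq + inverse qq) * (1 + qq ^ 2) = qq"
      using qq_nonzero qq_square by (simp add: field_simps power2_eq_square)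
    then show ?thesis by (simp add: mult_single flip: mult.assoc)
  qed
  have "coef (x_minus0_div2 v) n = Cst (inverse (qq + inverse qq)) *
      vop (cq qq) (\<sigma>q qq) (2 * n + 1) (vop (cq qq) (\<sigma>q qq) (2 * n + 1 + 2) (coef v (n + 2)))"
    by (simp add: x_minus0_div2_def coef_scalar_mult coef_x_minus0 algebra_simps)
  then show ?thesis
    unfolding vop_cq_vop_cq[OF qq_nonzero] c by (simp add: algebra_simps)
qed

section \<open>Specialization\<close>

lemma laurent_eval_add: "laurent_eval z (a + b) = laurent_eval z a + laurent_eval z b"
  unfolding laurent_eval_def by (rule keys_sum_add) (auto simp: distrib_right)

lemma laurent_eval_single: "laurent_eval z (sg k c) = c * z powi k"
  unfolding laurent_eval_def by (rule keys_sum_single) simp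

lemma laurent_eval_0 [simp]: "laurent_eval z 0 = 0"
  by (simp add: laurent_eval_def)

lemma laurent_eval_mult: "z \<noteq> 0 \<Longrightarrow> laurent_eval z (a * b) = laurent_eval z a * laurent_eval z b"
proof (induction a rule: pm_induct)
  case (single k c)
  show ?case
    by (induction b rule: pm_induct)
      (simp_all add: mult_single laurent_eval_single laurent_eval_add single.prems power_int_add distrib_left)
qed (simp_all add: laurent_eval_add distrib_right)

lemma of_laurent_inj: "inj of_laurent"
  by (rule injI) (simp add: of_laurent_def eq_fract)

lemma of_laurent_add: "of_laurent (a + b) = of_laurent a + of_laurent b"
  and of_laurent_mult: "of_laurent (a * b) = of_laurent a * of_laurent b"
  and of_laurent_0 [simp]: "of_laurent 0 = 0"
  by (simp_all add: of_laurent_def Zero_fract_def)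

lemma map_add:
  assumes "\<And>a b. f (a + b) = f a + (f b :: 'c::monoid_add)" "f 0 = 0"
  shows "Poly_Mapping.map f (p + q) = Poly_Mapping.map f p + Poly_Mapping.map f q"
  by (rule poly_mapping_eqI) (simp add: coef_map assms lookup_add)

lemma map_zero: "f 0 = 0 \<Longrightarrow> Poly_Mapping.map f 0 = 0"
  by (rule poly_mapping_eqI) (simp add: coef_map)

lemma map_mult:
  fixes f :: "'k::comm_ring_1 \<Rightarrow> 'l::comm_ring_1"
  assumes "\<And>a b. f (a + b) = f a + f b" "f 0 = 0" "\<And>a b. f (a * b) = f a * f b"
  shows "Poly_Mapping.map f (p * q) = Poly_Mapping.map f p * Poly_Mapping.map f (q :: 'm::monoid_add \<Rightarrow>\<^sub>0 'k)"
proof (induction p rule: pm_induct)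
  case (single k c)
  show ?case
    by (induction q rule: pm_induct)
      (simp_all add: mult_single map_single assms map_add[of f, OF assms(1,2)]
        map_zero[of f, OF assms(2)] distrib_left when_def)
qed (simp_all add: map_add[of f, OF assms(1,2)] map_zero[of f, OF assms(2)] distrib_right)

text \<open>Operators are specialized by relating vectors of the lattice to their reductions, so that
  \<open>inv_into UNIV of_laurent\<close> is unfolded only once.\<close>

definition spec_rel :: "ratq bpoly \<Rightarrow> complex bpoly \<Rightarrow> bool"
  where "spec_rel P P' \<longleftrightarrow>
    (\<exists>Q. P = Poly_Mapping.map of_laurent Q \<and> P' = Poly_Mapping.map (laurent_eval \<i>) Q)"

lemma spec_rel_0: "spec_rel 0 0"
  unfolding spec_rel_def by (rule exI[of _ 0]) (simp add: map_zero)

lemma spec_rel_add: "spec_rel P P' \<Longrightarrow> spec_rel Q Q' \<Longrightarrow> spec_rel (P + Q) (P' + Q')"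
  unfolding spec_rel_def by (metis map_add of_laurent_0 of_laurent_add laurent_eval_0 laurent_eval_add)

lemma spec_rel_mult: "spec_rel P P' \<Longrightarrow> spec_rel Q Q' \<Longrightarrow> spec_rel (P * Q) (P' * Q')"
proof -
  assume "spec_rel P P'" "spec_rel Q Q'"
  then obtain A B where "P = Poly_Mapping.map of_laurent A" "P' = Poly_Mapping.map (laurent_eval \<i>) A"
    "Q = Poly_Mapping.map of_laurent B" "Q' = Poly_Mapping.map (laurent_eval \<i>) B"
    unfolding spec_rel_def by blast
  then show ?thesis
    unfolding spec_rel_def
    by (intro exI[of _ "A * B"])
      (simp add: map_mult of_laurent_add of_laurent_mult laurent_eval_add laurent_eval_mult)
qed

lemma spec_rel_single: "spec_rel (sg M (of_laurent a)) (sg M (laurent_eval \<i> a))"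
  unfolding spec_rel_def by (intro exI[of _ "sg M a"]) (simp add: map_single)

lemma spec_rel_sum: "(\<And>a. a \<in> A \<Longrightarrow> spec_rel (f a) (g a)) \<Longrightarrow> spec_rel (sum f A) (sum g A)"
  by (induction A rule: infinite_finite_induct) (auto intro: spec_rel_0 spec_rel_add)

lemma of_laurent_const:
  "of_laurent 1 = 1" "of_laurent (- a) = - of_laurent a" "of_laurent (of_nat n) = of_nat n"
  by (simp_all add: of_laurent_def One_fract_def of_nat_fract)

lemma of_laurent_inverse_nat: "n > 0 \<Longrightarrow> of_laurent (sg 0 (inverse (of_nat n))) = inverse (of_nat n)"
proof -
  assume n: "n > 0"
  have "of_nat n * sg 0 (inverse (of_nat n)) = (1 :: laurent)"
    using n by (simp add: mult_single flip: single_of_nat)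
  then have "of_nat n * of_laurent (sg 0 (inverse (of_nat n))) = 1"
    by (metis of_laurent_mult of_laurent_const(1,3))
  then show ?thesis by (metis inverse_unique)
qed

lemma inverse_qq: "inverse qq = of_laurent (sg (- 1) 1)"
proof -
  have "qq * of_laurent (sg (- 1) 1) = 1"
    by (simp add: qq_def mult_single of_laurent_const flip: of_laurent_mult)
  then show ?thesis by (rule inverse_unique)
qed

lemma laurent_eval_1 [simp]: "laurent_eval z 1 = 1"
  using laurent_eval_single[of z 0 1] by simp

lemma laurent_eval_q: "laurent_eval \<i> (sg 1 1) = \<i>" "laurent_eval \<i> (sg (- 1) 1) = inverse \<i>"
  by (simp_all add: laurent_eval_single power_int_minus)

definition rel :: "ratq \<Rightarrow> complex \<Rightarrow> bool"
  where "rel r c \<longleftrightarrow> (\<exists>a. r = of_laurent a \<and> c = laurent_eval \<i> a)"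

lemma rel_intros:
  "rel r c \<Longrightarrow> rel r' c' \<Longrightarrow> rel (r + r') (c + c')" "rel r c \<Longrightarrow> rel r' c' \<Longrightarrow> rel (r * r') (c * c')"
  "rel qq \<i>" "rel (inverse qq) (inverse \<i>)" "n > 0 \<Longrightarrow> rel (inverse (of_nat n)) (inverse (of_nat n))"
  "rel (- 1) (- 1)" "rel 1 1"
  unfolding rel_def
       apply (metis of_laurent_add laurent_eval_add)
      apply (metis of_laurent_mult laurent_eval_mult complex_i_not_zero)
     apply (metis qq_def laurent_eval_q(1))
    apply (metis inverse_qq laurent_eval_q(2))
   apply (intro exI[of _ "sg 0 (inverse (of_nat n))"])
   apply (simp add: laurent_eval_single of_laurent_inverse_nat)
  apply (intro exI[of _ "- 1"])
  apply (metis laurent_eval_single mult.right_neutral of_laurent_const(1,2) power_int_0_right single_one single_uminus)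
  apply (intro exI[of _ 1])
  apply (simp add: of_laurent_const)
  done

lemma rel_power: "rel r c \<Longrightarrow> rel (r ^ n) (c ^ n)"
  by (induction n) (auto intro: rel_intros)

lemma spec_rel_Cst: "rel r c \<Longrightarrow> spec_rel (sg M r) (sg M c)"
  unfolding rel_def using spec_rel_single by blast

lemma spec_rel_of_nat: "spec_rel (of_nat n) (of_nat n)"
proof -
  have "rel (of_nat n) (of_nat n)"
  proof (induction n)
    case 0
    show ?case unfolding rel_def by (rule exI[of _ 0]) simp
  qed (auto intro: rel_intros)
  then show ?thesis using spec_rel_Cst[of _ _ 0] by (metis single_of_nat)
qed

lemma bderiv_map:
  fixes f :: "'k::comm_ring_1 \<Rightarrow> 'l::comm_ring_1"
  assumes "\<And>a b. f (a + b) = f a + f b" "f 0 = 0"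
  shows "bderiv n (Poly_Mapping.map f p) = Poly_Mapping.map f (bderiv n p)"
proof -
  have *: "f (of_nat k * c) = of_nat k * f c" for k c
    by (induction k) (simp_all add: assms distrib_right)
  show ?thesis
    by (rule pm_ext_additive[of "\<lambda>p. bderiv n (Poly_Mapping.map f p)" "\<lambda>p. Poly_Mapping.map f (bderiv n p)"])
      (simp_all add: map_add[of f, OF assms] bderiv_add map_single bderiv_single assms * when_def)
qed

lemma spec_rel_bderiv: "spec_rel P P' \<Longrightarrow> spec_rel (bderiv n P) (bderiv n P')"
  unfolding spec_rel_def
  by (metis bderiv_map of_laurent_0 of_laurent_add laurent_eval_0 laurent_eval_add)

text \<open>The only denominators in the recursion are positive integers, which are units of A.
  Hence exponentials preserve the lattice and are specialized factor by factor.\<close>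

lemma spec_rel_eop:
  assumes "\<And>n P P'. n \<ge> 1 \<Longrightarrow> spec_rel P P' \<Longrightarrow> spec_rel (G n P) (G' n P')" "spec_rel P P'"
  shows "spec_rel (eop G k P) (eop G' k P')"
proof (induction k rule: less_induct)
  case (less k)
  show ?case
  proof (cases k)
    case (Suc j)
    show ?thesis
      unfolding Suc eop.simps(2)
      by (intro spec_rel_mult spec_rel_sum spec_rel_of_nat assms(1) less.IH spec_rel_Cst rel_intros(5))
        (auto simp: Suc)
  qed (simp add: assms)
qed

lemma spec_rel_cq: "spec_rel (ci (cq qq) A) (ci (cq \<i>) A)"
proof -
  have "rel (\<gamma>q qq n) (\<gamma>q \<i> n)" if "n \<ge> 1" for n
    using rel_intros(2)[OF rel_intros(2)[OF rel_intros(6) rel_power[OF rel_intros(3)]] rel_intros(5)[of n], of n] that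
    by (simp add: \<gamma>q_def divide_inverse)
  then have "spec_rel (cq qq k) (cq \<i> k)" for k
    unfolding cf_def
    by (intro spec_rel_eop spec_rel_mult)
      (auto intro: spec_rel_Cst spec_rel_Cst[OF rel_intros(7), of 0, simplified] rel_intros(7) simp: bvar_def)
  then show ?thesis by (simp add: ci_def spec_rel_0)
qed

lemma spec_rel_\<sigma>q: "spec_rel P P' \<Longrightarrow> spec_rel (\<sigma>q qq k P) (\<sigma>q \<i> k P')"
  unfolding sh_def sq_def
  by (intro spec_rel_eop spec_rel_mult spec_rel_Cst spec_rel_bderiv rel_intros rel_power) auto

lemma spec_rel_vop: "spec_rel P P' \<Longrightarrow> spec_rel (vop (cq qq) (\<sigma>q qq) A P) (vop (cq \<i>) (\<sigma>q \<i>) A P')"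
proof -
  assume P: "spec_rel P P'"
  obtain N where N: "\<forall>k>N. \<sigma>q qq k P = 0" using sh_finite[of "\<lambda>n. n"] by blast
  obtain M where M: "\<forall>k>M. \<sigma>q \<i> k P' = 0" using sh_finite[of "\<lambda>n. n"] by blast
  have "\<forall>k>max N M. \<sigma>q qq k P = 0" "\<forall>k>max N M. \<sigma>q \<i> k P' = 0" using N M by auto
  then show ?thesis
    by (simp only: vop_eq) (intro spec_rel_sum spec_rel_mult spec_rel_cq spec_rel_\<sigma>q P)
qed

lemma spec_rel_vop2: "spec_rel P P' \<Longrightarrow>
  spec_rel (vop2 (cq qq) (\<sigma>q qq) (cq qq) (\<sigma>q qq) A B P) (vop2 (cq \<i>) (\<sigma>q \<i>) (cq \<i>) (\<sigma>q \<i>) A B P')"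
proof -
  assume P: "spec_rel P P'"
  obtain N where N: "\<forall>l>N. \<sigma>q qq l P = 0" "\<forall>l. \<forall>k>N. \<sigma>q qq k (\<sigma>q qq l P) = 0"
    using sh_finite2[of "\<lambda>n. n" "\<lambda>n. n"] by blast
  obtain M where M: "\<forall>l>M. \<sigma>q \<i> l P' = 0" "\<forall>l. \<forall>k>M. \<sigma>q \<i> k (\<sigma>q \<i> l P') = 0"
    using sh_finite2[of "\<lambda>n. n" "\<lambda>n. n"] by blast
  show ?thesis
    by (subst (1 2) vop2_eq[of "max N M"])
      (use N M in \<open>auto intro!: spec_rel_sum spec_rel_mult spec_rel_cq spec_rel_\<sigma>q P\<close>)
qed

lemma spec_fock_rel:
  assumes "\<And>n. spec_rel (coef V n) (coef v n)"
  shows "spec_fock V = v"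
proof (rule poly_mapping_eqI, rule poly_mapping_eqI)
  fix n M
  obtain Q where Q: "coef V n = Poly_Mapping.map of_laurent Q" "coef v n = Poly_Mapping.map (laurent_eval \<i>) Q"
    using assms unfolding spec_rel_def by blast
  have inv: "inv_into UNIV of_laurent (of_laurent a) = a" for a
    by (rule inv_into_f_f[OF of_laurent_inj]) simp
  have inv0: "inv_into UNIV of_laurent 0 = 0" using inv[of 0] by simp
  have m0: "Poly_Mapping.map (\<lambda>c. laurent_eval \<i> (inv_into UNIV of_laurent c)) 0 = 0"
    by (rule poly_mapping_eqI) (simp add: coef_map inv0)
  show "coef (coef (spec_fock V) n) M = coef (coef v n) M"
    unfolding spec_fock_def map_coeffs_def by (simp add: coef_map m0 inv0 Q inv)
qed

lemma spec_rel_embed: "spec_rel (coef (embed_fock v) n) (coef v n)"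
  unfolding spec_rel_def
proof (intro exI conjI)
  let ?Q = "Poly_Mapping.map (sg 0) (coef v n) :: laurent bpoly"
  have m0: "Poly_Mapping.map (\<lambda>c. of_laurent (sg 0 c)) 0 = 0"
    by (rule poly_mapping_eqI) (simp add: coef_map)
  show "coef (embed_fock v) n = Poly_Mapping.map of_laurent ?Q"
    by (rule poly_mapping_eqI) (simp add: embed_fock_def map_coeffs_def coef_map m0)
  show "coef v n = Poly_Mapping.map (laurent_eval \<i>) ?Q"
    by (rule poly_mapping_eqI) (simp add: coef_map laurent_eval_single)
qed

lemma coef_x0: "coef (x0 v) n = vop (cq \<i>) (\<sigma>q \<i>) (2 * n + 1) (coef v (n + 1))"
proof -
  define w where "w = chop (- 1) (\<lambda>m. vop (cq \<i>) (\<sigma>q \<i>) (2 * m - 1)) v"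
  have w: "coef w n = vop (cq \<i>) (\<sigma>q \<i>) (2 * n + 1) (coef v (n + 1))" for n
    unfolding w_def by (subst coef_chop) (simp_all add: algebra_simps)
  have "x0 v = w"
    unfolding x0_def specialize_def
    by (rule spec_fock_rel) (simp add: coef_x_minus0 w spec_rel_vop spec_rel_embed)
  then show ?thesis by (simp add: w)
qed

lemma coef_x0_2: "coef (x0_2 v) n =
  Cst \<i> * (vop2 (cq \<i>) (\<sigma>q \<i>) (cq \<i>) (\<sigma>q \<i>) (2 * n + 1) (2 * n + 3) (coef v (n + 2))
    - vop2 (cq \<i>) (\<sigma>q \<i>) (cq \<i>) (\<sigma>q \<i>) (2 * n + 2) (2 * n + 2) (coef v (n + 2)))"
proof -
  let ?E = "vop2 (cq \<i>) (\<sigma>q \<i>) (cq \<i>) (\<sigma>q \<i>)"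
  define w where "w = chop (- 2) (\<lambda>m P. Cst \<i> * (?E (2 * m - 3) (2 * m - 1) P - ?E (2 * m - 2) (2 * m - 2) P)) v"
  have w: "coef w n = Cst \<i> * (?E (2 * n + 1) (2 * n + 3) (coef v (n + 2)) - ?E (2 * n + 2) (2 * n + 2) (coef v (n + 2)))" for n
    unfolding w_def by (subst coef_chop) (simp_all add: vop2_def algebra_simps)
  have "spec_rel (Cst qq * (P - Q)) (Cst \<i> * (P' - Q'))" if "spec_rel P P'" "spec_rel Q Q'" for P P' Q Q'
  proof -
    have "spec_rel (Cst (- 1) * Q) (Cst (- 1) * Q')"
      by (intro spec_rel_mult spec_rel_Cst rel_intros that)
    then have "spec_rel (P + Cst (- 1) * Q) (P' + Cst (- 1) * Q')"
      by (intro spec_rel_add that)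
    then have "spec_rel (Cst qq * (P + Cst (- 1) * Q)) (Cst \<i> * (P' + Cst (- 1) * Q'))"
      by (intro spec_rel_mult spec_rel_Cst rel_intros)
    then show ?thesis by (simp add: single_uminus)
  qed
  then have "x0_2 v = w"
    unfolding x0_2_def specialize_def
    by (intro spec_fock_rel) (simp add: coef_x_minus0_div2 w spec_rel_vop2 spec_rel_embed)
  then show ?thesis by (simp add: w)
qed

section \<open>Fermionic vertex operators at \<open>q = \<surd>-1\<close>\<close>

text \<open>At \<open>q = \<surd>-1\<close> the operators \<open>b\<^sub>n\<close> with \<open>n > 0\<close> odd vanish, so the series splits into the factor
  \<open>\<Sum> Od k z\<^sup>k\<close> in the odd variables and the vertex operator with coefficients \<open>HH\<close>, \<open>\<sigma>\<close> in
  \<open>z\<^sup>2\<close>; the inverse series \<open>HI\<close>, \<open>\<tau>\<close> give the dual fermion.\<close>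

definition sE :: "nat \<Rightarrow> complex" where "sE n = 2 * (- 1) ^ n"
definition \<gamma>E :: "nat \<Rightarrow> complex" where "\<gamma>E n = - ((- 1) ^ n) / of_nat (2 * n)"
definition \<gamma>O :: "nat \<Rightarrow> complex" where "\<gamma>O n = (if odd n then \<gamma>q \<i> n else 0)"

definition dbl :: "nat \<Rightarrow> nat" where "dbl n = 2 * n"
abbreviation "\<sigma> \<equiv> sh sE dbl"
abbreviation "\<tau> \<equiv> sh (\<lambda>n. - sE n) dbl"

definition HH :: "nat \<Rightarrow> complex bpoly" where "HH = cf \<gamma>E dbl"
definition HI :: "nat \<Rightarrow> complex bpoly" where "HI = cf (\<lambda>n. - \<gamma>E n) dbl"
definition Od :: "nat \<Rightarrow> complex bpoly" where "Od = cf \<gamma>O (\<lambda>n. n)"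

lemma dbl: "inj_on dbl {1..}" "n \<ge> 1 \<Longrightarrow> n \<le> dbl n"
  by (auto simp: inj_on_def dbl_def)

lemma dbl_eq: "dbl = (\<lambda>n. 2 * n)"
  by (rule ext) (rule dbl_def)

lemmas vop_sh_eq = vop_eq[where S = "sh s \<phi>" for s \<phi>]
lemmas dbl_finite = sh_finite[of dbl, OF dbl(2)]
lemmas dbl_finite2 = sh_finite2[of dbl dbl, OF dbl(2) dbl(2)]

lemma \<sigma>q_even: "\<sigma>q \<i> (2 * k) P = \<sigma> k P" and \<sigma>q_odd: "odd k \<Longrightarrow> \<sigma>q \<i> k P = 0"
proof -
  have o: "sq \<i> n = 0" if "odd n" for n
    using that by (auto simp: sq_def elim!: oddE)
  have e: "sq \<i> (2 * n) = sE n" for n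
    by (simp add: sq_def sE_def power_mult)
  have "Cst (sq \<i> n) * bderiv n x = 0" if "odd n" for n x
    using o[OF that] by simp
  note eop_even[of "\<lambda>n P. Cst (sq \<i> n) * bderiv n P", OF this]
  then show "\<sigma>q \<i> (2 * k) P = \<sigma> k P" "odd k \<Longrightarrow> \<sigma>q \<i> k P = 0"
    by (simp_all add: sh_def dbl_def e)
qed

lemma cq_Od_HH: "cq \<i> k = (\<Sum>a\<le>k. if even (k - a) then Od a * HH ((k - a) div 2) else 0)"
proof -
  let ?o = "\<lambda>n P. Cst (\<gamma>O n) * bvar n * P" and ?e = "\<lambda>n P. Cst (if even n then \<gamma>q \<i> n else 0) * bvar n * P"
  have e: "\<gamma>q \<i> (2 * n) = \<gamma>E n" for n
    by (simp add: \<gamma>q_def \<gamma>E_def power_mult)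
  have "?e n x = 0" if "odd n" for n x using that by simp
  note ev = eop_even[of ?e, OF this]
  have E: "eop ?e j P = (if even j then HH (j div 2) * P else 0)" for j P
    using ev(1)[of "j div 2" P] ev(2)[of j P] by (auto simp: e HH_def dbl_eq eop_mult)
  have "cq \<i> k = eop (\<lambda>n x. ?o n x + ?e n x) k 1"
    unfolding cf_def by (rule eop_cong) (auto simp: \<gamma>O_def)
  also have "\<dots> = (\<Sum>a\<le>k. eop ?o a (eop ?e (k - a) 1))"
    by (rule eop_conv[symmetric]) (simp_all only: algebra_simps)
  also have "\<dots> = (\<Sum>a\<le>k. if even (k - a) then Od a * HH ((k - a) div 2) else 0)"
    by (rule sum.cong) (auto simp: E eop_mult Od_def)
  finally show ?thesis .
qed

lemma sum_parity:
  fixes f :: "nat \<Rightarrow> 'a::comm_monoid_add"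
  shows "(\<Sum>a\<le>2 * k. if even a then f a else 0) = (\<Sum>b\<le>k. f (2 * b))"
    and "(\<Sum>a\<le>2 * k + 1. if odd a then f a else 0) = (\<Sum>b\<le>k. f (2 * b + 1))"
  by (induction k) simp_all

text \<open>Terms with b > A vanish, so any upper bound B works; leaving it free allows one bound
  for all indices of an outer sum, whose order can then be exchanged.\<close>

lemma ci_cq_even:
  assumes "int B \<ge> A"
  shows "ci (cq \<i>) (2 * A) = (\<Sum>b\<le>B. Od (2 * b) * ci HH (A - int b))"
proof (cases "A < 0")
  case False
  then obtain k where k: "A = int k" by (metis nonneg_int_cases not_less)
  have "ci (cq \<i>) (2 * A) = cq \<i> (2 * k)" by (simp add: k ci_def nat_mult_distrib)
  also have "\<dots> = (\<Sum>a\<le>2 * k. if even a then Od a * HH ((2 * k - a) div 2) else 0)"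
    unfolding cq_Od_HH by (rule sum.cong) auto
  also have "\<dots> = (\<Sum>b\<le>k. Od (2 * b) * HH (k - b))"
    unfolding sum_parity by (simp flip: diff_mult_distrib2)
  also have "\<dots> = (\<Sum>b\<le>B. Od (2 * b) * ci HH (A - int b))"
    by (rule sum.mono_neutral_cong_left) (use assms in \<open>auto simp: k ci_def nat_diff_distrib\<close>)
  finally show ?thesis .
qed (auto simp: ci_neg intro!: sum.neutral)

lemma ci_cq_odd:
  assumes "int B \<ge> A"
  shows "ci (cq \<i>) (2 * A + 1) = (\<Sum>b\<le>B. Od (2 * b + 1) * ci HH (A - int b))"
proof (cases "A < 0")
  case False
  then obtain k where k: "A = int k" by (metis nonneg_int_cases not_less)
  have "ci (cq \<i>) (2 * A + 1) = cq \<i> (2 * k + 1)" by (simp add: k ci_def nat_add_distrib nat_mult_distrib)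
  also have "\<dots> = (\<Sum>a\<le>2 * k + 1. if odd a then Od a * HH ((2 * k + 1 - a) div 2) else 0)"
    unfolding cq_Od_HH by (rule sum.cong) auto
  also have "\<dots> = (\<Sum>b\<le>k. Od (2 * b + 1) * HH (k - b))"
    unfolding sum_parity by (simp flip: diff_mult_distrib2)
  also have "\<dots> = (\<Sum>b\<le>B. Od (2 * b + 1) * ci HH (A - int b))"
    by (rule sum.mono_neutral_cong_left) (use assms in \<open>auto simp: k ci_def nat_diff_distrib\<close>)
  finally show ?thesis .
qed (auto simp: ci_neg intro!: sum.neutral)

text \<open>The coefficients of 1 - x, the exponential of minus the sum of x^n / n: the exchange
  factor of a fermion with itself.\<close>

definition \<kappa>m :: "nat \<Rightarrow> complex" where "\<kappa>m r = (if r = 0 then 1 else if r = 1 then - 1 else 0)"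

lemma sE_\<gamma>E: "n \<ge> 1 \<Longrightarrow> of_nat n * (sE n * \<gamma>E n) = - 1"
  by (simp add: sE_def \<gamma>E_def field_simps flip: power_mult_distrib)

lemma \<kappa>m_rec: "k \<ge> 1 \<Longrightarrow> of_nat k * \<kappa>m k = (\<Sum>n=1..k. - \<kappa>m (k - n))"
proof -
  assume k: "k \<ge> 1"
  have "(\<Sum>n=1..k. - \<kappa>m (k - n)) = (\<Sum>j<k. - \<kappa>m j)"
    by (rule sum.reindex_bij_witness[of _ "\<lambda>j. k - j" "\<lambda>n. k - n"]) auto
  also have "\<dots> = (\<Sum>j\<in>{0, 1} \<inter> {..<k}. - \<kappa>m j)"
    by (rule sum.mono_neutral_right) (auto simp: \<kappa>m_def)
  also have "{0, 1} \<inter> {..<k} = (if k = 1 then {0} else {0, 1})" using k by auto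
  finally show ?thesis using k by (auto simp: \<kappa>m_def)
qed

lemma \<sigma>_HH: "\<sigma> r (ci HH A) = Cst (\<kappa>m r) * ci HH (A - int r)"
  unfolding HH_def
proof (rule sh_cf)
  fix k :: nat assume "k \<ge> 1"
  have "(\<Sum>n=1..k. of_nat n * (sE n * \<gamma>E n) * \<kappa>m (k - n)) = (\<Sum>n=1..k. - \<kappa>m (k - n))"
    by (rule sum.cong) (auto simp: sE_\<gamma>E)
  then show "of_nat k * \<kappa>m k = (\<Sum>n=1..k. of_nat n * (sE n * \<gamma>E n) * \<kappa>m (k - n))"
    by (simp only: \<kappa>m_rec[OF \<open>k \<ge> 1\<close>])
qed (use dbl in \<open>auto simp: \<kappa>m_def\<close>)

lemma \<tau>_HI: "\<tau> r (ci HI A) = Cst (\<kappa>m r) * ci HI (A - int r)"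
  unfolding HI_def
proof (rule sh_cf)
  fix k :: nat assume "k \<ge> 1"
  have "(\<Sum>n=1..k. of_nat n * (- sE n * - \<gamma>E n) * \<kappa>m (k - n)) = (\<Sum>n=1..k. - \<kappa>m (k - n))"
    by (rule sum.cong) (auto simp: sE_\<gamma>E)
  then show "of_nat k * \<kappa>m k = (\<Sum>n=1..k. of_nat n * (- sE n * - \<gamma>E n) * \<kappa>m (k - n))"
    by (simp only: \<kappa>m_rec[OF \<open>k \<ge> 1\<close>])
qed (use dbl in \<open>auto simp: \<kappa>m_def\<close>)

text \<open>Changing the sign of s makes n s_n gamma_n = 1, so the exchange factor is 1/(1 - x) and
  all its coefficients are 1.\<close>

lemma \<tau>_HH: "\<tau> r (ci HH A) = Cst 1 * ci HH (A - int r)"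
  unfolding HH_def
proof (rule sh_cf)
  fix k :: nat assume "k \<ge> 1"
  have "(\<Sum>n=1..k. of_nat n * (- sE n * \<gamma>E n) * 1) = (\<Sum>n=1..k. 1)"
    by (rule sum.cong) (auto simp: sE_\<gamma>E)
  then show "of_nat k * 1 = (\<Sum>n=1..k. of_nat n * (- sE n * \<gamma>E n) * 1)" by simp
qed (use dbl in auto)

lemma \<sigma>_HI: "\<sigma> r (ci HI A) = Cst 1 * ci HI (A - int r)"
  unfolding HI_def
proof (rule sh_cf)
  fix k :: nat assume "k \<ge> 1"
  have "(\<Sum>n=1..k. of_nat n * (sE n * - \<gamma>E n) * 1) = (\<Sum>n=1..k. 1)"
    by (rule sum.cong) (auto simp: sE_\<gamma>E)
  then show "of_nat k * 1 = (\<Sum>n=1..k. of_nat n * (sE n * - \<gamma>E n) * 1)" by simp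
qed (use dbl in auto)

lemma cf_conv_minus: "(\<Sum>a\<le>k. cf \<gamma> \<phi> a * cf (\<lambda>n. - \<gamma> n) \<phi> (k - a)) = (if k = 0 then 1 else 0)"
proof -
  let ?G = "\<lambda>n P. Cst (\<gamma> n) * bvar (\<phi> n) * P" and ?G' = "\<lambda>n P. Cst (- \<gamma> n) * bvar (\<phi> n) * P"
  have "(\<Sum>a\<le>k. cf \<gamma> \<phi> a * cf (\<lambda>n. - \<gamma> n) \<phi> (k - a)) = (\<Sum>a\<le>k. eop ?G a (eop ?G' (k - a) 1))"
    by (simp add: eop_mult)
  also have "\<dots> = eop (\<lambda>n x. ?G n x + ?G' n x) k 1"
    by (rule eop_conv) (simp_all only: algebra_simps)
  also have "\<dots> = eop (\<lambda>n x. 0) k 1"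
    by (rule eop_cong) (simp add: single_uminus)
  finally show ?thesis by (simp add: eop_zero)
qed

lemma sh_conv_minus: "(\<Sum>a\<le>k. sh s \<phi> a (sh (\<lambda>n. - s n) \<phi> (k - a) P)) = (if k = 0 then P else 0)"
proof -
  let ?G = "\<lambda>n P. Cst (s n) * bderiv (\<phi> n) P" and ?G' = "\<lambda>n P. Cst (- s n) * bderiv (\<phi> n) P"
  have "(\<Sum>a\<le>k. sh s \<phi> a (sh (\<lambda>n. - s n) \<phi> (k - a) P)) = eop (\<lambda>n x. ?G n x + ?G' n x) k P"
    unfolding sh_def
    by (rule eop_conv) (simp_all add: bderiv_add bderiv_Cst_mult bderiv_commute distrib_left mult.left_commute)
  also have "\<dots> = eop (\<lambda>n x. 0) k P"
    by (rule eop_cong) (simp add: single_uminus)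
  finally show ?thesis by (simp add: eop_zero)
qed

section \<open>Anticommutation relations of the vertex operators\<close>

lemma vop_HH_HH: "vop HH \<sigma> A (vop HH \<sigma> B P) = vop2 HH \<sigma> HH \<sigma> A B P - vop2 HH \<sigma> HH \<sigma> (A + 1) (B - 1) P"
proof -
  obtain N where N: "\<forall>l>N. \<sigma> l P = 0" "\<forall>l. \<forall>k>N. \<sigma> k (\<sigma> l P) = 0"
    using dbl_finite2 by blast
  define R where "R = nat (int N + B) + 2"
  have "vop HH \<sigma> A (vop HH \<sigma> B P) = (\<Sum>r\<le>R. Cst (\<kappa>m r) * vop2 HH \<sigma> HH \<sigma> (A + int r) (B - int r) P)"
    by (rule vop_vop[OF dbl(2) dbl(2) \<sigma>_HH N]) (auto simp: R_def)
  also have "\<dots> = (\<Sum>r\<in>{0, 1}. Cst (\<kappa>m r) * vop2 HH \<sigma> HH \<sigma> (A + int r) (B - int r) P)"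
    by (rule sum.mono_neutral_right) (auto simp: R_def \<kappa>m_def)
  finally show ?thesis by (simp add: \<kappa>m_def single_uminus)
qed

lemma vop_HI_HI: "vop HI \<tau> A (vop HI \<tau> B P) = vop2 HI \<tau> HI \<tau> A B P - vop2 HI \<tau> HI \<tau> (A + 1) (B - 1) P"
proof -
  obtain N where N: "\<forall>l>N. \<tau> l P = 0" "\<forall>l. \<forall>k>N. \<tau> k (\<tau> l P) = 0"
    using dbl_finite2 by blast
  define R where "R = nat (int N + B) + 2"
  have "vop HI \<tau> A (vop HI \<tau> B P) = (\<Sum>r\<le>R. Cst (\<kappa>m r) * vop2 HI \<tau> HI \<tau> (A + int r) (B - int r) P)"
    by (rule vop_vop[OF dbl(2) dbl(2) \<tau>_HI N]) (auto simp: R_def)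
  also have "\<dots> = (\<Sum>r\<in>{0, 1}. Cst (\<kappa>m r) * vop2 HI \<tau> HI \<tau> (A + int r) (B - int r) P)"
    by (rule sum.mono_neutral_right) (auto simp: R_def \<kappa>m_def)
  finally show ?thesis by (simp add: \<kappa>m_def single_uminus)
qed

lemma sum_ci_ci:
  assumes "\<And>k. (\<Sum>a\<le>k. c a * c' (k - a)) = (if k = 0 then 1 else 0 :: 'a::comm_ring_1)"
    and "finite T" "{- x..y} \<subseteq> T"
  shows "(\<Sum>t\<in>T. ci c (x + t) * ci c' (y - t)) = (if x + y = 0 then 1 else 0)"
proof -
  have "(\<Sum>t\<in>T. ci c (x + t) * ci c' (y - t)) = (\<Sum>t\<in>{- x..y}. ci c (x + t) * ci c' (y - t))"
  proof (rule sum.mono_neutral_right[OF assms(2,3)], rule ballI)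
    fix t assume "t \<in> T - {- x..y}"
    then have "x + t < 0 \<or> y - t < 0" by auto
    then show "ci c (x + t) * ci c' (y - t) = 0" by (auto simp: ci_neg)
  qed
  also have "\<dots> = (if x + y < 0 then 0 else \<Sum>a\<le>nat (x + y). c a * c' (nat (x + y) - a))"
  proof (cases "x + y < 0")
    case False
    have "(\<Sum>t\<in>{- x..y}. ci c (x + t) * ci c' (y - t)) = (\<Sum>a\<le>nat (x + y). c a * c' (nat (x + y) - a))"
    proof (rule sum.reindex_bij_witness[of _ "\<lambda>a. int a - x" "\<lambda>t. nat (x + t)"])
      fix t assume "t \<in> {- x..y}"
      then have "nat (x + y) - nat (x + t) = nat (y - t)" by auto
      with \<open>t \<in> _\<close> show "c (nat (x + t)) * c' (nat (x + y) - nat (x + t)) = ci c (x + t) * ci c' (y - t)"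
        by (simp add: ci_def)
    qed (use False in auto)
    then show ?thesis using False by simp
  qed auto
  finally show ?thesis unfolding assms(1) by auto
qed

text \<open>The two orders of the product expand the same exchange factor in opposite regions. The
  indices t = r of the first and t = -1 - r of the second together run through all integers, as in a
  delta function. It identifies the two formal variables, where \<open>HH\<close> and
  \<open>HI\<close> are inverse series, and so are \<open>\<sigma>\<close> and
  \<open>\<tau>\<close>.\<close>

lemma vop_anticomm_mixed:
  assumes "A + B = b - a"
  shows "vop HH \<sigma> A (vop HI \<tau> B P) + vop HI \<tau> (B + 1) (vop HH \<sigma> (A - 1) P) = (if a = b then P else 0)"
proof -
  let ?E = "vop2 HH \<sigma> HI \<tau>"
  obtain N1 where N1: "\<forall>l>N1. \<tau> l P = 0" "\<forall>l. \<forall>k>N1. \<sigma> k (\<tau> l P) = 0"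
    using dbl_finite2 by blast
  obtain N2 where N2: "\<forall>l>N2. \<sigma> l P = 0" "\<forall>l. \<forall>k>N2. \<tau> k (\<sigma> l P) = 0"
    using dbl_finite2 by blast
  define N where "N = max N1 N2"
  have N: "\<forall>l>N. \<tau> l P = 0" "\<forall>l. \<forall>k>N. \<sigma> k (\<tau> l P) = 0" "\<forall>l>N. \<sigma> l P = 0" "\<forall>l. \<forall>k>N. \<tau> k (\<sigma> l P) = 0"
    using N1 N2 by (auto simp: N_def)
  define R where "R = nat (int N + \<bar>A\<bar> + \<bar>B\<bar> + 1)"
  have 1: "vop HH \<sigma> A (vop HI \<tau> B P) = (\<Sum>r\<le>R. Cst 1 * ?E (A + int r) (B - int r) P)"
    by (rule vop_vop[OF dbl(2) dbl(2) \<sigma>_HI N(1,2)]) (auto simp: R_def)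
  have 2: "vop HI \<tau> (B + 1) (vop HH \<sigma> (A - 1) P) =
      (\<Sum>r\<le>R. Cst 1 * vop2 HI \<tau> HH \<sigma> (B + 1 + int r) (A - 1 - int r) P)"
    by (rule vop_vop[OF dbl(2) dbl(2) \<tau>_HH N(3,4)]) (auto simp: R_def)
  let ?T = "{- int R - 1..int R}"
  have T: "?T = int ` {..R} \<union> (\<lambda>r. - 1 - int r) ` {..R}"
  proof (safe)
    fix t assume t: "t \<in> ?T" "t \<notin> (\<lambda>r. - 1 - int r) ` {..R}"
    show "t \<in> int ` {..R}"
    proof (cases "t \<ge> 0")
      case True
      then show ?thesis using t by (intro image_eqI[of _ _ "nat t"]) auto
    next
      case False
      then have "t = - 1 - int (nat (- 1 - t))" "nat (- 1 - t) \<in> {..R}" using t by auto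
      then show ?thesis using t(2) by blast
    qed
  qed auto
  have "vop HH \<sigma> A (vop HI \<tau> B P) + vop HI \<tau> (B + 1) (vop HH \<sigma> (A - 1) P) =
      (\<Sum>r\<le>R. ?E (A + int r) (B - int r) P) + (\<Sum>r\<le>R. ?E (A + (- 1 - int r)) (B - (- 1 - int r)) P)"
    unfolding 1 2 by (simp add: vop2_commute[OF dbl(2) dbl(2), of HI] algebra_simps)
  also have "\<dots> = (\<Sum>t\<in>?T. ?E (A + t) (B - t) P)"
    unfolding T by (subst sum.union_disjoint) (auto simp: sum.reindex inj_on_def)
  also have "\<dots> = (\<Sum>t\<in>?T. \<Sum>k\<le>N. \<Sum>l\<le>N. ci HH (int k + (A + t)) * ci HI (int l + (B - t)) * \<sigma> k (\<tau> l P))"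
    by (subst vop2_eq[of N]) (use N in auto)
  also have "\<dots> = (\<Sum>k\<le>N. \<Sum>l\<le>N. (\<Sum>t\<in>?T. ci HH (int k + A + t) * ci HI (int l + B - t)) * \<sigma> k (\<tau> l P))"
    by (subst sum.swap, rule sum.cong, rule refl, subst sum.swap)
      (simp add: sum_distrib_right sum_distrib_left algebra_simps)
  also have "\<dots> = (\<Sum>k\<le>N. \<Sum>l\<le>N. if int k + int l = a - b then \<sigma> k (\<tau> l P) else 0)"
  proof (intro sum.cong refl)
    fix k l assume kl: "k \<in> {..N}" "l \<in> {..N}"
    have sub: "{- (int k + A)..int l + B} \<subseteq> ?T" using kl by (auto simp: R_def)
    have conv: "(\<Sum>a\<le>k. HH a * HI (k - a)) = (if k = 0 then 1 else 0)" for k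
      unfolding HH_def HI_def by (rule cf_conv_minus)
    show "(\<Sum>t\<in>?T. ci HH (int k + A + t) * ci HI (int l + B - t)) * \<sigma> k (\<tau> l P) =
        (if int k + int l = a - b then \<sigma> k (\<tau> l P) else 0)"
      unfolding sum_ci_ci[OF conv finite_atLeastAtMost_int sub] using assms by auto
  qed
  \<comment> \<open>What is left is the component of degree a - b of the product of the inverse
    series \<open>\<sigma>\<close> and \<open>\<tau>\<close>, which is 0 except in degree 0.\<close>
  also have "\<dots> = (if a = b then P else 0)"
  proof (cases "a - b < 0")
    case False
    then obtain n where n: "a - b = int n" by (metis nonneg_int_cases not_less)
    have z: "\<sigma> k (\<tau> l P) = 0" if "\<not> (k \<le> N \<and> l \<le> N)" for k l
      using N(1,2) that by (cases "k \<le> N") auto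
    have "(\<Sum>k\<le>N. \<Sum>l\<le>N. if int k + int l = a - b then \<sigma> k (\<tau> l P) else 0) =
        (\<Sum>(k, l)\<in>{..N} \<times> {..N}. if int k + int l = a - b then \<sigma> k (\<tau> l P) else 0)"
      by (simp add: sum.cartesian_product)
    also have "\<dots> = (\<Sum>(k, l)\<in>(\<lambda>k. (k, n - k)) ` {..n}. \<sigma> k (\<tau> l P))"
    proof (rule sum.mono_neutral_cong)
      show "\<And>x. x \<in> (\<lambda>k. (k, n - k)) ` {..n} - {..N} \<times> {..N} \<Longrightarrow> (case x of (k, l) \<Rightarrow> \<sigma> k (\<tau> l P)) = 0"
        using z by auto
      show "\<And>x. x \<in> {..N} \<times> {..N} - (\<lambda>k. (k, n - k)) ` {..n} \<Longrightarrow>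
          (case x of (k, l) \<Rightarrow> if int k + int l = a - b then \<sigma> k (\<tau> l P) else 0) = 0"
        by (auto simp: n image_iff)
    qed (auto simp: n)
    also have "\<dots> = (\<Sum>k\<le>n. \<sigma> k (\<tau> (n - k) P))"
      by (subst sum.reindex) (auto simp: inj_on_def)
    also have "\<dots> = (if a = b then P else 0)"
      unfolding sh_conv_minus using n by auto
    finally show ?thesis .
  qed (auto intro!: sum.neutral)
  finally show ?thesis .
qed

text \<open>The index m - n is dictated by 2m - 1 = (2b + 1) + 2(m - (b + 1)): with it, x_0^- on the
  component m becomes the sum of \<open>Od (2 * b + 1)\<close> times
  \<open>Psi (b + 1)\<close>.\<close>

definition Psi :: "int \<Rightarrow> complex charged \<Rightarrow> complex charged"
  where "Psi n = chop (- 1) (\<lambda>m. vop HH \<sigma> (m - n))"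

definition Psis :: "int \<Rightarrow> complex charged \<Rightarrow> complex charged"
  where "Psis n = chop 1 (\<lambda>m. vop HI \<tau> (n - m - 1))"

lemma coef_Psi: "coef (Psi n v) j = vop HH \<sigma> (j + 1 - n) (coef v (j + 1))"
  unfolding Psi_def by (subst coef_chop) simp_all

lemma coef_Psis: "coef (Psis n v) j = vop HI \<tau> (n - j) (coef v (j - 1))"
  unfolding Psis_def by (subst coef_chop) simp_all

lemma Psi_add: "Psi n (v + w) = Psi n v + Psi n w"
  by (rule poly_mapping_eqI) (simp add: coef_Psi lookup_add vop_add dbl(2))

lemma Psis_add: "Psis n (v + w) = Psis n v + Psis n w"
  by (rule poly_mapping_eqI) (simp add: coef_Psis lookup_add vop_add dbl(2))

lemma Psi_poly_mult:
  assumes "\<And>n. n \<ge> 1 \<Longrightarrow> bderiv (dbl n) d = 0"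
  shows "Psi n (poly_mult d v) = poly_mult d (Psi n v)" "Psis n (poly_mult d v) = poly_mult d (Psis n v)"
  by (rule poly_mapping_eqI; simp add: coef_Psi coef_Psis coef_poly_mult vop_mult_fixed dbl(2) assms)+

text \<open>The exchange factor 1 - x gives two normally ordered terms for each order of the
  product. By their symmetry the first term of one order cancels the second term of the
  other.\<close>

lemma Psi_Psi: "Psi a (Psi b v) + Psi b (Psi a v) = 0"
proof (rule poly_mapping_eqI)
  fix j :: int
  have eq: "j + 1 - a + 1 = j + 1 + 1 - a" "j + 1 + 1 - a - 1 = j + 1 - a" for a by simp_all
  note c = vop2_commute[OF dbl(2) dbl(2), of HH sE HH sE]
  show "coef (Psi a (Psi b v) + Psi b (Psi a v)) j = coef 0 j"
    unfolding lookup_add coef_Psi vop_HH_HH eq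
    using c[of "j + 1 - a" "j + 1 + 1 - b" "coef v (j + 1 + 1)"] c[of "j + 1 + 1 - a" "j + 1 - b" "coef v (j + 1 + 1)"]
    by simp
qed

lemma Psis_Psis: "Psis a (Psis b v) + Psis b (Psis a v) = 0"
proof (rule poly_mapping_eqI)
  fix j :: int
  have eq: "a - j + 1 = a - (j - 1)" "a - (j - 1) - 1 = a - j" for a by simp_all
  let ?s = "\<lambda>n. - sE n"
  show "coef (Psis a (Psis b v) + Psis b (Psis a v)) j = coef 0 j"
    unfolding lookup_add coef_Psis vop_HI_HI eq
    by (simp add: vop2_commute[OF dbl(2) dbl(2), of HI ?s HI ?s "a - j"]
        vop2_commute[OF dbl(2) dbl(2), of HI ?s HI ?s "a - (j - 1)"] del: diff_diff_eq2)
qed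

lemma Psi_Psis: "Psi a (Psis b v) + Psis b (Psi a v) = (if a = b then v else 0)"
proof (rule poly_mapping_eqI)
  fix j
  have "coef (Psi a (Psis b v) + Psis b (Psi a v)) j =
      vop HH \<sigma> (j + 1 - a) (vop HI \<tau> (b - (j + 1)) (coef v j)) +
      vop HI \<tau> (b - (j + 1) + 1) (vop HH \<sigma> (j + 1 - a - 1) (coef v j))"
    by (simp add: lookup_add coef_Psi coef_Psis)
  also have "\<dots> = (if a = b then coef v j else 0)"
    by (rule vop_anticomm_mixed) simp
  finally show "coef (Psi a (Psis b v) + Psis b (Psi a v)) j = coef (if a = b then v else 0) j" by simp
qed

lemma keys_finite_bound:
  fixes Q :: "int \<Rightarrow> 'a::zero \<Rightarrow> nat \<Rightarrow> bool"
  assumes "\<And>j P. \<exists>N. \<forall>n\<ge>N. Q j P n" "\<And>j n. Q j 0 n"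
  shows "\<exists>N. \<forall>n\<ge>N. \<forall>j. Q j (coef v j) n"
proof -
  obtain N where N: "\<And>j n. n \<ge> N j \<Longrightarrow> Q j (coef v j) n" 
  proof -
    have "\<forall>j. \<exists>N. \<forall>n\<ge>N. Q j (coef v j) n" using assms(1) by blast
    from choice[OF this] show ?thesis using that by blast
  qed
  have "Q j (coef v j) n" if "n \<ge> Max (insert 0 (N ` keys v))" for n j
  proof (cases "j \<in> keys v")
    case True
    then have "n \<ge> N j" using that by auto
    then show ?thesis by (rule N)
  qed (simp add: in_keys_iff assms(2))
  then show ?thesis by blast
qed

lemma vop_eventually_zero:
  assumes "\<And>n. n \<ge> 1 \<Longrightarrow> \<phi> n \<ge> n"
  shows "\<exists>N. \<forall>n\<ge>N. vop c (sh s \<phi>) (A - int n) P = 0"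
proof -
  obtain M where M: "\<forall>k>M. sh s \<phi> k P = 0" using sh_finite[of \<phi>, OF assms] by blast
  have "vop c (sh s \<phi>) (A - int n) P = 0" if "n \<ge> nat (int M + A + 1)" for n
    by (subst vop_sh_eq[OF M], rule sum.neutral) (use that in \<open>auto simp: ci_neg\<close>)
  then show ?thesis by blast
qed

lemma Psi_finite: "\<exists>N. \<forall>n\<ge>N. Psi (int n) v = 0"
proof -
  have "\<exists>N. \<forall>n\<ge>N. \<forall>j. vop HH \<sigma> (j - int n) (coef v j) = 0"
    by (rule keys_finite_bound[of "\<lambda>j P n. vop HH \<sigma> (j - int n) P = 0"])
      (auto intro!: vop_eventually_zero dbl(2))
  then obtain N where N: "\<And>n j. n \<ge> N \<Longrightarrow> vop HH \<sigma> (j - int n) (coef v j) = 0" by blast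
  have "Psi (int n) v = 0" if "n \<ge> N" for n
    by (rule poly_mapping_eqI) (use N[OF that] in \<open>simp add: coef_Psi\<close>)
  then show ?thesis by blast
qed

lemma Psis_finite: "\<exists>N. \<forall>n\<ge>N. Psis (- int n) v = 0"
proof -
  have "\<exists>N. \<forall>n\<ge>N. \<forall>j. vop HI \<tau> ((- j - 1) - int n) (coef v j) = 0"
    by (rule keys_finite_bound[of "\<lambda>j P n. vop HI \<tau> ((- j - 1) - int n) P = 0"])
      (auto intro!: vop_eventually_zero dbl(2))
  then obtain N where N: "\<And>n j. n \<ge> N \<Longrightarrow> vop HI \<tau> ((- j - 1) - int n) (coef v j) = 0" by blast
  have "Psis (- int n) v = 0" if "n \<ge> N" for n
  proof (rule poly_mapping_eqI)
    fix j
    have eq: "- int n - j = - (j - 1) - 1 - int n" by simp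
    show "coef (Psis (- int n) v) j = coef 0 j"
      using N[OF that, of "j - 1"] by (simp only: coef_Psis eq lookup_zero)
  qed
  then show ?thesis by blast
qed

section \<open>The operators \<open>x\<^sub>0\<^sup>-\<close> and \<open>(x\<^sub>0\<^sup>-)\<^bsup>(2)\<^esup>\<close> in terms of fermions\<close>

lemma sum_even_only:
  fixes f :: "nat \<Rightarrow> 'a::comm_monoid_add"
  assumes "\<And>k. odd k \<Longrightarrow> f k = 0"
  shows "(\<Sum>k\<le>2 * M. f k) = (\<Sum>k\<le>M. f (2 * k))"
proof -
  have "(\<Sum>k\<le>2 * M. f k) = (\<Sum>k\<le>2 * M. if even k then f k else 0)"
    by (rule sum.cong) (auto simp: assms)
  then show ?thesis by (simp only: sum_parity)
qed

lemma \<sigma>q_zero: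
  assumes "\<forall>k>M. \<sigma> k P = 0"
  shows "\<forall>k>2 * M. \<sigma>q \<i> k P = 0"
proof safe
  fix k assume "k > 2 * M"
  then show "\<sigma>q \<i> k P = 0"
    using assms by (cases "even k") (auto simp: \<sigma>q_odd \<sigma>q_even elim!: evenE)
qed

lemma vop_cq:
  assumes "\<forall>k>M. \<sigma> k P = 0"
  shows "vop (cq \<i>) (\<sigma>q \<i>) A P = (\<Sum>k\<le>M. ci (cq \<i>) (2 * int k + A) * \<sigma> k P)"
  by (subst vop_sh_eq[OF \<sigma>q_zero[OF assms]], subst sum_even_only) (simp_all add: \<sigma>q_odd \<sigma>q_even)

lemma vop2_cq:
  assumes "\<forall>l>M. \<sigma> l P = 0" "\<forall>l. \<forall>k>M. \<sigma> k (\<sigma> l P) = 0"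
  shows "vop2 (cq \<i>) (\<sigma>q \<i>) (cq \<i>) (\<sigma>q \<i>) A B P =
    (\<Sum>k\<le>M. \<Sum>l\<le>M. ci (cq \<i>) (2 * int k + A) * ci (cq \<i>) (2 * int l + B) * \<sigma> k (\<sigma> l P))"
proof -
  have *: "\<sigma>q \<i> k (\<sigma>q \<i> l P) = 0" if "k > 2 * M" for k l
    using \<sigma>q_zero[of M "\<sigma> (l div 2) P"] assms(2) that
    by (cases "even l") (auto simp: \<sigma>q_odd \<sigma>q_even elim!: evenE)
  show ?thesis
    by (subst vop2_eq[of "2 * M"], use \<sigma>q_zero[OF assms(1)] * in auto)
      (subst sum_even_only, auto simp: \<sigma>q_odd \<sigma>q_even sum_even_only)
qed

lemma x0_Psi:
  assumes "\<And>n. n \<ge> N \<Longrightarrow> Psi (int n + 1) v = 0"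
  shows "x0 v = (\<Sum>b<N. poly_mult (Od (2 * b + 1)) (Psi (int b + 1) v))"
proof (rule poly_mapping_eqI)
  fix j
  let ?P = "coef v (j + 1)"
  obtain M where M: "\<forall>k>M. \<sigma> k ?P = 0" using dbl_finite by blast
  \<comment> \<open>B is large enough for \<open>ci_cq_odd\<close> at every k up to M; the terms
    between N and B vanish by hypothesis.\<close>
  define B where "B = max N (nat (int M + \<bar>j\<bar>))"
  have "coef (x0 v) j = (\<Sum>k\<le>M. ci (cq \<i>) (2 * (int k + j) + 1) * \<sigma> k ?P)"
    unfolding coef_x0 vop_cq[OF M] by (simp add: algebra_simps)
  also have "\<dots> = (\<Sum>k\<le>M. (\<Sum>b\<le>B. Od (2 * b + 1) * ci HH (int k + j - int b)) * \<sigma> k ?P)"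
    by (intro sum.cong refl, subst ci_cq_odd) (auto simp: B_def)
  also have "\<dots> = (\<Sum>b\<le>B. Od (2 * b + 1) * (\<Sum>k\<le>M. ci HH (int k + (j - int b)) * \<sigma> k ?P))"
    unfolding sum_distrib_right sum_distrib_left
    by (subst sum.swap) (simp add: mult.assoc add_diff_eq)
  also have "\<dots> = (\<Sum>b\<le>B. Od (2 * b + 1) * coef (Psi (int b + 1) v) j)"
    by (simp add: coef_Psi vop_sh_eq[OF M])
  also have "\<dots> = (\<Sum>b<N. Od (2 * b + 1) * coef (Psi (int b + 1) v) j)"
    by (rule sum.mono_neutral_right) (auto simp: B_def assms)
  finally show "coef (x0 v) j = coef (\<Sum>b<N. poly_mult (Od (2 * b + 1)) (Psi (int b + 1) v)) j"
    by (simp add: lookup_sum coef_poly_mult)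
qed

text \<open>With \<open>\<Sum> Od k z\<^sup>k = C(z\<^sup>2) + z S(z\<^sup>2)\<close>, these are the coefficients of \<open>1 + x S(x) S(y) - C(x) C(y)\<close>. It
  vanishes for \<open>x = y\<close>, because the series in \<open>z\<close> and in \<open>-z\<close> are inverse to each other.\<close>

definition ff :: "nat \<Rightarrow> nat \<Rightarrow> complex bpoly"
  where "ff a b = (if a = 0 \<and> b = 0 then 1 else 0) + (if a = 0 then 0 else Od (2 * a - 1) * Od (2 * b + 1))
    - Od (2 * a) * Od (2 * b)"

text \<open>The quotient of \<open>\<Sum> ff a b x\<^sup>a y\<^sup>b\<close> by \<open>x - y\<close>.\<close>

definition Gam :: "nat \<Rightarrow> nat \<Rightarrow> complex bpoly"
  where "Gam a b = (\<Sum>c\<le>b. ff (a + 1 + c) (b - c))"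

section \<open>The kernel of the divided square and its quotient by x - y\<close>

lemma cf_scale: "cf (\<lambda>n. c ^ n * \<gamma> n) \<phi> k = Cst (c ^ k) * cf \<gamma> \<phi> k"
proof (rule cf_unique[symmetric])
  fix k :: nat
  have "of_nat k * (Cst (c ^ k) * cf \<gamma> \<phi> k) = Cst (c ^ k) * (of_nat k * cf \<gamma> \<phi> k)"
    by (rule mult.left_commute)
  also have "\<dots> = (\<Sum>n=1..k. of_nat n * (Cst (c ^ n * \<gamma> n) * bvar (\<phi> n) * (Cst (c ^ (k - n)) * cf \<gamma> \<phi> (k - n))))"
    unfolding cf_rec sum_distrib_left
  proof (intro sum.cong refl)
    fix n assume "n \<in> {1..k}"
    then have "Cst (c ^ k) = Cst (c ^ n) * Cst (c ^ (k - n))"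
      by (simp flip: Cst_mult power_add)
    then show "Cst (c ^ k) * (of_nat n * (Cst (\<gamma> n) * bvar (\<phi> n) * cf \<gamma> \<phi> (k - n))) =
        of_nat n * (Cst (c ^ n * \<gamma> n) * bvar (\<phi> n) * (Cst (c ^ (k - n)) * cf \<gamma> \<phi> (k - n)))"
      by (simp add: Cst_mult mult_ac)
  qed
  finally show "of_nat k * (Cst (c ^ k) * cf \<gamma> \<phi> k) =
    (\<Sum>n=1..k. of_nat n * (Cst (c ^ n * \<gamma> n) * bvar (\<phi> n) * (Cst (c ^ (k - n)) * cf \<gamma> \<phi> (k - n))))" .
qed simp

lemma Od_conv: "(\<Sum>a\<le>k. Od a * (Cst ((- 1) ^ (k - a)) * Od (k - a))) = (if k = 0 then 1 else 0)"
proof -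
  have "Cst ((- 1) ^ j) * Od j = cf (\<lambda>n. - \<gamma>O n) (\<lambda>n. n) j" for j
    unfolding Od_def cf_scale[symmetric] by (rule arg_cong[of _ _ "\<lambda>g. cf g _ _"]) (auto simp: \<gamma>O_def)
  then show ?thesis using cf_conv_minus[of \<gamma>O "\<lambda>n. n" k] by (simp add: Od_def)
qed

text \<open>The coefficient of z^(2n) in O(z) O(-z) = 1: the even indices contribute C(x)^2 and the
  odd ones -x S(x)^2, where x = z^2.\<close>

lemma ff_diagonal: "(\<Sum>c\<le>n. ff c (n - c)) = 0"
proof -
  have m: "Cst ((- 1) ^ j) = (if even j then 1 else - 1)" for j
    by (auto simp: single_uminus)
  have "(if n = 0 then 1 else 0) = (\<Sum>a\<le>2 * n. Od a * (Cst ((- 1) ^ (2 * n - a)) * Od (2 * n - a)))"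
    by (subst Od_conv) simp
  also have "\<dots> = (\<Sum>a\<le>2 * n. (if even a then Od a * Od (2 * n - a) else 0) -
      (if odd a then Od a * Od (2 * n - a) else 0))"
    by (rule sum.cong) (auto simp: m)
  also have "\<dots> = (\<Sum>b\<le>n. Od (2 * b) * Od (2 * n - 2 * b)) - (\<Sum>a\<le>2 * n. if odd a then Od a * Od (2 * n - a) else 0)"
    unfolding sum_subtractf sum_parity ..
  also have "(\<Sum>a\<le>2 * n. if odd a then Od a * Od (2 * n - a) else 0) =
      (\<Sum>b<n. Od (2 * b + 1) * Od (2 * n - (2 * b + 1)))"
  proof (cases n)
    case (Suc k)
    have "(\<Sum>a\<le>2 * n. if odd a then Od a * Od (2 * n - a) else 0) =
        (\<Sum>a\<le>2 * k + 1. if odd a then Od a * Od (2 * n - a) else 0)"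
      by (simp add: Suc)
    then show ?thesis unfolding sum_parity(2) by (simp add: Suc lessThan_Suc_atMost)
  qed simp
  also have "\<dots> = (\<Sum>c\<le>n. if c = 0 then 0 else Od (2 * c - 1) * Od (2 * (n - c) + 1))"
  proof (cases n)
    case (Suc k)
    then show ?thesis
      unfolding Suc sum.atMost_Suc_shift by (auto simp: lessThan_Suc_atMost intro!: sum.cong arg_cong[of _ _ Od])
  qed simp
  finally have *: "(if n = 0 then 1 else 0) = (\<Sum>b\<le>n. Od (2 * b) * Od (2 * n - 2 * b)) -
    (\<Sum>c\<le>n. if c = 0 then 0 else Od (2 * c - 1) * Od (2 * (n - c) + 1))" .
  have "(\<Sum>c\<le>n. ff c (n - c)) = (\<Sum>c\<le>n. if c = 0 then (if n = 0 then 1 else 0) else 0)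
     + (\<Sum>c\<le>n. if c = 0 then 0 else Od (2 * c - 1) * Od (2 * (n - c) + 1))
     - (\<Sum>b\<le>n. Od (2 * b) * Od (2 * n - 2 * b))"
    unfolding ff_def sum_subtractf sum.distrib
    by (intro arg_cong2[where f = "(-)"] arg_cong2[where f = "(+)"] sum.cong) (auto simp: diff_mult_distrib2)
  then show ?thesis using * by simp
qed

text \<open>The coefficient form of division by x - y. Within one total degree the partial sums of
  \<open>ff\<close> are the quotient; the full sum, which occurs for a = 0, has to vanish, and this
  is \<open>ff_diagonal\<close>.\<close>

lemma ff_Gam:
  "ff a b = (if a = 0 then 0 else Gam (a - 1) b) - (if b = 0 then 0 else Gam a (b - 1))"
proof -
  have G: "(if b = 0 then 0 else Gam a (b - 1)) = (\<Sum>c\<in>{1..b}. ff (a + c) (b - c))"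
  proof (cases b)
    case (Suc k)
    show ?thesis unfolding Suc Gam_def
      by (simp add: sum.atLeast1_atMost_eq lessThan_Suc_atMost del: sum.cl_ivl_Suc)
  qed simp
  have *: "(\<Sum>c\<le>b. ff (a + c) (b - c)) = ff a b + (\<Sum>c\<in>{1..b}. ff (a + c) (b - c))"
    by (simp add: atMost_atLeast0 sum.atLeast_Suc_atMost[of 0])
  have "(if a = 0 then 0 else Gam (a - 1) b) = (\<Sum>c\<le>b. ff (a + c) (b - c))"
    by (cases a) (simp_all add: ff_diagonal Gam_def)
  then show ?thesis unfolding G * by simp
qed

text \<open>Summation by parts: multiplication of the kernel by x - y is moved onto F, and the
  boundary terms vanish with F.\<close>

lemma sum_ff:
  fixes F :: "nat \<Rightarrow> nat \<Rightarrow> complex bpoly"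
  assumes "\<And>a b. a > B \<or> b > B \<Longrightarrow> F a b = 0"
  shows "(\<Sum>a\<le>B. \<Sum>b\<le>B. ff a b * F a b) = (\<Sum>a\<le>B. \<Sum>b\<le>B. Gam a b * (F (a + 1) b - F a (b + 1)))"
proof -
  have 1: "(\<Sum>a\<le>B. (if a = 0 then 0 else Gam (a - 1) b * F a b)) = (\<Sum>a\<le>B. Gam a b * F (a + 1) b)" for b
  proof -
    have "(\<Sum>a\<le>B. (if a = 0 then 0 else Gam (a - 1) b * F a b)) =
        (\<Sum>a\<le>Suc B. (if a = 0 then 0 else Gam (a - 1) b * F a b))" by (simp add: assms)
    also have "\<dots> = (\<Sum>a\<le>B. Gam a b * F (a + 1) b)" unfolding sum.atMost_Suc_shift by simp
    finally show ?thesis .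
  qed
  have 2: "(\<Sum>b\<le>B. (if b = 0 then 0 else Gam a (b - 1) * F a b)) = (\<Sum>b\<le>B. Gam a b * F a (b + 1))" for a
  proof -
    have "(\<Sum>b\<le>B. (if b = 0 then 0 else Gam a (b - 1) * F a b)) =
        (\<Sum>b\<le>Suc B. (if b = 0 then 0 else Gam a (b - 1) * F a b))" by (simp add: assms)
    also have "\<dots> = (\<Sum>b\<le>B. Gam a b * F a (b + 1))" unfolding sum.atMost_Suc_shift by simp
    finally show ?thesis .
  qed
  have "(\<Sum>a\<le>B. \<Sum>b\<le>B. ff a b * F a b) =
      (\<Sum>a\<le>B. \<Sum>b\<le>B. (if a = 0 then 0 else Gam (a - 1) b * F a b) - (if b = 0 then 0 else Gam a (b - 1) * F a b))"
    by (intro sum.cong refl) (auto simp: ff_Gam left_diff_distrib)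
  also have "\<dots> = (\<Sum>b\<le>B. \<Sum>a\<le>B. (if a = 0 then 0 else Gam (a - 1) b * F a b)) -
      (\<Sum>a\<le>B. \<Sum>b\<le>B. Gam a b * F a (b + 1))"
    unfolding sum_subtractf 2 by (subst sum.swap) simp
  also have "(\<Sum>b\<le>B. \<Sum>a\<le>B. (if a = 0 then 0 else Gam (a - 1) b * F a b)) = (\<Sum>a\<le>B. \<Sum>b\<le>B. Gam a b * F (a + 1) b)"
    unfolding 1 by (rule sum.swap)
  finally show ?thesis by (simp add: right_diff_distrib sum_subtractf)
qed

text \<open>Normally ordered products F enter with the odd part minus the even part, which is
  \<open>ff\<close> minus the constant 1. By \<open>Psi2\<close>, neighbouring differences of F are
  products of two \<open>Psi\<close>. So summation by parts turns the \<open>ff\<close> sum into the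
  \<open>Gam\<close> sum, and the constant contributes F 0 0, which telescopes along the
  antidiagonal into the sum of \<open>Psi (- k) (Psi (k + 1) v)\<close>.\<close>

lemma x0_2_Psi:
  assumes N: "\<And>n. n \<ge> N \<Longrightarrow> Psi (int n + 1) v = 0"
  shows "x0_2 v = poly_mult (Cst \<i>) (- (\<Sum>k<N. Psi (- int k) (Psi (int k + 1) v))
    + (\<Sum>a<N. \<Sum>b<N. poly_mult (Gam a b) (Psi (int a + 1) (Psi (int b + 1) v))))"
proof (rule poly_mapping_eqI)
  fix j
  let ?P = "coef v (j + 2)"
  let ?E = "vop2 HH \<sigma> HH \<sigma>"
  obtain M where M: "\<forall>l>M. \<sigma> l ?P = 0" "\<forall>l. \<forall>k>M. \<sigma> k (\<sigma> l ?P) = 0"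
    using dbl_finite2 by blast
  define B where "B = max N (nat (int M + \<bar>j\<bar> + 2))"
  define F where "F = (\<lambda>a b. ?E (j + 1 - a) (j + 1 - b) ?P)"
  have E: "?E A A' ?P = (\<Sum>k\<le>M. \<Sum>l\<le>M. ci HH (int k + A) * ci HH (int l + A') * \<sigma> k (\<sigma> l ?P))" for A A'
    by (subst vop2_eq[of M]) (use M in auto)
  have F0: "F a b = 0" if "a > int B \<or> b > int B" for a b
    unfolding F_def E using that by (intro sum.neutral ballI) (auto simp: B_def ci_neg)
  have Psi2: "coef (Psi a (Psi b v)) j = F a (b - 1) - F (a - 1) b" for a b
    unfolding coef_Psi F_def vop_HH_HH by (simp add: algebra_simps)
  have PN: "Psi (int b + 1) v = 0" if "b \<ge> N" for b using N that by blast
  have Psi0: "Psi n 0 = 0" for n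
    by (rule additive_sum(1)) (rule Psi_add)
  have PPN: "Psi (int a + 1) (Psi (int b + 1) v) = 0" if "a \<ge> N \<or> b \<ge> N" for a b
    using that PN Psi_Psi[of "int a + 1" "int b + 1" v] by (auto simp: Psi0)
  have rearr: "(\<Sum>k\<le>M. \<Sum>l\<le>M. (\<Sum>a\<le>B. f a * g k a) * (\<Sum>b\<le>B. f' b * g' l b) * h k l) =
      (\<Sum>a\<le>B. \<Sum>b\<le>B. f a * f' b * (\<Sum>k\<le>M. \<Sum>l\<le>M. g k a * g' l b * h k l))"
    for f f' :: "nat \<Rightarrow> complex bpoly" and g g' h
  proof -
    have "(\<Sum>k\<le>M. \<Sum>l\<le>M. (\<Sum>a\<le>B. f a * g k a) * (\<Sum>b\<le>B. f' b * g' l b) * h k l) =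
        (\<Sum>k\<le>M. \<Sum>l\<le>M. \<Sum>a\<le>B. \<Sum>b\<le>B. f a * f' b * (g k a * g' l b * h k l))"
      unfolding sum_product unfolding sum_distrib_right by (intro sum.cong refl) (simp add: mult_ac)
    also have "\<dots> = (\<Sum>k\<le>M. \<Sum>a\<le>B. \<Sum>b\<le>B. \<Sum>l\<le>M. f a * f' b * (g k a * g' l b * h k l))"
      by (subst sum.swap, rule sum.cong, rule refl, rule sum.cong, rule refl, subst sum.swap) (rule refl)
    also have "\<dots> = (\<Sum>a\<le>B. \<Sum>b\<le>B. \<Sum>k\<le>M. \<Sum>l\<le>M. f a * f' b * (g k a * g' l b * h k l))"
      by (subst sum.swap, rule sum.cong, rule refl, subst sum.swap) (rule refl)
    finally show ?thesis by (simp only: sum_distrib_left)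
  qed
  have odd: "vop2 (cq \<i>) (\<sigma>q \<i>) (cq \<i>) (\<sigma>q \<i>) (2 * j + 1) (2 * j + 3) ?P =
      (\<Sum>a\<le>B. \<Sum>b\<le>B. Od (2 * a + 1) * Od (2 * b + 1) * F (int a + 1) (int b))"
  proof -
    have "vop2 (cq \<i>) (\<sigma>q \<i>) (cq \<i>) (\<sigma>q \<i>) (2 * j + 1) (2 * j + 3) ?P =
        (\<Sum>k\<le>M. \<Sum>l\<le>M. ci (cq \<i>) (2 * (int k + j) + 1) * ci (cq \<i>) (2 * (int l + j + 1) + 1) * \<sigma> k (\<sigma> l ?P))"
      unfolding vop2_cq[OF M] by (simp add: algebra_simps)
    also have "\<dots> = (\<Sum>k\<le>M. \<Sum>l\<le>M. (\<Sum>a\<le>B. Od (2 * a + 1) * ci HH (int k + j - int a)) *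
        (\<Sum>b\<le>B. Od (2 * b + 1) * ci HH (int l + j + 1 - int b)) * \<sigma> k (\<sigma> l ?P))"
      by (intro sum.cong refl arg_cong2[where f = "(*)"] ci_cq_odd) (auto simp: B_def)
    also have "\<dots> = (\<Sum>a\<le>B. \<Sum>b\<le>B. Od (2 * a + 1) * Od (2 * b + 1) * F (int a + 1) (int b))"
      unfolding rearr by (simp add: F_def E algebra_simps)
    finally show ?thesis .
  qed
  have even: "vop2 (cq \<i>) (\<sigma>q \<i>) (cq \<i>) (\<sigma>q \<i>) (2 * j + 2) (2 * j + 2) ?P =
      (\<Sum>a\<le>B. \<Sum>b\<le>B. Od (2 * a) * Od (2 * b) * F (int a) (int b))"
  proof -
    have "vop2 (cq \<i>) (\<sigma>q \<i>) (cq \<i>) (\<sigma>q \<i>) (2 * j + 2) (2 * j + 2) ?P =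
        (\<Sum>k\<le>M. \<Sum>l\<le>M. ci (cq \<i>) (2 * (int k + j + 1)) * ci (cq \<i>) (2 * (int l + j + 1)) * \<sigma> k (\<sigma> l ?P))"
      unfolding vop2_cq[OF M] by (simp add: algebra_simps)
    also have "\<dots> = (\<Sum>k\<le>M. \<Sum>l\<le>M. (\<Sum>a\<le>B. Od (2 * a) * ci HH (int k + j + 1 - int a)) *
        (\<Sum>b\<le>B. Od (2 * b) * ci HH (int l + j + 1 - int b)) * \<sigma> k (\<sigma> l ?P))"
      by (intro sum.cong refl arg_cong2[where f = "(*)"] ci_cq_even) (auto simp: B_def)
    also have "\<dots> = (\<Sum>a\<le>B. \<Sum>b\<le>B. Od (2 * a) * Od (2 * b) * F (int a) (int b))"
      unfolding rearr by (simp add: F_def E algebra_simps)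
    finally show ?thesis .
  qed
  \<comment> \<open>The odd part comes with the arguments a + 1 and b; shifting a accounts for the
    factor x in x S(x) S(y).\<close>
  have shift: "(\<Sum>a\<le>B. \<Sum>b\<le>B. Od (2 * a + 1) * Od (2 * b + 1) * F (int a + 1) (int b)) =
      (\<Sum>a\<le>B. \<Sum>b\<le>B. (if a = 0 then 0 else Od (2 * a - 1) * Od (2 * b + 1)) * F (int a) (int b))"
  proof -
    have "(\<Sum>a\<le>B. \<Sum>b\<le>B. (if a = 0 then 0 else Od (2 * a - 1) * Od (2 * b + 1)) * F (int a) (int b)) =
        (\<Sum>a\<le>Suc B. \<Sum>b\<le>B. (if a = 0 then 0 else Od (2 * a - 1) * Od (2 * b + 1)) * F (int a) (int b))"
      by (simp add: F0)
    also have "\<dots> = (\<Sum>a\<le>B. \<Sum>b\<le>B. Od (2 * a + 1) * Od (2 * b + 1) * F (int a + 1) (int b))"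
      unfolding sum.atMost_Suc_shift by (simp add: add.commute)
    finally show ?thesis ..
  qed
  have one: "F 0 0 = (\<Sum>a\<le>B. \<Sum>b\<le>B. (if a = 0 \<and> b = 0 then 1 else 0) * F (int a) (int b))"
  proof -
    have "(\<Sum>b\<le>B. (if a = 0 \<and> b = 0 then 1 else 0) * F (int a) (int b)) = (if a = 0 then F 0 0 else 0)" for a :: nat
    proof -
      have "(\<Sum>b\<le>B. (if a = 0 \<and> b = 0 then 1 else 0) * F (int a) (int b)) =
          (\<Sum>b\<le>B. if b = 0 then (if a = 0 then F 0 0 else 0) else 0)"
        by (rule sum.cong) auto
      then show ?thesis by simp
    qed
    then show ?thesis by simp
  qed
  have ffs: "ff a b * x = (if a = 0 \<and> b = 0 then 1 else 0) * x +
      (if a = 0 then 0 else Od (2 * a - 1) * Od (2 * b + 1)) * x - Od (2 * a) * Od (2 * b) * x" for a b x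
    by (simp add: ff_def algebra_simps)
  have "coef (x0_2 v) j = Cst \<i> * (- F 0 0 + (\<Sum>a\<le>B. \<Sum>b\<le>B. ff a b * F (int a) (int b)))"
    unfolding coef_x0_2 odd even shift one ffs sum_subtractf sum.distrib by simp
  also have "(\<Sum>a\<le>B. \<Sum>b\<le>B. ff a b * F (int a) (int b)) =
      (\<Sum>a\<le>B. \<Sum>b\<le>B. Gam a b * (F (int (a + 1)) (int b) - F (int a) (int (b + 1))))"
    by (rule sum_ff) (auto simp: F0)
  also have "\<dots> = (\<Sum>a\<le>B. \<Sum>b\<le>B. Gam a b * coef (Psi (int a + 1) (Psi (int b + 1) v)) j)"
    by (simp add: Psi2 add.commute)
  also have "\<dots> = (\<Sum>a\<le>B. \<Sum>b<N. Gam a b * coef (Psi (int a + 1) (Psi (int b + 1) v)) j)"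
    by (intro sum.cong refl sum.mono_neutral_right) (auto simp: B_def PPN)
  also have "\<dots> = (\<Sum>a<N. \<Sum>b<N. Gam a b * coef (Psi (int a + 1) (Psi (int b + 1) v)) j)"
    by (rule sum.mono_neutral_right) (auto simp: B_def PPN)
  also have "F 0 0 = (\<Sum>k\<le>B. coef (Psi (- int k) (Psi (int k + 1) v)) j)"
  proof -
    have "(\<Sum>k\<le>B. coef (Psi (- int k) (Psi (int k + 1) v)) j) =
        (\<Sum>k\<le>B. F (- int k) (int k) - F (- int (Suc k)) (int (Suc k)))"
    proof (intro sum.cong refl)
      fix k
      have "- int k - 1 = - int (Suc k)" "int k + 1 - 1 = int k" "int k + 1 = int (Suc k)" by simp_all
      then show "coef (Psi (- int k) (Psi (int k + 1) v)) j = F (- int k) (int k) - F (- int (Suc k)) (int (Suc k))"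
        by (simp only: Psi2)
    qed
    also have "\<dots> = F 0 0 - F (- int (Suc B)) (int (Suc B))"
      by (subst sum_telescope) simp
    finally show ?thesis by (simp add: F0)
  qed
  also have "\<dots> = (\<Sum>k<N. coef (Psi (- int k) (Psi (int k + 1) v)) j)"
    by (rule sum.mono_neutral_right) (auto simp: B_def PN Psi0)
  finally show "coef (x0_2 v) j = coef (poly_mult (Cst \<i>) (- (\<Sum>k<N. Psi (- int k) (Psi (int k + 1) v))
    + (\<Sum>a<N. \<Sum>b<N. poly_mult (Gam a b) (Psi (int a + 1) (Psi (int b + 1) v))))) j"
    by (simp add: coef_poly_mult lookup_add lookup_minus lookup_sum)
qed

section \<open>The fermionic Fock space over a commutative ring\<close>

text \<open>The coefficient ring is left general: complex numbers are used for H_{2n} and W_{2n},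
  polynomials for the tensor product of D with H_{2n}.\<close>

definition fsg :: "int \<Rightarrow> int set \<Rightarrow> 'r::comm_ring_1"
  where "fsg n T = (- 1) ^ card {t \<in> T. t < n}"

definition ins :: "int \<Rightarrow> (int set \<Rightarrow>\<^sub>0 'r::comm_ring_1) \<Rightarrow> (int set \<Rightarrow>\<^sub>0 'r)"
  where "ins n v = (\<Sum>T\<in>keys v. if n \<notin> T then sg (insert n T) (fsg n T * coef v T) else 0)"

definition del :: "int \<Rightarrow> (int set \<Rightarrow>\<^sub>0 'r::comm_ring_1) \<Rightarrow> (int set \<Rightarrow>\<^sub>0 'r)"
  where "del n v = (\<Sum>T\<in>keys v. if n \<in> T then sg (T - {n}) (fsg n T * coef v T) else 0)"

definition sm :: "'r \<Rightarrow> ('a \<Rightarrow>\<^sub>0 'r) \<Rightarrow> ('a \<Rightarrow>\<^sub>0 'r::comm_ring_1)"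
  where "sm d = Poly_Mapping.map ((*) d)"

text \<open>The index type also contains infinite sets, on which \<open>card\<close> yields no sign
  compatible with the relations; the Fock space consists of the vectors supported on finite
  sets.\<close>

definition fk :: "(int set \<Rightarrow>\<^sub>0 'r::comm_ring_1) set"
  where "fk = {v. \<forall>T\<in>keys v. finite T}"

lemma coef_sm: "coef (sm d v) T = d * coef v T"
  by (simp add: sm_def coef_map)

lemma sm_single: "sm d (sg T c) = sg T (d * c)"
  by (rule poly_mapping_eqI) (simp add: coef_sm lookup_single when_def)

lemma sm_add: "sm d (v + w) = sm d v + sm d w" and sm_add_left: "sm (d + e) v = sm d v + sm e v"
  and sm_sm: "sm d (sm e v) = sm (d * e) v" and sm_one: "sm 1 v = v" and sm_zero: "sm d 0 = 0"
  by (rule poly_mapping_eqI; simp add: coef_sm lookup_add algebra_simps)+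

lemma ins_add: "ins n (v + w) = ins n v + ins n w"
  unfolding ins_def by (rule keys_sum_add) (auto simp: distrib_left single_add)

lemma del_add: "del n (v + w) = del n v + del n w"
  unfolding del_def by (rule keys_sum_add) (auto simp: distrib_left single_add)

lemma ins_single: "ins n (sg T c) = (if n \<in> T then 0 else sg (insert n T) (fsg n T * c))"
  unfolding ins_def by (subst keys_sum_single) auto

lemma del_single: "del n (sg T c) = (if n \<in> T then sg (T - {n}) (fsg n T * c) else 0)"
  unfolding del_def by (subst keys_sum_single) auto

lemma ins_zero [simp]: "ins n 0 = 0" and del_zero [simp]: "del n 0 = 0"
  by (simp_all add: ins_def del_def)

lemma ins_sum: "ins n (sum f A) = (\<Sum>a\<in>A. ins n (f a))"
  by (rule additive_sum(4)) (rule ins_add)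

lemma del_sum: "del n (sum f A) = (\<Sum>a\<in>A. del n (f a))"
  by (rule additive_sum(4)) (rule del_add)

lemma ins_sm: "ins n (sm d v) = sm d (ins n v)"
  by (rule pm_ext_additive[of "\<lambda>v. ins n (sm d v)" "\<lambda>v. sm d (ins n v)"])
    (auto simp: sm_add ins_add sm_single ins_single sm_zero mult_ac)

lemma del_sm: "del n (sm d v) = sm d (del n v)"
  by (rule pm_ext_additive[of "\<lambda>v. del n (sm d v)" "\<lambda>v. sm d (del n v)"])
    (auto simp: sm_add del_add sm_single del_single sm_zero mult_ac)

lemma fsg_insert:
  assumes "finite T" "k \<notin> T"
  shows "fsg n (insert k T) = (if k < n then - fsg n T else fsg n T)"
proof (cases "k < n")
  case True
  then have "{t \<in> insert k T. t < n} = insert k {t \<in> T. t < n}" by auto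
  then show ?thesis using assms True by (simp add: fsg_def)
next
  case False
  then have "{t \<in> insert k T. t < n} = {t \<in> T. t < n}" by auto
  then show ?thesis using False by (simp add: fsg_def)
qed

lemma fsg_remove: "finite T \<Longrightarrow> k \<in> T \<Longrightarrow> fsg n (T - {k}) = (if k < n then - fsg n T else fsg n T)"
  for T :: "int set"
  using fsg_insert[of "T - {k}" k n, where ?'a = 'a] by (auto simp: insert_absorb)

lemma fsg_square: "fsg n T * fsg n T = 1" "fsg n T * (fsg n T * c) = c"
  by (simp_all add: fsg_def flip: mult.assoc power_mult_distrib)

lemma fsg_least: "\<forall>t\<in>T. n < t \<Longrightarrow> fsg n T = 1"
proof -
  assume "\<forall>t\<in>T. n < t"
  then have "{t \<in> T. t < n} = {}" by auto
  then show ?thesis unfolding fsg_def by (metis card.empty power_0)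
qed

lemma additive_ext_keys:
  fixes f g :: "('a \<Rightarrow>\<^sub>0 'b::ab_group_add) \<Rightarrow> 'c::ab_group_add"
  assumes "\<And>x y. f (x + y) = f x + f y" "\<And>x y. g (x + y) = g x + g y"
    "\<And>T. T \<in> keys x \<Longrightarrow> f (sg T (coef x T)) = g (sg T (coef x T))"
  shows "f x = g x"
proof -
  have "f (\<Sum>T\<in>keys x. sg T (coef x T)) = g (\<Sum>T\<in>keys x. sg T (coef x T))"
    unfolding additive_sum(4)[of f, OF assms(1)] additive_sum(4)[of g, OF assms(2)]
    by (rule sum.cong) (auto simp: assms(3))
  then show ?thesis by (simp only: sum_single)
qed

lemma ins_ins: assumes "v \<in> fk" shows "ins k (ins l v) + ins l (ins k v) = 0"
proof (rule additive_ext_keys[of "\<lambda>v. ins k (ins l v) + ins l (ins k v)" "\<lambda>v. 0"])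
  fix T assume "T \<in> keys v"
  then have "finite T" using assms by (auto simp: fk_def)
  then show "ins k (ins l (sg T (coef v T))) + ins l (ins k (sg T (coef v T))) = 0"
    by (auto simp: ins_single fsg_insert insert_commute mult_ac simp flip: single_add)
qed (simp_all add: ins_add)

lemma del_del: assumes "v \<in> fk" shows "del k (del l v) + del l (del k v) = 0"
proof (rule additive_ext_keys[of "\<lambda>v. del k (del l v) + del l (del k v)" "\<lambda>v. 0"])
  fix T assume "T \<in> keys v"
  then have "finite T" using assms by (auto simp: fk_def)
  moreover have "T - {k} - {l} = T - {l} - {k}" by auto
  ultimately show "del k (del l (sg T (coef v T))) + del l (del k (sg T (coef v T))) = 0"
    by (auto simp: del_single fsg_remove mult_ac simp flip: single_add)
qed (simp_all add: del_add)

lemma ins_del: assumes "v \<in> fk" shows "ins k (del l v) + del l (ins k v) = (if k = l then v else 0)"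
proof (rule additive_ext_keys[of "\<lambda>v. ins k (del l v) + del l (ins k v)" "\<lambda>v. if k = l then v else 0"])
  fix T assume "T \<in> keys v"
  then have T: "finite T" using assms by (auto simp: fk_def)
  show "ins k (del l (sg T (coef v T))) + del l (ins k (sg T (coef v T))) =
      (if k = l then sg T (coef v T) else 0)"
  proof (cases "k = l")
    case True
    then show ?thesis using T by (auto simp: ins_single del_single fsg_insert fsg_remove insert_absorb fsg_square)
  next
    case False
    then have "insert k T - {l} = insert k (T - {l})" by auto
    then show ?thesis
      using T False by (auto simp: ins_single del_single fsg_insert fsg_remove mult_ac simp flip: single_add)
  qed
qed (simp_all add: ins_add del_add)

lemma fk_0: "0 \<in> fk" and fk_add: "v \<in> fk \<Longrightarrow> w \<in> fk \<Longrightarrow> v + w \<in> fk"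
  and fk_single: "finite T \<Longrightarrow> sg T c \<in> fk"
  using keys_add[of v w] by (auto simp: fk_def split: if_splits)

lemma fk_sum: "(\<And>a. a \<in> A \<Longrightarrow> f a \<in> fk) \<Longrightarrow> sum f A \<in> fk"
  by (induction A rule: infinite_finite_induct) (auto intro: fk_0 fk_add)

lemma fk_ins: "v \<in> fk \<Longrightarrow> ins n v \<in> fk"
  unfolding ins_def by (rule fk_sum) (auto simp: fk_def split: if_splits)

lemma fk_del: "v \<in> fk \<Longrightarrow> del n v \<in> fk"
  unfolding del_def by (rule fk_sum) (auto simp: fk_def split: if_splits)

lemma fk_sm: "v \<in> fk \<Longrightarrow> sm d v \<in> fk"
  by (auto simp: fk_def in_keys_iff coef_sm)

text \<open>The sign s depends on the order of the list and is left implicit; s * s = 1 suffices to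
  cancel it.\<close>

lemma foldr_del_single:
  assumes "distinct xs"
  shows "\<exists>s. s * s = 1 \<and> (\<forall>c. foldr del xs (sg T c) =
    (if set xs \<subseteq> T then sg (T - set xs) (s * c) else 0 :: int set \<Rightarrow>\<^sub>0 'r::comm_ring_1))"
  using assms
proof (induction xs)
  case (Cons x xs)
  then obtain s where s: "s * s = 1" "\<And>c. foldr del xs (sg T c) =
    (if set xs \<subseteq> T then sg (T - set xs) (s * c) else 0 :: int set \<Rightarrow>\<^sub>0 'r)" by auto
  let ?f = "fsg x (T - set xs)"
  have "?f * s * (?f * s) = 1" using s(1) fsg_square(1)[of x "T - set xs", where ?'a = 'r]
    by (metis mult.assoc mult.left_commute mult.right_neutral)
  moreover have "foldr del (x # xs) (sg T c) =
      (if set (x # xs) \<subseteq> T then sg (T - set (x # xs)) (?f * s * c) else 0)" for c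
    using Cons.prems by (auto simp: s(2) del_single mult.assoc set_diff_eq intro!: arg_cong[of _ _ "\<lambda>A. sg A _"])
  ultimately show ?case by blast
qed (auto intro!: exI[of _ 1])

section \<open>Representations of the canonical anticommutation relations\<close>

text \<open>\<open>no_two\<close> turns the relation 2 psi^2 = 0 into psi^2 = 0. The two finiteness
  conditions give meaning to infinite combinations of annihilation operators.\<close>

locale car =
  fixes sc :: "'r::comm_ring_1 \<Rightarrow> 'v::ab_group_add \<Rightarrow> 'v" and psi psis :: "int \<Rightarrow> 'v \<Rightarrow> 'v"
  assumes sc_add: "sc d (v + w) = sc d v + sc d w" and sc_add_left: "sc (d + e) v = sc d v + sc e v"
    and sc_sc: "sc d (sc e v) = sc (d * e) v" and sc_one: "sc 1 v = v"
    and psi_add: "psi n (v + w) = psi n v + psi n w" and psi_sc: "psi n (sc d v) = sc d (psi n v)"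
    and psis_add: "psis n (v + w) = psis n v + psis n w" and psis_sc: "psis n (sc d v) = sc d (psis n v)"
    and psi_psi: "psi a (psi b v) + psi b (psi a v) = 0"
    and psis_psis: "psis a (psis b v) + psis b (psis a v) = 0"
    and psi_psis: "psi a (psis b v) + psis b (psi a v) = (if a = b then v else 0)"
    and psi_fin: "\<exists>N. \<forall>n\<ge>N. psi (int n) v = 0"
    and psis_fin: "\<exists>N. \<forall>n\<ge>N. psis (- int n) v = 0"
    and no_two: "v + v = 0 \<Longrightarrow> v = 0"
begin

lemma sc_zero [simp]: "sc d 0 = 0" and sc_minus: "sc d (- v) = - sc d v"
  and sc_sum: "sc d (sum f A) = (\<Sum>a\<in>A. sc d (f a))"
  using additive_sum[of "sc d", OF sc_add] by auto

lemma sc_diff: "sc d (v - w) = sc d v - sc d w"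
  using additive_sum(3)[of "sc d", OF sc_add] .

lemma sc_zero_left [simp]: "sc 0 v = 0" and sc_minus_left: "sc (- d) v = - sc d v"
proof -
  interpret additive "\<lambda>d. sc d v" by standard (rule sc_add_left)
  show "sc 0 v = 0" "sc (- d) v = - sc d v" by (simp_all add: zero minus)
qed

lemma psi_zero [simp]: "psi n 0 = 0"
  and psi_diff: "psi n (v - w) = psi n v - psi n w"
  and psi_sum: "psi n (sum f A) = (\<Sum>a\<in>A. psi n (f a))"
  using additive_sum[of "psi n", OF psi_add] by auto

lemma psis_zero [simp]: "psis n 0 = 0"
  and psis_diff: "psis n (v - w) = psis n v - psis n w"
  and psis_sum: "psis n (sum f A) = (\<Sum>a\<in>A. psis n (f a))"
  using additive_sum[of "psis n", OF psis_add] by auto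

definition cr :: "int \<Rightarrow> 'v \<Rightarrow> 'v" where "cr n = (if n \<le> 0 then psi n else psis n)"
definition an :: "int \<Rightarrow> 'v \<Rightarrow> 'v" where "an n = (if n \<le> 0 then psis n else psi n)"

lemma cr_add: "cr n (v + w) = cr n v + cr n w" and an_add: "an n (v + w) = an n v + an n w"
  and cr_sc: "cr n (sc d v) = sc d (cr n v)" and an_sc: "an n (sc d v) = sc d (an n v)"
  and cr_zero [simp]: "cr n 0 = 0" and an_zero [simp]: "an n 0 = 0"
  by (simp_all add: cr_def an_def psi_add psis_add psi_sc psis_sc)

lemma psis_psi: "psis a (psi b v) + psi b (psis a v) = (if a = b then v else 0)"
  using psi_psis[of b a v] by (simp add: add.commute eq_commute)

lemma psi_psi_eq: "psi a (psi b v) = - psi b (psi a v)"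
  and psis_psis_eq: "psis a (psis b v) = - psis b (psis a v)"
  and psi_psis_eq: "psi a (psis b v) = (if a = b then v else 0) - psis b (psi a v)"
  and psis_psi_eq: "psis a (psi b v) = (if a = b then v else 0) - psi b (psis a v)"
  using psi_psi[of a b v] psis_psis[of a b v] psi_psis[of a b v] psis_psi[of a b v]
  by (simp_all only: eq_neg_iff_add_eq_0 eq_diff_eq)

lemma cr_cr: "cr a (cr b v) = - cr b (cr a v)"
proof (cases "a \<le> 0")
  case a: True
  show ?thesis
  proof (cases "b \<le> 0")
    case True
    then show ?thesis using a psi_psi_eq[of a b v] unfolding cr_def by (simp only: if_True)
  next
    case False
    then have "a \<noteq> b" using a by auto
    then show ?thesis using a False psi_psis_eq[of a b v] unfolding cr_def by (simp only: if_True if_False diff_0)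
  qed
next
  case a: False
  show ?thesis
  proof (cases "b \<le> 0")
    case True
    then have "a \<noteq> b" using a by auto
    then show ?thesis using a True psis_psi_eq[of a b v] unfolding cr_def by (simp only: if_True if_False diff_0)
  next
    case False
    then show ?thesis using a psis_psis_eq[of a b v] unfolding cr_def by (simp only: if_False)
  qed
qed

lemma an_cr: "an a (cr b v) = (if a = b then v else 0) - cr b (an a v)"
proof (cases "a \<le> 0")
  case a: True
  show ?thesis
  proof (cases "b \<le> 0")
    case True
    then show ?thesis using a psis_psi_eq[of a b v] unfolding cr_def an_def by (simp only: if_True)
  next
    case False
    then have "a \<noteq> b" using a by auto
    then show ?thesis using a False psis_psis_eq[of a b v] unfolding cr_def an_def by (simp only: if_True if_False diff_0)
  qed
next
  case a: False
  show ?thesis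
  proof (cases "b \<le> 0")
    case True
    then have "a \<noteq> b" using a by auto
    then show ?thesis using a True psi_psi_eq[of a b v] unfolding cr_def an_def by (simp only: if_True if_False diff_0)
  next
    case False
    then show ?thesis using a psi_psis_eq[of a b v] unfolding cr_def an_def by (simp only: if_False)
  qed
qed

lemma cr_square: "cr a (cr a v) = 0"
proof (rule no_two)
  show "cr a (cr a v) + cr a (cr a v) = 0"
    using cr_cr[of a a v] by (simp only: eq_neg_iff_add_eq_0)
qed

end

locale car_vac = car +
  fixes vac :: 'b
  assumes an_vac: "an n vac = 0"
begin

definition vT :: "int set \<Rightarrow> 'b" where "vT T = foldr cr (sorted_list_of_set T) vac"

lemma vT_empty [simp]: "vT {} = vac"
  by (simp add: vT_def)

lemma vT_insert_min:
  assumes "finite T" "\<forall>t\<in>T. n < t"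
  shows "vT (insert n T) = cr n (vT T)"
proof -
  have "n \<notin> T" using assms(2) by auto
  then have "sorted_list_of_set (insert n T) = n # sorted_list_of_set T"
    using assms by (simp add: insort_is_Cons less_imp_le)
  then show ?thesis by (simp add: vT_def)
qed

lemma cr_vT: "finite T \<Longrightarrow> cr n (vT T) = (if n \<in> T then 0 else sc (fsg n T) (vT (insert n T)))"
proof (induction T arbitrary: n rule: finite_linorder_min_induct)
  case empty
  then show ?case using vT_insert_min[of "{}" n] by (simp add: fsg_least sc_one)
next
  case (insert b A)
  have b: "b \<notin> A" using insert.hyps by auto
  have vb: "vT (insert b A) = cr b (vT A)" using vT_insert_min insert.hyps by blast
  consider "n < b" | "n = b" | "n > b" by linarith
  then show ?case
  proof cases
    case 1
    then have "\<forall>t\<in>insert b A. n < t" using insert.hyps by auto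
    then show ?thesis
      using vT_insert_min[of "insert b A" n] insert.hyps by (auto simp: fsg_least sc_one)
  next
    case 2
    then show ?thesis by (simp add: vb cr_square)
  next
    case 3
    have "vT (insert n (insert b A)) = cr b (vT (insert n A))" if "n \<notin> A"
      using vT_insert_min[of "insert n A" b] 3 insert.hyps by (simp add: insert_commute)
    then show ?thesis
      using 3 b insert.hyps
      by (auto simp: vb cr_cr[of n b] insert.IH[of n] cr_sc fsg_insert sc_minus_left)
  qed
qed

lemma an_vT: "finite T \<Longrightarrow> an n (vT T) = (if n \<in> T then sc (fsg n T) (vT (T - {n})) else 0)"
proof (induction T arbitrary: n rule: finite_linorder_min_induct)
  case empty
  then show ?case by (simp add: an_vac)
next
  case (insert b A)
  have b: "b \<notin> A" using insert.hyps by auto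
  have vb: "vT (insert b A) = cr b (vT A)" using vT_insert_min insert.hyps by blast
  have fb: "fsg b (insert b A) = 1"
    using fsg_insert[of A b b] insert.hyps b by (simp add: fsg_least)
  show ?case
  proof (cases "n = b")
    case True
    then show ?thesis using b by (simp add: vb an_cr insert.IH fb sc_one)
  next
    case False
    have "vT (insert b A - {n}) = cr b (vT (A - {n}))" if "n \<in> A"
    proof -
      have "insert b A - {n} = insert b (A - {n})" using False by auto
      then show ?thesis using vT_insert_min[of "A - {n}" b] insert.hyps by auto
    qed
    moreover have "n > b" if "n \<in> A" using that insert.hyps by auto
    ultimately show ?thesis
      using False b insert.hyps
      by (auto simp: vb an_cr insert.IH cr_sc fsg_insert sc_minus_left)
  qed
qed

definition Phi :: "(int set \<Rightarrow>\<^sub>0 'a) \<Rightarrow> 'b" where "Phi x = (\<Sum>T\<in>keys x. sc (coef x T) (vT T))"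

lemma Phi_add: "Phi (x + y) = Phi x + Phi y"
  unfolding Phi_def by (rule keys_sum_add) (auto simp: sc_add_left)

lemma Phi_single: "Phi (sg T d) = sc d (vT T)"
  unfolding Phi_def by (rule keys_sum_single) simp

lemma Phi_zero [simp]: "Phi 0 = 0" and Phi_minus: "Phi (- x) = - Phi x"
  and Phi_sum: "Phi (sum f A) = (\<Sum>a\<in>A. Phi (f a))"
  using additive_sum[of Phi, OF Phi_add] by auto

lemma Phi_sm: "Phi (sm d x) = sc d (Phi x)"
  by (rule pm_ext_additive[of "\<lambda>x. Phi (sm d x)" "\<lambda>x. sc d (Phi x)"])
    (simp_all add: sm_add Phi_add sc_add sm_single Phi_single sc_sc)

lemma Phi_ins:
  assumes "x \<in> fk"
  shows "Phi (ins n x) = cr n (Phi x)"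
proof (rule additive_ext_keys[of "\<lambda>x. Phi (ins n x)" "\<lambda>x. cr n (Phi x)"])
  fix T assume "T \<in> keys x"
  then have "finite T" using assms by (auto simp: fk_def)
  then show "Phi (ins n (sg T (coef x T))) = cr n (Phi (sg T (coef x T)))"
    by (simp add: ins_single Phi_single cr_sc cr_vT sc_sc mult.commute)
qed (simp_all add: ins_add Phi_add cr_add)

lemma Phi_del:
  assumes "x \<in> fk"
  shows "Phi (del n x) = an n (Phi x)"
proof (rule additive_ext_keys[of "\<lambda>x. Phi (del n x)" "\<lambda>x. an n (Phi x)"])
  fix T assume "T \<in> keys x"
  then have "finite T" using assms by (auto simp: fk_def)
  then show "Phi (del n (sg T (coef x T))) = an n (Phi (sg T (coef x T)))"
    by (simp add: del_single Phi_single an_sc an_vT sc_sc mult.commute)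
qed (simp_all add: del_add Phi_add an_add)

text \<open>Removing from \<open>x\<close> the elements of a largest \<open>T\<^sub>0\<close> in its support leaves a multiple of the vacuum.\<close>

lemma Phi_injective:
  assumes x: "x \<in> fk" "Phi x = 0" and vac: "\<And>d. sc d vac = 0 \<Longrightarrow> d = 0"
  shows "x = 0"
proof (rule ccontr)
  assume "x \<noteq> 0"
  then have ne: "keys x \<noteq> {}" by simp
  define T0 where "T0 = arg_max_on card (keys x)"
  have T0: "T0 \<in> keys x" "\<And>T. T \<in> keys x \<Longrightarrow> card T \<le> card T0"
  proof -
    have "Max (card ` keys x) \<in> card ` keys x" using ne by (intro Max_in) auto
    then obtain S where S: "S \<in> keys x" "card S = Max (card ` keys x)" by auto
    have "is_arg_max card (\<lambda>T. T \<in> keys x) S"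
      using S by (auto simp: is_arg_max_linorder)
    then have "is_arg_max card (\<lambda>T. T \<in> keys x) T0"
      unfolding T0_def arg_max_on_def arg_max_def by (rule someI)
    then show "T0 \<in> keys x" "\<And>T. T \<in> keys x \<Longrightarrow> card T \<le> card T0"
      by (auto simp: is_arg_max_linorder)
  qed
  have finT: "finite T" if "T \<in> keys x" for T using x(1) that by (auto simp: fk_def)
  define xs where "xs = sorted_list_of_set T0"
  have xs: "distinct xs" "set xs = T0" using finT[OF T0(1)] by (auto simp: xs_def)
  have fd: "foldr del ys x \<in> fk \<and> Phi (foldr del ys x) = 0" for ys
    by (induction ys) (auto simp: x fk_del Phi_del)
  have fsum: "foldr del ys (sum f A) = (\<Sum>a\<in>A. foldr del ys (f a))" for ys A and f :: "int set \<Rightarrow> int set \<Rightarrow>\<^sub>0 'a"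
    by (induction ys) (simp_all add: del_sum)
  obtain s :: 'a where s: "s * s = 1" "\<And>c. foldr del xs (sg T0 c) = sg {} (s * c)"
  proof -
    obtain s :: 'a where s: "s * s = 1" "\<forall>c. foldr del xs (sg T0 c) =
        (if set xs \<subseteq> T0 then sg (T0 - set xs) (s * c) else 0)"
      using foldr_del_single[OF xs(1)] by blast
    then have "foldr del xs (sg T0 c) = sg {} (s * c)" for c using xs(2) by simp
    then show ?thesis by (intro that[of s] s(1))
  qed
  have "foldr del xs x = (\<Sum>T\<in>keys x. foldr del xs (sg T (coef x T)))"
    by (subst (1) sum_single[of x, symmetric]) (rule fsum)
  also have "\<dots> = (\<Sum>T\<in>keys x. if T = T0 then sg {} (s * coef x T0) else 0)"
  proof (rule sum.cong[OF refl])
    fix T assume T: "T \<in> keys x"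
    show "foldr del xs (sg T (coef x T)) = (if T = T0 then sg {} (s * coef x T0) else 0)"
    proof (cases "T = T0")
      case False
      then have "\<not> T0 \<subseteq> T" using T0(2)[OF T] finT[OF T] by (metis card_seteq)
      then show ?thesis using foldr_del_single[OF xs(1), of T, where ?'r = 'a] xs(2) False by auto
    qed (simp add: s)
  qed
  also have "\<dots> = sg {} (s * coef x T0)" using T0(1) by simp
  finally have "sc (s * coef x T0) vac = 0" using fd[of xs] by (simp add: Phi_single)
  then have "s * coef x T0 = 0" by (rule vac)
  then have "coef x T0 = 0" using s(1) by (metis mult.assoc mult_1 mult_zero_right)
  then show False using T0(1) by (simp add: in_keys_iff)
qed

lemma psi_Phi: "x \<in> fk \<Longrightarrow> psi n (Phi x) = Phi (if n \<le> 0 then ins n x else del n x)"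
  and psis_Phi: "x \<in> fk \<Longrightarrow> psis n (Phi x) = Phi (if n \<le> 0 then del n x else ins n x)"
  by (simp_all add: Phi_ins Phi_del cr_def an_def)

end

section \<open>Modified fermions\<close>

context car
begin

text \<open>\<open>pA\<close> and \<open>pB\<close> are infinite combinations of the two kinds of
  annihilation operators; only finitely many terms act on a given vector.\<close>

definition pA :: "(nat \<Rightarrow> 'r) \<Rightarrow> 'v \<Rightarrow> 'v" where "pA \<mu> v = Sum_any (\<lambda>b. sc (\<mu> b) (psi (int b + 1) v))"
definition pB :: "(nat \<Rightarrow> 'r) \<Rightarrow> 'v \<Rightarrow> 'v" where "pB \<mu> v = Sum_any (\<lambda>k. sc (\<mu> k) (psis (- int k) v))"

lemma pA_eq: "(\<And>b. b \<ge> N \<Longrightarrow> psi (int b + 1) v = 0) \<Longrightarrow> pA \<mu> v = (\<Sum>b<N. sc (\<mu> b) (psi (int b + 1) v))"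
  unfolding pA_def by (rule Sum_any.expand_superset) (auto simp: not_le[symmetric])

lemma pB_eq: "(\<And>b. b \<ge> N \<Longrightarrow> psis (- int b) v = 0) \<Longrightarrow> pB \<mu> v = (\<Sum>b<N. sc (\<mu> b) (psis (- int b) v))"
  unfolding pB_def by (rule Sum_any.expand_superset) (auto simp: not_le[symmetric])

lemma psi_fin1: "\<exists>N. \<forall>b\<ge>N. psi (int b + 1) v = 0"
proof -
  obtain N where "\<forall>n\<ge>N. psi (int n) v = 0" using psi_fin by blast
  then have "\<forall>b\<ge>N. psi (int (Suc b)) v = 0" by (metis le_Suc_eq)
  then show ?thesis by (auto simp: add.commute)
qed

lemma pA_add: "pA \<mu> (v + w) = pA \<mu> v + pA \<mu> w"
proof -
  obtain N where N: "\<forall>b\<ge>N. psi (int b + 1) v = 0" using psi_fin1 by blast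
  obtain M where M: "\<forall>b\<ge>M. psi (int b + 1) w = 0" using psi_fin1 by blast
  show ?thesis using N M
    by (subst (1 2 3) pA_eq[of "max N M"]) (auto simp: psi_add sc_add sum.distrib)
qed

lemma pB_add: "pB \<mu> (v + w) = pB \<mu> v + pB \<mu> w"
proof -
  obtain N where N: "\<forall>b\<ge>N. psis (- int b) v = 0" using psis_fin by blast
  obtain M where M: "\<forall>b\<ge>M. psis (- int b) w = 0" using psis_fin by blast
  show ?thesis using N M
    by (subst (1 2 3) pB_eq[of "max N M"]) (auto simp: psis_add sc_add sum.distrib)
qed

lemma pA_zero [simp]: "pA \<mu> 0 = 0"
  and pA_sum: "pA \<mu> (sum f A) = (\<Sum>a\<in>A. pA \<mu> (f a))"
  using additive_sum[of "pA \<mu>", OF pA_add] by auto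

lemma pB_zero [simp]: "pB \<mu> 0 = 0"
  and pB_sum: "pB \<mu> (sum f A) = (\<Sum>a\<in>A. pB \<mu> (f a))"
  using additive_sum[of "pB \<mu>", OF pB_add] by auto

lemma pA_sc: "pA \<mu> (sc d v) = sc d (pA \<mu> v)"
proof -
  obtain N where N: "\<forall>b\<ge>N. psi (int b + 1) v = 0" using psi_fin1 by blast
  then show ?thesis
    by (subst (1 2) pA_eq[of N]) (auto simp: psi_sc sc_sum sc_sc mult.commute)
qed

lemma pB_sc: "pB \<mu> (sc d v) = sc d (pB \<mu> v)"
proof -
  obtain N where N: "\<forall>b\<ge>N. psis (- int b) v = 0" using psis_fin by blast
  then show ?thesis
    by (subst (1 2) pB_eq[of N]) (auto simp: psis_sc sc_sum sc_sc mult.commute)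
qed

lemma anti_iff: "(x::'v) + y = 0 \<longleftrightarrow> x = - y"
  by (rule eq_neg_iff_add_eq_0[symmetric])

lemma psi_pA: "psi n (pA \<mu> v) = - pA \<mu> (psi n v)"
proof -
  obtain N where N: "\<And>b. b \<ge> N \<Longrightarrow> psi (int b + 1) v = 0" using psi_fin1 by blast
  have anti: "psi (int b + 1) (psi n v) = - psi n (psi (int b + 1) v)" for b
    using psi_psi anti_iff by blast
  then have "\<And>b. b \<ge> N \<Longrightarrow> psi (int b + 1) (psi n v) = 0" using N by simp
  then show ?thesis
    using N by (simp add: pA_eq[of N] psi_sum psi_sc anti sc_minus sum_negf)
qed

lemma psis_pB: "psis n (pB \<mu> v) = - pB \<mu> (psis n v)"
proof -
  obtain N where N: "\<And>b. b \<ge> N \<Longrightarrow> psis (- int b) v = 0" using psis_fin by blast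
  have anti: "psis (- int b) (psis n v) = - psis n (psis (- int b) v)" for b
    using psis_psis anti_iff by blast
  then have "\<And>b. b \<ge> N \<Longrightarrow> psis (- int b) (psis n v) = 0" using N by simp
  then show ?thesis
    using N by (simp add: pB_eq[of N] psis_sum psis_sc anti sc_minus sum_negf)
qed

lemma pA_pA: "pA \<mu> (pA \<nu> v) = - pA \<nu> (pA \<mu> v)"
proof -
  obtain N where N: "\<And>b. b \<ge> N \<Longrightarrow> psi (int b + 1) v = 0" using psi_fin1 by blast
  then have "\<And>b. b \<ge> N \<Longrightarrow> psi (int b + 1) (pA \<nu> v) = 0" by (simp add: psi_pA)
  then have "pA \<mu> (pA \<nu> v) = - pA \<nu> (\<Sum>b<N. sc (\<mu> b) (psi (int b + 1) v))"
    by (simp add: pA_eq[of N "pA \<nu> v"] psi_pA pA_sum pA_sc sc_minus sum_negf)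
  then show ?thesis using N by (simp add: pA_eq[of N v])
qed

lemma pB_pB: "pB \<mu> (pB \<nu> v) = - pB \<nu> (pB \<mu> v)"
proof -
  obtain N where N: "\<And>b. b \<ge> N \<Longrightarrow> psis (- int b) v = 0" using psis_fin by blast
  then have "\<And>b. b \<ge> N \<Longrightarrow> psis (- int b) (pB \<nu> v) = 0" by (simp add: psis_pB)
  then have "pB \<mu> (pB \<nu> v) = - pB \<nu> (\<Sum>b<N. sc (\<mu> b) (psis (- int b) v))"
    by (simp add: pB_eq[of N "pB \<nu> v"] psis_pB pB_sum pB_sc sc_minus sum_negf)
  then show ?thesis using N by (simp add: pB_eq[of N v])
qed

lemma psis_pA: "psis n (pA \<mu> v) = (if n \<ge> 1 then sc (\<mu> (nat (n - 1))) v else 0) - pA \<mu> (psis n v)"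
proof -
  obtain N0 where N0: "\<And>b. b \<ge> N0 \<Longrightarrow> psi (int b + 1) v = 0" using psi_fin1 by blast
  \<comment> \<open>The contraction with \<open>psis n\<close> takes place at b = n - 1, which has
    to lie below N.\<close>
  define N where "N = max N0 (nat n)"
  have N: "\<And>b. b \<ge> N \<Longrightarrow> psi (int b + 1) v = 0" using N0 by (simp add: N_def)
  have anti: "psis n (psi (int b + 1) v) = (if n = int b + 1 then v else 0) - psi (int b + 1) (psis n v)" for b
    by (rule psis_psi_eq)
  have N': "psi (int b + 1) (psis n v) = 0" if "b \<ge> N" for b
    using anti[of b] N[OF that] that by (auto simp: N_def split: if_splits)
  have "psis n (pA \<mu> v) = (\<Sum>b<N. (if b = nat (n - 1) \<and> n \<ge> 1 then sc (\<mu> b) v else 0) -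
      sc (\<mu> b) (psi (int b + 1) (psis n v)))"
  proof -
    have "pA \<mu> v = (\<Sum>b<N. sc (\<mu> b) (psi (int b + 1) v))" by (rule pA_eq) (rule N)
    then show ?thesis
      by (simp only: psis_sum psis_sc anti sc_diff) (intro sum.cong refl, auto)
  qed
  also have "\<dots> = (\<Sum>b<N. (if b = nat (n - 1) then (if n \<ge> 1 then sc (\<mu> b) v else 0) else 0)) - pA \<mu> (psis n v)"
  proof -
    have "pA \<mu> (psis n v) = (\<Sum>b<N. sc (\<mu> b) (psi (int b + 1) (psis n v)))" by (rule pA_eq) (rule N')
    then show ?thesis
      unfolding sum_subtractf by (intro arg_cong2[where f = "(-)"] sum.cong) auto
  qed
  also have "(\<Sum>b<N. (if b = nat (n - 1) then (if n \<ge> 1 then sc (\<mu> b) v else 0) else 0)) =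
      (if n \<ge> 1 then sc (\<mu> (nat (n - 1))) v else 0)"
    by (auto simp: N_def)
  finally show ?thesis .
qed

lemma psi_pB: "psi n (pB \<mu> v) = (if n \<le> 0 then sc (\<mu> (nat (- n))) v else 0) - pB \<mu> (psi n v)"
proof -
  obtain N0 where N0: "\<And>b. b \<ge> N0 \<Longrightarrow> psis (- int b) v = 0" using psis_fin by blast
  define N where "N = max N0 (nat (1 - n))"
  have N: "\<And>b. b \<ge> N \<Longrightarrow> psis (- int b) v = 0" using N0 by (simp add: N_def)
  have anti: "psi n (psis (- int b) v) = (if n = - int b then v else 0) - psis (- int b) (psi n v)" for b
    by (rule psi_psis_eq)
  have N': "psis (- int b) (psi n v) = 0" if "b \<ge> N" for b
    using anti[of b] N[OF that] that by (auto simp: N_def split: if_splits)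
  have "psi n (pB \<mu> v) = (\<Sum>b<N. (if b = nat (- n) \<and> n \<le> 0 then sc (\<mu> b) v else 0) -
      sc (\<mu> b) (psis (- int b) (psi n v)))"
  proof -
    have "pB \<mu> v = (\<Sum>b<N. sc (\<mu> b) (psis (- int b) v))" by (rule pB_eq) (rule N)
    then show ?thesis
      by (simp only: psi_sum psi_sc anti sc_diff) (intro sum.cong refl, auto)
  qed
  also have "\<dots> = (\<Sum>b<N. (if b = nat (- n) then (if n \<le> 0 then sc (\<mu> b) v else 0) else 0)) - pB \<mu> (psi n v)"
  proof -
    have "pB \<mu> (psi n v) = (\<Sum>b<N. sc (\<mu> b) (psis (- int b) (psi n v)))" by (rule pB_eq) (rule N')
    then show ?thesis
      unfolding sum_subtractf by (intro arg_cong2[where f = "(-)"] sum.cong) auto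
  qed
  also have "(\<Sum>b<N. (if b = nat (- n) then (if n \<le> 0 then sc (\<mu> b) v else 0) else 0)) =
      (if n \<le> 0 then sc (\<mu> (nat (- n))) v else 0)"
    by (auto simp: N_def)
  finally show ?thesis .
qed

lemma pA_pB: "pA \<mu> (pB \<nu> v) = - pB \<nu> (pA \<mu> v)"
proof -
  obtain N where N: "\<And>b. b \<ge> N \<Longrightarrow> psi (int b + 1) v = 0" using psi_fin1 by blast
  then have "\<And>b. b \<ge> N \<Longrightarrow> psi (int b + 1) (pB \<nu> v) = 0" by (simp add: psi_pB)
  then have "pA \<mu> (pB \<nu> v) = - pB \<nu> (\<Sum>b<N. sc (\<mu> b) (psi (int b + 1) v))"
    by (simp add: pA_eq[of N "pB \<nu> v"] psi_pB pB_sum pB_sc sc_minus sum_negf)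
  then show ?thesis using N by (simp add: pA_eq[of N v])
qed

end

text \<open>Adding annihilation operators to creation operators preserves the anticommutation relations if
  the dual operators are corrected by the transposed matrix.\<close>

locale car_modified = car +
  fixes \<mu> :: "nat \<Rightarrow> nat \<Rightarrow> 'a"
begin

definition psi' :: "int \<Rightarrow> 'b \<Rightarrow> 'b"
  where "psi' n v = (if n \<le> 0 then psi n v + pA (\<mu> (nat (- n))) v else psi n v)"

definition psis' :: "int \<Rightarrow> 'b \<Rightarrow> 'b"
  where "psis' n v = (if n \<le> 0 then psis n v else psis n v - pB (\<lambda>k. \<mu> k (nat (n - 1))) v)"

lemma car_psi': "car sc psi' psis'"
proof
  fix a b :: int and v w d
  have diff: "pA \<mu> (v - w) = pA \<mu> v - pA \<mu> w" "pB \<mu> (v - w) = pB \<mu> v - pB \<mu> w" for \<mu> v w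
    using additive_sum(3)[of "pA \<mu>", OF pA_add] additive_sum(3)[of "pB \<mu>", OF pB_add] by auto
  show "psi' a (v + w) = psi' a v + psi' a w" "psis' a (v + w) = psis' a v + psis' a w"
    by (simp_all add: psi'_def psis'_def psi_add psis_add pA_add pB_add)
  show "psi' a (sc d v) = sc d (psi' a v)" "psis' a (sc d v) = sc d (psis' a v)"
    by (simp_all add: psi'_def psis'_def psi_sc psis_sc pA_sc pB_sc sc_add sc_diff)
  show "psi' a (psi' b v) + psi' b (psi' a v) = 0"
    by (cases "a \<le> 0"; cases "b \<le> 0")
      (simp_all add: psi'_def psi_add pA_add psi_pA psi_psi_eq[of a b v] pA_pA[of "\<mu> (nat (- a))" "\<mu> (nat (- b))" v])
  show "psis' a (psis' b v) + psis' b (psis' a v) = 0"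
    by (cases "a \<le> 0"; cases "b \<le> 0")
      (simp_all add: psis'_def psis_diff diff psis_pB psis_psis_eq[of a b v]
        pB_pB[of "\<lambda>k. \<mu> k (nat (a - 1))" "\<lambda>k. \<mu> k (nat (b - 1))" v])
  \<comment> \<open>In the case a <= 0 < b the correction of \<open>psi a\<close> contracts with
    \<open>psis b\<close> to the scalar \<open>\<mu> (- a) (b - 1)\<close>, and the transposed
    correction of \<open>psis b\<close> contracts with \<open>psi a\<close> to its negative.\<close>
  show "psi' a (psis' b v) + psis' b (psi' a v) = (if a = b then v else 0)"
    by (cases "a \<le> 0"; cases "b \<le> 0")
      (simp_all add: psi'_def psis'_def psis_add pA_add pB_add psi_diff diff psis_pA psi_pB pA_pB psi_psis_eq[of a b v])
  show "\<exists>N. \<forall>n\<ge>N. psi' (int n) v = 0"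
  proof -
    obtain N where N: "\<forall>n\<ge>N. psi (int n) v = 0" using psi_fin by blast
    then show ?thesis by (intro exI[of _ "max 1 N"]) (auto simp: psi'_def)
  qed
  show "\<exists>N. \<forall>n\<ge>N. psis' (- int n) v = 0"
    using psis_fin[of v] by (auto simp: psis'_def)
qed (fact sc_add sc_add_left sc_sc sc_one no_two)+

lemma psi'_pos: "n > 0 \<Longrightarrow> psi' n v = psi n v" and psis'_neg: "n \<le> 0 \<Longrightarrow> psis' n v = psis n v"
  by (simp_all add: psi'_def psis'_def)

lemma sum_psi'_psi':
  assumes "\<And>b. b \<ge> N \<Longrightarrow> psi (int b + 1) v = 0"
  shows "(\<Sum>k<N. psi' (- int k) (psi' (int k + 1) v)) =
    (\<Sum>k<N. psi (- int k) (psi (int k + 1) v)) +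
    (\<Sum>b<N. \<Sum>k<N. sc (\<mu> k b) (psi (int b + 1) (psi (int k + 1) v)))"
proof -
  have "psi (int b + 1) (psi (int k + 1) v) = 0" if "b \<ge> N" for b k
    using psi_psi[of "int b + 1" "int k + 1" v] assms[OF that] by simp
  then have "pA (\<mu> k) (psi (int k + 1) v) = (\<Sum>b<N. sc (\<mu> k b) (psi (int b + 1) (psi (int k + 1) v)))" for k
    by (rule pA_eq)
  then have "psi' (- int k) (psi' (int k + 1) v) = psi (- int k) (psi (int k + 1) v) +
      (\<Sum>b<N. sc (\<mu> k b) (psi (int b + 1) (psi (int k + 1) v)))" for k
    by (simp add: psi'_def)
  then show ?thesis by (simp add: sum.distrib) (rule sum.swap)
qed

text \<open>The correction is a combination of operators of positive index, which are not modified,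
  so it can be undone inside I. This transfers surjectivity from the modified fermions to the
  original ones.\<close>

lemma stable_psi:
  assumes "0 \<in> I" "\<And>v w. v \<in> I \<Longrightarrow> w \<in> I \<Longrightarrow> v + w \<in> I" "\<And>d v. v \<in> I \<Longrightarrow> sc d v \<in> I"
    "\<And>n v. v \<in> I \<Longrightarrow> psi' n v \<in> I" "v \<in> I"
  shows "psi n v \<in> I"
proof -
  obtain N where N: "\<And>b. b \<ge> N \<Longrightarrow> psi (int b + 1) v = 0" using psi_fin1 by blast
  have "(\<Sum>b\<in>B. sc (\<nu> b) (psi (int b + 1) v)) \<in> I" for \<nu> and B :: "nat set"
    by (induction B rule: infinite_finite_induct)
      (use assms(1-3) assms(4)[OF assms(5), of "int _ + 1"] in \<open>auto simp: psi'_def\<close>)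
  then have "pA \<nu> v \<in> I" for \<nu> using N by (simp add: pA_eq[of N])
  then have "sc (- 1) (pA \<nu> v) \<in> I" for \<nu> using assms(3) by blast
  then have m: "- pA \<nu> v \<in> I" for \<nu> by (simp add: sc_minus_left sc_one)
  show ?thesis
  proof (cases "n \<le> 0")
    case True
    then have "psi n v = psi' n v + - pA (\<mu> (nat (- n))) v" by (simp add: psi'_def)
    then show ?thesis using m assms(2,4,5) by metis
  next
    case False
    then show ?thesis using assms(4)[OF assms(5), of n] by (simp add: psi'_def)
  qed
qed

lemma stable_psis:
  assumes "0 \<in> I" "\<And>v w. v \<in> I \<Longrightarrow> w \<in> I \<Longrightarrow> v + w \<in> I" "\<And>d v. v \<in> I \<Longrightarrow> sc d v \<in> I"
    "\<And>n v. v \<in> I \<Longrightarrow> psis' n v \<in> I" "v \<in> I"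
  shows "psis n v \<in> I"
proof -
  obtain N where N: "\<And>b. b \<ge> N \<Longrightarrow> psis (- int b) v = 0" using psis_fin by blast
  have "(\<Sum>b\<in>B. sc (\<nu> b) (psis (- int b) v)) \<in> I" for \<nu> and B :: "nat set"
    by (induction B rule: infinite_finite_induct)
      (use assms(1-3) assms(4)[OF assms(5), of "- int _"] in \<open>auto simp: psis'_def\<close>)
  then have m: "pB \<nu> v \<in> I" for \<nu> using N by (simp add: pB_eq[of N])
  show ?thesis
  proof (cases "n \<le> 0")
    case True
    then show ?thesis using assms(4)[OF assms(5), of n] by (simp add: psis'_def)
  next
    case False
    then have "psis n v = psis' n v + pB (\<lambda>k. \<mu> k (nat (n - 1))) v" by (simp add: psis'_def)
    then show ?thesis using m assms(2,4,5) by metis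
  qed
qed

end

section \<open>The operators on the fermionic side\<close>

lemma charge_insert:
  assumes "finite T" "n \<notin> T"
  shows "charge (insert n T) = (if n \<le> 0 then charge T - 1 else charge T + 1)"
proof -
  have "{s \<in> insert n T. 0 < s} = (if n \<le> 0 then {s \<in> T. 0 < s} else insert n {s \<in> T. 0 < s})"
    "{s \<in> insert n T. s \<le> 0} = (if n \<le> 0 then insert n {s \<in> T. s \<le> 0} else {s \<in> T. s \<le> 0})"
    by auto
  then show ?thesis using assms by (simp add: charge_def)
qed

lemma charge_remove:
  assumes "finite T" "n \<in> T"
  shows "charge (T - {n}) = (if n \<le> 0 then charge T + 1 else charge T - 1)"
  using charge_insert[of "T - {n}" n] assms by (auto simp: insert_absorb split: if_splits)

definition fkc :: "int \<Rightarrow> (int set \<Rightarrow>\<^sub>0 'r::comm_ring_1) set"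
  where "fkc n = {v. \<forall>T\<in>keys v. finite T \<and> charge T = n}"

lemma fkc_fk: "v \<in> fkc n \<Longrightarrow> v \<in> fk"
  by (auto simp: fkc_def fk_def)

lemma fkc_0: "0 \<in> fkc n" and fkc_add: "v \<in> fkc n \<Longrightarrow> w \<in> fkc n \<Longrightarrow> v + w \<in> fkc n"
  and fkc_minus: "v \<in> fkc n \<Longrightarrow> - v \<in> fkc n"
  using keys_add[of v w] by (auto simp: fkc_def)

lemma fkc_sm: "v \<in> fkc n \<Longrightarrow> sm d v \<in> fkc n"
  by (auto simp: fkc_def in_keys_iff coef_sm)

lemma fkc_sum: "(\<And>a. a \<in> A \<Longrightarrow> f a \<in> fkc n) \<Longrightarrow> sum f A \<in> fkc n"
  by (induction A rule: infinite_finite_induct) (auto intro: fkc_0 fkc_add)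

lemma fkc_ins: "v \<in> fkc c \<Longrightarrow> ins n v \<in> fkc (if n \<le> 0 then c - 1 else c + 1)"
  unfolding ins_def by (rule fkc_sum) (auto simp: fkc_def charge_insert split: if_splits)

lemma fkc_del: "v \<in> fkc c \<Longrightarrow> del n v \<in> fkc (if n \<le> 0 then c + 1 else c - 1)"
  unfolding del_def by (rule fkc_sum) (auto simp: fkc_def charge_remove split: if_splits)

lemma sm_sum: "sm d (sum f A) = (\<Sum>a\<in>A. sm d (f a))" and sm_minus: "sm d (- v) = - sm d v"
  using additive_sum[of "sm d", OF sm_add] by auto

lemma ins_minus: "ins n (- v) = - ins n v" and del_minus: "del n (- v) = - del n v"
  using additive_sum(2)[of "ins n", OF ins_add] additive_sum(2)[of "del n", OF del_add] by auto

lemma del_eq_0: "(\<And>T. T \<in> keys x \<Longrightarrow> n \<notin> T) \<Longrightarrow> del n x = 0"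
  unfolding del_def by (rule sum.neutral) auto

lemma del_bound:
  assumes "x \<in> fk"
  shows "\<exists>N. \<forall>n\<ge>N. del (int n + 1) x = 0"
proof -
  have fin: "finite (\<Union>(keys x))" using assms by (auto simp: fk_def)
  have "del (int n + 1) x = 0" if n: "n \<ge> nat (Max (insert 0 (\<Union>(keys x))))" for n
    unfolding del_def
  proof (rule sum.neutral, rule ballI)
    fix T assume T: "T \<in> keys x"
    have "int n + 1 \<notin> T"
    proof
      assume "int n + 1 \<in> T"
      then have "int n + 1 \<le> Max (insert 0 (\<Union>(keys x)))" using T fin by (intro Max_ge) auto
      then show False using n by auto
    qed
    then show "(if int n + 1 \<in> T then sg (T - {int n + 1}) (fsg (int n + 1) T * coef x T) else 0) = 0" by simp
  qed
  then show ?thesis by blast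
qed

definition om :: "(int set \<Rightarrow>\<^sub>0 'r::comm_ring_1) \<Rightarrow> (int set \<Rightarrow>\<^sub>0 'r)"
  where "om x = - Sum_any (\<lambda>k. ins (- int k) (del (int k + 1) x))"

text \<open>The variable \<open>bvar (Suc j)\<close> stands for the generator
  \<open>Od (2 * j + 1)\<close> of D, which \<open>iot\<close> will substitute for it.\<close>

definition kap :: "(int set \<Rightarrow>\<^sub>0 complex bpoly) \<Rightarrow> (int set \<Rightarrow>\<^sub>0 complex bpoly)"
  where "kap x = Sum_any (\<lambda>j. sm (bvar (Suc j)) (del (int j + 1) x))"

lemma om_eq: "(\<And>n. n \<ge> N \<Longrightarrow> del (int n + 1) x = 0) \<Longrightarrow> om x = - (\<Sum>k<N. ins (- int k) (del (int k + 1) x))"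
  unfolding om_def by (subst Sum_any.expand_superset[of "{..<N}"]) (auto simp: not_le[symmetric])

lemma kap_eq: "(\<And>n. n \<ge> N \<Longrightarrow> del (int n + 1) x = 0) \<Longrightarrow> kap x = (\<Sum>j<N. sm (bvar (Suc j)) (del (int j + 1) x))"
  unfolding kap_def by (subst Sum_any.expand_superset[of "{..<N}"]) (auto simp: not_le[symmetric] sm_zero)

lemma del_bound2:
  assumes "x \<in> fk" "y \<in> fk"
  obtains N where "\<And>n. n \<ge> N \<Longrightarrow> del (int n + 1) x = 0" "\<And>n. n \<ge> N \<Longrightarrow> del (int n + 1) y = 0"
proof -
  obtain N where "\<forall>n\<ge>N. del (int n + 1) x = 0" using del_bound[OF assms(1)] by blast
  moreover obtain M where "\<forall>n\<ge>M. del (int n + 1) y = 0" using del_bound[OF assms(2)] by blast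
  ultimately have "del (int n + 1) x = 0 \<and> del (int n + 1) y = 0" if "n \<ge> max N M" for n
    using that by simp
  then show ?thesis using that by blast
qed

lemma om_add: "x \<in> fk \<Longrightarrow> y \<in> fk \<Longrightarrow> om (x + y) = om x + om y"
proof -
  assume "x \<in> fk" "y \<in> fk"
  then obtain N where N: "\<And>n. n \<ge> N \<Longrightarrow> del (int n + 1) x = 0" "\<And>n. n \<ge> N \<Longrightarrow> del (int n + 1) y = 0"
    using del_bound2 by blast
  then show ?thesis
    by (subst (1 2 3) om_eq[of N]) (auto simp: del_add ins_add sum.distrib)
qed

lemma om_sm: "x \<in> fk \<Longrightarrow> om (sm d x) = sm d (om x)"
proof -
  assume "x \<in> fk"
  then obtain N where N: "\<And>n. n \<ge> N \<Longrightarrow> del (int n + 1) x = 0" using del_bound by blast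
  then show ?thesis
    by (subst (1 2) om_eq[of N]) (auto simp: del_sm ins_sm sm_zero sm_sum sm_minus)
qed

lemma kap_add: "x \<in> fk \<Longrightarrow> y \<in> fk \<Longrightarrow> kap (x + y) = kap x + kap y"
proof -
  assume "x \<in> fk" "y \<in> fk"
  then obtain N where N: "\<And>n. n \<ge> N \<Longrightarrow> del (int n + 1) x = 0" "\<And>n. n \<ge> N \<Longrightarrow> del (int n + 1) y = 0"
    using del_bound2 by blast
  then show ?thesis
    by (subst (1 2 3) kap_eq[of N]) (auto simp: del_add sm_add sum.distrib)
qed

lemma kap_sm: "x \<in> fk \<Longrightarrow> kap (sm d x) = sm d (kap x)"
proof -
  assume "x \<in> fk"
  then obtain N where N: "\<And>n. n \<ge> N \<Longrightarrow> del (int n + 1) x = 0" using del_bound by blast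
  then show ?thesis
    by (subst (1 2) kap_eq[of N]) (auto simp: del_sm sm_zero sm_sum sm_sm mult.commute)
qed

lemma om_fkc: "x \<in> fkc c \<Longrightarrow> om x \<in> fkc (c - 2)"
proof -
  assume x: "x \<in> fkc c"
  then obtain N where N: "\<And>n. n \<ge> N \<Longrightarrow> del (int n + 1) x = 0" using del_bound fkc_fk by blast
  have "ins (- int k) (del (int k + 1) x) \<in> fkc (c - 2)" for k
    using fkc_ins[OF fkc_del[OF x, of "int k + 1"], of "- int k"] by simp
  then show ?thesis by (simp add: om_eq[of N, OF N] fkc_minus fkc_sum)
qed

lemma kap_fkc: "x \<in> fkc c \<Longrightarrow> kap x \<in> fkc (c - 1)"
proof -
  assume x: "x \<in> fkc c"
  then obtain N where N: "\<And>n. n \<ge> N \<Longrightarrow> del (int n + 1) x = 0" using del_bound fkc_fk by blast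
  have "sm (bvar (Suc k)) (del (int k + 1) x) \<in> fkc (c - 1)" for k
    using fkc_sm[OF fkc_del[OF x, of "int k + 1"]] by simp
  then show ?thesis by (simp add: kap_eq[of N, OF N] fkc_sum)
qed

lemma del_del_eq: "x \<in> fk \<Longrightarrow> del a (del b x) = - del b (del a x)"
  using del_del[of x a b] by (simp only: eq_neg_iff_add_eq_0)

lemma ins_ins_eq: "x \<in> fk \<Longrightarrow> ins a (ins b x) = - ins b (ins a x)"
  using ins_ins[of x a b] by (simp only: eq_neg_iff_add_eq_0)

lemma del_ins_eq: "x \<in> fk \<Longrightarrow> del b (ins a x) = (if a = b then x else 0) - ins a (del b x)"
  using ins_del[of x a b] by (simp only: eq_diff_eq add.commute)

text \<open>In the double sum the coefficients are symmetric and the deletions antisymmetric in the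
  two indices, so it equals its negative; complex coefficients admit division by 2.\<close>

lemma kap_kap: "x \<in> fk \<Longrightarrow> kap (kap x) = 0"
proof -
  assume x: "x \<in> fk"
  then obtain N where N: "\<And>n. n \<ge> N \<Longrightarrow> del (int n + 1) x = 0" using del_bound by blast
  have k: "kap x = (\<Sum>j<N. sm (bvar (Suc j)) (del (int j + 1) x))" by (rule kap_eq[OF N])
  have N': "del (int n + 1) (kap x) = 0" if "n \<ge> N" for n
    unfolding k by (simp add: del_sum del_sm del_del_eq[OF x, of "int n + 1"] N[OF that] sm_zero)
  let ?S = "\<Sum>i<N. \<Sum>j<N. sm (bvar (Suc i) * bvar (Suc j)) (del (int i + 1) (del (int j + 1) x))"
  have S: "kap (kap x) = ?S"
  proof -
    have "kap (kap x) = (\<Sum>j<N. sm (bvar (Suc j)) (del (int j + 1) (kap x)))" by (rule kap_eq) (rule N')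
    then show ?thesis by (simp add: k[THEN arg_cong[of _ _ "del _"]] del_sum del_sm sm_sum sm_sm)
  qed
  have "?S = (\<Sum>j<N. \<Sum>i<N. sm (bvar (Suc i) * bvar (Suc j)) (- del (int j + 1) (del (int i + 1) x)))"
    by (subst sum.swap, intro sum.cong refl arg_cong[of _ _ "sm _"]) (rule del_del_eq[OF x])
  also have "\<dots> = - ?S"
    by (simp add: sm_minus sum_negf mult.commute)
  finally have "?S = - ?S" .
  then have "?S + ?S = 0" by (simp only: eq_neg_iff_add_eq_0)
  then have "coef (coef (?S + ?S) T) M = 0" for T M by (simp only: lookup_zero)
  then have "coef (coef ?S T) M + coef (coef ?S T) M = 0" for T M by (simp only: lookup_add)
  then have "coef (coef ?S T) M = 0" for T M by simp
  then show ?thesis unfolding S by (intro poly_mapping_eqI) (simp only: lookup_zero)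
qed

lemma fk_om: "x \<in> fk \<Longrightarrow> om x \<in> fk" and fk_kap: "y \<in> fk \<Longrightarrow> kap y \<in> fk"
proof -
  have minus: "- v \<in> fk" if "v \<in> fk" for v :: "int set \<Rightarrow>\<^sub>0 'b::comm_ring_1" using that by (simp add: fk_def)
  assume x: "x \<in> fk"
  then obtain N where N: "\<And>n. n \<ge> N \<Longrightarrow> del (int n + 1) x = 0" using del_bound by blast
  show "om x \<in> fk"
  proof -
    have "om x = - (\<Sum>k<N. ins (- int k) (del (int k + 1) x))" by (rule om_eq) (rule N)
    then show ?thesis using x by (auto intro!: minus fk_sum fk_ins fk_del)
  qed
next
  assume x: "y \<in> fk"
  then obtain N where N: "\<And>n. n \<ge> N \<Longrightarrow> del (int n + 1) y = 0" using del_bound by blast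
  show "kap y \<in> fk"
  proof -
    have "kap y = (\<Sum>j<N. sm (bvar (Suc j)) (del (int j + 1) y))" by (rule kap_eq) (rule N)
    then show ?thesis using x by (auto intro!: fk_sum fk_sm fk_del)
  qed
qed

text \<open>A deletion of positive index contracts neither with an insertion of index -k <= 0 nor
  with another deletion, and passing the two factors of omega changes the sign twice.\<close>

lemma kap_om: "x \<in> fk \<Longrightarrow> kap (om x) = om (kap x)"
proof -
  assume x: "x \<in> fk"
  then obtain N where N: "\<And>n. n \<ge> N \<Longrightarrow> del (int n + 1) x = 0" using del_bound by blast
  have k: "kap x = (\<Sum>j<N. sm (bvar (Suc j)) (del (int j + 1) x))" by (rule kap_eq[OF N])
  have o: "om x = - (\<Sum>k<N. ins (- int k) (del (int k + 1) x))" by (rule om_eq[OF N])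
  have move: "del (int n + 1) (ins (- int k) (del l x)) = ins (- int k) (del l (del (int n + 1) x))" for n k l
    by (simp add: del_ins_eq[OF fk_del[OF x]] del_del_eq[OF x, of "int n + 1"] ins_minus)
  have Nk: "del (int n + 1) (kap x) = 0" if "n \<ge> N" for n
    unfolding k by (simp add: del_sum del_sm del_del_eq[OF x, of "int n + 1"] N[OF that] sm_zero)
  have No: "del (int n + 1) (om x) = 0" if "n \<ge> N" for n
    unfolding o by (simp add: del_minus del_sum move N[OF that])
  have "kap (om x) = - (\<Sum>j<N. \<Sum>k<N. sm (bvar (Suc j)) (ins (- int k) (del (int k + 1) (del (int j + 1) x))))"
  proof -
    have "kap (om x) = (\<Sum>j<N. sm (bvar (Suc j)) (del (int j + 1) (om x)))" by (rule kap_eq) (rule No)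
    then show ?thesis by (simp add: o[THEN arg_cong[of _ _ "del _"]] del_minus del_sum move sm_minus sm_sum sum_negf)
  qed
  also have "\<dots> = om (kap x)"
  proof -
    have "om (kap x) = - (\<Sum>k<N. ins (- int k) (del (int k + 1) (kap x)))" by (rule om_eq) (rule Nk)
    then show ?thesis
      by (subst sum.swap) (simp add: k[THEN arg_cong[of _ _ "del _"]] del_sum ins_sum del_sm ins_sm)
  qed
  finally show ?thesis .
qed

section \<open>Injectivity of \<open>\<omega>\<close> on positive charges\<close>

text \<open>\<open>\<omega>\<close> is the lowering operator of an \<open>sl\<^sub>2\<close>-triple whose Cartan element is the charge; a finite
  window of indices suffices for a given vector.\<close>

definition Xw :: "nat \<Rightarrow> int \<Rightarrow> (int set \<Rightarrow>\<^sub>0 'r::comm_ring_1) set"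
  where "Xw K c = {x. \<forall>T\<in>keys x. T \<subseteq> {- int K<..int K} \<and> charge T = c}"

definition sf :: "nat \<Rightarrow> (int set \<Rightarrow>\<^sub>0 'r::comm_ring_1) \<Rightarrow> (int set \<Rightarrow>\<^sub>0 'r)"
  where "sf K x = (\<Sum>k<K. ins (- int k) (del (int k + 1) x))"

definition se :: "nat \<Rightarrow> (int set \<Rightarrow>\<^sub>0 'r::comm_ring_1) \<Rightarrow> (int set \<Rightarrow>\<^sub>0 'r)"
  where "se K x = (\<Sum>k<K. ins (int k + 1) (del (- int k) x))"

lemma Xw_fk: "x \<in> Xw K c \<Longrightarrow> x \<in> fk"
  by (auto simp: Xw_def fk_def intro: finite_subset[of _ "{- int K<..int K}"])

lemma Xw_0: "0 \<in> Xw K c" and Xw_add: "v \<in> Xw K c \<Longrightarrow> w \<in> Xw K c \<Longrightarrow> v + w \<in> Xw K c"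
  using keys_add[of v w] by (auto simp: Xw_def)

lemma Xw_sum: "(\<And>a. a \<in> A \<Longrightarrow> f a \<in> Xw K n) \<Longrightarrow> sum f A \<in> Xw K n"
  by (induction A rule: infinite_finite_induct) (auto intro: Xw_0 Xw_add)

lemma Xw_ins: "n \<in> {- int K<..int K} \<Longrightarrow> v \<in> Xw K c \<Longrightarrow> ins n v \<in> Xw K (if n \<le> 0 then c - 1 else c + 1)"
  unfolding ins_def
  by (rule Xw_sum)
    (auto simp: Xw_def charge_insert finite_subset[of _ "{- int K<..int K}"] split: if_splits)

lemma Xw_del: "v \<in> Xw K c \<Longrightarrow> del n v \<in> Xw K (if n \<le> 0 then c + 1 else c - 1)"
  unfolding del_def
  by (rule Xw_sum)
    (auto simp: Xw_def charge_remove finite_subset[of _ "{- int K<..int K}"] split: if_splits)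

lemma se_Xw: "x \<in> Xw K c \<Longrightarrow> se K x \<in> Xw K (c + 2)"
proof -
  assume x: "x \<in> Xw K c"
  have "ins (int k + 1) (del (- int k) x) \<in> Xw K (c + 2)" if "k < K" for k
    using Xw_ins[OF _ Xw_del[OF x, of "- int k"], of "int k + 1"] that by (simp add: add.commute)
  then show ?thesis unfolding se_def by (intro Xw_sum) auto
qed

text \<open>The products \<open>ins s (del r x)\<close> satisfy the commutation relations of matrix
  units.\<close>

lemma ins_del_commutator:
  assumes x: "x \<in> fk"
  shows "ins s (del r (ins r' (del s' x))) - ins r' (del s' (ins s (del r x))) =
    (if r = r' then ins s (del s' x) else 0) - (if s = s' then ins r' (del r x) else 0)"
proof -
  have 1: "ins s (del r (ins r' (del s' x))) = (if r = r' then ins s (del s' x) else 0) - ins s (ins r' (del r (del s' x)))"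
    using del_ins_eq[OF fk_del[OF x], of r r' s'] by (simp add: additive_sum(3)[of "ins s", OF ins_add])
  have 2: "ins r' (del s' (ins s (del r x))) = (if s = s' then ins r' (del r x) else 0) - ins r' (ins s (del s' (del r x)))"
    using del_ins_eq[OF fk_del[OF x], of s' s r] by (simp add: additive_sum(3)[of "ins r'", OF ins_add])
  have "ins s (ins r' (del r (del s' x))) = - ins r' (ins s (- del s' (del r x)))"
    using ins_ins_eq[OF fk_del[OF fk_del[OF x]], of s r' r s'] del_del_eq[OF x, of r s'] by simp
  then show ?thesis unfolding 1 2 by (simp add: ins_minus)
qed

lemma sum_constant_single: "(\<Sum>k\<in>A. sg T (a :: 'r::comm_ring_1)) = sg T (of_nat (card A) * a)"
  by (induction A rule: infinite_finite_induct) (simp_all add: distrib_right single_add)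

text \<open>Only the diagonal terms of the commutator survive. They count the elements k + 1 of T
  minus the elements -k, and over a window containing T the total is the charge.\<close>

lemma se_sf:
  assumes x: "x \<in> Xw K c"
  shows "se K (sf K x) - sf K (se K x) = sm (of_int c) x"
proof -
  have "se K (sf K x) - sf K (se K x) = (\<Sum>k<K. \<Sum>l<K.
      ins (int k + 1) (del (- int k) (ins (- int l) (del (int l + 1) x))) -
      ins (- int l) (del (int l + 1) (ins (int k + 1) (del (- int k) x))))"
    unfolding se_def sf_def del_sum ins_sum sum_subtractf
    by (subst (4) sum.swap) (rule refl)
  also have "\<dots> = (\<Sum>k<K. \<Sum>l<K. if l = k then ins (int k + 1) (del (int k + 1) x) - ins (- int k) (del (- int k) x) else 0)"
    unfolding ins_del_commutator[OF Xw_fk[OF x]] by (intro sum.cong refl) auto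
  also have "\<dots> = (\<Sum>k<K. ins (int k + 1) (del (int k + 1) x) - ins (- int k) (del (- int k) x))"
    by simp
  also have "\<dots> = sm (of_int c) x"
  proof (rule additive_ext_keys[of "\<lambda>x. \<Sum>k<K. ins (int k + 1) (del (int k + 1) x) - ins (- int k) (del (- int k) x)" "sm (of_int c)"])
    fix T assume T: "T \<in> keys x"
    then have W: "T \<subseteq> {- int K<..int K}" "charge T = c" using x by (auto simp: Xw_def)
    then have fin: "finite T" by (auto intro: finite_subset)
    have n: "ins j (del j (sg T a)) = (if j \<in> T then sg T a else 0)" for j and a :: 'a
      using fin by (auto simp: ins_single del_single fsg_remove insert_absorb fsg_square)
    have c1: "(\<Sum>k<K. if int k + 1 \<in> T then sg T a else 0) = sg T (of_nat (card {s \<in> T. 0 < s}) * a)" for a :: 'a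
    proof -
      have "(\<lambda>k. int k + 1) ` {k. k < K \<and> int k + 1 \<in> T} = {s \<in> T. 0 < s}"
      proof (safe)
        fix s assume "s \<in> T" "0 < s"
        then show "s \<in> (\<lambda>k. int k + 1) ` {k. k < K \<and> int k + 1 \<in> T}"
          using W by (intro image_eqI[of _ _ "nat (s - 1)"]) auto
      qed auto
      then have "card {s \<in> T. 0 < s} = card {k. k < K \<and> int k + 1 \<in> T}"
        by (metis (no_types, lifting) card_image inj_on_def add_right_cancel of_nat_eq_iff)
      then show ?thesis
        by (simp add: sum.If_cases Int_def sum_constant_single)
    qed
    have c2: "(\<Sum>k<K. if - int k \<in> T then sg T a else 0) = sg T (of_nat (card {s \<in> T. s \<le> 0}) * a)" for a :: 'a
    proof -
      have "(\<lambda>k. - int k) ` {k. k < K \<and> - int k \<in> T} = {s \<in> T. s \<le> 0}"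
      proof (safe)
        fix s assume "s \<in> T" "s \<le> 0"
        then show "s \<in> (\<lambda>k. - int k) ` {k. k < K \<and> - int k \<in> T}"
          using W by (intro image_eqI[of _ _ "nat (- s)"]) auto
      qed auto
      then have "card {s \<in> T. s \<le> 0} = card {k. k < K \<and> - int k \<in> T}"
        by (metis (no_types, lifting) card_image inj_on_def neg_equal_iff_equal of_nat_eq_iff)
      then show ?thesis
        by (simp add: sum.If_cases Int_def sum_constant_single)
    qed
    show "(\<Sum>k<K. ins (int k + 1) (del (int k + 1) (sg T (coef x T))) - ins (- int k) (del (- int k) (sg T (coef x T)))) =
        sm (of_int c) (sg T (coef x T))"
      unfolding n sum_subtractf c1 c2 sm_single W(2)[symmetric] charge_def
      by (simp add: left_diff_distrib single_diff)
  qed (simp_all add: ins_add del_add sum.distrib sum_subtractf sm_add)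
  finally show ?thesis .
qed

lemma se_add: "se K (x + y) = se K x + se K y"
  by (simp add: se_def ins_add del_add sum.distrib)

lemma se_sm: "se K (sm d x) = sm d (se K x)"
  by (simp add: se_def ins_sm del_sm sm_sum)

lemma se_zero [simp]: "se K 0 = 0" and sf_zero [simp]: "sf K 0 = 0"
  by (simp_all add: se_def sf_def)

lemma se_power_Xw: "x \<in> Xw K c \<Longrightarrow> (se K ^^ N) x \<in> Xw K (c + 2 * int N)"
proof (induction N)
  case (Suc N)
  then show ?case using se_Xw[of "(se K ^^ N) x" K "c + 2 * int N"] by (simp add: algebra_simps)
qed simp

text \<open>The standard computation for a lowest weight vector of weight c: the commutators
  contribute c + 2i for i = 0, ..., N, with sum (N + 1)(c + N).\<close>

lemma sf_se_power:
  assumes x: "x \<in> Xw K c" "sf K x = 0"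
  shows "sf K ((se K ^^ Suc N) x) = - sm (of_int ((int N + 1) * (c + int N))) ((se K ^^ N) x)"
proof (induction N)
  case 0
  then show ?case using se_sf[OF x(1)] x(2) by (simp, metis minus_minus)
next
  case (Suc N)
  let ?y = "(se K ^^ Suc N) x"
  have "sf K (se K ?y) = se K (sf K ?y) - sm (of_int (c + 2 * int (Suc N))) ?y"
    using se_sf[OF se_power_Xw[OF x(1), of "Suc N"]] by (simp add: algebra_simps)
  also have "se K (sf K ?y) = - sm (of_int ((int N + 1) * (c + int N))) ?y"
    unfolding Suc.IH by (simp add: additive_sum(2)[of "se K", OF se_add] se_sm)
  also have "- sm (of_int ((int N + 1) * (c + int N))) ?y - sm (of_int (c + 2 * int (Suc N))) ?y =
      - sm (of_int ((int (Suc N) + 1) * (c + int (Suc N)))) ?y"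
    by (simp add: sm_add_left[symmetric] diff_conv_add_uminus[symmetric] algebra_simps flip: minus_add_distrib)
  finally show ?case by simp
qed

lemma charge_window: "T \<subseteq> {- int K<..int K} \<Longrightarrow> charge T \<le> int K"
proof -
  assume "T \<subseteq> {- int K<..int K}"
  then have "{s \<in> T. 0 < s} \<subseteq> {1..int K}" by auto
  then have "card {s \<in> T. 0 < s} \<le> card {1..int K}" by (intro card_mono) auto
  then show ?thesis by (simp add: charge_def)
qed

lemma sm_of_int_eq_0:
  fixes x :: "int set \<Rightarrow>\<^sub>0 'r::{idom, ring_char_0}"
  assumes "sm (of_int z) x = 0" "z \<noteq> 0"
  shows "x = 0"
proof (rule poly_mapping_eqI)
  fix T
  have "of_int z * coef x T = 0" using assms(1) coef_sm[of "of_int z" x T] by simp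
  then show "coef x T = coef 0 T" using assms(2) by simp
qed

text \<open>Raising K times would produce charge c + 2K, more than the K positive places of the
  window allow, so the result is 0. For c >= 1 the scalars of \<open>sf_se_power\<close> are
  nonzero, and the powers of \<open>se\<close> can be stripped off one by one.\<close>

lemma sf_injective:
  fixes x :: "int set \<Rightarrow>\<^sub>0 'r::{idom, ring_char_0}"
  assumes x: "x \<in> Xw K c" "sf K x = 0" and c: "c \<ge> 1"
  shows "x = 0"
proof -
  have "(se K ^^ K) x = 0"
  proof (rule ccontr)
    assume "(se K ^^ K) x \<noteq> 0"
    then obtain T where "T \<in> keys ((se K ^^ K) x)" by (metis all_not_in_conv keys_eq_empty)
    then have "T \<subseteq> {- int K<..int K}" "charge T = c + 2 * int K"
      using se_power_Xw[OF x(1), of K] by (auto simp: Xw_def)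
    then show False using charge_window[of T K] c by simp
  qed
  moreover have "(se K ^^ N) x = 0 \<Longrightarrow> x = 0" for N
  proof (induction N)
    case (Suc N)
    have "sm (of_int ((int N + 1) * (c + int N))) ((se K ^^ N) x) = 0"
      using sf_se_power[OF x, of N] Suc.prems by simp
    then have "(se K ^^ N) x = 0" by (rule sm_of_int_eq_0) (use c in auto)
    then show ?case by (rule Suc.IH)
  qed simp
  ultimately show ?thesis by blast
qed

lemma om_injective:
  fixes x :: "int set \<Rightarrow>\<^sub>0 'r::{idom, ring_char_0}"
  assumes x: "x \<in> fkc c" "om x = 0" and c: "c \<ge> 1"
  shows "x = 0"
proof -
  have fin: "finite (\<Union>(keys x))" using x(1) by (auto simp: fkc_def)
  \<comment> \<open>With |t| < K for all occurring t, the supports lie in the window and the terms k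
    >= K of omega vanish.\<close>
  define K where "K = nat (Max (insert 0 (abs ` \<Union>(keys x)))) + 1"
  have b: "\<bar>t\<bar> < int K" if "T \<in> keys x" "t \<in> T" for t T
  proof -
    have "\<bar>t\<bar> \<le> Max (insert 0 (abs ` \<Union>(keys x)))" using that fin by (intro Max_ge) auto
    moreover have "0 \<le> Max (insert 0 (abs ` \<Union>(keys x)))" using fin by (intro Max_ge) auto
    ultimately show ?thesis by (simp add: K_def)
  qed
  have w: "x \<in> Xw K c"
    using x(1) b by (fastforce simp: Xw_def fkc_def abs_less_iff)
  have "del (int n + 1) x = 0" if "n \<ge> K" for n
    by (rule del_eq_0) (use b that in fastforce)
  then have "sf K x = 0" using x(2) om_eq[of K x] by (simp add: sf_def)
  then show ?thesis using sf_injective[OF w] c by blast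
qed

section \<open>The Koszul complex\<close>

definition dd :: "nat \<Rightarrow> (int set \<Rightarrow>\<^sub>0 complex bpoly) \<Rightarrow> (int set \<Rightarrow>\<^sub>0 complex bpoly)"
  where "dd j = Poly_Mapping.map (bderiv (Suc j))"

lemma coef_dd: "coef (dd j x) T = bderiv (Suc j) (coef x T)"
  by (simp add: dd_def coef_map)

lemma dd_add: "dd j (x + y) = dd j x + dd j y"
  by (rule poly_mapping_eqI) (simp add: coef_dd lookup_add bderiv_add)

lemma dd_single: "dd j (sg T p) = sg T (bderiv (Suc j) p)"
  by (rule poly_mapping_eqI) (simp add: coef_dd lookup_single when_def)

lemma dd_zero [simp]: "dd j 0 = 0" and dd_sum: "dd j (sum f A) = (\<Sum>a\<in>A. dd j (f a))"
  using additive_sum[of "dd j", OF dd_add] by auto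

lemma bderiv_fsg: "bderiv n (fsg k T * p) = fsg k T * bderiv n p"
proof -
  have "fsg k T = Cst (fsg k T)"
    by (cases "even (card {t \<in> T. t < k})") (auto simp: fsg_def single_uminus)
  then show ?thesis by (metis bderiv_Cst_mult)
qed

lemma dd_del: "dd j (del n x) = del n (dd j x)"
  by (rule pm_ext_additive[of "\<lambda>x. dd j (del n x)" "\<lambda>x. del n (dd j x)"])
    (auto simp: dd_add del_add del_single dd_single bderiv_fsg)

lemma dd_sm_bvar: "dd j (sm (bvar (Suc i)) x) = (if i = j then x else 0) + sm (bvar (Suc i)) (dd j x)"
  by (rule poly_mapping_eqI) (simp add: coef_dd coef_sm bderiv_mult bderiv_bvar lookup_add)

lemma fk_dd: "x \<in> fk \<Longrightarrow> dd j x \<in> fk"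
  by (auto simp: fk_def in_keys_iff coef_dd)

text \<open>\<open>hJ\<close> is the de Rham type homotopy: \<open>kJ hJ + hJ kJ\<close> is multiplication by the weight \<open>wt\<close>, which \<open>Linv\<close>
  inverts in positive charge.\<close>

definition kJ :: "nat \<Rightarrow> (int set \<Rightarrow>\<^sub>0 complex bpoly) \<Rightarrow> (int set \<Rightarrow>\<^sub>0 complex bpoly)"
  where "kJ J x = (\<Sum>j<J. sm (bvar (Suc j)) (del (int j + 1) x))"

definition hJ :: "nat \<Rightarrow> (int set \<Rightarrow>\<^sub>0 complex bpoly) \<Rightarrow> (int set \<Rightarrow>\<^sub>0 complex bpoly)"
  where "hJ J x = (\<Sum>j<J. ins (int j + 1) (dd j x))"

lemma kJ_add: "kJ J (x + y) = kJ J x + kJ J y" and hJ_add: "hJ J (x + y) = hJ J x + hJ J y"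
  by (simp_all add: kJ_def hJ_def del_add ins_add sm_add dd_add sum.distrib)

text \<open>Off the diagonal, insertions and deletions anticommute and the two compositions cancel.
  On the diagonal the commutator of the derivative with its variable and the anticommutator of
  deletion and insertion leave the two number operators.\<close>

lemma kJ_hJ:
  assumes x: "x \<in> fk"
  shows "kJ J (hJ J x) + hJ J (kJ J x) =
    (\<Sum>j<J. sm (bvar (Suc j)) (dd j x) + ins (int j + 1) (del (int j + 1) x))"
proof -
  have "kJ J (hJ J x) + hJ J (kJ J x) = (\<Sum>i<J. \<Sum>j<J.
      sm (bvar (Suc i)) (del (int i + 1) (ins (int j + 1) (dd j x))) +
      ins (int j + 1) (dd j (sm (bvar (Suc i)) (del (int i + 1) x))))"
    unfolding kJ_def hJ_def del_sum dd_sum ins_sum sm_sum sum.distrib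
    by (subst (4) sum.swap) (rule refl)
  also have "\<dots> = (\<Sum>i<J. \<Sum>j<J. if j = i then sm (bvar (Suc i)) (dd i x) + ins (int i + 1) (del (int i + 1) x) else 0)"
  proof (intro sum.cong refl)
    fix i j
    have 1: "del (int i + 1) (ins (int j + 1) (dd j x)) =
        (if j = i then dd j x else 0) + - ins (int j + 1) (del (int i + 1) (dd j x))"
      using del_ins_eq[OF fk_dd[OF x], of "int i + 1" "int j + 1" j] by simp
    show "sm (bvar (Suc i)) (del (int i + 1) (ins (int j + 1) (dd j x))) +
        ins (int j + 1) (dd j (sm (bvar (Suc i)) (del (int i + 1) x))) =
        (if j = i then sm (bvar (Suc i)) (dd i x) + ins (int i + 1) (del (int i + 1) x) else 0)"
      unfolding 1 dd_sm_bvar sm_add ins_add by (simp add: dd_del ins_sm sm_minus sm_zero)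
  qed
  finally show ?thesis by simp
qed

definition wt :: "nat \<Rightarrow> (nat \<Rightarrow>\<^sub>0 nat) \<Rightarrow> int set \<Rightarrow> nat"
  where "wt J M T = (\<Sum>j<J. coef M j) + card {j. j < J \<and> int j + 1 \<in> T}"

lemma kJ_hJ_single:
  assumes "finite T"
  shows "kJ J (hJ J (sg T (sg M c))) + hJ J (kJ J (sg T (sg M c))) = sg T (sg M (of_nat (wt J M T) * c))"
proof -
  have y: "sm (bvar (Suc j)) (dd j (sg T (sg M c))) = sg T (sg M (of_nat (coef M j) * c))" for j
  proof (cases "coef M j = 0")
    case False
    then have "sg j 1 + (M - sg j 1) = M"
      by (intro poly_mapping_eqI) (auto simp: lookup_add lookup_minus lookup_single when_def)
    then show ?thesis by (simp add: dd_single sm_single bderiv_single bvar_def mult_single)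
  qed (simp add: dd_single sm_single bderiv_single sm_zero)
  have n: "ins j (del j (sg T a)) = (if j \<in> T then sg T a else 0)" for j and a :: "complex bpoly"
    using assms by (auto simp: ins_single del_single fsg_remove insert_absorb fsg_square)
  have "(\<Sum>j<J. if int j + 1 \<in> T then sg T (sg M c) else 0) = sg T (sg M (of_nat (card {j. j < J \<and> int j + 1 \<in> T}) * c))"
    by (simp add: sum.If_cases Int_def sum_constant_single mult_single flip: single_of_nat)
  moreover have "(\<Sum>j<J. sg T (sg M (of_nat (coef M j) * c))) = sg T (sg M (of_nat (\<Sum>j<J. coef M j) * c))"
    by (simp add: additive_sum(4)[of "\<lambda>a. sg T (sg M a)"] single_add sum_distrib_right)
  ultimately show ?thesis
    by (simp add: kJ_hJ[OF fk_single[OF assms]] y n sum.distrib wt_def distrib_right single_add)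
qed

definition Linv :: "nat \<Rightarrow> (int set \<Rightarrow>\<^sub>0 complex bpoly) \<Rightarrow> (int set \<Rightarrow>\<^sub>0 complex bpoly)"
  where "Linv J x = (\<Sum>T\<in>keys x. sg T (\<Sum>M\<in>keys (coef x T). sg M (coef (coef x T) M / of_nat (wt J M T))))"

lemma Linv_inner_add: "(\<Sum>M\<in>keys (p + q). sg M (coef (p + q) M / of_nat (wt J M T))) =
    (\<Sum>M\<in>keys p. sg M (coef p M / of_nat (wt J M T))) + (\<Sum>M\<in>keys q. sg M (coef q M / (of_nat (wt J M T) :: complex)))"
  by (rule keys_sum_add) (auto simp: add_divide_distrib single_add)

lemma Linv_add: "Linv J (x + y) = Linv J x + Linv J y"
  unfolding Linv_def
  by (rule keys_sum_add) (simp_all only: Linv_inner_add single_add, simp)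

lemma Linv_single: "Linv J (sg T (sg M c)) = sg T (sg M (c / of_nat (wt J M T)))"
  unfolding Linv_def by (subst keys_sum_single, simp, subst keys_sum_single) auto

lemma Linv_zero [simp]: "Linv J 0 = 0" and Linv_sum: "Linv J (sum f A) = (\<Sum>a\<in>A. Linv J (f a))"
  using additive_sum[of "Linv J", OF Linv_add] by auto

lemma keys_Linv: "keys (Linv J x) \<subseteq> keys x"
proof
  fix S assume "S \<in> keys (Linv J x)"
  then show "S \<in> keys x"
    unfolding Linv_def using keys_sum by (fastforce split: if_splits)
qed

lemma additive_ext_keys2:
  fixes f g :: "('a \<Rightarrow>\<^sub>0 'b \<Rightarrow>\<^sub>0 'c::ab_group_add) \<Rightarrow> 'd::ab_group_add"
  assumes "\<And>x y. f (x + y) = f x + f y" "\<And>x y. g (x + y) = g x + g y"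
    "\<And>T M c. T \<in> keys x \<Longrightarrow> f (sg T (sg M c)) = g (sg T (sg M c))"
  shows "f x = g x"
proof (rule additive_ext_keys[of f g, OF assms(1,2)])
  fix T assume T: "T \<in> keys x"
  show "f (sg T (coef x T)) = g (sg T (coef x T))"
    by (rule pm_ext_additive[of "\<lambda>p. f (sg T p)" "\<lambda>p. g (sg T p)"])
      (simp_all only: single_add assms(1,2), rule assms(3)[OF T])
qed

text \<open>A summand of \<open>kJ\<close> removes one element of T and multiplies by one variable,
  so the weight is constant along it and division by the weight commutes with it.\<close>

lemma kJ_Linv: "kJ J (Linv J x) = Linv J (kJ J x)"
  if x: "x \<in> fk"
proof (rule additive_ext_keys2[of "\<lambda>x. kJ J (Linv J x)" "\<lambda>x. Linv J (kJ J x)"])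
  fix T M and c :: complex assume "T \<in> keys x"
  then have T: "finite T" using x by (auto simp: fk_def)
  have s: "sm (bvar (Suc j)) (del (int j + 1) (sg T (sg M c))) =
      (if int j + 1 \<in> T then sg (T - {int j + 1}) (sg (sg j 1 + M) (fsg (int j + 1) T * c)) else 0)" for j and c :: complex
  proof -
    have "(fsg k T :: complex bpoly) = Cst (fsg k T)" for k
      by (cases "even (card {t \<in> T. t < k})") (auto simp: fsg_def single_uminus)
    then have "(fsg (int j + 1) T :: complex bpoly) * sg M c = sg M (fsg (int j + 1) T * c)"
      by (metis add_0 mult_single)
    then show ?thesis by (simp add: del_single sm_single bvar_def mult_single sm_zero)
  qed
  have w: "wt J (sg j 1 + M) (T - {int j + 1}) = wt J M T" if "j < J" "int j + 1 \<in> T" for j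
  proof -
    have "{i. i < J \<and> int i + 1 \<in> T - {int j + 1}} = {i. i < J \<and> int i + 1 \<in> T} - {j}" by auto
    moreover have "Suc (card ({i. i < J \<and> int i + 1 \<in> T} - {j})) = card {i. i < J \<and> int i + 1 \<in> T}"
      by (rule card_Suc_Diff1) (use that in auto)
    ultimately have "Suc (card {i. i < J \<and> int i + 1 \<in> T - {int j + 1}}) = card {i. i < J \<and> int i + 1 \<in> T}"
      by simp
    moreover have "(\<Sum>i<J. coef (sg j 1 + M) i) = Suc (\<Sum>i<J. coef M i)"
      using that by (simp add: lookup_add sum.distrib lookup_single when_def)
    ultimately show ?thesis by (simp add: wt_def)
  qed
  show "kJ J (Linv J (sg T (sg M c))) = Linv J (kJ J (sg T (sg M c)))"
    unfolding Linv_single kJ_def s Linv_sum by (intro sum.cong refl) (simp add: Linv_single w[unfolded One_nat_def])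
qed (simp_all add: kJ_add Linv_add)

lemma koszul_exact:
  assumes x: "x \<in> fkc c" "kap x = 0" and c: "c \<ge> 1"
  shows "\<exists>x'\<in>fkc (c + 1). kap x' = x"
proof -
  have fin: "finite (\<Union>(keys x))" using x(1) by (auto simp: fkc_def)
  define J where "J = nat (Max (insert 0 (\<Union>(keys x))))"
  have b: "t \<le> int J" if "T \<in> keys x" "t \<in> T" for t T
  proof -
    have "t \<le> Max (insert 0 (\<Union>(keys x)))" using that fin by (intro Max_ge) auto
    then show ?thesis by (simp add: J_def)
  qed
  have xfk: "x \<in> fk" using x(1) by (rule fkc_fk)
  have dJ: "del (int n + 1) x = 0" if "n \<ge> J" for n
    by (rule del_eq_0) (use b that in fastforce)
  have kx: "kJ J x = 0" using x(2) kap_eq[of J x, OF dJ] by (simp add: kJ_def)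
  let ?y = "Linv J x"
  have yc: "?y \<in> fkc c" using x(1) keys_Linv[of J x] by (auto simp: fkc_def)
  then have yfk: "?y \<in> fk" by (rule fkc_fk)
  have ky: "kJ J ?y = 0" by (simp add: kJ_Linv[OF xfk] kx)
  have hy: "kJ J (hJ J ?y) + hJ J (kJ J ?y) = x"
  proof (rule additive_ext_keys2[of "\<lambda>x. kJ J (hJ J (Linv J x)) + hJ J (kJ J (Linv J x))" "\<lambda>x. x"])
    fix T M and a :: complex assume T: "T \<in> keys x"
    then have f: "finite T" "charge T = c" using x(1) by (auto simp: fkc_def)
    \<comment> \<open>Positive charge forces an element s > 0 in T. It lies below the bound J and
      makes the weight positive, so that \<open>Linv\<close> divides by a nonzero number.\<close>
    then have "card {s \<in> T. 0 < s} > 0" using c by (auto simp: charge_def)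
    then have "{s \<in> T. 0 < s} \<noteq> {}" by (metis card.empty less_irrefl)
    then obtain s where s: "s \<in> T" "0 < s" by blast
    then have "nat (s - 1) \<in> {j. j < J \<and> int j + 1 \<in> T}" using b[OF T s(1)] by auto
    then have "card {j. j < J \<and> int j + 1 \<in> T} > 0" by (subst card_gt_0_iff) auto
    then have "wt J M T > 0" by (simp add: wt_def)
    then show "kJ J (hJ J (Linv J (sg T (sg M a)))) + hJ J (kJ J (Linv J (sg T (sg M a)))) = sg T (sg M a)"
      by (simp add: Linv_single kJ_hJ_single[OF f(1)])
  qed (simp_all add: Linv_add kJ_add hJ_add)
  define x' where "x' = hJ J ?y"
  have "hJ J 0 = 0" by (rule additive_sum(1)) (rule hJ_add)
  then have kx': "kJ J x' = x" using hy by (simp add: ky x'_def)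
  have x'c: "x' \<in> fkc (c + 1)"
  proof -
    have "dd j ?y \<in> fkc c" for j using yc by (auto simp: fkc_def in_keys_iff coef_dd)
    then have "ins (int j + 1) (dd j ?y) \<in> fkc (c + 1)" for j
      using fkc_ins[of "dd j ?y" c "int j + 1"] by simp
    then show ?thesis unfolding x'_def hJ_def by (intro fkc_sum)
  qed
  \<comment> \<open>\<open>kap\<close> agrees with \<open>kJ J\<close> on vectors whose sets have no
    element above J; the homotopy preserves this because it only inserts j + 1 with j < J.\<close>
  have "del (int n + 1) x' = 0" if n: "n \<ge> J" for n
  proof -
    have "del (int n + 1) ?y = 0"
      by (rule del_eq_0) (use b n keys_Linv[of J x] in fastforce)
    then have "del (int n + 1) (dd j ?y) = 0" for j by (simp flip: dd_del)
    moreover have "del (int n + 1) (ins (int j + 1) (dd j ?y)) = - ins (int j + 1) (del (int n + 1) (dd j ?y))" if "j < J" for j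
      using del_ins_eq[OF fk_dd[OF yfk], of "int n + 1" "int j + 1" j] that n by simp
    ultimately show ?thesis unfolding x'_def hJ_def del_sum by (intro sum.neutral) auto
  qed
  then have "kap x' = x" using kap_eq[of J x'] kx' by (simp add: kJ_def)
  then show ?thesis using x'c by blast
qed

section \<open>Polynomial substitution\<close>

definition mon :: "(nat \<Rightarrow> 'k::comm_ring_1 bpoly) \<Rightarrow> (nat \<Rightarrow>\<^sub>0 nat) \<Rightarrow> 'k bpoly"
  where "mon val M = (\<Prod>j\<in>keys M. val j ^ coef M j)"

definition psubst :: "(nat \<Rightarrow> 'k::comm_ring_1 bpoly) \<Rightarrow> 'k bpoly \<Rightarrow> 'k bpoly"
  where "psubst val p = (\<Sum>M\<in>keys p. Cst (coef p M) * mon val M)"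

lemma mon_superset: "finite A \<Longrightarrow> keys M \<subseteq> A \<Longrightarrow> mon val M = (\<Prod>j\<in>A. val j ^ coef M j)"
  unfolding mon_def by (rule prod.mono_neutral_left) (auto simp: in_keys_iff)

lemma mon_add: "mon val (M + N) = mon val M * mon val N"
  by (subst (1 2 3) mon_superset[of "keys M \<union> keys N"])
    (use keys_add[of M N] in \<open>auto simp: lookup_add power_add prod.distrib\<close>)

lemma psubst_add: "psubst val (p + q) = psubst val p + psubst val q"
  unfolding psubst_def by (rule keys_sum_add) (auto simp: Cst_add distrib_right)

lemma psubst_single: "psubst val (sg M c) = Cst c * mon val M"
  unfolding psubst_def by (rule keys_sum_single) simp

lemma psubst_zero [simp]: "psubst val 0 = 0" and psubst_minus: "psubst val (- p) = - psubst val p"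
  and psubst_sum: "psubst val (sum f A) = (\<Sum>a\<in>A. psubst val (f a))"
  using additive_sum[of "psubst val", OF psubst_add] by auto

lemma psubst_mult: "psubst val (p * q) = psubst val p * psubst val q"
proof (induction p rule: pm_induct)
  case (single M c)
  have "psubst val (sg M c * sg N d) = psubst val (sg M c) * psubst val (sg N d)" for N d
    unfolding mult_single[of M c N d] by (simp only: psubst_single mon_add Cst_mult mult_ac)
  then show ?case
    by (induction q rule: pm_induct) (simp_all add: psubst_add distrib_left)
qed (simp_all add: psubst_add distrib_right)

lemma psubst_Cst [simp]: "psubst val (Cst c) = Cst c"
  by (simp add: psubst_single mon_def)

lemma psubst_one [simp]: "psubst val 1 = 1"
  using psubst_Cst[of val 1] by simp

lemma psubst_of_nat [simp]: "psubst val (of_nat n) = of_nat n"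
  using psubst_Cst[of val "of_nat n"] by simp

lemma psubst_bvar: "n \<ge> 1 \<Longrightarrow> psubst val (bvar n) = val (n - 1)"
  by (simp add: bvar_def psubst_single mon_def)

lemma psubst_id: "psubst (\<lambda>j. bvar (Suc j)) p = p"
  by (induction p rule: bpoly_induct) (simp_all add: psubst_bvar psubst_add psubst_mult)

section \<open>The algebra \<open>\<D>\<close>\<close>

abbreviation Dset :: "complex bpoly set" where "Dset \<equiv> carrier D_alg"

lemma Dset_iff: "p \<in> Dset \<longleftrightarrow> (\<forall>M\<in>keys p. \<forall>j\<in>keys M. even j)"
  by (simp add: D_alg_def)

lemma Dset_0 [simp]: "0 \<in> Dset" and Dset_Cst [simp]: "Cst c \<in> Dset"
  and Dset_bvar: "odd n \<Longrightarrow> bvar n \<in> Dset"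
  by (auto simp: Dset_iff bvar_def odd_pos)

lemma Dset_add: "p \<in> Dset \<Longrightarrow> q \<in> Dset \<Longrightarrow> p + q \<in> Dset"
  using keys_add[of p q] by (auto simp: Dset_iff)

lemma Dset_mult: "p \<in> Dset \<Longrightarrow> q \<in> Dset \<Longrightarrow> p * q \<in> Dset"
proof -
  assume pq: "p \<in> Dset" "q \<in> Dset"
  show ?thesis
    unfolding Dset_iff
  proof (intro ballI)
    fix M j assume "M \<in> keys (p * q)" "j \<in> keys M"
    then obtain A B where "A \<in> keys p" "B \<in> keys q" "M = A + B" using keys_mult[of p q] by blast
    then show "even j" using pq \<open>j \<in> keys M\<close> keys_add[of A B] by (auto simp: Dset_iff)
  qed
qed

lemma Dset_one [simp]: "1 \<in> Dset"
  using Dset_Cst[of 1] by simp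

lemma Dset_of_nat [simp]: "of_nat n \<in> Dset"
  using Dset_Cst[of "of_nat n"] by simp

lemma Dset_minus: "p \<in> Dset \<Longrightarrow> - p \<in> Dset"
  by (auto simp: Dset_iff)

lemma Dset_diff: "p \<in> Dset \<Longrightarrow> q \<in> Dset \<Longrightarrow> p - q \<in> Dset"
  using Dset_add[of p "- q"] Dset_minus[of q] by simp

lemma Dset_sum: "(\<And>a. a \<in> A \<Longrightarrow> f a \<in> Dset) \<Longrightarrow> sum f A \<in> Dset"
  by (induction A rule: infinite_finite_induct) (auto intro: Dset_add)

lemma Dset_induct [consumes 1, case_names const var add mult]:
  assumes "p \<in> Dset" "\<And>c. P (Cst c)" "\<And>n. odd n \<Longrightarrow> P (bvar n)" "\<And>x y. P x \<Longrightarrow> P y \<Longrightarrow> P (x + y)"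
    "\<And>x y. P x \<Longrightarrow> P y \<Longrightarrow> P (x * y)"
  shows "P p"
proof -
  have one: "P 1" and zero: "P 0" using assms(2)[of 1] assms(2)[of 0] by simp_all
  have pow: "P (x ^ n)" if "P x" for x n
    by (induction n) (auto intro: one assms(5) that)
  have prod: "P (prod f A)" if "\<And>a. a \<in> A \<Longrightarrow> P (f a)" for f :: "nat \<Rightarrow> complex bpoly" and A
    using that by (induction A rule: infinite_finite_induct) (auto intro: one assms(5))
  have sum: "P (sum f A)" if "\<And>a. a \<in> A \<Longrightarrow> P (f a)" for f :: "(nat \<Rightarrow>\<^sub>0 nat) \<Rightarrow> complex bpoly" and A
    using that by (induction A rule: infinite_finite_induct) (auto intro: zero assms(4))
  \<comment> \<open>Substituting the variables for themselves displays p as a polynomial in the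
    variables that occur in it, and these have odd index.\<close>
  have "P (psubst (\<lambda>j. bvar (Suc j)) p)"
    unfolding psubst_def mon_def
    by (intro sum assms(5) assms(2) prod pow assms(3)) (use assms(1) in \<open>auto simp: Dset_iff\<close>)
  then show ?thesis by (simp only: psubst_id)
qed

lemma bderiv_Dset: "d \<in> Dset \<Longrightarrow> n \<ge> 1 \<Longrightarrow> bderiv (dbl n) d = 0"
proof (induction d rule: Dset_induct)
  case (var m)
  then have "m \<ge> 1" "2 * n \<noteq> m" by (auto elim: oddE)
  then show ?case using var by (simp add: dbl_def bderiv_bvar)
qed (simp_all add: bderiv_add bderiv_mult)

lemma Od_rec: "of_nat k * Od k = (\<Sum>n=1..k. of_nat n * (Cst (\<gamma>O n) * bvar n * Od (k - n)))"
  unfolding Od_def by (rule cf_rec)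

lemma Od_0: "Od 0 = 1"
  by (simp add: Od_def)

lemma Dset_of_nat_cancel: "k > 0 \<Longrightarrow> of_nat k * p \<in> Dset \<Longrightarrow> p \<in> Dset"
  using Dset_mult[of "Cst (inverse (of_nat k))" "of_nat k * p"] of_nat_Cst_inverse[of k p]
  by (simp add: mult.left_commute)

lemma Od_Dset: "Od k \<in> Dset"
proof (induction k rule: less_induct)
  case (less k)
  show ?case
  proof (cases "k = 0")
    case False
    have "of_nat k * Od k \<in> Dset"
      unfolding Od_rec
    proof (rule Dset_sum)
      fix n assume "n \<in> {1..k}"
      then show "of_nat n * (Cst (\<gamma>O n) * bvar n * Od (k - n)) \<in> Dset"
        using less.IH[of "k - n"] by (cases "odd n") (auto intro!: Dset_mult Dset_bvar simp: \<gamma>O_def)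
    qed
    then show ?thesis using False Dset_of_nat_cancel by blast
  qed (simp add: Od_0)
qed

lemma Gam_Dset: "Gam a b \<in> Dset"
  unfolding Gam_def ff_def
  by (intro Dset_sum Dset_diff Dset_add Dset_mult Od_Dset) (auto intro: Dset_mult Od_Dset)

text \<open>The coefficients of odd index of the odd creation series are free generators of \<open>\<D>\<close>.\<close>

definition iot :: "complex bpoly \<Rightarrow> complex bpoly"
  where "iot = psubst (\<lambda>j. Od (2 * j + 1))"

text \<open>The inverse of \<open>iot\<close>: \<open>bo k\<close> consists of the preimages of the \<open>k\<close>-th coefficients of the
  exponent and of the exponential.\<close>

fun bo :: "nat \<Rightarrow> complex bpoly \<times> complex bpoly" where
  "bo k = (let S = Cst (inverse (of_nat k)) * (\<Sum>n\<in>{1..<k}. of_nat n * (fst (bo n) * snd (bo (k - n)))) in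
     if k = 0 then (0, 1) else if odd k then (bvar ((k + 1) div 2) - S, bvar ((k + 1) div 2)) else (0, S))"

declare bo.simps [simp del]

abbreviation "bt k \<equiv> fst (bo k)"
abbreviation "ot k \<equiv> snd (bo k)"

lemma bo_even: "even k \<Longrightarrow> bt k = 0" and bo_0: "ot 0 = 1"
  by (subst bo.simps; simp add: Let_def)+

lemma bo_odd: "odd k \<Longrightarrow> ot k = bvar ((k + 1) div 2)"
  by (subst bo.simps) (auto simp: Let_def)

lemma bo_rec: "of_nat k * ot k = (\<Sum>n=1..k. of_nat n * (bt n * ot (k - n)))"
proof (cases "k = 0")
  case False
  let ?S = "\<Sum>n\<in>{1..<k}. of_nat n * (bt n * ot (k - n))"
  have S: "(\<Sum>n=1..k. of_nat n * (bt n * ot (k - n))) = ?S + of_nat k * bt k"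
    using False by (cases k) (simp_all add: bo_0 atLeastLessThanSuc_atLeastAtMost)
  have "of_nat k * (ot k - bt k) = of_nat k * (Cst (inverse (of_nat k)) * ?S)"
    by (subst (1 2) bo.simps) (simp add: Let_def False)
  also have "\<dots> = ?S" using False by (intro of_nat_Cst_inverse) simp
  finally show ?thesis unfolding S by (simp add: algebra_simps)
qed simp

definition eta :: "complex bpoly \<Rightarrow> complex bpoly"
  where "eta = psubst (\<lambda>j. Cst (inverse (\<gamma>O (Suc j))) * bt (Suc j))"

lemma \<gamma>O_nonzero: "odd n \<Longrightarrow> \<gamma>O n \<noteq> 0"
  by (auto simp: \<gamma>O_def \<gamma>q_def odd_pos)

text \<open>\<open>eta\<close> sends the exponent of the odd series to the series of the
  \<open>bt k\<close>, so both sides satisfy the same recursion of an exponential.\<close>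

lemma eta_Od: "eta (Od k) = ot k"
proof (induction k rule: less_induct)
  case (less k)
  show ?case
  proof (cases "k = 0")
    case False
    have "of_nat k * eta (Od k) = (\<Sum>n=1..k. of_nat n * (bt n * ot (k - n)))"
    proof -
      have "of_nat k * eta (Od k) = eta (of_nat k * Od k)" by (simp add: eta_def psubst_mult)
      also have "\<dots> = (\<Sum>n=1..k. of_nat n * (Cst (\<gamma>O n) * eta (bvar n) * eta (Od (k - n))))"
        unfolding Od_rec by (simp add: eta_def psubst_sum psubst_mult)
      also have "\<dots> = (\<Sum>n=1..k. of_nat n * (bt n * ot (k - n)))"
      proof (rule sum.cong[OF refl])
        fix n assume n: "n \<in> {1..k}"
        have "Cst (\<gamma>O n) * eta (bvar n) = bt n"
        proof (cases "odd n")
          case True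
          then show ?thesis
            using n \<gamma>O_nonzero[OF True] by (simp add: eta_def psubst_bvar mult_single flip: mult.assoc)
        qed (simp add: \<gamma>O_def bo_even)
        then show "of_nat n * (Cst (\<gamma>O n) * eta (bvar n) * eta (Od (k - n))) = of_nat n * (bt n * ot (k - n))"
          using n less.IH[of "k - n"] by simp
      qed
      finally show ?thesis .
    qed
    then have "of_nat k * eta (Od k) = of_nat k * ot k" by (simp only: bo_rec)
    then show ?thesis using False by (intro of_nat_cancel[of k "eta (Od k)"]) simp
  qed (simp add: Od_0 bo_0 eta_def)
qed

lemma eta_iot: "eta (iot p) = p"
proof (induction p rule: bpoly_induct)
  case (var n)
  then have "(2 * (n - 1) + 1 + 1) div 2 = n" by simp
  then show ?case using var by (simp add: iot_def psubst_bvar eta_Od bo_odd)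
qed (simp_all add: iot_def eta_def psubst_add psubst_mult)

text \<open>The recursion is triangular. For odd k the value of \<open>ot k\<close> is prescribed
  and \<open>bt k\<close> is solved for; for even k the exponent has no term and \<open>ot k\<close>
  follows. In either case \<open>iot\<close> reproduces the corresponding step of the recursion for
  \<open>Od\<close>.\<close>

lemma iot_bo: "iot (bt k) = Cst (\<gamma>O k) * bvar k \<and> iot (ot k) = Od k"
proof (induction k rule: less_induct)
  case (less k)
  show ?case
  proof (cases "k = 0")
    case False
    have S: "(\<Sum>n\<in>{1..<k}. of_nat n * (iot (bt n) * iot (ot (k - n)))) =
        (\<Sum>n\<in>{1..<k}. of_nat n * (Cst (\<gamma>O n) * bvar n * Od (k - n)))"
      by (rule sum.cong) (auto simp: less.IH)
    have split: "(\<Sum>n=1..k. f n) = (\<Sum>n\<in>{1..<k}. f n) + f k" for f :: "nat \<Rightarrow> complex bpoly"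
      using False by (cases k) (simp_all add: atLeastLessThanSuc_atLeastAtMost)
    have 1: "of_nat k * iot (ot k) = (\<Sum>n\<in>{1..<k}. of_nat n * (iot (bt n) * iot (ot (k - n)))) + of_nat k * iot (bt k)"
    proof -
      have "of_nat k * iot (ot k) = iot (of_nat k * ot k)" by (simp add: iot_def psubst_mult)
      also have "\<dots> = (\<Sum>n=1..k. of_nat n * (iot (bt n) * iot (ot (k - n))))"
        unfolding bo_rec by (simp add: iot_def psubst_sum psubst_mult)
      finally show ?thesis unfolding split by (simp add: bo_0 iot_def)
    qed
    have 2: "of_nat k * Od k = (\<Sum>n\<in>{1..<k}. of_nat n * (Cst (\<gamma>O n) * bvar n * Od (k - n))) + of_nat k * (Cst (\<gamma>O k) * bvar k)"
      unfolding Od_rec split by (simp add: Od_0)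
    show ?thesis
    proof (cases "odd k")
      case True
      then have "2 * ((k + 1) div 2 - 1) + 1 = k" "(k + 1) div 2 \<ge> 1" by (auto elim!: oddE)
      then have o: "iot (ot k) = Od k"
        by (simp add: bo_odd[OF True] iot_def psubst_bvar)
      have "of_nat k * iot (bt k) = of_nat k * (Cst (\<gamma>O k) * bvar k)"
        using trans[OF 1[unfolded S o, symmetric] 2] by (simp only: add_left_cancel)
      with False have "iot (bt k) = Cst (\<gamma>O k) * bvar k"
        by (intro of_nat_cancel[of k "iot (bt k)"]) simp
      then show ?thesis using o by simp
    next
      case even: False
      then have "of_nat k * iot (ot k) = of_nat k * Od k"
        using 1 2 unfolding S by (simp add: bo_even \<gamma>O_def iot_def)
      with False have "iot (ot k) = Od k"
        by (intro of_nat_cancel[of k "iot (ot k)"]) simp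
      then show ?thesis using even by (simp add: bo_even \<gamma>O_def iot_def)
    qed
  qed (simp add: bo_0 Od_0 bo_even \<gamma>O_def iot_def)
qed

lemma iot_eta: "p \<in> Dset \<Longrightarrow> iot (eta p) = p"
proof (induction p rule: Dset_induct)
  case (var n)
  have "eta (bvar n) = Cst (inverse (\<gamma>O n)) * bt n" using var by (simp add: eta_def psubst_bvar odd_pos Suc_le_eq)
  then have "iot (eta (bvar n)) = Cst (inverse (\<gamma>O n)) * iot (bt n)" by (simp add: iot_def psubst_mult)
  then show ?case using \<gamma>O_nonzero[OF var] by (simp add: iot_bo mult_single flip: mult.assoc)
qed (simp_all add: iot_def eta_def psubst_add psubst_mult)

lemma iot_Dset: "iot p \<in> Dset"
  by (induction p rule: bpoly_induct)
    (auto simp: iot_def psubst_bvar psubst_add psubst_mult intro: Od_Dset Dset_add Dset_mult)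

lemma iot_hom: "iot (p + q) = iot p + iot q" "iot (p * q) = iot p * iot q" "iot 1 = 1" "iot 0 = 0"
  "iot (- p) = - iot p" "iot (Cst c) = Cst c"
  by (simp_all add: iot_def psubst_add psubst_mult psubst_minus)

lemma iot_inj: "iot p = iot q \<Longrightarrow> p = q"
  by (metis eta_iot)

section \<open>The boson-fermion correspondence\<close>

text \<open>The full polynomial ring acts through its isomorphism \<open>iot\<close> onto D. In
  these coordinates the coefficients of x_0^- are the variables.\<close>

definition scD :: "complex bpoly \<Rightarrow> complex charged \<Rightarrow> complex charged"
  where "scD p v = poly_mult (iot p) v"

text \<open>The value is forced by \<open>x0_2_Psi\<close>: replacing \<open>Psi (- k)\<close> by
  the modified operator in minus the sum of \<open>Psi (- k) (Psi (k + 1) v)\<close> adds -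
  \<open>mu k b\<close> times \<open>Psi (b + 1) (Psi (k + 1) v)\<close>, which has to be the
  \<open>Gam\<close> term. This explains the sign and the transposition; \<open>eta\<close> passes
  to the coordinates of \<open>scD\<close>.\<close>

definition mu :: "nat \<Rightarrow> nat \<Rightarrow> complex bpoly" where "mu k b = - eta (Gam b k)"

lemma iot_mu: "iot (mu k b) = - Gam b k"
  by (simp add: mu_def iot_hom iot_eta Gam_Dset)

definition vac :: "complex charged" where "vac = sg 0 1"

lemma car_Psi: "car scD Psi Psis"
proof
  fix d :: "complex bpoly" and n :: int and v :: "complex charged"
  show "Psi n (scD d v) = scD d (Psi n v)" "Psis n (scD d v) = scD d (Psis n v)"
    unfolding scD_def by (intro Psi_poly_mult bderiv_Dset iot_Dset; simp)+
  show "v + v = 0 \<Longrightarrow> v = 0"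
  proof (rule poly_mapping_eqI, rule poly_mapping_eqI)
    fix j M assume "v + v = 0"
    then have "coef (coef (v + v) j) M = 0" by (simp only: lookup_zero)
    then have "coef (coef v j) M + coef (coef v j) M = 0" by (simp only: lookup_add)
    then show "coef (coef v j) M = coef (coef 0 j) M" by simp
  qed
qed (auto simp: scD_def poly_mult_def iot_hom distrib_left distrib_right single_add mult_single
    Psi_add Psis_add Psi_Psi Psis_Psis Psi_Psis Psi_finite Psis_finite simp flip: mult.assoc)

interpretation Md: car_modified scD Psi Psis mu
  unfolding car_modified_def by (rule car_Psi)

lemma Psi_single: "Psi n (sg m P) = sg (m - 1) (vop HH \<sigma> (m - n) P)"
  by (rule poly_mapping_eqI) (auto simp: coef_Psi lookup_single when_def)

lemma Psis_single: "Psis n (sg m P) = sg (m + 1) (vop HI \<tau> (n - m - 1) P)"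
  by (rule poly_mapping_eqI) (auto simp: coef_Psis lookup_single when_def diff_diff_eq)

lemma vop_one: "vop c (sh s \<phi>) A 1 = ci c A"
  by (subst vop_sh_eq[of 0]) (auto simp: sh_one)

lemma Psi_vac: "n > 0 \<Longrightarrow> Psi n vac = 0" and Psis_vac: "n \<le> 0 \<Longrightarrow> Psis n vac = 0"
  by (simp_all add: vac_def Psi_single Psis_single vop_one ci_neg del: single_one)

lemma an_vac: "car.an Md.psi' Md.psis' n vac = 0"
proof -
  have "Md.pA \<nu> vac = 0" for \<nu> by (subst Md.pA_eq[of 0]) (auto simp: Psi_vac)
  then show ?thesis
    unfolding car.an_def[OF Md.car_psi'] by (simp add: Md.psi'_def Md.psis'_def Psi_vac Psis_vac)
qed

interpretation Fk: car_vac scD Md.psi' Md.psis' vac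
  by (rule car_vac.intro[OF Md.car_psi']) (unfold_locales, rule an_vac)

text \<open>What the charged vacua generate under D and the unmodified \<open>Psi\<close>. That this
  is the whole space is the completeness half of the boson-fermion correspondence.\<close>

inductive_set gen :: "complex charged set" where
  vacuum: "sg m 1 \<in> gen"
| add: "v \<in> gen \<Longrightarrow> w \<in> gen \<Longrightarrow> v + w \<in> gen"
| scal: "v \<in> gen \<Longrightarrow> d \<in> Dset \<Longrightarrow> poly_mult d v \<in> gen"
| Psi: "v \<in> gen \<Longrightarrow> Psi n v \<in> gen"

lemma poly_mult_zero [simp]: "poly_mult 0 v = 0" "poly_mult d 0 = 0"
  by (simp_all add: poly_mult_def)

lemma gen_0: "0 \<in> gen"
  using gen.scal[OF gen.vacuum[of 0] Dset_0] by simp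

lemma gen_sum: "(\<And>a. a \<in> A \<Longrightarrow> f a \<in> gen) \<Longrightarrow> sum f A \<in> gen"
  by (induction A rule: infinite_finite_induct) (auto intro: gen_0 gen.add)

text \<open>The exchange factor 1/(1 - x) of \<open>\<tau>\<close> with \<open>HH\<close>
  contributes one term for each shift r. Hence \<open>gen\<close> is stable under
  \<open>\<tau>\<close>, which is used to recover multiplication by \<open>HH a\<close>.\<close>

lemma \<tau>_vop: "\<tau> k (vop HH \<sigma> A P) = (\<Sum>r\<le>k. vop HH \<sigma> (A - int r) (\<tau> (k - r) P))"
proof -
  obtain N where N: "\<forall>l>N. \<sigma> l P = 0" using dbl_finite by blast
  then have N': "\<forall>l>N. \<sigma> l (\<tau> j P) = 0" for j by (simp add: sh_commute[of sE])
  have "\<tau> k (vop HH \<sigma> A P) = (\<Sum>l\<le>N. \<Sum>r\<le>k. ci HH (int l + A - int r) * \<tau> (k - r) (\<sigma> l P))"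
    unfolding vop_sh_eq[OF N] sh_sum sh_mult \<tau>_HH by simp
  also have "\<dots> = (\<Sum>r\<le>k. \<Sum>l\<le>N. ci HH (int l + (A - int r)) * \<sigma> l (\<tau> (k - r) P))"
    by (subst sum.swap) (simp add: sh_commute[of sE] add_diff_eq)
  also have "\<dots> = (\<Sum>r\<le>k. vop HH \<sigma> (A - int r) (\<tau> (k - r) P))"
    by (simp add: vop_sh_eq[OF N'])
  finally show ?thesis .
qed

lemma gen_\<tau>: "v \<in> gen \<Longrightarrow> Poly_Mapping.map (\<tau> k) v \<in> gen"
proof (induction v arbitrary: k rule: gen.induct)
  case (vacuum m)
  have "Poly_Mapping.map (\<tau> k) (sg m 1) = (if k = 0 then sg m 1 else 0)"
    by (rule poly_mapping_eqI) (auto simp: coef_map lookup_single when_def sh_one)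
  then show ?case by (auto intro: gen_0 gen.vacuum)
next
  case (add v w)
  then show ?case by (simp add: map_add sh_add gen.add)
next
  case (scal v d)
  have "Poly_Mapping.map (\<tau> k) (poly_mult d v) = poly_mult d (Poly_Mapping.map (\<tau> k) v)"
    by (rule poly_mapping_eqI) (simp add: coef_map coef_poly_mult sh_mult_fixed bderiv_Dset[OF scal.hyps(2)])
  then show ?case using scal by (simp add: gen.scal)
next
  case (Psi v n)
  have "Poly_Mapping.map (\<tau> k) (Psi n v) = (\<Sum>r\<le>k. Psi (n + int r) (Poly_Mapping.map (\<tau> (k - r)) v))"
    by (rule poly_mapping_eqI) (simp add: coef_map coef_Psi \<tau>_vop lookup_sum diff_diff_eq)
  then show ?case using Psi by (auto intro!: gen_sum gen.Psi)
qed

lemma gen_shift: "v \<in> gen \<Longrightarrow> chop d (\<lambda>m P. P) v \<in> gen"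
proof (induction v rule: gen.induct)
  case (vacuum m)
  have "chop d (\<lambda>m P. P) (sg m 1) = sg (m + d) (1 :: complex bpoly)"
    by (rule poly_mapping_eqI) (auto simp: coef_chop lookup_single when_def)
  then show ?case by (simp add: gen.vacuum)
next
  case (add v w)
  have "chop d (\<lambda>m P. P) (v + w) = chop d (\<lambda>m P. P) v + chop d (\<lambda>m P. P) w"
    by (rule poly_mapping_eqI) (simp add: coef_chop lookup_add)
  then show ?case using add by (simp add: gen.add)
next
  case (scal v e)
  have "chop d (\<lambda>m P. P) (poly_mult e v) = poly_mult e (chop d (\<lambda>m P. P) v)"
    by (rule poly_mapping_eqI) (simp add: coef_chop coef_poly_mult)
  then show ?case using scal by (simp add: gen.scal)
next
  case (Psi v n)
  have "chop d (\<lambda>m P. P) (Psi n v) = Psi (n + d) (chop d (\<lambda>m P. P) v)"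
    by (rule poly_mapping_eqI) (simp add: coef_chop coef_Psi algebra_simps)
  then show ?case using Psi by (simp add: gen.Psi)
qed

text \<open>Since \<open>\<sigma>\<close> and \<open>\<tau>\<close> are inverse to each other, multiplication by the coefficients of the creation
  series is recovered from the vertex operator.\<close>

lemma HH_mult_vop:
  assumes N: "\<forall>l>N. \<tau> l P = 0" "\<forall>l. \<forall>k>N. \<sigma> k (\<tau> l P) = 0"
  shows "HH a * P = (\<Sum>l\<le>N. vop HH \<sigma> (int a + int l) (\<tau> l P))"
proof -
  have "(\<Sum>l\<le>N. vop HH \<sigma> (int a + int l) (\<tau> l P)) =
      (\<Sum>l\<le>N. \<Sum>k\<le>N. ci HH (int k + (int a + int l)) * \<sigma> k (\<tau> l P))"
    by (intro sum.cong refl, subst vop_sh_eq[of N]) (use N in auto)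
  also have "\<dots> = (\<Sum>(l, k)\<in>{..N} \<times> {..N}. HH (k + l + a) * \<sigma> k (\<tau> l P))"
    unfolding sum.cartesian_product by (rule sum.cong) (auto simp: ci_def nat_add_distrib algebra_simps)
  also have "\<dots> = (\<Sum>(n, k)\<in>(SIGMA n:{..2 * N}. {..n}). HH (n + a) * \<sigma> k (\<tau> (n - k) P))"
  proof (rule sum.reindex_bij_witness_not_neutral[where S' = "{}"
        and T' = "(SIGMA n:{..2 * N}. {..n}) - (\<lambda>(l, k). (k + l, k)) ` ({..N} \<times> {..N})"
        and i = "\<lambda>(n, k). (n - k, k)" and j = "\<lambda>(l, k). (k + l, k)"])
    fix b assume b: "b \<in> (SIGMA n:{..2 * N}. {..n}) - (\<lambda>(l, k). (k + l, k)) ` ({..N} \<times> {..N})"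
    obtain n k where nk: "b = (n, k)" by (cases b)
    with b have "(n - k, k) \<notin> {..N} \<times> {..N}" by force
    then show "(case b of (n, k) \<Rightarrow> HH (n + a) * \<sigma> k (\<tau> (n - k) P)) = 0"
      using N nk by (cases "k \<le> N") auto
  qed (auto simp: image_iff)
  also have "\<dots> = (\<Sum>n\<le>2 * N. HH (n + a) * (\<Sum>k\<le>n. \<sigma> k (\<tau> (n - k) P)))"
    by (simp add: sum.Sigma sum_distrib_left)
  also have "\<dots> = (\<Sum>n\<le>2 * N. if n = 0 then HH a * P else 0)"
    by (intro sum.cong refl) (simp add: sh_conv_minus)
  finally show ?thesis by simp
qed

lemma gen_HH: "sg m P \<in> gen \<Longrightarrow> sg m (HH a * P) \<in> gen"
proof -
  assume P: "sg m P \<in> gen"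
  obtain N where N: "\<forall>l>N. \<tau> l P = 0" "\<forall>l. \<forall>k>N. \<sigma> k (\<tau> l P) = 0"
    using dbl_finite2 by blast
  have "sg m (HH a * P) = (\<Sum>l\<le>N. chop 1 (\<lambda>m P. P) (Psi (m - int a - int l) (Poly_Mapping.map (\<tau> l) (sg m P))))"
    unfolding HH_mult_vop[OF N]
    by (rule poly_mapping_eqI)
      (auto simp: lookup_sum coef_chop map_single Psi_single lookup_single when_def diff_diff_eq)
  then show ?thesis by (simp only:) (intro gen_sum gen_shift gen.Psi gen_\<tau> P)
qed

lemma gen_single_add: "sg m P \<in> gen \<Longrightarrow> sg m Q \<in> gen \<Longrightarrow> sg m (P + Q) \<in> gen"
  by (simp add: single_add gen.add)

lemma gen_single_Dset: "sg m P \<in> gen \<Longrightarrow> d \<in> Dset \<Longrightarrow> sg m (d * P) \<in> gen"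
  using gen.scal[of "sg m P" d] by (simp add: poly_mult_def mult_single)

text \<open>In the recursion for \<open>HH b\<close> the top variable occurs linearly with a nonzero
  coefficient, so multiplication by it is obtained from \<open>HH b\<close> and the lower variables
  of even index.\<close>

lemma gen_bvar_even: "b \<ge> 1 \<Longrightarrow> sg m P \<in> gen \<Longrightarrow> sg m (bvar (dbl b) * P) \<in> gen"
proof (induction b arbitrary: P rule: less_induct)
  case (less b)
  let ?f = "\<lambda>n. of_nat n * (Cst (\<gamma>E n) * bvar (dbl n) * HH (b - n))"
  have rec: "of_nat b * HH b = (\<Sum>n\<in>{1..<b}. ?f n) + of_nat b * (Cst (\<gamma>E b) * bvar (dbl b))"
  proof -
    have "of_nat b * HH b = (\<Sum>n=1..b. ?f n)" unfolding HH_def by (rule cf_rec)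
    also have "\<dots> = (\<Sum>n\<in>{1..<b}. ?f n) + ?f b"
      using less.prems by (cases b) (simp_all add: atLeastLessThanSuc_atLeastAtMost)
    finally show ?thesis by (simp add: HH_def)
  qed
  have \<gamma>: "of_nat b * \<gamma>E b \<noteq> 0" using less.prems by (simp add: \<gamma>E_def)
  have "sg m (?f n * P) \<in> gen" if "n \<in> {1..<b}" for n
  proof -
    have "sg m (bvar (dbl n) * (HH (b - n) * P)) \<in> gen"
      using that by (intro less.IH gen_HH less.prems) auto
    then have "sg m ((of_nat n * Cst (\<gamma>E n)) * (bvar (dbl n) * (HH (b - n) * P))) \<in> gen"
      by (rule gen_single_Dset) (auto intro: Dset_mult)
    then show ?thesis by (simp add: mult.assoc)
  qed
  then have s: "sg m ((\<Sum>n\<in>{1..<b}. ?f n) * P) \<in> gen"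
    unfolding sum_distrib_right additive_sum(4)[of "sg m", OF single_add] by (rule gen_sum)
  have "sg m ((of_nat b * HH b) * P + Cst (- 1) * ((\<Sum>n\<in>{1..<b}. ?f n) * P)) \<in> gen"
    using gen_single_Dset[OF gen_HH[OF less.prems(2)], of "of_nat b" b]
    by (intro gen_single_add gen_single_Dset[OF s]) (simp_all add: mult.assoc)
  also have "(of_nat b * HH b) * P + Cst (- 1) * ((\<Sum>n\<in>{1..<b}. ?f n) * P) = Cst (of_nat b * \<gamma>E b) * (bvar (dbl b) * P)"
    unfolding rec by (simp add: single_uminus Cst_mult algebra_simps)
  finally have "sg m (Cst (inverse (of_nat b * \<gamma>E b)) * (Cst (of_nat b * \<gamma>E b) * (bvar (dbl b) * P))) \<in> gen"
    by (rule gen_single_Dset) simp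
  moreover have "Cst (inverse z) * (Cst z * y) = y" if "z \<noteq> 0" for z :: complex and y
    using that by (simp add: mult_single flip: mult.assoc)
  ultimately show ?case using \<gamma> by metis
qed

lemma gen_UNIV: "v \<in> gen"
proof -
  have "sg m P \<in> gen \<Longrightarrow> sg m (p * P) \<in> gen" for m p P
  proof (induction p arbitrary: P rule: bpoly_induct)
    case (const c)
    then show ?case by (intro gen_single_Dset) simp_all
  next
    case (var n)
    show ?case
    proof (cases "odd n")
      case True
      then show ?thesis using var by (intro gen_single_Dset Dset_bvar) simp_all
    next
      case False
      then obtain b where "n = dbl b" "b \<ge> 1" using var by (auto simp: dbl_def elim!: evenE)
      then show ?thesis using gen_bvar_even var by blast
    qed
  next
    case (add x y)
    then show ?case by (simp add: distrib_right gen_single_add)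
  next
    case (mult x y)
    then show ?case by (simp add: mult.assoc)
  qed
  from this[OF gen.vacuum] have "sg m p \<in> gen" for m p by (metis mult.right_neutral)
  then have "(\<Sum>m\<in>keys v. sg m (coef v m)) \<in> gen" by (intro gen_sum)
  then show ?thesis by (simp only: sum_single)
qed

text \<open>The image of \<open>Phi\<close> is stable under the modified and hence under the
  original fermions. It contains every \<open>sg m 1\<close>, since one creation operator leads from
  each of these vectors to the next one away from charge 0; the rest is generated by them.\<close>

lemma Phi_surj: "v \<in> Fk.Phi ` fk"
proof -
  let ?I = "Fk.Phi ` fk"
  have zero: "0 \<in> ?I" using fk_0 by (intro image_eqI[of _ _ 0]) auto
  have add: "v + w \<in> ?I" if "v \<in> ?I" "w \<in> ?I" for v w
    using that by (auto simp flip: Fk.Phi_add intro: fk_add)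
  have sc: "scD d v \<in> ?I" if "v \<in> ?I" for d v
    using that by (auto simp flip: Fk.Phi_sm intro: fk_sm)
  have psi': "Md.psi' n v \<in> ?I" "Md.psis' n v \<in> ?I" if "v \<in> ?I" for n v
    using that by (auto simp: Fk.psi_Phi Fk.psis_Phi intro!: imageI fk_ins fk_del)
  have psi: "Psi n v \<in> ?I" if "v \<in> ?I" for n v
    by (rule Md.stable_psi[OF zero add sc psi'(1) that])
  have psis: "Psis n v \<in> ?I" if "v \<in> ?I" for n v
    by (rule Md.stable_psis[OF zero add sc psi'(2) that])
  have vac0: "sg 0 1 \<in> ?I"
  proof -
    have "Fk.Phi (sg {} 1) = vac" by (simp add: Fk.Phi_single Fk.sc_one)
    then have "vac \<in> ?I" using fk_single[of "{}" 1] by (metis finite.emptyI imageI)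
    then show ?thesis by (simp only: vac_def)
  qed
  have vac: "sg m 1 \<in> ?I" for m
  proof (cases "m \<ge> 0")
    case True
    have "sg (int k) 1 \<in> ?I" for k
    proof (induction k)
      case (Suc k)
      then have "Psis (int k + 1) (sg (int k) 1) \<in> ?I" by (rule psis)
      then show ?case by (simp add: Psis_single vop_one ci_def HI_def add.commute)
    qed (simp add: vac0 del: single_one)
    then show ?thesis using True by (metis nonneg_int_cases)
  next
    case False
    have "sg (- int k) 1 \<in> ?I" for k
    proof (induction k)
      case (Suc k)
      then have "Psi (- int k) (sg (- int k) 1) \<in> ?I" by (rule psi)
      moreover have "Psi (- int k) (sg (- int k) 1) = sg (- int k - 1) 1"
        by (simp add: Psi_single vop_one ci_def HH_def)
      moreover have "- int (Suc k) = - int k - 1" by simp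
      ultimately show ?case by (simp only:)
    qed (simp add: vac0 del: single_one)
    then show ?thesis using False by (metis nonpos_int_cases linear)
  qed
  show ?thesis using gen_UNIV[of v]
  proof (induction v rule: gen.induct)
    case (scal v d)
    then have "scD (eta d) v \<in> ?I" by (intro sc)
    moreover have "scD (eta d) v = poly_mult d v" using scal by (simp add: scD_def iot_eta)
    ultimately show ?case by simp
  qed (auto intro: vac add psi)
qed

lemma Phi_inj: "x \<in> fk \<Longrightarrow> Fk.Phi x = 0 \<Longrightarrow> x = 0"
proof (rule Fk.Phi_injective)
  fix d assume "scD d vac = 0"
  then have "coef (scD d vac) 0 = 0" by simp
  then have "iot d = iot 0" by (simp add: scD_def coef_poly_mult vac_def iot_hom)
  then show "d = 0" by (rule iot_inj)
qed

lemma Psi_Phi_pos: "x \<in> fk \<Longrightarrow> Psi (int n + 1) (Fk.Phi x) = Fk.Phi (del (int n + 1) x)"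
  using Fk.psi_Phi[of x "int n + 1"] by (simp add: Md.psi'_def)

lemma x0_Phi:
  assumes x: "x \<in> fk" and N: "\<And>n. n \<ge> N \<Longrightarrow> del (int n + 1) x = 0"
  shows "x0 (Fk.Phi x) = Fk.Phi (\<Sum>j<N. sm (bvar (Suc j)) (del (int j + 1) x))"
proof -
  have "x0 (Fk.Phi x) = (\<Sum>b<N. poly_mult (Od (2 * b + 1)) (Psi (int b + 1) (Fk.Phi x)))"
    by (rule x0_Psi) (simp add: Psi_Phi_pos x N)
  also have "\<dots> = (\<Sum>b<N. scD (bvar (Suc b)) (Psi (int b + 1) (Fk.Phi x)))"
    by (simp add: scD_def iot_def psubst_bvar)
  finally show ?thesis by (simp add: Psi_Phi_pos x Fk.Phi_sum Fk.Phi_sm)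
qed

lemma x0_2_Phi:
  assumes x: "x \<in> fk" and N: "\<And>n. n \<ge> N \<Longrightarrow> del (int n + 1) x = 0"
  shows "x0_2 (Fk.Phi x) = Fk.Phi (sm (Cst \<i>) (- (\<Sum>k<N. ins (- int k) (del (int k + 1) x))))"
proof -
  let ?v = "Fk.Phi x"
  have N': "Psi (int n + 1) ?v = 0" if "n \<ge> N" for n
    by (simp add: Psi_Phi_pos x N that)
  have "x0_2 ?v = poly_mult (Cst \<i>) (- (\<Sum>k<N. Psi (- int k) (Psi (int k + 1) ?v))
      + (\<Sum>a<N. \<Sum>b<N. poly_mult (Gam a b) (Psi (int a + 1) (Psi (int b + 1) ?v))))"
    by (rule x0_2_Psi) (rule N')
  also have "- (\<Sum>k<N. Psi (- int k) (Psi (int k + 1) ?v))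
      + (\<Sum>a<N. \<Sum>b<N. poly_mult (Gam a b) (Psi (int a + 1) (Psi (int b + 1) ?v))) =
      - (\<Sum>k<N. Md.psi' (- int k) (Md.psi' (int k + 1) ?v))"
  proof -
    have "scD (mu b a) w = - poly_mult (Gam a b) w" for a b w
      by (simp add: scD_def iot_mu poly_mult_def single_uminus)
    moreover have "(\<Sum>k<N. Md.psi' (- int k) (Md.psi' (int k + 1) ?v)) =
        (\<Sum>k<N. Psi (- int k) (Psi (int k + 1) ?v)) +
        (\<Sum>b<N. \<Sum>k<N. scD (mu k b) (Psi (int b + 1) (Psi (int k + 1) ?v)))"
      by (rule Md.sum_psi'_psi') (rule N')
    ultimately show ?thesis by (simp add: sum_negf)
  qed
  also have "(\<Sum>k<N. Md.psi' (- int k) (Md.psi' (int k + 1) ?v)) =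
      Fk.Phi (\<Sum>k<N. ins (- int k) (del (int k + 1) x))"
    by (simp add: Fk.psi_Phi x fk_del Fk.Phi_sum)
  also have "poly_mult (Cst \<i>) w = scD (Cst \<i>) w" for w
    by (simp add: scD_def iot_hom)
  finally show ?thesis
    by (simp only: Fk.Phi_sm Fk.Phi_minus)
qed

lemma psi'_charge: "v \<in> range (sg m) \<Longrightarrow> Md.psi' n v \<in> range (sg (m - 1))"
proof -
  assume "v \<in> range (sg m)"
  then obtain P where v: "v = sg m P" by blast
  obtain N where N: "\<And>b. b \<ge> N \<Longrightarrow> Psi (int b + 1) v = 0" using Md.psi_fin1 by blast
  have "Md.pA \<nu> v = sg (m - 1) (\<Sum>b<N. iot (\<nu> b) * vop HH \<sigma> (m - (int b + 1)) P)" for \<nu>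
    by (subst Md.pA_eq[of N, OF N])
      (simp_all add: v Psi_single scD_def poly_mult_def mult_single additive_sum(4)[of "sg (m - 1)", OF single_add])
  then show ?thesis unfolding Md.psi'_def by (auto simp: v Psi_single simp flip: single_add)
qed

lemma psis'_charge: "v \<in> range (sg m) \<Longrightarrow> Md.psis' n v \<in> range (sg (m + 1))"
proof -
  assume "v \<in> range (sg m)"
  then obtain P where v: "v = sg m P" by blast
  obtain N where N: "\<And>b. b \<ge> N \<Longrightarrow> Psis (- int b) v = 0" using Md.psis_fin by blast
  have "Md.pB \<nu> v = sg (m + 1) (\<Sum>b<N. iot (\<nu> b) * vop HI \<tau> (- int b - m - 1) P)" for \<nu>
    by (subst Md.pB_eq[of N, OF N])
      (simp_all add: v Psis_single scD_def poly_mult_def mult_single additive_sum(4)[of "sg (m + 1)", OF single_add])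
  then show ?thesis unfolding Md.psis'_def by (auto simp: v Psis_single simp flip: single_diff)
qed

lemma vT_charge: "finite T \<Longrightarrow> Fk.vT T \<in> range (sg (charge T))"
proof (induction T rule: finite_linorder_min_induct)
  case empty
  show ?case unfolding Fk.vT_empty by (simp add: vac_def charge_def del: single_one)
next
  case (insert b A)
  have "b \<notin> A" using insert.hyps by auto
  moreover have "Fk.vT (insert b A) = Fk.cr b (Fk.vT A)" using Fk.vT_insert_min insert.hyps by blast
  ultimately show ?case
    using psi'_charge[OF insert.IH] psis'_charge[OF insert.IH] insert.hyps
    by (simp add: charge_insert Fk.cr_def)
qed

lemma Phi_charge:
  assumes "\<And>T. T \<in> keys x \<Longrightarrow> finite T \<and> charge T = n"
  shows "Fk.Phi x \<in> range (sg n)"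
proof -
  have "scD (coef x T) (Fk.vT T) \<in> range (sg n)" if T: "T \<in> keys x" for T
  proof -
    obtain P where "Fk.vT T = sg n P" using vT_charge[of T] assms[OF T] by auto
    then show ?thesis by (simp add: scD_def poly_mult_def mult_single)
  qed
  then have "\<forall>T\<in>keys x. \<exists>P. scD (coef x T) (Fk.vT T) = sg n P" by blast
  then obtain P where "\<And>T. T \<in> keys x \<Longrightarrow> scD (coef x T) (Fk.vT T) = sg n (P T)" by metis
  then have "Fk.Phi x = sg n (\<Sum>T\<in>keys x. P T)"
    unfolding Fk.Phi_def by (simp add: additive_sum(4)[of "sg n", OF single_add])
  then show ?thesis by blast
qed

section \<open>Quotients of modules\<close>

text \<open>Distributivity in the scalar is demanded only modulo N, so that formal tensors are
  covered: there the two sides of (r + s) (a, w) = r (a, w) + s (a, w) differ by a defining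
  relation.\<close>

locale quot_setup =
  fixes R :: "('r, 'i) ring_scheme" and M :: "('r, 'a::ab_group_add, 'j) module_scheme" and N :: "'a set"
  assumes cring_R: "cring R"
    and add_M: "add M = (+)" and zero_M: "\<zero>\<^bsub>M\<^esub> = 0"
    and C_0: "0 \<in> carrier M" and C_add: "x \<in> carrier M \<Longrightarrow> y \<in> carrier M \<Longrightarrow> x + y \<in> carrier M"
    and C_minus: "x \<in> carrier M \<Longrightarrow> - x \<in> carrier M"
    and smult_C: "r \<in> carrier R \<Longrightarrow> x \<in> carrier M \<Longrightarrow> r \<odot>\<^bsub>M\<^esub> x \<in> carrier M"
    and N_C: "N \<subseteq> carrier M" and N_0: "0 \<in> N"
    and N_add: "x \<in> N \<Longrightarrow> y \<in> N \<Longrightarrow> x + y \<in> N" and N_minus: "x \<in> N \<Longrightarrow> - x \<in> N"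
    and smult_N: "r \<in> carrier R \<Longrightarrow> x \<in> N \<Longrightarrow> r \<odot>\<^bsub>M\<^esub> x \<in> N"
    and smult_add: "r \<in> carrier R \<Longrightarrow> x \<in> carrier M \<Longrightarrow> y \<in> carrier M \<Longrightarrow> r \<odot>\<^bsub>M\<^esub> (x + y) = r \<odot>\<^bsub>M\<^esub> x + r \<odot>\<^bsub>M\<^esub> y"
    and smult_assoc: "r \<in> carrier R \<Longrightarrow> s \<in> carrier R \<Longrightarrow> x \<in> carrier M \<Longrightarrow> (r \<otimes>\<^bsub>R\<^esub> s) \<odot>\<^bsub>M\<^esub> x = r \<odot>\<^bsub>M\<^esub> (s \<odot>\<^bsub>M\<^esub> x)"
    and smult_one: "x \<in> carrier M \<Longrightarrow> \<one>\<^bsub>R\<^esub> \<odot>\<^bsub>M\<^esub> x = x"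
    and smult_add_left: "r \<in> carrier R \<Longrightarrow> s \<in> carrier R \<Longrightarrow> x \<in> carrier M \<Longrightarrow>
      (r \<oplus>\<^bsub>R\<^esub> s) \<odot>\<^bsub>M\<^esub> x - (r \<odot>\<^bsub>M\<^esub> x + s \<odot>\<^bsub>M\<^esub> x) \<in> N"
begin

definition ccl :: "'a \<Rightarrow> 'a set" where "ccl x = {n + x | n. n \<in> N}"

abbreviation Q :: "('r, 'a set) module" where "Q \<equiv> quot_module M N"

lemma N_diff: "x \<in> N \<Longrightarrow> y \<in> N \<Longrightarrow> x - y \<in> N"
  using N_add[of x "- y"] N_minus[of y] by simp

lemma C_diff: "x \<in> carrier M \<Longrightarrow> y \<in> carrier M \<Longrightarrow> x - y \<in> carrier M"
  using C_add[of x "- y"] C_minus[of y] by simp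

lemma C_sum: "(\<And>a. a \<in> A \<Longrightarrow> f a \<in> carrier M) \<Longrightarrow> sum f A \<in> carrier M"
  by (induction A rule: infinite_finite_induct) (auto intro: C_0 C_add)

lemma coset_ccl: "N +>\<^bsub>M\<^esub> x = ccl x"
  by (auto simp: a_r_coset_def' ccl_def add_M)

lemma ccl_self: "x \<in> ccl x"
  using N_0 by (auto simp: ccl_def)

lemma ccl_eq: "ccl x = ccl y \<longleftrightarrow> x - y \<in> N"
proof
  assume "ccl x = ccl y"
  then have "x \<in> ccl y" using ccl_self by blast
  then show "x - y \<in> N" by (auto simp: ccl_def)
next
  assume *: "x - y \<in> N"
  show "ccl x = ccl y"
  proof (intro Set.set_eqI iffI)
    fix z assume "z \<in> ccl x"
    then obtain n where "n \<in> N" "z = n + x" by (auto simp: ccl_def)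
    then have "z = (n + (x - y)) + y" "n + (x - y) \<in> N" using * N_add by auto
    then show "z \<in> ccl y" unfolding ccl_def by blast
  next
    fix z assume "z \<in> ccl y"
    then obtain n where "n \<in> N" "z = n + y" by (auto simp: ccl_def)
    then have "z = (n - (x - y)) + x" "n - (x - y) \<in> N" using * N_diff by auto
    then show "z \<in> ccl x" unfolding ccl_def by blast
  qed
qed

lemma in_ccl: "y \<in> ccl x \<longleftrightarrow> y - x \<in> N"
  by (auto simp: ccl_def) (metis diff_add_cancel)

lemma ccl_zero: "ccl 0 = N"
  by (auto simp: ccl_def)

lemma carrier_Q: "carrier Q = ccl ` carrier M"
  by (auto simp: quot_module_def A_RCOSETS_def' coset_ccl)

lemma zero_Q: "\<zero>\<^bsub>Q\<^esub> = ccl 0"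
  by (simp add: quot_module_def ccl_zero)

lemma add_Q: "ccl x \<oplus>\<^bsub>Q\<^esub> ccl y = ccl (x + y)"
proof -
  have "ccl x \<oplus>\<^bsub>Q\<^esub> ccl y = {a + b | a b. a \<in> ccl x \<and> b \<in> ccl y}"
    by (auto simp: quot_module_def set_add_def' add_M)
  also have "\<dots> = ccl (x + y)"
  proof (intro Set.set_eqI iffI)
    fix z assume "z \<in> {a + b | a b. a \<in> ccl x \<and> b \<in> ccl y}"
    then obtain a b where "z = a + b" "a - x \<in> N" "b - y \<in> N" by (auto simp: in_ccl)
    then show "z \<in> ccl (x + y)" using N_add[of "a - x" "b - y"] by (simp add: in_ccl algebra_simps)
  next
    fix z assume "z \<in> ccl (x + y)"
    then have "z = (z - y) + y" "z - y \<in> ccl x" by (simp_all add: in_ccl algebra_simps)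
    then show "z \<in> {a + b | a b. a \<in> ccl x \<and> b \<in> ccl y}" using ccl_self by blast
  qed
  finally show ?thesis .
qed

lemma smult_diff:
  assumes "r \<in> carrier R" "x \<in> carrier M" "y \<in> carrier M"
  shows "r \<odot>\<^bsub>M\<^esub> (x - y) = r \<odot>\<^bsub>M\<^esub> x - r \<odot>\<^bsub>M\<^esub> y"
  using smult_add[of r "x - y" y] C_diff assms by (simp add: algebra_simps)

lemma smult_Q:
  assumes r: "r \<in> carrier R" and x: "x \<in> carrier M"
  shows "r \<odot>\<^bsub>Q\<^esub> ccl x = ccl (r \<odot>\<^bsub>M\<^esub> x)"
proof -
  have "ccl (r \<odot>\<^bsub>M\<^esub> y) = ccl (r \<odot>\<^bsub>M\<^esub> x)" if "y \<in> ccl x" for y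
  proof -
    have n: "y - x \<in> N" using that by (simp add: in_ccl)
    then have "y - x + x \<in> carrier M" using N_C x C_add by blast
    then have "y \<in> carrier M" by simp
    then have "r \<odot>\<^bsub>M\<^esub> y - r \<odot>\<^bsub>M\<^esub> x \<in> N" using smult_N[OF r n] smult_diff r x by simp
    then show ?thesis by (simp add: ccl_eq)
  qed
  then have "(\<Union>y\<in>ccl x. ccl (r \<odot>\<^bsub>M\<^esub> y)) = (\<Union>y\<in>ccl x. ccl (r \<odot>\<^bsub>M\<^esub> x))"
    by (intro SUP_cong refl)
  also have "\<dots> = ccl (r \<odot>\<^bsub>M\<^esub> x)" using ccl_self[of x] by blast
  finally show ?thesis by (simp add: quot_module_def coset_ccl)
qed

lemma module_Q: "Module.module R Q"
proof (rule Module.moduleI)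
  show "cring R" by (rule cring_R)
  show "abelian_group Q"
  proof (rule abelian_groupI)
    fix X assume "X \<in> carrier Q"
    then obtain x where "x \<in> carrier M" "X = ccl x" by (auto simp: carrier_Q)
    then show "\<exists>Y\<in>carrier Q. Y \<oplus>\<^bsub>Q\<^esub> X = \<zero>\<^bsub>Q\<^esub>"
      using C_minus by (intro bexI[of _ "ccl (- x)"]) (auto simp: carrier_Q add_Q zero_Q)
  next
    fix X Y assume "X \<in> carrier Q" "Y \<in> carrier Q"
    then obtain x y where *: "x \<in> carrier M" "X = ccl x" "y \<in> carrier M" "Y = ccl y" by (auto simp: carrier_Q)
    then show "X \<oplus>\<^bsub>Q\<^esub> Y \<in> carrier Q" by (simp add: carrier_Q add_Q C_add)
    show "X \<oplus>\<^bsub>Q\<^esub> Y = Y \<oplus>\<^bsub>Q\<^esub> X" unfolding * add_Q by (simp only: add.commute)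
    fix Z assume "Z \<in> carrier Q"
    then obtain z where z: "Z = ccl z" by (auto simp: carrier_Q)
    show "X \<oplus>\<^bsub>Q\<^esub> Y \<oplus>\<^bsub>Q\<^esub> Z = X \<oplus>\<^bsub>Q\<^esub> (Y \<oplus>\<^bsub>Q\<^esub> Z)" unfolding * z add_Q by (simp only: add.assoc)
  next
    show "\<zero>\<^bsub>Q\<^esub> \<in> carrier Q" using C_0 by (simp add: carrier_Q zero_Q)
    fix X assume "X \<in> carrier Q"
    then show "\<zero>\<^bsub>Q\<^esub> \<oplus>\<^bsub>Q\<^esub> X = X" by (auto simp: carrier_Q zero_Q add_Q)
  qed
next
  fix r X assume "r \<in> carrier R" "X \<in> carrier Q"
  then show "r \<odot>\<^bsub>Q\<^esub> X \<in> carrier Q" by (auto simp: carrier_Q smult_Q smult_C)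
next
  fix r s X assume rs: "r \<in> carrier R" "s \<in> carrier R" and "X \<in> carrier Q"
  then obtain x where x: "x \<in> carrier M" "X = ccl x" by (auto simp: carrier_Q)
  have "r \<oplus>\<^bsub>R\<^esub> s \<in> carrier R" using rs cring_R by (simp add: cring.cring_simprules)
  then show "(r \<oplus>\<^bsub>R\<^esub> s) \<odot>\<^bsub>Q\<^esub> X = r \<odot>\<^bsub>Q\<^esub> X \<oplus>\<^bsub>Q\<^esub> s \<odot>\<^bsub>Q\<^esub> X"
    using smult_add_left[OF rs x(1)] rs x by (simp add: smult_Q add_Q ccl_eq)
  have "r \<otimes>\<^bsub>R\<^esub> s \<in> carrier R" using rs cring_R by (simp add: cring.cring_simprules)
  then show "(r \<otimes>\<^bsub>R\<^esub> s) \<odot>\<^bsub>Q\<^esub> X = r \<odot>\<^bsub>Q\<^esub> (s \<odot>\<^bsub>Q\<^esub> X)"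
    using rs x by (simp add: smult_Q smult_assoc smult_C)
next
  fix r X Y assume "r \<in> carrier R" "X \<in> carrier Q" "Y \<in> carrier Q"
  then show "r \<odot>\<^bsub>Q\<^esub> (X \<oplus>\<^bsub>Q\<^esub> Y) = r \<odot>\<^bsub>Q\<^esub> X \<oplus>\<^bsub>Q\<^esub> r \<odot>\<^bsub>Q\<^esub> Y"
    by (auto simp: carrier_Q smult_Q add_Q smult_add C_add)
next
  fix X assume "X \<in> carrier Q"
  moreover have "\<one>\<^bsub>R\<^esub> \<in> carrier R" using cring_R by (simp add: cring.cring_simprules)
  ultimately show "\<one>\<^bsub>R\<^esub> \<odot>\<^bsub>Q\<^esub> X = X"
    by (auto simp: carrier_Q smult_Q smult_one)
qed

lemma finsum_Q:
  assumes "finite A" "f \<in> A \<rightarrow> carrier M"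
  shows "(\<Oplus>\<^bsub>Q\<^esub>a\<in>A. ccl (f a)) = ccl (sum f A)"
proof -
  interpret Module.module R Q by (rule module_Q)
  show ?thesis
    using assms
  proof (induction A)
    case empty
    then show ?case using zero_Q by simp
  next
    case (insert a A)
    then have "(\<lambda>a. ccl (f a)) \<in> A \<rightarrow> carrier Q" "ccl (f a) \<in> carrier Q" by (auto simp: carrier_Q)
    then show ?case using insert by (simp add: M.finsum_insert add_Q)
  qed
qed

end

lemma induced_map_hom:
  assumes "quot_setup R M N" "quot_setup R M' N'"
    and f: "\<And>x. x \<in> carrier M \<Longrightarrow> f x \<in> carrier M'"
    and f_N: "\<And>x. x \<in> N \<Longrightarrow> f x \<in> N'"
    and f_add: "\<And>x y. x \<in> carrier M \<Longrightarrow> y \<in> carrier M \<Longrightarrow> f (x + y) - (f x + f y) \<in> N'"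
    and f_smult: "\<And>r x. r \<in> carrier R \<Longrightarrow> x \<in> carrier M \<Longrightarrow> f (r \<odot>\<^bsub>M\<^esub> x) - r \<odot>\<^bsub>M'\<^esub> f x \<in> N'"
  shows "x \<in> carrier M \<Longrightarrow> induced_map M' N' f (quot_setup.ccl N x) = quot_setup.ccl N' (f x)"
    and "induced_map M' N' f \<in> mod_hom R (quot_module M N) (quot_module M' N')"
proof -
  interpret A: quot_setup R M N by fact
  interpret B: quot_setup R M' N' by fact
  show ccl: "induced_map M' N' f (A.ccl x) = B.ccl (f x)" if x: "x \<in> carrier M" for x
  proof -
    have "B.ccl (f y) = B.ccl (f x)" if "y \<in> A.ccl x" for y
    proof -
      have n: "y - x \<in> N" using that by (simp add: A.in_ccl)
      then have "f (y - x + x) - (f (y - x) + f x) \<in> N'" using x A.N_C by (intro f_add) auto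
      then have "f (y - x + x) - (f (y - x) + f x) + f (y - x) \<in> N'" using f_N[OF n] B.N_add by blast
      then show ?thesis by (simp add: B.ccl_eq)
    qed
    then have "(\<Union>y\<in>A.ccl x. B.ccl (f y)) = (\<Union>y\<in>A.ccl x. B.ccl (f x))"
      by (intro SUP_cong refl)
    also have "\<dots> = B.ccl (f x)" using A.ccl_self[of x] by blast
    finally show ?thesis by (simp add: induced_map_def B.coset_ccl)
  qed
  show "induced_map M' N' f \<in> mod_hom R (quot_module M N) (quot_module M' N')"
    unfolding mod_hom_def
  proof (intro CollectI conjI ballI Pi_I)
    fix X assume "X \<in> carrier A.Q"
    then obtain x where x: "x \<in> carrier M" "X = A.ccl x" by (auto simp: A.carrier_Q)
    then show "induced_map M' N' f X \<in> carrier B.Q" using f by (simp add: ccl B.carrier_Q)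
    fix Y assume "Y \<in> carrier A.Q"
    then obtain y where y: "y \<in> carrier M" "Y = A.ccl y" by (auto simp: A.carrier_Q)
    show "induced_map M' N' f (X \<oplus>\<^bsub>A.Q\<^esub> Y) = induced_map M' N' f X \<oplus>\<^bsub>B.Q\<^esub> induced_map M' N' f Y"
      using x y f_add by (simp add: A.add_Q B.add_Q ccl A.C_add B.ccl_eq)
  next
    fix r X assume r: "r \<in> carrier R" and "X \<in> carrier A.Q"
    then obtain x where x: "x \<in> carrier M" "X = A.ccl x" by (auto simp: A.carrier_Q)
    show "induced_map M' N' f (r \<odot>\<^bsub>A.Q\<^esub> X) = r \<odot>\<^bsub>B.Q\<^esub> induced_map M' N' f X"
      using r x f_smult f by (simp add: A.smult_Q B.smult_Q ccl A.smult_C B.ccl_eq)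
  qed
qed

section \<open>Transport along isomorphisms\<close>

lemma mod_homD:
  assumes "h \<in> mod_hom R M N"
  shows "x \<in> carrier M \<Longrightarrow> h x \<in> carrier N"
    "x \<in> carrier M \<Longrightarrow> y \<in> carrier M \<Longrightarrow> h (x \<oplus>\<^bsub>M\<^esub> y) = h x \<oplus>\<^bsub>N\<^esub> h y"
    "r \<in> carrier R \<Longrightarrow> x \<in> carrier M \<Longrightarrow> h (r \<odot>\<^bsub>M\<^esub> x) = r \<odot>\<^bsub>N\<^esub> h x"
  using assms by (auto simp: mod_hom_def)

lemma mod_hom_zero:
  assumes "h \<in> mod_hom R M N" "Module.module R M" "Module.module R N"
  shows "h \<zero>\<^bsub>M\<^esub> = \<zero>\<^bsub>N\<^esub>"
proof -
  interpret M: Module.module R M by fact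
  interpret N: Module.module R N by fact
  have z: "h \<zero>\<^bsub>M\<^esub> \<in> carrier N" by (rule mod_homD[OF assms(1)]) simp
  have "h \<zero>\<^bsub>M\<^esub> \<oplus>\<^bsub>N\<^esub> h \<zero>\<^bsub>M\<^esub> = h \<zero>\<^bsub>M\<^esub>"
    using mod_homD(2)[OF assms(1), of "\<zero>\<^bsub>M\<^esub>" "\<zero>\<^bsub>M\<^esub>"] by simp
  then show ?thesis using z by (simp add: N.M.add.r_cancel_one)
qed

lemma mod_hom_finsum:
  assumes "h \<in> mod_hom R M N" "Module.module R M" "Module.module R N" "finite A" "f \<in> A \<rightarrow> carrier M"
  shows "h (\<Oplus>\<^bsub>M\<^esub>a\<in>A. f a) = (\<Oplus>\<^bsub>N\<^esub>a\<in>A. h (f a))"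
proof -
  interpret M: Module.module R M by fact
  interpret N: Module.module R N by fact
  show ?thesis
    using assms(4,5)
  proof (induction A)
    case empty
    then show ?case using mod_hom_zero[OF assms(1-3)] by simp
  next
    case (insert a A)
    then have "f \<in> A \<rightarrow> carrier M" "f a \<in> carrier M" "(\<lambda>a. h (f a)) \<in> A \<rightarrow> carrier N" "h (f a) \<in> carrier N"
      using mod_homD(1)[OF assms(1)] by auto
    then show ?case using insert by (simp add: mod_homD(2)[OF assms(1)])
  qed
qed

lemma mod_iso_inverse:
  assumes "h \<in> mod_iso R M N" "Module.module R M"
  shows "inv_into (carrier M) h \<in> mod_iso R N M"
proof -
  let ?g = "inv_into (carrier M) h"
  interpret M: Module.module R M by fact
  have hom: "h \<in> mod_hom R M N" and bij: "bij_betw h (carrier M) (carrier N)"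
    using assms(1) by (auto simp: mod_iso_def)
  have bij': "bij_betw ?g (carrier N) (carrier M)" by (rule bij_betw_inv_into[OF bij])
  have g: "?g y \<in> carrier M" "h (?g y) = y" if "y \<in> carrier N" for y
    using bij_betwE[OF bij'] bij that by (auto simp: bij_betw_inv_into_right)
  have gi: "?g (h x) = x" if "x \<in> carrier M" for x
    using bij that by (simp add: bij_betw_inv_into_left)
  have "?g (y \<oplus>\<^bsub>N\<^esub> z) = ?g y \<oplus>\<^bsub>M\<^esub> ?g z" if "y \<in> carrier N" "z \<in> carrier N" for y z
    using gi[of "?g y \<oplus>\<^bsub>M\<^esub> ?g z"] mod_homD(2)[OF hom, of "?g y" "?g z"] g that by simp
  moreover have "?g (r \<odot>\<^bsub>N\<^esub> y) = r \<odot>\<^bsub>M\<^esub> ?g y" if "r \<in> carrier R" "y \<in> carrier N" for r y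
    using gi[of "r \<odot>\<^bsub>M\<^esub> ?g y"] mod_homD(3)[OF hom, of r "?g y"] g that by simp
  ultimately show ?thesis using bij' g by (auto simp: mod_iso_def mod_hom_def)
qed

lemma mod_hom_compose:
  "f \<in> mod_hom R M N \<Longrightarrow> g \<in> mod_hom R N P \<Longrightarrow> (\<lambda>x. g (f x)) \<in> mod_hom R M P"
  by (auto simp: mod_hom_def Pi_iff)

lemma is_basis_iso:
  assumes h: "h \<in> mod_iso R M N" and M: "Module.module R M" and N: "Module.module R N"
    and B: "is_basis R M B"
  shows "is_basis R N (h ` B)"
  unfolding is_basis_def
proof (intro conjI ballI)
  interpret M: Module.module R M by fact
  interpret N: Module.module R N by fact
  have hom: "h \<in> mod_hom R M N" and bij: "bij_betw h (carrier M) (carrier N)"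
    using h by (auto simp: mod_iso_def)
  have BM: "B \<subseteq> carrier M" using B by (simp add: is_basis_def)
  then have inj: "inj_on h B" using bij by (meson bij_betw_def inj_on_subset)
  show "h ` B \<subseteq> carrier N" using BM mod_homD(1)[OF hom] by auto
  let ?P = "\<lambda>x c. c \<in> B \<rightarrow> carrier R \<and> (\<forall>b. b \<notin> B \<longrightarrow> c b = \<zero>\<^bsub>R\<^esub>) \<and> finite {b. c b \<noteq> \<zero>\<^bsub>R\<^esub>} \<and>
    x = (\<Oplus>\<^bsub>M\<^esub>b\<in>{b. c b \<noteq> \<zero>\<^bsub>R\<^esub>}. c b \<odot>\<^bsub>M\<^esub> b)"
  let ?P' = "\<lambda>y c. c \<in> h ` B \<rightarrow> carrier R \<and> (\<forall>b. b \<notin> h ` B \<longrightarrow> c b = \<zero>\<^bsub>R\<^esub>) \<and> finite {b. c b \<noteq> \<zero>\<^bsub>R\<^esub>} \<and>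
    y = (\<Oplus>\<^bsub>N\<^esub>b\<in>{b. c b \<noteq> \<zero>\<^bsub>R\<^esub>}. c b \<odot>\<^bsub>N\<^esub> b)"
  \<comment> \<open>\<open>up\<close> and \<open>dn\<close> carry coefficient families along h and
    back; both are extended by 0 off the basis, as \<open>is_basis\<close> prescribes.\<close>
  define up where "up = (\<lambda>c b'. if b' \<in> h ` B then c (inv_into B h b') else \<zero>\<^bsub>R\<^esub>)"
  define dn where "dn = (\<lambda>c b. if b \<in> B then c (h b) else \<zero>\<^bsub>R\<^esub>)"
  have sum: "h (\<Oplus>\<^bsub>M\<^esub>b\<in>{b. c b \<noteq> \<zero>\<^bsub>R\<^esub>}. c b \<odot>\<^bsub>M\<^esub> b) = (\<Oplus>\<^bsub>N\<^esub>b\<in>{b. c' b \<noteq> \<zero>\<^bsub>R\<^esub>}. c' b \<odot>\<^bsub>N\<^esub> b)"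
    if c: "c \<in> B \<rightarrow> carrier R" "\<forall>b. b \<notin> B \<longrightarrow> c b = \<zero>\<^bsub>R\<^esub>" "finite {b. c b \<noteq> \<zero>\<^bsub>R\<^esub>}"
      and c': "\<forall>b. b \<notin> h ` B \<longrightarrow> c' b = \<zero>\<^bsub>R\<^esub>" "\<And>b. b \<in> B \<Longrightarrow> c' (h b) = c b" for c c'
  proof -
    let ?A = "{b. c b \<noteq> \<zero>\<^bsub>R\<^esub>}"
    have A: "?A \<subseteq> B" using c by blast
    have A': "{b. c' b \<noteq> \<zero>\<^bsub>R\<^esub>} = h ` ?A"
      using c' A by force
    have cM: "(\<lambda>b. c b \<odot>\<^bsub>M\<^esub> b) \<in> ?A \<rightarrow> carrier M" using A c BM by (auto simp: Pi_iff subset_iff)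
    have "h (\<Oplus>\<^bsub>M\<^esub>b\<in>?A. c b \<odot>\<^bsub>M\<^esub> b) = (\<Oplus>\<^bsub>N\<^esub>b\<in>?A. h (c b \<odot>\<^bsub>M\<^esub> b))"
      by (rule mod_hom_finsum[OF hom M N c(3) cM])
    also have "\<dots> = (\<Oplus>\<^bsub>N\<^esub>b\<in>?A. c' (h b) \<odot>\<^bsub>N\<^esub> h b)"
    proof (rule N.M.finsum_cong')
      fix b assume b: "b \<in> ?A"
      then have "b \<in> B" "c b \<in> carrier R" "b \<in> carrier M" using A c BM by auto
      then show "h (c b \<odot>\<^bsub>M\<^esub> b) = c' (h b) \<odot>\<^bsub>N\<^esub> h b"
        using mod_homD(3)[OF hom] c'(2) by simp
    next
      show "(\<lambda>b. c' (h b) \<odot>\<^bsub>N\<^esub> h b) \<in> ?A \<rightarrow> carrier N"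
        using A c BM c'(2) mod_homD(1)[OF hom] by (auto simp: Pi_iff subset_iff)
    qed simp
    also have "\<dots> = (\<Oplus>\<^bsub>N\<^esub>b\<in>h ` ?A. c' b \<odot>\<^bsub>N\<^esub> b)"
    proof (rule N.M.finsum_reindex[symmetric])
      show "(\<lambda>b. c' b \<odot>\<^bsub>N\<^esub> b) \<in> h ` ?A \<rightarrow> carrier N"
        using A c BM c'(2) mod_homD(1)[OF hom] by (auto simp: Pi_iff subset_iff)
      show "inj_on h ?A" using inj A by (rule inj_on_subset)
    qed
    finally show ?thesis unfolding A' .
  qed
  fix y assume "y \<in> carrier N"
  then obtain x where x: "x \<in> carrier M" "y = h x" using bij by (auto simp: bij_betw_def)
  then have "\<exists>!c. ?P x c" using B by (auto simp: is_basis_def)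
  then obtain c where c: "?P x c" and uniq: "\<forall>e. ?P x e \<longrightarrow> e = c" by (rule ex1E)
  have up_h: "up c (h b) = c b" if "b \<in> B" for b
    using that inj by (simp add: up_def)
  have fin_up: "finite {b. up c b \<noteq> \<zero>\<^bsub>R\<^esub>}"
  proof (rule finite_subset)
    show "{b. up c b \<noteq> \<zero>\<^bsub>R\<^esub>} \<subseteq> h ` {b. c b \<noteq> \<zero>\<^bsub>R\<^esub>}"
    proof
      fix b' assume "b' \<in> {b. up c b \<noteq> \<zero>\<^bsub>R\<^esub>}"
      then have nz: "up c b' \<noteq> \<zero>\<^bsub>R\<^esub>" by simp
      then have "b' \<in> h ` B" by (metis up_def)
      then obtain b where "b \<in> B" "b' = h b" by blast
      with nz show "b' \<in> h ` {b. c b \<noteq> \<zero>\<^bsub>R\<^esub>}" using up_h by auto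
    qed
    show "finite (h ` {b. c b \<noteq> \<zero>\<^bsub>R\<^esub>})" using c by simp
  qed
  show "\<exists>!c. ?P' y c"
  proof (rule ex1I)
    show "?P' y (up c)"
    proof (intro conjI)
      show "up c \<in> h ` B \<rightarrow> carrier R" using c up_h by auto
      show "\<forall>b. b \<notin> h ` B \<longrightarrow> up c b = \<zero>\<^bsub>R\<^esub>" by (simp add: up_def)
      then show "y = (\<Oplus>\<^bsub>N\<^esub>b\<in>{b. up c b \<noteq> \<zero>\<^bsub>R\<^esub>}. up c b \<odot>\<^bsub>N\<^esub> b)"
        using sum[of c "up c"] c x up_h by simp
    qed (rule fin_up)
  next
    fix e assume e: "?P' y e"
    have dn_h: "\<And>b. b \<in> B \<Longrightarrow> e (h b) = dn e b" by (simp add: dn_def)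
    have dn: "dn e \<in> B \<rightarrow> carrier R" "\<forall>b. b \<notin> B \<longrightarrow> dn e b = \<zero>\<^bsub>R\<^esub>"
      using e by (auto simp: dn_def)
    have fin: "finite {b. dn e b \<noteq> \<zero>\<^bsub>R\<^esub>}"
    proof (rule inj_on_finite[of h])
      show "inj_on h {b. dn e b \<noteq> \<zero>\<^bsub>R\<^esub>}" using inj by (rule inj_on_subset) (auto simp: dn_def)
      show "h ` {b. dn e b \<noteq> \<zero>\<^bsub>R\<^esub>} \<subseteq> {b. e b \<noteq> \<zero>\<^bsub>R\<^esub>}" by (auto simp: dn_def split: if_splits)
      show "finite {b. e b \<noteq> \<zero>\<^bsub>R\<^esub>}" using e by blast
    qed
    have eq: "h (\<Oplus>\<^bsub>M\<^esub>b\<in>{b. dn e b \<noteq> \<zero>\<^bsub>R\<^esub>}. dn e b \<odot>\<^bsub>M\<^esub> b) = h x"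
      using sum[OF dn fin, of e] e dn_h x by simp
    have cl: "(\<Oplus>\<^bsub>M\<^esub>b\<in>{b. dn e b \<noteq> \<zero>\<^bsub>R\<^esub>}. dn e b \<odot>\<^bsub>M\<^esub> b) \<in> carrier M"
      using dn BM by (intro M.M.finsum_closed) (auto simp: Pi_iff subset_iff)
    have "inj_on h (carrier M)" using bij by (simp add: bij_betw_def)
    from inj_onD[OF this eq cl x(1)]
    have "x = (\<Oplus>\<^bsub>M\<^esub>b\<in>{b. dn e b \<noteq> \<zero>\<^bsub>R\<^esub>}. dn e b \<odot>\<^bsub>M\<^esub> b)" by (rule sym)
    with dn fin have "?P x (dn e)" by (intro conjI)
    then have "dn e = c" by (rule uniq[rule_format])
    then show "e = up c"
    proof (intro ext)
      fix b' show "e b' = up c b'"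
        using \<open>dn e = c\<close> e up_h dn_h by (cases "b' \<in> h ` B") (auto simp: up_def)
    qed
  qed
qed

lemma free_module_iso:
  "h \<in> mod_iso R M N \<Longrightarrow> Module.module R N \<Longrightarrow> free_module R M \<Longrightarrow> free_module R N"
  unfolding free_module_def using is_basis_iso by blast

lemma free_resolution_iso:
  assumes res: "free_resolution R P d \<epsilon> A" and iso: "\<And>k. \<phi> k \<in> mod_iso R (P k) (P' k)"
    and P': "\<And>k. Module.module R (P' k)"
  shows "\<exists>d' \<epsilon>'. (\<forall>k. \<forall>X\<in>carrier (P (Suc k)). d' k (\<phi> (Suc k) X) = \<phi> k (d k X)) \<and>
    (\<forall>X\<in>carrier (P 0). \<epsilon>' (\<phi> 0 X) = \<epsilon> X) \<and> free_resolution R P' d' \<epsilon>' A"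
proof -
  have P: "\<And>k. Module.module R (P k)" "\<And>k. free_module R (P k)"
    and d: "\<And>k. d k \<in> mod_hom R (P (Suc k)) (P k)" and \<epsilon>: "\<epsilon> \<in> mod_hom R (P 0) A" "\<epsilon> ` carrier (P 0) = carrier A"
    and A: "Module.module R A"
    and ex0: "a_kernel (P 0) A \<epsilon> = d 0 ` carrier (P 1)"
    and ex: "\<And>k. a_kernel (P (Suc k)) (P k) (d k) = d (Suc k) ` carrier (P (Suc (Suc k)))"
    using res by (auto simp: free_resolution_def resolution_def)
  define g where "g = (\<lambda>k. inv_into (carrier (P k)) (\<phi> k))"
  have hom: "\<phi> k \<in> mod_hom R (P k) (P' k)" and bij: "bij_betw (\<phi> k) (carrier (P k)) (carrier (P' k))" for k
    using iso[of k] by (auto simp: mod_iso_def)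
  have giso: "g k \<in> mod_iso R (P' k) (P k)" for k
    unfolding g_def by (rule mod_iso_inverse[OF iso P(1)])
  then have ghom: "g k \<in> mod_hom R (P' k) (P k)" and gbij: "bij_betw (g k) (carrier (P' k)) (carrier (P k))" for k
    by (auto simp: mod_iso_def)
  have g\<phi>: "g k (\<phi> k X) = X" if "X \<in> carrier (P k)" for k X
    using bij[of k] that by (simp add: g_def bij_betw_inv_into_left)
  have \<phi>g: "\<phi> k (g k Y) = Y" if "Y \<in> carrier (P' k)" for k Y
    using bij[of k] that by (simp add: g_def bij_betw_inv_into_right)
  have gim: "g k ` carrier (P' k) = carrier (P k)" and \<phi>im: "\<phi> k ` carrier (P k) = carrier (P' k)" for k
    using gbij[of k] bij[of k] by (simp_all add: bij_betw_def)
  define d' where "d' = (\<lambda>k Y. \<phi> k (d k (g (Suc k) Y)))"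
  define \<epsilon>' where "\<epsilon>' = (\<lambda>Y. \<epsilon> (g 0 Y))"
  have d'hom: "d' k \<in> mod_hom R (P' (Suc k)) (P' k)" for k
    unfolding d'_def by (rule mod_hom_compose[OF mod_hom_compose[OF ghom d] hom])
  have \<epsilon>'hom: "\<epsilon>' \<in> mod_hom R (P' 0) A"
    unfolding \<epsilon>'_def by (rule mod_hom_compose[OF ghom \<epsilon>(1)])
  have d'im: "d' k ` carrier (P' (Suc k)) = \<phi> k ` d k ` carrier (P (Suc k))" for k
    unfolding d'_def gim[symmetric] by (simp add: image_image)
  have ker: "{Y \<in> carrier (P' k). F (g k Y)} = \<phi> k ` {X \<in> carrier (P k). F X}" for k F
  proof (intro Set.set_eqI iffI)
    fix Y assume Y: "Y \<in> {Y \<in> carrier (P' k). F (g k Y)}"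
    then have "g k Y \<in> {X \<in> carrier (P k). F X}" using mod_homD(1)[OF ghom] by auto
    then show "Y \<in> \<phi> k ` {X \<in> carrier (P k). F X}" using \<phi>g Y by (metis (no_types, lifting) image_eqI mem_Collect_eq)
  next
    fix Y assume "Y \<in> \<phi> k ` {X \<in> carrier (P k). F X}"
    then show "Y \<in> {Y \<in> carrier (P' k). F (g k Y)}" using g\<phi> mod_homD(1)[OF hom] by auto
  qed
  have kerd: "a_kernel (P' (Suc k)) (P' k) (d' k) = \<phi> (Suc k) ` a_kernel (P (Suc k)) (P k) (d k)" for k
  proof -
    have inj: "\<phi> k Z = \<zero>\<^bsub>P' k\<^esub> \<longleftrightarrow> Z = \<zero>\<^bsub>P k\<^esub>" if "Z \<in> carrier (P k)" for Z
    proof -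
      have "\<phi> k \<zero>\<^bsub>P k\<^esub> = \<zero>\<^bsub>P' k\<^esub>" by (rule mod_hom_zero[OF hom P(1) P'])
      moreover have "\<zero>\<^bsub>P k\<^esub> \<in> carrier (P k)"
        using P(1)[of k] by (simp add: Module.module_def abelian_group.axioms abelian_monoid.zero_closed)
      ultimately show ?thesis using bij[of k] that by (metis bij_betw_def inj_onD)
    qed
    have "a_kernel (P' (Suc k)) (P' k) (d' k) = {Y \<in> carrier (P' (Suc k)). d k (g (Suc k) Y) = \<zero>\<^bsub>P k\<^esub>}"
      unfolding a_kernel_def' d'_def using inj mod_homD(1)[OF d] mod_homD(1)[OF ghom] by blast
    also have "\<dots> = \<phi> (Suc k) ` {X \<in> carrier (P (Suc k)). d k X = \<zero>\<^bsub>P k\<^esub>}" by (rule ker)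
    finally show ?thesis unfolding a_kernel_def' .
  qed
  have ker\<epsilon>: "a_kernel (P' 0) A \<epsilon>' = \<phi> 0 ` a_kernel (P 0) A \<epsilon>"
    unfolding a_kernel_def' \<epsilon>'_def by (rule ker)
  have "resolution R P' d' \<epsilon>' A"
    unfolding resolution_def
  proof (intro conjI allI)
    show "\<epsilon>' ` carrier (P' 0) = carrier A"
      unfolding \<epsilon>'_def \<epsilon>(2)[symmetric] gim[symmetric] by (simp add: image_image)
    show "a_kernel (P' 0) A \<epsilon>' = d' 0 ` carrier (P' 1)"
      unfolding ker\<epsilon> ex0 using d'im[of 0] by simp
    show "a_kernel (P' (Suc k)) (P' k) (d' k) = d' (Suc k) ` carrier (P' (Suc (Suc k)))" for k
      unfolding kerd ex d'im ..
  qed (fact P' A d'hom \<epsilon>'hom)+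
  moreover have "free_module R (P' k)" for k by (rule free_module_iso[OF iso P' P(2)])
  ultimately have "free_resolution R P' d' \<epsilon>' A" by (simp add: free_resolution_def)
  moreover have "d' k (\<phi> (Suc k) X) = \<phi> k (d k X)" if "X \<in> carrier (P (Suc k))" for k X
    using g\<phi>[OF that] by (simp add: d'_def)
  moreover have "\<epsilon>' (\<phi> 0 X) = \<epsilon> X" if "X \<in> carrier (P 0)" for X
    using g\<phi>[OF that] by (simp add: \<epsilon>'_def)
  ultimately show ?thesis by blast
qed

section \<open>The modules of the resolution\<close>

lemma D_ops: "x \<oplus>\<^bsub>D_alg\<^esub> y = x + y" "x \<otimes>\<^bsub>D_alg\<^esub> y = x * y" "\<one>\<^bsub>D_alg\<^esub> = 1" "\<zero>\<^bsub>D_alg\<^esub> = 0"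
  "c \<odot>\<^bsub>D_alg\<^esub> x = Cst c * x"
  by (simp_all add: D_alg_def)

lemma cring_D: "cring D_alg"
proof (rule cringI)
  show "abelian_group D_alg"
  proof (rule abelian_groupI)
    fix x assume "x \<in> carrier D_alg"
    then show "\<exists>y\<in>carrier D_alg. y \<oplus>\<^bsub>D_alg\<^esub> x = \<zero>\<^bsub>D_alg\<^esub>"
      by (intro bexI[of _ "- x"]) (simp_all add: Dset_minus D_ops)
  qed (simp_all add: Dset_add D_ops add_ac)
  show "comm_monoid D_alg"
    by (rule comm_monoidI) (simp_all add: Dset_mult D_ops mult_ac)
qed (simp add: D_ops distrib_right)

lemma V_ops: "carrier (V_mod n) = range (sg n)" "add (V_mod n) = (+)" "\<zero>\<^bsub>V_mod n\<^esub> = 0"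
  "smult (V_mod n) = poly_mult"
  by (simp_all add: V_mod_def)

lemma poly_mult_simps: "poly_mult p (v + w) = poly_mult p v + poly_mult p w"
  "poly_mult (p + q) v = poly_mult p v + poly_mult q v" "poly_mult (p * q) v = poly_mult p (poly_mult q v)"
  "poly_mult 1 v = v" "poly_mult p (sg n P) = sg n (p * P)"
  by (simp_all add: poly_mult_def distrib_left distrib_right single_add mult_single flip: mult.assoc)

lemma quot_setup_V:
  assumes "N \<subseteq> range (sg n)" "0 \<in> N" "\<And>x y. x \<in> N \<Longrightarrow> y \<in> N \<Longrightarrow> x + y \<in> N" "\<And>x. x \<in> N \<Longrightarrow> - x \<in> N"
    "\<And>d x. d \<in> Dset \<Longrightarrow> x \<in> N \<Longrightarrow> poly_mult d x \<in> N"
  shows "quot_setup D_alg (V_mod n) N"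
proof (rule quot_setup.intro)
  show "0 \<in> carrier (V_mod n)" using single_zero[of n] unfolding V_ops by (metis rangeI)
qed (use assms in \<open>auto simp: cring_D V_ops D_ops poly_mult_simps simp flip: single_add single_uminus\<close>)

section \<open>The submodules on the fermionic side\<close>

abbreviation "Phi \<equiv> Fk.Phi"

lemma coef_range: "v \<in> range (sg n) \<Longrightarrow> j \<noteq> n \<Longrightarrow> coef v j = 0"
  by (auto simp: lookup_single when_def)

lemma Phi_fkc: "x \<in> fkc n \<Longrightarrow> Phi x \<in> range (sg n)"
  by (rule Phi_charge) (auto simp: fkc_def)

lemma Phi_onto: "v \<in> range (sg n) \<Longrightarrow> \<exists>x\<in>fkc n. Phi x = v"
proof -
  assume v: "v \<in> range (sg n)"
  obtain x where x: "x \<in> fk" "Phi x = v" using Phi_surj[of v] by blast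
  let ?A = "{T \<in> keys x. charge T = n}" and ?B = "{T \<in> keys x. charge T \<noteq> n}"
  define y where "y = (\<Sum>T\<in>?A. sg T (coef x T))"
  define z where "z = (\<Sum>T\<in>?B. sg T (coef x T))"
  have fin: "finite T" if "T \<in> keys x" for T using x(1) that by (auto simp: fk_def)
  have "x = (\<Sum>T\<in>keys x. sg T (coef x T))" by (rule sum_single[symmetric])
  also have "keys x = ?A \<union> ?B" by auto
  also have "(\<Sum>T\<in>?A \<union> ?B. sg T (coef x T)) = y + z"
    unfolding y_def z_def by (rule sum.union_disjoint) auto
  finally have xyz: "x = y + z" .
  have y: "y \<in> fkc n"
    unfolding y_def using fin by (intro fkc_sum) (auto simp: fkc_def split: if_splits)
  have "coef (Phi z) n = 0"
  proof -
    have "coef (scD d (Fk.vT T)) n = 0" if "T \<in> ?B" for T d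
      using vT_charge[of T] fin that by (auto simp: scD_def coef_poly_mult coef_range)
    then show ?thesis by (simp add: z_def Fk.Phi_sum Fk.Phi_single lookup_sum)
  qed
  moreover have "v = Phi y + Phi z" using x(2) by (simp only: xyz Fk.Phi_add)
  ultimately have "coef (Phi y) n = coef v n" by (simp add: lookup_add)
  moreover have "coef (Phi y) j = coef v j" if "j \<noteq> n" for j
    using that coef_range[OF v] coef_range[OF Phi_fkc[OF y]] by simp
  ultimately have "Phi y = v" by (intro poly_mapping_eqI) metis
  then show ?thesis using y by blast
qed

lemma fkc_diff: "v \<in> fkc n \<Longrightarrow> w \<in> fkc n \<Longrightarrow> v - w \<in> fkc n"
  using fkc_add[of v n "- w"] fkc_minus[of w n] by simp

lemma fk_minus: "v \<in> fk \<Longrightarrow> - v \<in> fk"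
  by (simp add: fk_def)

lemma fk_diff: "v \<in> fk \<Longrightarrow> w \<in> fk \<Longrightarrow> v - w \<in> fk"
  using fk_add[of v "- w"] fk_minus[of w] by simp

lemma om_minus: "x \<in> fk \<Longrightarrow> om (- x) = - om x"
proof -
  have m: "- z = sm (- 1) z" for z :: "int set \<Rightarrow>\<^sub>0 'a" by (rule poly_mapping_eqI) (simp add: coef_sm)
  assume "x \<in> fk"
  then show "om (- x) = - om x" unfolding m by (rule om_sm)
qed

lemma kap_diff: "x \<in> fk \<Longrightarrow> y \<in> fk \<Longrightarrow> kap (x - y) = kap x - kap y"
proof -
  have m: "- z = sm (- 1) z" for z :: "int set \<Rightarrow>\<^sub>0 complex bpoly" by (rule poly_mapping_eqI) (simp add: coef_sm)
  assume "x \<in> fk" "y \<in> fk"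
  then show ?thesis
    using kap_add[of x "- y"] fk_minus[of y] kap_sm[of y "- 1"] by (simp flip: m)
qed

lemma om_0 [simp]: "om 0 = 0"
  by (subst om_eq[of 0]) auto

lemma Phi_eq_iff: "x \<in> fk \<Longrightarrow> y \<in> fk \<Longrightarrow> Phi x = Phi y \<longleftrightarrow> x = y"
proof
  assume "x \<in> fk" "y \<in> fk" "Phi x = Phi y"
  then have "Phi (x - y) = 0" "x - y \<in> fk"
    using additive_sum(3)[of Phi, OF Fk.Phi_add] fk_diff by auto
  then show "x = y" using Phi_inj[of "x - y"] by simp
qed simp

lemma x0_Phi_kap: "x \<in> fk \<Longrightarrow> x0 (Phi x) = Phi (kap x)"
proof -
  assume x: "x \<in> fk"
  then obtain N where N: "\<And>n. n \<ge> N \<Longrightarrow> del (int n + 1) x = 0" using del_bound by blast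
  have "kap x = (\<Sum>j<N. sm (bvar (Suc j)) (del (int j + 1) x))" by (rule kap_eq) (rule N)
  moreover have "x0 (Phi x) = Phi (\<Sum>j<N. sm (bvar (Suc j)) (del (int j + 1) x))" by (rule x0_Phi[OF x]) (rule N)
  ultimately show ?thesis by simp
qed

lemma x0_2_Phi_om: "x \<in> fk \<Longrightarrow> x0_2 (Phi x) = Phi (om (sm (Cst \<i>) x))"
proof -
  assume x: "x \<in> fk"
  then obtain N where N: "\<And>n. n \<ge> N \<Longrightarrow> del (int n + 1) x = 0" using del_bound by blast
  have "om x = - (\<Sum>k<N. ins (- int k) (del (int k + 1) x))" by (rule om_eq) (rule N)
  moreover have "x0_2 (Phi x) = Phi (sm (Cst \<i>) (- (\<Sum>k<N. ins (- int k) (del (int k + 1) x))))"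
    by (rule x0_2_Phi[OF x]) (rule N)
  ultimately show ?thesis by (simp add: om_sm[OF x])
qed

lemma poly_mult_Phi: "d \<in> Dset \<Longrightarrow> poly_mult d (Phi x) = Phi (sm (eta d) x)"
proof -
  assume "d \<in> Dset"
  then have "poly_mult d v = scD (eta d) v" for v by (simp add: scD_def iot_eta)
  then show ?thesis by (simp add: Fk.Phi_sm)
qed

lemma Q_sub_eq: "Q_sub n = Phi ` om ` fkc (n + 2)"
proof
  show "Q_sub n \<subseteq> Phi ` om ` fkc (n + 2)"
  proof
    fix v assume "v \<in> Q_sub n"
    then obtain u where u: "u \<in> range (sg (n + 2))" "v = x0_2 u" by (auto simp: Q_sub_def V_ops)
    then obtain x where "x \<in> fkc (n + 2)" "Phi x = u" using Phi_onto by blast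
    then show "v \<in> Phi ` om ` fkc (n + 2)"
      using u(2) by (auto simp: x0_2_Phi_om fkc_fk intro!: imageI fkc_sm)
  qed
  show "Phi ` om ` fkc (n + 2) \<subseteq> Q_sub n"
  proof
    fix v assume "v \<in> Phi ` om ` fkc (n + 2)"
    then obtain x where x: "x \<in> fkc (n + 2)" "v = Phi (om x)" by blast
    \<comment> \<open>The scalar is the inverse of the factor by which the divided square differs
      from omega.\<close>
    let ?y = "sm (Cst (- \<i>)) x"
    have y: "?y \<in> fkc (n + 2)" using x(1) by (rule fkc_sm)
    have "sm (Cst \<i>) ?y = x" by (simp add: sm_sm mult_single sm_one)
    then have "x0_2 (Phi ?y) = v" using x0_2_Phi_om[OF fkc_fk[OF y]] x(2) by simp
    then show "v \<in> Q_sub n" using Phi_fkc[OF y] unfolding Q_sub_def V_ops by blast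
  qed
qed

lemma x0_image: "x0 ` range (sg (n + 1)) = Phi ` kap ` fkc (n + 1)"
proof
  show "x0 ` range (sg (n + 1)) \<subseteq> Phi ` kap ` fkc (n + 1)"
  proof
    fix v assume "v \<in> x0 ` range (sg (n + 1))"
    then obtain u where u: "u \<in> range (sg (n + 1))" "v = x0 u" by blast
    then obtain x where "x \<in> fkc (n + 1)" "Phi x = u" using Phi_onto by blast
    then show "v \<in> Phi ` kap ` fkc (n + 1)"
      using u(2) by (auto simp: x0_Phi_kap fkc_fk)
  qed
  show "Phi ` kap ` fkc (n + 1) \<subseteq> x0 ` range (sg (n + 1))"
  proof safe
    fix x :: "int set \<Rightarrow>\<^sub>0 complex bpoly" assume x: "x \<in> fkc (n + 1)"
    show "Phi (kap x) \<in> x0 ` range (sg (n + 1))"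
      by (rule image_eqI[of _ _ "Phi x"]) (simp_all only: x0_Phi_kap fkc_fk[OF x] Phi_fkc[OF x])
  qed
qed

lemma A_sub_eq: "A_sub n = {Phi (kap x + om y) | x y. x \<in> fkc (n + 1) \<and> y \<in> fkc (n + 2)}"
proof -
  have "A_sub n = {u + v | u v. u \<in> Phi ` kap ` fkc (n + 1) \<and> v \<in> Phi ` om ` fkc (n + 2)}"
    unfolding A_sub_def V_ops(1) x0_image Q_sub_eq[unfolded Q_sub_def V_ops(1)]
    by (auto simp: set_add_def' V_ops)
  also have "\<dots> = {Phi (kap x + om y) | x y. x \<in> fkc (n + 1) \<and> y \<in> fkc (n + 2)}"
    unfolding Fk.Phi_add by blast
  finally show ?thesis .
qed

lemma om_fkcI: "x \<in> fkc c \<Longrightarrow> c = d + 2 \<Longrightarrow> om x \<in> fkc d"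
  using om_fkc[of x c] by simp

lemma kap_fkcI: "x \<in> fkc c \<Longrightarrow> c = d + 1 \<Longrightarrow> kap x \<in> fkc d"
  using kap_fkc[of x c] by simp

lemma om_fkc': "x \<in> fkc (n + 2) \<Longrightarrow> om x \<in> fkc n"
  using om_fkc[of x "n + 2"] by simp

lemma kap_fkc': "x \<in> fkc (n + 1) \<Longrightarrow> kap x \<in> fkc n"
  using kap_fkc[of x "n + 1"] by simp

lemma quot_setup_Q: "quot_setup D_alg (V_mod n) (Q_sub n)"
proof (rule quot_setup_V)
  show "Q_sub n \<subseteq> range (sg n)"
    unfolding Q_sub_eq using Phi_fkc[OF om_fkc'] by blast
  show "0 \<in> Q_sub n"
    unfolding Q_sub_eq using fkc_0[of "n + 2"] by (intro image_eqI[of _ _ "om 0"] image_eqI[of _ _ 0]) auto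
next
  fix u v assume "u \<in> Q_sub n" "v \<in> Q_sub n"
  then obtain x y where *: "x \<in> fkc (n + 2)" "u = Phi (om x)" "y \<in> fkc (n + 2)" "v = Phi (om y)"
    unfolding Q_sub_eq by blast
  then have "u + v = Phi (om (x + y))" by (simp add: om_add fkc_fk Fk.Phi_add)
  then show "u + v \<in> Q_sub n" unfolding Q_sub_eq using * fkc_add by blast
next
  fix u assume "u \<in> Q_sub n"
  then obtain x where *: "x \<in> fkc (n + 2)" "u = Phi (om x)" unfolding Q_sub_eq by blast
  then have "- u = Phi (om (- x))" by (simp add: om_minus fkc_fk Fk.Phi_minus)
  then show "- u \<in> Q_sub n" unfolding Q_sub_eq using * fkc_minus by blast
next
  fix d u assume d: "d \<in> Dset" and "u \<in> Q_sub n"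
  then obtain x where *: "x \<in> fkc (n + 2)" "u = Phi (om x)" unfolding Q_sub_eq by blast
  then have "poly_mult d u = Phi (om (sm (eta d) x))" by (simp add: om_sm fkc_fk poly_mult_Phi[OF d])
  then show "poly_mult d u \<in> Q_sub n" unfolding Q_sub_eq using * fkc_sm by blast
qed

lemma quot_setup_A: "quot_setup D_alg (V_mod n) (A_sub n)"
proof (rule quot_setup_V)
  show "A_sub n \<subseteq> range (sg n)"
    unfolding A_sub_eq using Phi_fkc[OF fkc_add[OF kap_fkc' om_fkc']] by blast
  have "kap 0 = 0" by (subst kap_eq[of 0]) auto
  then have "0 = Phi (kap 0 + om 0)" by simp
  then show "0 \<in> A_sub n" unfolding A_sub_eq using fkc_0 by blast
next
  fix u v assume "u \<in> A_sub n" "v \<in> A_sub n"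
  then obtain x y z w where *: "x \<in> fkc (n + 1)" "y \<in> fkc (n + 2)" "u = Phi (kap x + om y)"
      "z \<in> fkc (n + 1)" "w \<in> fkc (n + 2)" "v = Phi (kap z + om w)"
    unfolding A_sub_eq by blast
  then have "u + v = Phi (kap (x + z) + om (y + w))"
    by (simp add: om_add kap_add fkc_fk Fk.Phi_add)
  then show "u + v \<in> A_sub n" unfolding A_sub_eq using * fkc_add by blast
next
  fix d u assume d: "d \<in> Dset" and "u \<in> A_sub n"
  then obtain x y where *: "x \<in> fkc (n + 1)" "y \<in> fkc (n + 2)" "u = Phi (kap x + om y)"
    unfolding A_sub_eq by blast
  then have "poly_mult d u = Phi (kap (sm (eta d) x) + om (sm (eta d) y))"
    by (simp add: om_sm kap_sm fkc_fk poly_mult_Phi[OF d] sm_add)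
  then show A: "poly_mult d u \<in> A_sub n" unfolding A_sub_eq using * fkc_sm by blast
next
  fix u assume "u \<in> A_sub n"
  then obtain x y where *: "x \<in> fkc (n + 1)" "y \<in> fkc (n + 2)" "u = Phi (kap x + om y)"
    unfolding A_sub_eq by blast
  have m: "- z = sm (- 1) z" for z :: "int set \<Rightarrow>\<^sub>0 complex bpoly" by (rule poly_mapping_eqI) (simp add: coef_sm)
  have "- u = Phi (- (kap x + om y))" unfolding *(3) by (simp only: Fk.Phi_minus)
  also have "- (kap x + om y) = kap (sm (- 1) x) + om (sm (- 1) y)"
    unfolding m using * by (simp add: om_sm kap_sm fkc_fk sm_add)
  finally show "- u \<in> A_sub n" unfolding A_sub_eq using * fkc_sm by blast
qed

section \<open>The maps of the complex and their exactness\<close>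

lemma x0_linear:
  assumes "u \<in> range (sg (n + 1))" "v \<in> range (sg (n + 1))"
  shows "x0 u \<in> range (sg n)" "x0 (u + v) = x0 u + x0 v" "d \<in> Dset \<Longrightarrow> x0 (poly_mult d u) = poly_mult d (x0 u)"
proof -
  obtain x y where *: "x \<in> fkc (n + 1)" "Phi x = u" "y \<in> fkc (n + 1)" "Phi y = v"
    using Phi_onto assms by meson
  then have fk: "x \<in> fk" "y \<in> fk" by (auto intro: fkc_fk)
  show "x0 u \<in> range (sg n)" using x0_Phi_kap[OF fk(1)] Phi_fkc[OF kap_fkc'[OF *(1)]] *(2) by simp
  show "x0 (u + v) = x0 u + x0 v"
    unfolding *(2,4)[symmetric] by (simp add: x0_Phi_kap fk fk_add kap_add flip: Fk.Phi_add)
  show "x0 (poly_mult d u) = poly_mult d (x0 u)" if "d \<in> Dset"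
    unfolding *(2)[symmetric] by (simp add: poly_mult_Phi[OF that] x0_Phi_kap fk fk_sm kap_sm)
qed

lemma x0_Q_sub: "v \<in> Q_sub (n + 1) \<Longrightarrow> x0 v \<in> Q_sub n"
proof -
  assume "v \<in> Q_sub (n + 1)"
  then obtain x where x: "x \<in> fkc (n + 1 + 2)" "v = Phi (om x)" unfolding Q_sub_eq by blast
  then have "x0 v = Phi (om (kap x))" by (simp add: x0_Phi_kap fk_om fkc_fk kap_om)
  moreover have "kap x \<in> fkc (n + 2)" by (rule kap_fkcI[OF x(1)]) simp
  ultimately show ?thesis unfolding Q_sub_eq by blast
qed

lemma Q_map_ccl:
  "v \<in> range (sg (n + 1)) \<Longrightarrow> Q_map n (quot_setup.ccl (Q_sub (n + 1)) v) = quot_setup.ccl (Q_sub n) (x0 v)"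
  and Q_map_hom: "Q_map n \<in> mod_hom D_alg (Q_mod (n + 1)) (Q_mod n)"
proof -
  interpret A: quot_setup D_alg "V_mod (n + 1)" "Q_sub (n + 1)" by (rule quot_setup_Q)
  interpret B: quot_setup D_alg "V_mod n" "Q_sub n" by (rule quot_setup_Q)
  note hom = induced_map_hom[OF A.quot_setup_axioms B.quot_setup_axioms, of x0]
  show "v \<in> range (sg (n + 1)) \<Longrightarrow> Q_map n (A.ccl v) = B.ccl (x0 v)"
    unfolding Q_map_def by (rule hom(1)) (auto simp: V_ops x0_linear x0_Q_sub B.N_0)
  show "Q_map n \<in> mod_hom D_alg (Q_mod (n + 1)) (Q_mod n)"
    unfolding Q_map_def Q_mod_def by (rule hom(2)) (auto simp: V_ops x0_linear x0_Q_sub B.N_0)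
qed

lemma A_proj_ccl:
  "v \<in> range (sg n) \<Longrightarrow> A_proj n (quot_setup.ccl (Q_sub n) v) = quot_setup.ccl (A_sub n) v"
  and A_proj_hom: "A_proj n \<in> mod_hom D_alg (Q_mod n) (A_mod n)"
proof -
  interpret A: quot_setup D_alg "V_mod n" "Q_sub n" by (rule quot_setup_Q)
  interpret B: quot_setup D_alg "V_mod n" "A_sub n" by (rule quot_setup_A)
  have sub: "v \<in> A_sub n" if v: "v \<in> Q_sub n" for v
  proof -
    obtain x where x: "x \<in> fkc (n + 2)" "v = Phi (om x)" using v unfolding Q_sub_eq by blast
    have "kap 0 = 0" by (subst kap_eq[of 0]) auto
    then have "v = Phi (kap 0 + om x)" using x by simp
    then show ?thesis unfolding A_sub_eq using x(1) fkc_0 by blast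
  qed
  note hom = induced_map_hom[OF A.quot_setup_axioms B.quot_setup_axioms, of "\<lambda>v. v"]
  show "v \<in> range (sg n) \<Longrightarrow> A_proj n (A.ccl v) = B.ccl v"
    unfolding A_proj_def by (rule hom(1)) (use sub B.N_0 in \<open>auto simp: V_ops\<close>)
  show "A_proj n \<in> mod_hom D_alg (Q_mod n) (A_mod n)"
    unfolding A_proj_def Q_mod_def A_mod_def by (rule hom(2)) (use sub B.N_0 in \<open>auto simp: V_ops\<close>)
qed

text \<open>The chase in the double complex. Applying kappa to the equation gives omega kappa w = 0,
  so kappa w = 0 because omega is injective in charge n + 1. Then w = kappa w' by the Koszul
  complex, and x - omega w' is a cycle of charge n + 1, hence a boundary.\<close>

lemma exact_fkc:
  assumes n: "n \<ge> 0" and x: "x \<in> fkc (n + 1)" and w: "w \<in> fkc (n + 2)" and eq: "kap x = om w"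
  shows "\<exists>y\<in>fkc (n + 2). \<exists>w'\<in>fkc (n + 3). x = kap y + om w'"
proof -
  have kw: "kap w \<in> fkc (n + 1)" by (rule kap_fkcI[OF w]) simp
  have "om (kap w) = kap (kap x)" using kap_om[OF fkc_fk[OF w]] eq by simp
  then have "om (kap w) = 0" using kap_kap[OF fkc_fk[OF x]] by simp
  then have "kap w = 0" using om_injective[OF kw] n by simp
  then obtain w' where w': "w' \<in> fkc (n + 3)" "kap w' = w"
    using koszul_exact[OF w] n by (auto simp: add.assoc)
  have ow: "om w' \<in> fkc (n + 1)" by (rule om_fkcI[OF w'(1)]) simp
  have "kap (x - om w') = 0"
    using eq w'(2) by (simp add: kap_diff fkc_fk[OF x] fkc_fk[OF ow] kap_om[OF fkc_fk[OF w'(1)]])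
  moreover have "x - om w' \<in> fkc (n + 1)" using x ow by (rule fkc_diff)
  ultimately obtain y where "y \<in> fkc (n + 1 + 1)" "kap y = x - om w'"
    using koszul_exact[of "x - om w'" "n + 1"] n by auto
  then show ?thesis using w'(1) by (intro bexI[of _ y] bexI[of _ w']) (simp_all add: add.assoc)
qed

lemma Q_exact:
  assumes n: "n \<ge> 0"
  shows "a_kernel (Q_mod (n + 1)) (Q_mod n) (Q_map n) = Q_map (n + 1) ` carrier (Q_mod (n + 2))"
proof -
  interpret C: quot_setup D_alg "V_mod (n + 2)" "Q_sub (n + 2)" by (rule quot_setup_Q)
  interpret A: quot_setup D_alg "V_mod (n + 1)" "Q_sub (n + 1)" by (rule quot_setup_Q)
  interpret B: quot_setup D_alg "V_mod n" "Q_sub n" by (rule quot_setup_Q)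
  have two: "n + 1 + 1 = n + 2" "n + 1 + 2 = n + 3" by simp_all
  have mapA: "Q_map (n + 1) (C.ccl v) = A.ccl (x0 v)" if "v \<in> range (sg (n + 2))" for v
    using Q_map_ccl[of v "n + 1"] that by (simp add: two)
  show ?thesis
  proof (intro Set.set_eqI iffI)
    fix X assume "X \<in> a_kernel (Q_mod (n + 1)) (Q_mod n) (Q_map n)"
    then have X: "X \<in> carrier A.Q" "Q_map n X = \<zero>\<^bsub>B.Q\<^esub>" by (auto simp: a_kernel_def' Q_mod_def)
    then obtain v where v: "v \<in> range (sg (n + 1))" "X = A.ccl v" by (auto simp: A.carrier_Q V_ops)
    obtain x where x: "x \<in> fkc (n + 1)" "Phi x = v" using Phi_onto v(1) by blast
    have "x0 v \<in> Q_sub n" using X(2) Q_map_ccl[OF v(1)] v(2) by (simp add: B.zero_Q B.ccl_eq)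
    then obtain w where w: "w \<in> fkc (n + 2)" "x0 v = Phi (om w)" unfolding Q_sub_eq by blast
    then have "kap x = om w"
      using x0_Phi_kap[OF fkc_fk[OF x(1)]] x(2) Phi_eq_iff fk_kap fk_om fkc_fk[OF x(1)] fkc_fk[OF w(1)] by metis
    then obtain y w' where y: "y \<in> fkc (n + 2)" "w' \<in> fkc (n + 3)" "x = kap y + om w'"
      using exact_fkc[OF n x(1) w(1)] by blast
    have "v - x0 (Phi y) = Phi (om w')"
      using x(2) y by (simp add: x0_Phi_kap fkc_fk Fk.Phi_add flip: x(2))
    then have "v - x0 (Phi y) \<in> Q_sub (n + 1)" unfolding Q_sub_eq two using y(2) by blast
    then have "X = Q_map (n + 1) (C.ccl (Phi y))"
      unfolding v(2) mapA[OF Phi_fkc[OF y(1)]] by (simp add: A.ccl_eq)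
    moreover have "C.ccl (Phi y) \<in> carrier (Q_mod (n + 2))"
      using Phi_fkc[OF y(1)] by (simp add: Q_mod_def C.carrier_Q V_ops)
    ultimately show "X \<in> Q_map (n + 1) ` carrier (Q_mod (n + 2))" by blast
  next
    fix X assume "X \<in> Q_map (n + 1) ` carrier (Q_mod (n + 2))"
    then obtain v where v: "v \<in> range (sg (n + 2))" "X = Q_map (n + 1) (C.ccl v)"
      by (auto simp: Q_mod_def C.carrier_Q V_ops)
    obtain y where y: "y \<in> fkc (n + 2)" "Phi y = v" using Phi_onto v(1) by blast
    have ky: "kap y \<in> fkc (n + 1)" by (rule kap_fkcI[OF y(1)]) simp
    have X: "X = A.ccl (Phi (kap y))"
      unfolding v(2) mapA[OF v(1)] using x0_Phi_kap[OF fkc_fk[OF y(1)]] y(2) by simp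
    have "x0 (Phi (kap y)) = 0"
      by (simp add: x0_Phi_kap fkc_fk[OF ky] kap_kap fkc_fk[OF y(1)])
    then have "Q_map n X = \<zero>\<^bsub>B.Q\<^esub>" unfolding X Q_map_ccl[OF Phi_fkc[OF ky]] by (simp add: B.zero_Q)
    moreover have "X \<in> carrier A.Q" unfolding X using Phi_fkc[OF ky] by (simp add: A.carrier_Q V_ops)
    ultimately show "X \<in> a_kernel (Q_mod (n + 1)) (Q_mod n) (Q_map n)"
      by (simp add: a_kernel_def' Q_mod_def)
  qed
qed

text \<open>Exactness at the end is built into A_{2n}: its submodule is the sum of the images of
  x_0^- and of the divided square.\<close>

lemma A_exact: "a_kernel (Q_mod n) (A_mod n) (A_proj n) = Q_map n ` carrier (Q_mod (n + 1))"
proof -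
  interpret C: quot_setup D_alg "V_mod (n + 1)" "Q_sub (n + 1)" by (rule quot_setup_Q)
  interpret A: quot_setup D_alg "V_mod n" "Q_sub n" by (rule quot_setup_Q)
  interpret B: quot_setup D_alg "V_mod n" "A_sub n" by (rule quot_setup_A)
  show ?thesis
  proof (intro Set.set_eqI iffI)
    fix X assume "X \<in> a_kernel (Q_mod n) (A_mod n) (A_proj n)"
    then have X: "X \<in> carrier A.Q" "A_proj n X = \<zero>\<^bsub>B.Q\<^esub>" by (auto simp: a_kernel_def' Q_mod_def A_mod_def)
    then obtain v where v: "v \<in> range (sg n)" "X = A.ccl v" by (auto simp: A.carrier_Q V_ops)
    have "v \<in> A_sub n" using X(2) A_proj_ccl[OF v(1)] v(2) by (simp add: B.zero_Q B.ccl_eq)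
    then obtain x y where xy: "x \<in> fkc (n + 1)" "y \<in> fkc (n + 2)" "v = Phi (kap x + om y)"
      unfolding A_sub_eq by blast
    have "v - x0 (Phi x) = Phi (om y)" using xy by (simp add: x0_Phi_kap fkc_fk Fk.Phi_add)
    then have "v - x0 (Phi x) \<in> Q_sub n" unfolding Q_sub_eq using xy(2) by blast
    then have "X = Q_map n (C.ccl (Phi x))"
      unfolding v(2) Q_map_ccl[OF Phi_fkc[OF xy(1)]] by (simp add: A.ccl_eq)
    moreover have "C.ccl (Phi x) \<in> carrier (Q_mod (n + 1))"
      using Phi_fkc[OF xy(1)] by (simp add: Q_mod_def C.carrier_Q V_ops)
    ultimately show "X \<in> Q_map n ` carrier (Q_mod (n + 1))" by blast
  next
    fix X assume "X \<in> Q_map n ` carrier (Q_mod (n + 1))"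
    then obtain v where v: "v \<in> range (sg (n + 1))" "X = Q_map n (C.ccl v)"
      by (auto simp: Q_mod_def C.carrier_Q V_ops)
    have X: "X = A.ccl (x0 v)" unfolding v(2) by (rule Q_map_ccl[OF v(1)])
    have x0v: "x0 v \<in> range (sg n)" using x0_linear(1)[OF v(1) v(1)] .
    obtain x where x: "x \<in> fkc (n + 1)" "Phi x = v" using Phi_onto v(1) by blast
    have "x0 v = Phi (kap x + om 0)" using x0_Phi_kap[OF fkc_fk[OF x(1)]] x(2) by simp
    then have "x0 v \<in> A_sub n" unfolding A_sub_eq using x(1) fkc_0 by blast
    then have "A_proj n X = \<zero>\<^bsub>B.Q\<^esub>" unfolding X A_proj_ccl[OF x0v] by (simp add: B.zero_Q B.ccl_eq)
    moreover have "X \<in> carrier A.Q" unfolding X using x0v by (simp add: A.carrier_Q V_ops)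
    ultimately show "X \<in> a_kernel (Q_mod n) (A_mod n) (A_proj n)"
      by (simp add: a_kernel_def' Q_mod_def A_mod_def)
  qed
qed

lemma Q_resolution:
  assumes "m \<ge> 0"
  shows "resolution D_alg (\<lambda>k. Q_mod (m + int k)) (\<lambda>k. Q_map (m + int k)) (A_proj m) (A_mod m)"
  unfolding resolution_def
proof (intro conjI allI)
  have Suc: "m + int (Suc k) = m + int k + 1" "m + int (Suc (Suc k)) = m + int k + 2" for k by simp_all
  show "Module.module D_alg (Q_mod (m + int k))" for k
    unfolding Q_mod_def by (rule quot_setup.module_Q[OF quot_setup_Q])
  show "Module.module D_alg (A_mod m)"
    unfolding A_mod_def by (rule quot_setup.module_Q[OF quot_setup_A])
  show "Q_map (m + int k) \<in> mod_hom D_alg (Q_mod (m + int (Suc k))) (Q_mod (m + int k))" for k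
    unfolding Suc by (rule Q_map_hom)
  show "A_proj m \<in> mod_hom D_alg (Q_mod (m + int 0)) (A_mod m)"
    using A_proj_hom by simp
  show "A_proj m ` carrier (Q_mod (m + int 0)) = carrier (A_mod m)"
  proof -
    interpret A: quot_setup D_alg "V_mod m" "Q_sub m" by (rule quot_setup_Q)
    interpret B: quot_setup D_alg "V_mod m" "A_sub m" by (rule quot_setup_A)
    show ?thesis
      unfolding Q_mod_def A_mod_def by (simp add: A.carrier_Q B.carrier_Q image_image V_ops A_proj_ccl cong: image_cong)
  qed
  show "a_kernel (Q_mod (m + int 0)) (A_mod m) (A_proj m) = Q_map (m + int 0) ` carrier (Q_mod (m + int 1))"
    using A_exact[of m] by simp
  show "a_kernel (Q_mod (m + int (Suc k))) (Q_mod (m + int k)) (Q_map (m + int k)) =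
      Q_map (m + int (Suc k)) ` carrier (Q_mod (m + int (Suc (Suc k))))" for k
    unfolding Suc(2) unfolding Suc(1) using Q_exact[of "m + int k"] assms by simp
qed

section \<open>Freeness\<close>

lemma H_ops: "carrier (H_mod n) = fkc n" "add (H_mod n) = (+)" "\<zero>\<^bsub>H_mod n\<^esub> = 0" "smult (H_mod n) = sm"
  by (auto simp: H_mod_def fkc_def sm_def)

lemma f_insert_ins: "f_insert n = ins n" and f_delete_del: "f_delete n = del n"
  by (intro ext; simp add: f_insert_def f_delete_def ins_def del_def fsign_def fsg_def cong: if_cong)+

lemma omega_om:
  assumes "v \<in> fk"
  shows "omega v = om v"
proof -
  obtain N where N: "\<And>n. n \<ge> N \<Longrightarrow> del (int n + 1) v = 0" using del_bound[OF assms] by blast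
  let ?f = "\<lambda>n. if 1 \<le> n then psi (- (n - 1)) (psi n v) else 0"
  have z: "?f n = 0" if "n \<notin> (\<lambda>k. int k + 1) ` {..<N}" for n
  proof (cases "1 \<le> n")
    case True
    then have n: "n = int (nat (n - 1)) + 1" by simp
    then have "nat (n - 1) \<notin> {..<N}" using that by blast
    then have "del (int (nat (n - 1)) + 1) v = 0" by (intro N) simp
    then have "psi n v = 0" using True by (simp add: psi_def f_delete_del)
    moreover have "psi (- (n - 1)) 0 = 0" by (simp add: psi_def f_insert_ins f_delete_del)
    ultimately show ?thesis by (simp only: if_cancel)
  qed simp
  have "Sum_any ?f = (\<Sum>n\<in>(\<lambda>k. int k + 1) ` {..<N}. ?f n)"
  proof (rule Sum_any.expand_superset)
    show "{n. ?f n \<noteq> 0} \<subseteq> (\<lambda>k. int k + 1) ` {..<N}" using z by blast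
  qed simp
  also have "\<dots> = (\<Sum>k<N. ?f (int k + 1))"
    by (subst sum.reindex) (auto simp: inj_on_def)
  also have "\<dots> = (\<Sum>k<N. ins (- int k) (del (int k + 1) v))"
    by (rule sum.cong) (auto simp: psi_def f_insert_ins f_delete_del)
  finally have s: "Sum_any ?f = (\<Sum>k<N. ins (- int k) (del (int k + 1) v))" .
  have "om v = - (\<Sum>k<N. ins (- int k) (del (int k + 1) v))" by (rule om_eq) (rule N)
  then show ?thesis unfolding omega_def s by simp
qed

text \<open>Over the complex numbers this is the subspace divided out in W_{2n}; over polynomials
  \<open>Phi\<close> carries it onto \<open>Q_sub n\<close>. The same notation serves both so that
  they can be compared coefficientwise.\<close>

abbreviation U :: "int \<Rightarrow> (int set \<Rightarrow>\<^sub>0 'r::comm_ring_1) set" where "U n \<equiv> om ` fkc (n + 2)"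

lemma W_mod_U: "W_mod n = quot_module (H_mod n) (U n)"
proof -
  have "omega ` fkc (n + 2) = om ` fkc (n + 2)" by (rule image_cong) (auto simp: omega_om fkc_fk)
  then show ?thesis by (simp add: W_mod_def H_ops)
qed

lemma U_fkc: "v \<in> U n \<Longrightarrow> v \<in> fkc n"
  using om_fkc' by blast

lemma U_0: "0 \<in> U n"
  using fkc_0 by (metis image_eqI om_0)

lemma U_add: "v \<in> U n \<Longrightarrow> w \<in> U n \<Longrightarrow> v + w \<in> U n"
proof -
  assume "v \<in> U n" "w \<in> U n"
  then obtain x y where "x \<in> fkc (n + 2)" "y \<in> fkc (n + 2)" "v = om x" "w = om y" by blast
  then show ?thesis by (intro image_eqI[of _ om "x + y"]) (simp_all add: om_add fkc_fk fkc_add)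
qed

lemma U_sm: "v \<in> U n \<Longrightarrow> sm d v \<in> U n"
proof -
  assume "v \<in> U n"
  then obtain x where "x \<in> fkc (n + 2)" "v = om x" by blast
  then show ?thesis by (intro image_eqI[of _ om "sm d x"]) (simp_all add: om_sm fkc_fk fkc_sm)
qed

lemma U_minus: "v \<in> U n \<Longrightarrow> - v \<in> U n"
proof -
  assume "v \<in> U n"
  then obtain x where "x \<in> fkc (n + 2)" "v = om x" by blast
  then show ?thesis by (intro image_eqI[of _ om "- x"]) (simp_all add: om_minus fkc_fk fkc_minus)
qed

lemma U_diff: "v \<in> U n \<Longrightarrow> w \<in> U n \<Longrightarrow> v - w \<in> U n"
  using U_add[of v n "- w"] U_minus[of w n] by simp

lemma U_sum: "(\<And>a. a \<in> A \<Longrightarrow> f a \<in> U n) \<Longrightarrow> sum f A \<in> U n"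
  by (induction A rule: infinite_finite_induct) (auto intro: U_0 U_add)

lemma keys_map: "f 0 = 0 \<Longrightarrow> keys (Poly_Mapping.map f x) \<subseteq> keys x"
  by (auto simp: in_keys_iff coef_map)

lemma keys_sm: "keys (sm d x) \<subseteq> keys x"
  by (auto simp: in_keys_iff coef_sm)

lemma map_fkc: "f 0 = 0 \<Longrightarrow> x \<in> fkc n \<Longrightarrow> Poly_Mapping.map f x \<in> fkc n"
  using keys_map[of f x] by (auto simp: fkc_def)

text \<open>Only additivity of f is assumed, because one application is the extraction of the
  coefficient of a monomial, which is not multiplicative. The other is the inclusion of
  constants.\<close>

context
  fixes f :: "'r::comm_ring_1 \<Rightarrow> 's::comm_ring_1"
  assumes f_add: "\<And>a b. f (a + b) = f a + f b"
begin

private lemma f_0: "f 0 = 0" and f_fsg: "f (fsg n T * c) = fsg n T * f c"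
  using additive_sum[of f, OF f_add] by (cases "even (card {t \<in> T. t < n})"; simp add: fsg_def)+

private lemma m_add: "Poly_Mapping.map f (x + y) = Poly_Mapping.map f x + Poly_Mapping.map f y"
  by (rule map_add) (simp_all add: f_add f_0)

lemma map_ins: "Poly_Mapping.map f (ins n x) = ins n (Poly_Mapping.map f x)"
  by (rule pm_ext_additive[of "\<lambda>x. Poly_Mapping.map f (ins n x)" "\<lambda>x. ins n (Poly_Mapping.map f x)"])
    (simp_all add: ins_add m_add ins_single map_single map_zero f_0 f_fsg)

lemma map_del: "Poly_Mapping.map f (del n x) = del n (Poly_Mapping.map f x)"
  by (rule pm_ext_additive[of "\<lambda>x. Poly_Mapping.map f (del n x)" "\<lambda>x. del n (Poly_Mapping.map f x)"])
    (simp_all add: del_add m_add del_single map_single map_zero f_0 f_fsg)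

lemma map_om: "x \<in> fk \<Longrightarrow> Poly_Mapping.map f (om x) = om (Poly_Mapping.map f x)"
proof -
  assume "x \<in> fk"
  then obtain N where N: "\<And>n. n \<ge> N \<Longrightarrow> del (int n + 1) x = 0" using del_bound by blast
  have "Poly_Mapping.map f 0 = (0 :: int set \<Rightarrow>\<^sub>0 's)" using additive_sum(1)[of "Poly_Mapping.map f", OF m_add] .
  then have "del (int n + 1) (Poly_Mapping.map f x) = 0" if "n \<ge> N" for n
    using N[OF that] by (simp flip: map_del)
  then have 1: "om (Poly_Mapping.map f x) = - (\<Sum>k<N. ins (- int k) (del (int k + 1) (Poly_Mapping.map f x)))"
    by (rule om_eq)
  have 2: "om x = - (\<Sum>k<N. ins (- int k) (del (int k + 1) x))" by (rule om_eq) (rule N)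
  show ?thesis
    unfolding 1 2 additive_sum(2)[of "Poly_Mapping.map f", OF m_add] additive_sum(4)[of "Poly_Mapping.map f", OF m_add]
    by (simp add: map_ins map_del)
qed

lemma map_U: "x \<in> U n \<Longrightarrow> Poly_Mapping.map f x \<in> U n"
proof -
  assume "x \<in> U n"
  then obtain y where "y \<in> fkc (n + 2)" "x = om y" by blast
  then show ?thesis
    by (intro image_eqI[of _ om "Poly_Mapping.map f y"]) (simp_all add: map_om fkc_fk map_fkc f_0)
qed

end

section \<open>A basis modulo the image of omega, and extension of scalars\<close>

interpretation FV: vector_space "sm :: complex \<Rightarrow> fermion \<Rightarrow> fermion"
  by unfold_locales (simp_all add: sm_add sm_add_left sm_sm sm_one)

definition lcomb :: "(fermion \<Rightarrow>\<^sub>0 complex) \<Rightarrow> fermion"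
  where "lcomb c = (\<Sum>b\<in>keys c. sm (coef c b) b)"

lemma sm_0_left: "sm 0 x = 0"
  by (rule poly_mapping_eqI) (simp add: coef_sm)

lemma lcomb_add: "lcomb (c + e) = lcomb c + lcomb e"
  unfolding lcomb_def by (rule keys_sum_add) (simp_all add: sm_0_left sm_add_left)

lemma lcomb_single: "lcomb (sg b r) = sm r b"
  unfolding lcomb_def by (rule keys_sum_single) (simp add: sm_0_left)

text \<open>I consists of the vectors added to a basis of \<open>U n\<close> in order to span
  \<open>fkc n\<close>, so it is a basis modulo \<open>U n\<close>.\<close>

lemma basis_mod_U:
  obtains I where "I \<subseteq> fkc n" "\<And>w. w \<in> fkc n \<Longrightarrow> \<exists>c. keys c \<subseteq> I \<and> w - lcomb c \<in> U n"
    "\<And>c. keys c \<subseteq> I \<Longrightarrow> lcomb c \<in> U n \<Longrightarrow> c = 0"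
proof -
  obtain B0 where B0: "B0 \<subseteq> U n" "FV.independent B0" "U n \<subseteq> FV.span B0"
    using FV.maximal_independent_subset[of "U n"] by blast
  have "B0 \<subseteq> fkc n" using B0(1) U_fkc by blast
  then obtain B where B: "B0 \<subseteq> B" "B \<subseteq> fkc n" "FV.independent B" "fkc n \<subseteq> FV.span B"
    using FV.maximal_independent_subset_extend B0(2) by metis
  have "FV.subspace (U n)" by (rule FV.subspaceI) (auto intro: U_0 U_add U_sm simp del: image_iff)
  then have span0: "FV.span B0 \<subseteq> U n" using B0(1) by (intro FV.span_minimal)
  define I where "I = B - B0"
  have sp: "\<exists>c. keys c \<subseteq> I \<and> lcomb c = y" if "y \<in> FV.span I" for y
    using that
  proof (induction y rule: FV.span_induct_alt)
    case base
    show ?case by (rule exI[of _ 0]) (simp add: lcomb_def)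
  next
    case (step r b y)
    then obtain c where "keys c \<subseteq> I" "lcomb c = y" by blast
    then show ?case using step(1) keys_add[of "sg b r" c]
      by (intro exI[of _ "sg b r + c"]) (auto simp: lcomb_add lcomb_single split: if_splits)
  qed
  show thesis
  proof
    show "I \<subseteq> fkc n" using B(2) by (auto simp: I_def)
  next
    fix w :: fermion assume "w \<in> fkc n"
    then have "w \<in> FV.span (B0 \<union> I)" using B(1,4) by (auto simp: I_def Un_absorb1)
    then obtain u y where u: "w = u + y" "u \<in> FV.span B0" "y \<in> FV.span I" unfolding FV.span_Un by blast
    then obtain c where "keys c \<subseteq> I" "lcomb c = y" using sp by blast
    then show "\<exists>c. keys c \<subseteq> I \<and> w - lcomb c \<in> U n" using u span0 by (intro exI[of _ c]) auto
  next
    fix c assume c: "keys c \<subseteq> I" "lcomb c \<in> U n"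
    show "c = 0"
    proof (rule ccontr)
      assume "c \<noteq> 0"
      then obtain b where b: "b \<in> keys c" by (metis all_not_in_conv keys_eq_empty)
      then have bI: "b \<in> B" "b \<notin> B0" using c(1) by (auto simp: I_def)
      have "B0 \<subseteq> B - {b}" using bI B(1) by blast
      then have 1: "lcomb c \<in> FV.span (B - {b})" using c(2) B0(3) FV.span_mono[of B0 "B - {b}"] by blast
      have 2: "(\<Sum>a\<in>keys c - {b}. sm (coef c a) a) \<in> FV.span (B - {b})"
        using c(1) by (intro FV.span_sum FV.span_scale FV.span_base) (auto simp: I_def)
      have "sm (coef c b) b = lcomb c - (\<Sum>a\<in>keys c - {b}. sm (coef c a) a)"
        unfolding lcomb_def by (subst sum.remove[OF _ b]) simp_all
      then have "sm (coef c b) b \<in> FV.span (B - {b})" using FV.span_diff[OF 1 2] by simp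
      then have "sm (inverse (coef c b)) (sm (coef c b) b) \<in> FV.span (B - {b})" by (rule FV.span_scale)
      then have "b \<in> FV.span (B - {b})" using b by (simp add: sm_sm sm_one in_keys_iff)
      then show False using B(3) bI(1) unfolding FV.dependent_def by blast
    qed
  qed
qed

definition emb :: "fermion \<Rightarrow> (int set \<Rightarrow>\<^sub>0 complex bpoly)"
  where "emb = Poly_Mapping.map Cst"

definition comb :: "(fermion \<Rightarrow>\<^sub>0 complex bpoly) \<Rightarrow> (int set \<Rightarrow>\<^sub>0 complex bpoly)"
  where "comb c = (\<Sum>b\<in>keys c. sm (coef c b) (emb b))"

lemma coef_emb: "coef (emb w) T = Cst (coef w T)"
  by (simp add: emb_def coef_map)

lemma emb_add: "emb (v + w) = emb v + emb w" and emb_sm: "emb (sm c v) = sm (Cst c) (emb v)"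
  and emb_diff: "emb (v - w) = emb v - emb w"
  by (rule poly_mapping_eqI; simp add: coef_emb coef_sm lookup_add lookup_minus single_add single_uminus
    single_diff mult_single)+

lemma emb_fkc: "w \<in> fkc n \<Longrightarrow> emb w \<in> fkc n"
  unfolding emb_def by (rule map_fkc) simp_all

lemma emb_U: "w \<in> U n \<Longrightarrow> emb w \<in> U n"
  unfolding emb_def by (rule map_U) (simp_all add: single_add)

lemma comb_add: "comb (c + e) = comb c + comb e"
  unfolding comb_def by (rule keys_sum_add) (simp_all add: sm_0_left sm_add_left)

lemma comb_single: "comb (sg b p) = sm p (emb b)"
  unfolding comb_def by (rule keys_sum_single) (simp add: sm_0_left)

lemma comb_sm: "comb (sm d c) = sm d (comb c)"
  by (rule pm_ext_additive[of "\<lambda>c. comb (sm d c)" "\<lambda>c. sm d (comb c)"])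
    (simp_all add: comb_add comb_single sm_add sm_single sm_sm)

lemma comb_lcomb: "comb (Poly_Mapping.map Cst c) = emb (lcomb c)"
proof (rule pm_ext_additive[of "\<lambda>c. comb (Poly_Mapping.map Cst c)" "\<lambda>c. emb (lcomb c)"])
  fix c e :: "fermion \<Rightarrow>\<^sub>0 complex"
  have "Poly_Mapping.map Cst (c + e) = Poly_Mapping.map Cst c + (Poly_Mapping.map Cst e :: fermion \<Rightarrow>\<^sub>0 complex bpoly)"
    by (rule map_add) (simp_all add: single_add)
  then show "comb (Poly_Mapping.map Cst (c + e)) = comb (Poly_Mapping.map Cst c) + comb (Poly_Mapping.map Cst e)"
    by (simp add: comb_add)
qed (simp_all add: lcomb_add emb_add map_single comb_single lcomb_single emb_sm)

text \<open>The vectors \<open>emb b\<close> have constant coefficients, so the coefficient of a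
  fixed monomial M can be taken inside the combination. This reduces independence over polynomials
  to independence over the complex numbers.\<close>

lemma map_coef_comb: "Poly_Mapping.map (\<lambda>p. coef p M) (comb c) = lcomb (Poly_Mapping.map (\<lambda>p. coef p M) c)"
proof (rule pm_ext_additive[of "\<lambda>c. Poly_Mapping.map (\<lambda>p. coef p M) (comb c)"
      "\<lambda>c. lcomb (Poly_Mapping.map (\<lambda>p. coef p M) c)"])
  note ma = map_add[where f = "\<lambda>p. coef p M", OF lookup_add lookup_zero]
  fix c e :: "fermion \<Rightarrow>\<^sub>0 complex bpoly"
  show "Poly_Mapping.map (\<lambda>p. coef p M) (comb (c + e)) =
      Poly_Mapping.map (\<lambda>p. coef p M) (comb c) + Poly_Mapping.map (\<lambda>p. coef p M) (comb e)"
    by (simp add: comb_add ma)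
  show "lcomb (Poly_Mapping.map (\<lambda>p. coef p M) (c + e)) =
      lcomb (Poly_Mapping.map (\<lambda>p. coef p M) c) + lcomb (Poly_Mapping.map (\<lambda>p. coef p M) e)"
    by (simp add: lcomb_add ma)
next
  fix b :: fermion and d :: "complex bpoly"
  have "Poly_Mapping.map (\<lambda>p. coef p M) (sm d (emb b)) = sm (coef d M) b"
  proof (rule poly_mapping_eqI)
    fix T
    have "coef (d * Cst (coef b T)) M = coef d M * coef b T"
      by (subst (1 2) mult.commute) (rule coef_Cst_mult)
    then show "coef (Poly_Mapping.map (\<lambda>p. coef p M) (sm d (emb b))) T = coef (sm (coef d M) b) T"
      by (simp add: coef_map coef_sm coef_emb)
  qed
  then show "Poly_Mapping.map (\<lambda>p. coef p M) (comb (sg b d)) = lcomb (Poly_Mapping.map (\<lambda>p. coef p M) (sg b d))"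
    by (simp add: comb_single map_single lcomb_single)
qed

lemma sum_emb: "x = (\<Sum>T\<in>keys x. sm (coef x T) (emb (sg T 1)))"
proof -
  have "sm p (emb (sg T 1)) = sg T p" for p :: "complex bpoly" and T
    by (simp add: emb_def map_single sm_single)
  then show ?thesis using sum_single[of x] by simp
qed

text \<open>Every vector is a polynomial combination of basis vectors with constant coefficients;
  each of these is reduced over the complex numbers, and the reduction is compatible with polynomial
  scalars.\<close>

lemma comb_mod_U:
  assumes I: "\<And>w. w \<in> fkc n \<Longrightarrow> \<exists>c. keys c \<subseteq> I \<and> w - lcomb c \<in> U n" and x: "x \<in> fkc n"
  shows "\<exists>c. keys c \<subseteq> I \<and> x - comb c \<in> U n"
proof -
  have "\<exists>c. keys c \<subseteq> I \<and> sm p (emb w) - comb c \<in> U n" if w: "w \<in> fkc n" for p w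
  proof -
    obtain c where c: "keys c \<subseteq> I" "w - lcomb c \<in> U n" using I[OF w] by blast
    have "sm p (emb w) - comb (sm p (Poly_Mapping.map Cst c)) = sm p (emb (w - lcomb c))"
      using sm_add[of p "emb (w - lcomb c)" "emb (lcomb c)"] by (simp add: comb_sm comb_lcomb emb_diff)
    moreover have "keys (sm p (Poly_Mapping.map Cst c)) \<subseteq> I"
      using c(1) keys_sm[of p] keys_map[of Cst c] by (meson order_trans single_zero)
    ultimately show ?thesis using U_sm[OF emb_U[OF c(2)]] by metis
  qed
  then have "\<forall>T\<in>keys x. \<exists>c. keys c \<subseteq> I \<and> sm (coef x T) (emb (sg T 1)) - comb c \<in> U n"
    using x by (auto simp: fkc_def simp del: single_one)
  then obtain C where C: "\<And>T. T \<in> keys x \<Longrightarrow> keys (C T) \<subseteq> I \<and> sm (coef x T) (emb (sg T 1)) - comb (C T) \<in> U n"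
    by metis
  have "comb (\<Sum>T\<in>keys x. C T) = (\<Sum>T\<in>keys x. comb (C T))" by (rule additive_sum(4)) (rule comb_add)
  then have "x - comb (\<Sum>T\<in>keys x. C T) = (\<Sum>T\<in>keys x. sm (coef x T) (emb (sg T 1)) - comb (C T))"
    by (subst (1) sum_emb) (simp add: sum_subtractf del: single_one)
  moreover have "keys (\<Sum>T\<in>keys x. C T) \<subseteq> I"
  proof
    fix b assume "b \<in> keys (\<Sum>T\<in>keys x. C T)"
    then have "(\<Sum>T\<in>keys x. coef (C T) b) \<noteq> 0" by (simp add: in_keys_iff lookup_sum)
    then obtain T where "T \<in> keys x" "coef (C T) b \<noteq> 0" using sum.not_neutral_contains_not_neutral by blast
    then show "b \<in> I" using C[of T] by (auto simp: in_keys_iff)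
  qed
  ultimately show ?thesis using C by (intro exI[of _ "\<Sum>T\<in>keys x. C T"]) (auto intro!: U_sum simp del: image_iff)
qed

lemma comb_inj_U:
  assumes I: "\<And>c. keys c \<subseteq> I \<Longrightarrow> lcomb c \<in> U n \<Longrightarrow> c = 0" and c: "keys c \<subseteq> I" "comb c \<in> U n"
  shows "c = 0"
proof (rule poly_mapping_eqI, rule poly_mapping_eqI)
  fix b M
  let ?f = "\<lambda>p :: complex bpoly. coef p M"
  have "Poly_Mapping.map ?f (comb c) \<in> U n" by (rule map_U) (simp_all add: lookup_add c(2))
  moreover have "keys (Poly_Mapping.map ?f c) \<subseteq> I" using keys_map[of ?f c] c(1) by simp
  ultimately have "Poly_Mapping.map ?f c = 0" using I by (simp add: map_coef_comb)
  then have "coef (Poly_Mapping.map ?f c) b = 0" by simp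
  then show "coef (coef c b) M = coef (coef 0 b) M" by (simp add: coef_map)
qed

abbreviation qcl :: "int \<Rightarrow> complex charged \<Rightarrow> complex charged set"
  where "qcl n \<equiv> quot_setup.ccl (Q_sub n)"

lemma qcl_eq: "x \<in> fkc n \<Longrightarrow> y \<in> fkc n \<Longrightarrow> qcl n (Phi x) = qcl n (Phi y) \<longleftrightarrow> x - y \<in> U n"
proof -
  interpret A: quot_setup D_alg "V_mod n" "Q_sub n" by (rule quot_setup_Q)
  assume xy: "x \<in> fkc n" "y \<in> fkc n"
  have "Phi x - Phi y = Phi (x - y)" using additive_sum(3)[of Phi, OF Fk.Phi_add] by simp
  moreover have "Phi (x - y) \<in> Phi ` U n \<longleftrightarrow> x - y \<in> U n"
  proof
    assume "Phi (x - y) \<in> Phi ` U n"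
    then obtain u where u: "u \<in> U n" "Phi (x - y) = Phi u" by blast
    have "x - y \<in> fk" "u \<in> fk" using fkc_fk[OF fkc_diff[OF xy]] fkc_fk[OF U_fkc[OF u(1)]] by blast+
    then show "x - y \<in> U n" using u Phi_eq_iff by metis
  qed blast
  ultimately show "qcl n (Phi x) = qcl n (Phi y) \<longleftrightarrow> x - y \<in> U n"
    unfolding A.ccl_eq unfolding Q_sub_eq by simp
qed

lemma free_Q_mod: "free_module D_alg (Q_mod n)"
proof -
  interpret A: quot_setup D_alg "V_mod n" "Q_sub n" by (rule quot_setup_Q)
  interpret M: Module.module D_alg A.Q by (rule A.module_Q)
  obtain I where I: "I \<subseteq> fkc n" and gen: "\<And>w. w \<in> fkc n \<Longrightarrow> \<exists>c. keys c \<subseteq> I \<and> w - lcomb c \<in> U n"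
    and ind: "\<And>c. keys c \<subseteq> I \<Longrightarrow> lcomb c \<in> U n \<Longrightarrow> c = 0"
    by (rule basis_mod_U[of n]) blast
  define \<kappa> where "\<kappa> = (\<lambda>b. A.ccl (Phi (emb b)))"
  \<comment> \<open>\<open>E c\<close> reindexes a family c on I by the classes of its elements and
    translates the polynomials into D by \<open>iot\<close>.\<close>
  define E where "E = (\<lambda>c X. if X \<in> \<kappa> ` I then iot (coef c (inv_into I \<kappa> X)) else 0)"
  have comb_fkc: "comb c \<in> fkc n" if "keys c \<subseteq> I" for c
    unfolding comb_def using that I by (intro fkc_sum fkc_sm emb_fkc) auto
  have comb_eq: "c = c'" if c: "keys c \<subseteq> I" "keys c' \<subseteq> I"
    and eq: "A.ccl (Phi (comb c)) = A.ccl (Phi (comb c'))" for c c'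
  proof -
    have "comb c - comb c' \<in> U n" using eq qcl_eq[OF comb_fkc comb_fkc] c by simp
    then have "comb (c - c') \<in> U n" using additive_sum(3)[of comb, OF comb_add] by simp
    moreover have "keys (c - c') \<subseteq> I" using keys_diff[of c c'] c by blast
    ultimately have "c - c' = 0" using comb_inj_U[OF ind] by blast
    then show ?thesis by simp
  qed
  \<comment> \<open>A basis is a set of cosets, so coefficients can be indexed by classes only after
    distinct elements of I are known to have distinct classes.\<close>
  have inj: "inj_on \<kappa> I"
  proof (rule inj_onI)
    fix b b' assume b: "b \<in> I" "b' \<in> I" and eq: "\<kappa> b = \<kappa> b'"
    have "sg b (1 :: complex bpoly) = sg b' 1"
      by (rule comb_eq) (use b eq in \<open>auto simp: comb_single \<kappa>_def sm_one simp del: single_one\<close>)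
    then have "keys (sg b (1 :: complex bpoly)) = keys (sg b' (1 :: complex bpoly))" by simp
    then show "b = b'" by simp
  qed
  have inv: "inv_into I \<kappa> (\<kappa> b) = b" if "b \<in> I" for b
    using inj that by simp
  have carr: "Phi (sm p (emb b)) \<in> carrier (V_mod n)" if "b \<in> I" for p b
    using that I by (auto simp: V_ops intro!: Phi_fkc fkc_sm emb_fkc)
  have act: "iot p \<odot>\<^bsub>A.Q\<^esub> \<kappa> b = A.ccl (Phi (sm p (emb b)))" if "b \<in> I" for p b
    unfolding \<kappa>_def using carr[OF that, of 1] that
    by (simp add: A.smult_Q iot_Dset V_ops(4) poly_mult_Phi eta_iot sm_one)
  have iot_0: "iot p = 0 \<longleftrightarrow> p = 0" for p using iot_inj[of p 0] iot_hom(4) by auto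
  have supp: "{X. E c X \<noteq> 0} = \<kappa> ` keys c" if c: "keys c \<subseteq> I" for c
    using c by (auto simp: E_def iot_0 inv in_keys_iff subset_iff)
  have E_sum: "(\<Oplus>\<^bsub>A.Q\<^esub>X\<in>{X. E c X \<noteq> 0}. E c X \<odot>\<^bsub>A.Q\<^esub> X) = A.ccl (Phi (comb c))" if c: "keys c \<subseteq> I" for c
  proof -
    have "(\<Oplus>\<^bsub>A.Q\<^esub>X\<in>\<kappa> ` keys c. E c X \<odot>\<^bsub>A.Q\<^esub> X) = (\<Oplus>\<^bsub>A.Q\<^esub>b\<in>keys c. E c (\<kappa> b) \<odot>\<^bsub>A.Q\<^esub> \<kappa> b)"
    proof (rule M.finsum_reindex)
      show "(\<lambda>X. E c X \<odot>\<^bsub>A.Q\<^esub> X) \<in> \<kappa> ` keys c \<rightarrow> carrier A.Q"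
        using c carr by (auto simp: E_def inv act A.carrier_Q subset_iff)
      show "inj_on \<kappa> (keys c)" using inj c by (rule inj_on_subset)
    qed
    also have "\<dots> = (\<Oplus>\<^bsub>A.Q\<^esub>b\<in>keys c. A.ccl (Phi (sm (coef c b) (emb b))))"
      by (rule M.finsum_cong') (use c carr in \<open>auto simp: E_def inv act A.carrier_Q subset_iff\<close>)
    also have "\<dots> = A.ccl (\<Sum>b\<in>keys c. Phi (sm (coef c b) (emb b)))"
      by (rule A.finsum_Q) (use c carr in auto)
    finally show ?thesis unfolding supp[OF c] comb_def Fk.Phi_sum .
  qed
  have "is_basis D_alg A.Q (\<kappa> ` I)"
    unfolding is_basis_def D_ops
  proof (intro conjI ballI)
    show "\<kappa> ` I \<subseteq> carrier A.Q" using carr[of _ 1] by (auto simp: \<kappa>_def A.carrier_Q sm_one)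
    fix X assume "X \<in> carrier A.Q"
    then obtain v where v: "v \<in> range (sg n)" "X = A.ccl v" by (auto simp: A.carrier_Q V_ops)
    obtain x where x: "x \<in> fkc n" "v = Phi x" using Phi_onto[OF v(1)] by blast
    obtain c where c: "keys c \<subseteq> I" "x - comb c \<in> U n" using comb_mod_U[OF gen x(1)] by blast
    then have X: "X = A.ccl (Phi (comb c))" using v(2) x qcl_eq[OF x(1) comb_fkc] by simp
    have finE: "finite {X. E c X \<noteq> 0}" unfolding supp[OF c(1)] by simp
    show "\<exists>!e. e \<in> \<kappa> ` I \<rightarrow> Dset \<and> (\<forall>b. b \<notin> \<kappa> ` I \<longrightarrow> e b = 0) \<and> finite {b. e b \<noteq> 0} \<and>
        X = (\<Oplus>\<^bsub>A.Q\<^esub>b\<in>{b. e b \<noteq> 0}. e b \<odot>\<^bsub>A.Q\<^esub> b)"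
    proof (rule ex1I)
      show "E c \<in> \<kappa> ` I \<rightarrow> Dset \<and> (\<forall>b. b \<notin> \<kappa> ` I \<longrightarrow> E c b = 0) \<and> finite {b. E c b \<noteq> 0} \<and>
          X = (\<Oplus>\<^bsub>A.Q\<^esub>b\<in>{b. E c b \<noteq> 0}. E c b \<odot>\<^bsub>A.Q\<^esub> b)"
        unfolding E_sum[OF c(1)] using finE X by (simp add: E_def iot_Dset)
    next
      fix e assume e: "e \<in> \<kappa> ` I \<rightarrow> Dset \<and> (\<forall>b. b \<notin> \<kappa> ` I \<longrightarrow> e b = 0) \<and> finite {b. e b \<noteq> 0} \<and>
        X = (\<Oplus>\<^bsub>A.Q\<^esub>b\<in>{b. e b \<noteq> 0}. e b \<odot>\<^bsub>A.Q\<^esub> b)"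
      let ?K = "{b \<in> I. e (\<kappa> b) \<noteq> 0}"
      \<comment> \<open>Any competing coefficient family with values in D is pulled back to I by
        \<open>eta\<close>, so that uniqueness becomes \<open>comb_eq\<close>.\<close>
      define c' where "c' = (\<Sum>b\<in>?K. sg b (eta (e (\<kappa> b))))"
      have fin: "finite ?K"
      proof (rule inj_on_finite[of \<kappa>])
        show "inj_on \<kappa> ?K" using inj by (rule inj_on_subset) auto
        show "finite {b. e b \<noteq> 0}" using e by blast
      qed auto
      have coef_c': "coef c' b = (if b \<in> ?K then eta (e (\<kappa> b)) else 0)" for b
        unfolding c'_def lookup_sum using fin by (simp add: lookup_single when_def)
      have "keys c' \<subseteq> I" by (auto simp: in_keys_iff coef_c' split: if_splits)
      have "E c' X = e X" for X
      proof (cases "X \<in> \<kappa> ` I")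
        case True
        then obtain b where b: "b \<in> I" "X = \<kappa> b" by blast
        then have "e X \<in> Dset" using e by blast
        then show ?thesis using b by (auto simp: E_def inv coef_c' iot_eta iot_hom)
      qed (use e in \<open>auto simp: E_def\<close>)
      then have eE: "e = E c'" by (intro ext) (rule sym)
      have "X = A.ccl (Phi (comb c'))" using e unfolding eE E_sum[OF \<open>keys c' \<subseteq> I\<close>] by (elim conjE)
      then have "c' = c" by (intro comb_eq[OF \<open>keys c' \<subseteq> I\<close> c(1)]) (rule trans[OF sym X])
      then show "e = E c" using eE by simp
    qed
  qed
  then show ?thesis unfolding free_module_def Q_mod_def using A.module_Q by blast
qed

section \<open>Tensor products\<close>

lemma complex_ring_ops: "carrier complex_ring = UNIV" "x \<oplus>\<^bsub>complex_ring\<^esub> y = x + y" "x \<otimes>\<^bsub>complex_ring\<^esub> y = x * y"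
  "\<one>\<^bsub>complex_ring\<^esub> = 1" "\<zero>\<^bsub>complex_ring\<^esub> = 0"
  by (simp_all add: complex_ring_def)

lemma cring_complex_ring: "cring complex_ring"
proof (rule cringI)
  show "abelian_group complex_ring"
  proof (rule abelian_groupI)
    fix x show "\<exists>y\<in>carrier complex_ring. y \<oplus>\<^bsub>complex_ring\<^esub> x = \<zero>\<^bsub>complex_ring\<^esub>"
      by (intro bexI[of _ "- x"]) (simp_all add: complex_ring_ops)
  qed (simp_all add: complex_ring_ops add_ac)
  show "comm_monoid complex_ring"
    by (rule comm_monoidI) (simp_all add: complex_ring_ops mult_ac)
qed (simp add: complex_ring_ops distrib_right)

lemma quot_setup_H: "quot_setup complex_ring (H_mod n) (U n)"
proof (rule quot_setup.intro)
  show "U n \<subseteq> carrier (H_mod n)" unfolding H_ops using U_fkc by blast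
qed (simp_all add: cring_complex_ring complex_ring_ops H_ops fkc_0 fkc_add fkc_minus fkc_sm U_0 U_add U_minus U_sm
    sm_add sm_add_left sm_sm sm_one del: image_iff)

abbreviation Nt :: "(complex, 'w, 'j) module_scheme \<Rightarrow> ((complex bpoly \<times> 'w) \<Rightarrow>\<^sub>0 int) set"
  where "Nt W \<equiv> generate (add_monoid (tensor_pre D_alg W)) (tensor_rels complex_ring D_alg W)"

lemma T_ops: "carrier (tensor_pre D_alg W) = {z. keys z \<subseteq> Dset \<times> carrier W}" "add (tensor_pre D_alg W) = (+)"
  "\<zero>\<^bsub>tensor_pre D_alg W\<^esub> = 0"
  "d \<odot>\<^bsub>tensor_pre D_alg W\<^esub> z = frag_extend (\<lambda>(a, w). frag_of (d * a, w)) z"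
  by (auto simp: tensor_pre_def D_ops)

lemma group_T: "Group.group (add_monoid (tensor_pre D_alg W))"
  and inv_T: "z \<in> carrier (tensor_pre D_alg W) \<Longrightarrow> inv\<^bsub>add_monoid (tensor_pre D_alg W)\<^esub> z = - z"
proof -
  have cl: "keys (x + y) \<subseteq> S" if "keys x \<subseteq> S" "keys y \<subseteq> S" for x y :: "(complex bpoly \<times> 'a) \<Rightarrow>\<^sub>0 int" and S
    using keys_add[of x y] that by blast
  show g: "Group.group (add_monoid (tensor_pre D_alg W))"
  proof (rule groupI)
    fix x assume "x \<in> carrier (add_monoid (tensor_pre D_alg W))"
    then show "\<exists>y\<in>carrier (add_monoid (tensor_pre D_alg W)). y \<otimes>\<^bsub>add_monoid (tensor_pre D_alg W)\<^esub> x =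
        \<one>\<^bsub>add_monoid (tensor_pre D_alg W)\<^esub>"
      by (intro bexI[of _ "- x"]) (simp_all add: T_ops)
  qed (simp_all add: T_ops cl add.assoc)
  assume "z \<in> carrier (tensor_pre D_alg W)"
  then show "inv\<^bsub>add_monoid (tensor_pre D_alg W)\<^esub> z = - z"
    by (intro group.inv_equality[OF g]) (simp_all add: T_ops)
qed

lemma tensor_rels_cases:
  assumes "x \<in> tensor_rels complex_ring D_alg W"
  obtains (add_left) a b w where "x = frag_of (a + b, w) - frag_of (a, w) - frag_of (b, w)"
      "a \<in> Dset" "b \<in> Dset" "w \<in> carrier W"
    | (add_right) a v w where "x = frag_of (a, v \<oplus>\<^bsub>W\<^esub> w) - frag_of (a, v) - frag_of (a, w)"
      "a \<in> Dset" "v \<in> carrier W" "w \<in> carrier W"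
    | (scale) c a w where "x = frag_of (Cst c * a, w) - frag_of (a, c \<odot>\<^bsub>W\<^esub> w)" "a \<in> Dset" "w \<in> carrier W"
  using assms unfolding tensor_rels_def D_ops complex_ring_ops by blast

lemma rels_carrier:
  assumes "Module.module complex_ring W"
  shows "tensor_rels complex_ring D_alg W \<subseteq> carrier (tensor_pre D_alg W)"
proof
  interpret W: Module.module complex_ring W by fact
  have 2: "keys (x - y) \<subseteq> S" if "keys x \<subseteq> S" "keys y \<subseteq> S" for x y :: "(complex bpoly \<times> 'a) \<Rightarrow>\<^sub>0 int" and S
    using keys_diff[of x y] that by blast
  have C: "Cst c * a \<in> Dset" if "a \<in> Dset" for c a using that by (intro Dset_mult Dset_Cst)
  fix x assume "x \<in> tensor_rels complex_ring D_alg W"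
  then show "x \<in> carrier (tensor_pre D_alg W)"
    unfolding T_ops mem_Collect_eq
  proof (cases rule: tensor_rels_cases)
    case (add_left a b w)
    then show "keys x \<subseteq> Dset \<times> carrier W" unfolding add_left(1) by (intro 2) (simp_all add: Dset_add)
  next
    case (add_right a v w)
    then show "keys x \<subseteq> Dset \<times> carrier W" unfolding add_right(1) by (intro 2) simp_all
  next
    case (scale c a w)
    then show "keys x \<subseteq> Dset \<times> carrier W"
      unfolding scale(1) by (intro 2) (simp_all add: C complex_ring_ops)
  qed
qed

lemma Nt_induct [consumes 2, case_names rel zero add minus]:
  assumes "Module.module complex_ring W" "z \<in> Nt W"
    and "\<And>x. x \<in> tensor_rels complex_ring D_alg W \<Longrightarrow> P x" "P 0" "\<And>x y. P x \<Longrightarrow> P y \<Longrightarrow> P (x + y)"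
    "\<And>x. P x \<Longrightarrow> P (- x)"
  shows "P z"
  using assms(2)
proof (induction rule: generate.induct)
  case one
  then show ?case using assms(4) by (simp add: T_ops)
next
  case (inv h)
  have "h \<in> carrier (tensor_pre D_alg W)" using inv rels_carrier[OF assms(1)] by blast
  then show ?case using assms(3)[OF inv] assms(6) by (simp add: inv_T)
next
  case (eng x y)
  then show ?case using assms(5) by (simp add: T_ops)
qed (use assms in auto)

lemma Nt_closed:
  assumes W: "Module.module complex_ring W"
  shows "Nt W \<subseteq> carrier (tensor_pre D_alg W)" "0 \<in> Nt W" "x \<in> Nt W \<Longrightarrow> y \<in> Nt W \<Longrightarrow> x + y \<in> Nt W"
    "x \<in> Nt W \<Longrightarrow> - x \<in> Nt W"
proof -
  note g = group_T[of W] and r = rels_carrier[OF W]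
  have r': "tensor_rels complex_ring D_alg W \<subseteq> carrier (add_monoid (tensor_pre D_alg W))" using r by simp
  show 1: "Nt W \<subseteq> carrier (tensor_pre D_alg W)" using group.generate_incl[OF g r'] by simp
  show "0 \<in> Nt W" using generate.one[of "add_monoid (tensor_pre D_alg W)"] by (simp add: T_ops)
  show "x \<in> Nt W \<Longrightarrow> y \<in> Nt W \<Longrightarrow> x + y \<in> Nt W"
    using generate.eng[of x "add_monoid (tensor_pre D_alg W)" _ y] by (simp add: T_ops)
  show "x \<in> Nt W \<Longrightarrow> - x \<in> Nt W"
    using group.generate_m_inv_closed[OF g r', of x] inv_T[of x W] 1 by auto
qed

lemma Nt_rels:
  assumes "a \<in> Dset" "w \<in> carrier W"
  shows "b \<in> Dset \<Longrightarrow> frag_of (a + b, w) - frag_of (a, w) - frag_of (b, w) \<in> Nt W"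
    "v \<in> carrier W \<Longrightarrow> frag_of (a, v \<oplus>\<^bsub>W\<^esub> w) - frag_of (a, v) - frag_of (a, w) \<in> Nt W"
    "frag_of (Cst c * a, w) - frag_of (a, c \<odot>\<^bsub>W\<^esub> w) \<in> Nt W"
proof -
  show "b \<in> Dset \<Longrightarrow> frag_of (a + b, w) - frag_of (a, w) - frag_of (b, w) \<in> Nt W"
    by (rule generate.incl) (use assms in \<open>auto simp: tensor_rels_def D_ops\<close>)
  show "v \<in> carrier W \<Longrightarrow> frag_of (a, v \<oplus>\<^bsub>W\<^esub> w) - frag_of (a, v) - frag_of (a, w) \<in> Nt W"
    by (rule generate.incl) (use assms in \<open>auto simp: tensor_rels_def D_ops\<close>)
  show "frag_of (Cst c * a, w) - frag_of (a, c \<odot>\<^bsub>W\<^esub> w) \<in> Nt W"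
    by (rule generate.incl) (use assms in \<open>auto simp: tensor_rels_def D_ops complex_ring_ops\<close>)
qed

abbreviation tsm :: "complex bpoly \<Rightarrow> ((complex bpoly \<times> 'w) \<Rightarrow>\<^sub>0 int) \<Rightarrow> ((complex bpoly \<times> 'w) \<Rightarrow>\<^sub>0 int)"
  where "tsm d \<equiv> frag_extend (\<lambda>(a, w). frag_of (d * a, w))"

lemma tsm_Nt:
  assumes W: "Module.module complex_ring W" and d: "d \<in> Dset" and z: "z \<in> Nt W"
  shows "tsm d z \<in> Nt W"
  using W z
proof (induction rule: Nt_induct)
  case (rel x)
  then show ?case
  proof (cases rule: tensor_rels_cases)
    case (add_left a b w)
    then show ?thesis
      using Nt_rels(1)[of "d * a" w W "d * b"] d by (simp add: frag_extend_diff Dset_mult distrib_left)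
  next
    case (add_right a v w)
    then show ?thesis
      using Nt_rels(2)[of "d * a" w W v] d by (simp add: frag_extend_diff Dset_mult)
  next
    case (scale c a w)
    then show ?thesis
      using Nt_rels(3)[of "d * a" w W c] d by (simp add: frag_extend_diff Dset_mult mult.left_commute)
  qed
qed (simp_all add: frag_extend_add frag_extend_minus Nt_closed[OF W])

lemma quot_setup_T:
  assumes W: "Module.module complex_ring W"
  shows "quot_setup D_alg (tensor_pre D_alg W) (Nt W)"
proof (rule quot_setup.intro)
  let ?C = "carrier (tensor_pre D_alg W)"
  have diff: "x - y \<in> ?C" if "x \<in> ?C" "y \<in> ?C" for x y
    using keys_diff[of x y] that unfolding T_ops by blast
  have N_diff: "x - y \<in> Nt W" if "x \<in> Nt W" "y \<in> Nt W" for x y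
    using Nt_closed(3)[OF W that(1) Nt_closed(4)[OF W that(2)]] by simp
  show "r \<odot>\<^bsub>tensor_pre D_alg W\<^esub> x \<in> ?C" if "r \<in> Dset" "x \<in> ?C" for r x
  proof -
    have "keys (frag_of (case aw of (a, w) \<Rightarrow> (r * a, w))) \<subseteq> Dset \<times> carrier W" if "aw \<in> keys x" for aw
      using \<open>r \<in> Dset\<close> \<open>x \<in> ?C\<close> that by (cases aw) (auto simp: T_ops Dset_mult subset_iff)
    then show ?thesis
      unfolding T_ops mem_Collect_eq using keys_frag_extend[of "\<lambda>(a, w). frag_of (r * a, w)" x] by fastforce
  qed
  show "(r \<otimes>\<^bsub>D_alg\<^esub> s) \<odot>\<^bsub>tensor_pre D_alg W\<^esub> x = r \<odot>\<^bsub>tensor_pre D_alg W\<^esub> (s \<odot>\<^bsub>tensor_pre D_alg W\<^esub> x)"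
    if "x \<in> ?C" for r s x
    using that unfolding T_ops(1) mem_Collect_eq unfolding T_ops(4)
    by (induction x rule: frag_induction) (auto simp: frag_extend_diff D_ops mult.assoc)
  show "\<one>\<^bsub>D_alg\<^esub> \<odot>\<^bsub>tensor_pre D_alg W\<^esub> x = x" if "x \<in> ?C" for x
    using that unfolding T_ops(1) mem_Collect_eq unfolding T_ops(4)
    by (induction x rule: frag_induction) (auto simp: frag_extend_diff D_ops)
  show "(r \<oplus>\<^bsub>D_alg\<^esub> s) \<odot>\<^bsub>tensor_pre D_alg W\<^esub> x - (r \<odot>\<^bsub>tensor_pre D_alg W\<^esub> x + s \<odot>\<^bsub>tensor_pre D_alg W\<^esub> x) \<in> Nt W"
    if rs: "r \<in> Dset" "s \<in> Dset" and "x \<in> ?C" for r s x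
  proof -
    have "keys x \<subseteq> Dset \<times> carrier W" using that(3) by (simp add: T_ops)
    then show ?thesis
      unfolding T_ops(4) D_ops
    proof (induction x rule: frag_induction)
      case zero
      show ?case using Nt_closed(2)[OF W] by (simp only: frag_extend_0 add_0_left diff_self)
    next
      case (one aw)
      then obtain a w where "aw = (a, w)" "a \<in> Dset" "w \<in> carrier W" by auto
      then show ?case
        using Nt_rels(1)[of "r * a" w W "s * a"] rs by (simp add: Dset_mult distrib_right diff_diff_eq)
    next
      case (diff x y)
      then show ?case using N_diff[OF diff] by (simp add: frag_extend_diff algebra_simps)
    qed
  qed
  show "x + y \<in> ?C" if "x \<in> ?C" "y \<in> ?C" for x y using that keys_add[of x y] unfolding T_ops by blast
qed (use Nt_closed[OF W] tsm_Nt[OF W] in \<open>simp_all add: T_ops cring_D frag_extend_add\<close>)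

lemma (in quot_setup) N_sum: "(\<And>a. a \<in> A \<Longrightarrow> f a \<in> N) \<Longrightarrow> sum f A \<in> N"
  by (induction A rule: infinite_finite_induct) (auto intro: N_0 N_add)

lemma eta_hom: "eta (p + q) = eta p + eta q" "eta (p * q) = eta p * eta q" "eta (Cst c) = Cst c"
  by (simp_all add: eta_def psubst_add psubst_mult)

context
  fixes n :: int
begin

interpretation H: quot_setup complex_ring "H_mod n" "U n" by (rule quot_setup_H)

interpretation T: quot_setup D_alg "tensor_pre D_alg (W_mod n)" "Nt (W_mod n)"
  by (rule quot_setup_T) (simp add: W_mod_U H.module_Q)

interpretation Q: quot_setup D_alg "V_mod n" "Q_sub n" by (rule quot_setup_Q)

private lemma W_carrier: "X \<in> carrier (W_mod n) \<longleftrightarrow> (\<exists>w\<in>fkc n. X = H.ccl w)"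
  by (auto simp: W_mod_U H.carrier_Q H_ops)

private lemma W_add: "H.ccl v \<oplus>\<^bsub>W_mod n\<^esub> H.ccl w = H.ccl (v + w)"
  by (simp add: W_mod_U H.add_Q)

private lemma W_smult: "w \<in> fkc n \<Longrightarrow> c \<odot>\<^bsub>W_mod n\<^esub> H.ccl w = H.ccl (sm c w)"
  by (simp add: W_mod_U H.smult_Q complex_ring_ops H_ops)

definition rep :: "fermion set \<Rightarrow> fermion"
  where "rep X = (SOME w. w \<in> fkc n \<and> H.ccl w = X)"

private lemma rep_ccl:
  assumes "w \<in> fkc n"
  shows "rep (H.ccl w) \<in> fkc n" "rep (H.ccl w) - w \<in> U n"
proof -
  have "rep (H.ccl w) \<in> fkc n \<and> H.ccl (rep (H.ccl w)) = H.ccl w"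
    unfolding rep_def by (rule someI[of _ w]) (simp add: assms)
  then show "rep (H.ccl w) \<in> fkc n" "rep (H.ccl w) - w \<in> U n" by (simp_all only: H.ccl_eq)
qed

text \<open>\<open>unten\<close> multiplies out formal tensors. It is additive, and well defined modulo \<open>\<omega>\<close> although the
  representatives \<open>rep\<close> are arbitrary.\<close>

definition unten :: "((complex bpoly \<times> fermion set) \<Rightarrow>\<^sub>0 int) \<Rightarrow> (int set \<Rightarrow>\<^sub>0 complex bpoly)"
  where "unten z = (\<Sum>i\<in>keys z. sm (of_int (coef z i)) (sm (eta (fst i)) (emb (rep (snd i)))))"

private lemma unten_add: "unten (y + z) = unten y + unten z"
  unfolding unten_def by (rule keys_sum_add) (simp_all add: sm_0_left sm_add_left)

private lemmas unten_additive = additive_sum[of unten, OF unten_add]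

private lemma unten_of: "unten (frag_of (d, X)) = sm (eta d) (emb (rep X))"
  unfolding unten_def by (subst keys_sum_single) (simp_all add: sm_0_left sm_one)

private lemma unten_tsm: "unten (tsm d z) = sm (eta d) (unten z)"
proof -
  have "keys z \<subseteq> UNIV" by simp
  then show ?thesis
  proof (induction z rule: frag_induction)
    case zero
    then show ?case by (simp add: unten_additive sm_zero)
  next
    case (one i)
    then show ?case by (cases i) (simp add: unten_of eta_hom sm_sm)
  next
    case (diff y z)
    have "sm (eta d) (unten y - unten z) = sm (eta d) (unten y) - sm (eta d) (unten z)"
      by (rule additive_sum(3)) (rule sm_add)
    then show ?case using diff by (simp add: frag_extend_diff unten_additive)
  qed
qed

private lemma unten_fkc: "z \<in> carrier (tensor_pre D_alg (W_mod n)) \<Longrightarrow> unten z \<in> fkc n"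
  unfolding unten_def T_ops
  by (intro fkc_sum fkc_sm emb_fkc) (auto simp: W_carrier subset_iff, metis rep_ccl(1))

private lemma sm_diff: "sm d (v - w) = sm d v - sm d w"
  by (rule additive_sum(3)) (rule sm_add)

text \<open>The choice \<open>rep\<close> of representatives is neither additive nor homogeneous,
  but its defect lies in \<open>U n\<close>, which is stable under extension of scalars and
  multiplication by polynomials.\<close>

private lemma unten_rel:
  assumes "x \<in> tensor_rels complex_ring D_alg (W_mod n)"
  shows "unten x \<in> U n"
  using assms
proof (cases rule: tensor_rels_cases)
  case (add_left a b X)
  then show ?thesis
    using U_0 by (simp add: unten_additive unten_of eta_hom sm_add_left del: image_iff)
next
  case (add_right a Y X)
  then obtain v w where vw: "v \<in> fkc n" "Y = H.ccl v" "w \<in> fkc n" "X = H.ccl w" by (auto simp: W_carrier)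
  have "(rep (H.ccl (v + w)) - (v + w)) - (rep (H.ccl v) - v) - (rep (H.ccl w) - w) \<in> U n"
    using vw by (intro U_diff rep_ccl fkc_add)
  then have "rep (H.ccl (v + w)) - rep Y - rep X \<in> U n" unfolding vw by (simp add: algebra_simps del: image_iff)
  then have "sm (eta a) (emb (rep (H.ccl (v + w)) - rep Y - rep X)) \<in> U n" by (intro U_sm emb_U)
  then show ?thesis
    unfolding add_right(1) vw W_add unten_additive unten_of by (simp only: emb_diff sm_diff)
next
  case (scale c a X)
  then obtain w where w: "w \<in> fkc n" "X = H.ccl w" by (auto simp: W_carrier)
  have "sm c (rep (H.ccl w) - w) - (rep (H.ccl (sm c w)) - sm c w) \<in> U n"
    using w by (intro U_diff U_sm rep_ccl fkc_sm)
  then have "sm c (rep (H.ccl w)) - rep (H.ccl (sm c w)) \<in> U n" by (simp add: sm_diff del: image_iff)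
  then have "sm (eta a) (emb (sm c (rep (H.ccl w)) - rep (H.ccl (sm c w)))) \<in> U n" by (intro U_sm emb_U)
  then show ?thesis
    unfolding scale(1) w(2) W_smult[OF w(1)] unten_additive unten_of
    by (simp only: emb_diff sm_diff emb_sm sm_sm eta_hom mult.commute)
qed

private lemma W_module: "Module.module complex_ring (W_mod n)"
  by (simp add: W_mod_U H.module_Q)

private lemma unten_Nt: "z \<in> Nt (W_mod n) \<Longrightarrow> unten z \<in> U n"
proof -
  assume "z \<in> Nt (W_mod n)"
  with W_module show ?thesis
    by (induction rule: Nt_induct)
      (simp_all only: unten_rel unten_add unten_additive U_0 U_add U_minus)
qed

definition tn :: "complex bpoly \<Rightarrow> fermion \<Rightarrow> ((complex bpoly \<times> fermion set) \<Rightarrow>\<^sub>0 int)"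
  where "tn p w = frag_of (iot p, H.ccl w)"

private lemma tn_rels:
  assumes "w \<in> fkc n"
  shows "tn (p - q) w - (tn p w - tn q w) \<in> Nt (W_mod n)" "tn 0 w \<in> Nt (W_mod n)"
    "v \<in> fkc n \<Longrightarrow> tn p (v + w) - tn p v - tn p w \<in> Nt (W_mod n)" "tn p 0 \<in> Nt (W_mod n)"
    "tn p (sm c w) - tn (Cst c * p) w \<in> Nt (W_mod n)"
proof -
  have X: "H.ccl w \<in> carrier (W_mod n)" if "w \<in> fkc n" for w using that by (auto simp: W_carrier)
  have "tn ((p - q) + q) w - tn (p - q) w - tn q w \<in> Nt (W_mod n)"
    unfolding tn_def iot_hom by (rule Nt_rels) (use X assms in \<open>auto simp: iot_Dset\<close>)
  then have "tn p w - tn (p - q) w - tn q w \<in> Nt (W_mod n)" by (simp only: diff_add_cancel)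
  then have "- (tn p w - tn (p - q) w - tn q w) \<in> Nt (W_mod n)" by (rule T.N_minus)
  moreover have "- (tn p w - tn (p - q) w - tn q w) = tn (p - q) w - (tn p w - tn q w)" by (simp add: algebra_simps)
  ultimately show "tn (p - q) w - (tn p w - tn q w) \<in> Nt (W_mod n)" by (simp only:)
  have "tn (0 + 0) w - tn 0 w - tn 0 w \<in> Nt (W_mod n)"
    unfolding tn_def iot_hom(1) by (rule Nt_rels) (use X assms in \<open>auto simp: iot_Dset\<close>)
  then have "- tn 0 w \<in> Nt (W_mod n)" by simp
  then show "tn 0 w \<in> Nt (W_mod n)" using T.N_minus[of "- tn 0 w"] by simp
  have A: "tn p (v + w) - tn p v - tn p w \<in> Nt (W_mod n)" if "v \<in> fkc n" "w \<in> fkc n" for v w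
    using Nt_rels(2)[of "iot p" "H.ccl w" "W_mod n" "H.ccl v"] X[OF that(1)] X[OF that(2)]
    by (simp only: tn_def W_add iot_Dset)
  then show "v \<in> fkc n \<Longrightarrow> tn p (v + w) - tn p v - tn p w \<in> Nt (W_mod n)" using assms by blast
  have "tn p (0 + 0) - tn p 0 - tn p 0 \<in> Nt (W_mod n)" by (rule A) (rule fkc_0)+
  then have "- tn p 0 \<in> Nt (W_mod n)" by simp
  then show "tn p 0 \<in> Nt (W_mod n)" using T.N_minus[of "- tn p 0"] by simp
  have "frag_of (Cst c * iot p, H.ccl w) - frag_of (iot p, c \<odot>\<^bsub>W_mod n\<^esub> H.ccl w) \<in> Nt (W_mod n)"
    by (rule Nt_rels(3)) (use X assms in \<open>auto simp: iot_Dset\<close>)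
  then have "tn (Cst c * p) w - tn p (sm c w) \<in> Nt (W_mod n)"
    unfolding tn_def iot_hom W_smult[OF assms] .
  then have "- (tn (Cst c * p) w - tn p (sm c w)) \<in> Nt (W_mod n)" by (rule T.N_minus)
  then show "tn p (sm c w) - tn (Cst c * p) w \<in> Nt (W_mod n)" by simp
qed

private lemma tn_sum:
  assumes "finite A" "\<And>a. a \<in> A \<Longrightarrow> f a \<in> fkc n"
  shows "tn p (sum f A) - (\<Sum>a\<in>A. tn p (f a)) \<in> Nt (W_mod n)"
  using assms
proof (induction A)
  case empty
  then show ?case using tn_rels(4)[OF fkc_0] by simp
next
  case (insert a A)
  have "sum f A \<in> fkc n" using insert by (intro fkc_sum) auto
  then have "(tn p (f a + sum f A) - tn p (f a) - tn p (sum f A)) + (tn p (sum f A) - (\<Sum>a\<in>A. tn p (f a))) \<in> Nt (W_mod n)"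
    using insert by (intro T.N_add tn_rels(3)) auto
  then show ?case using insert(1,2) by (simp add: algebra_simps)
qed

definition nf :: "(fermion \<Rightarrow>\<^sub>0 complex bpoly) \<Rightarrow> ((complex bpoly \<times> fermion set) \<Rightarrow>\<^sub>0 int)"
  where "nf c = (\<Sum>b\<in>keys c. tn (coef c b) b)"

text \<open>In the free abelian group a formal tensor with first factor 0 is not 0. Enlarging the
  index set therefore changes the sum, but only by elements of the relation subgroup.\<close>

private lemma nf_superset:
  assumes "finite K" "keys c \<subseteq> K" "K \<subseteq> fkc n"
  shows "nf c - (\<Sum>b\<in>K. tn (coef c b) b) \<in> Nt (W_mod n)"
proof -
  have "(\<Sum>b\<in>K. tn (coef c b) b) = (\<Sum>b\<in>K - keys c. tn (coef c b) b) + nf c"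
    unfolding nf_def by (rule sum.subset_diff[OF assms(2,1)])
  moreover have "(\<Sum>b\<in>K - keys c. tn (coef c b) b) \<in> Nt (W_mod n)"
    by (rule T.N_sum) (use assms tn_rels(2) in \<open>auto simp: in_keys_iff\<close>)
  then have "- (\<Sum>b\<in>K - keys c. tn (coef c b) b) \<in> Nt (W_mod n)" by (rule T.N_minus)
  ultimately show ?thesis by (simp only: diff_add_eq_diff_diff_swap diff_self diff_0)
qed

private lemma nf_diff:
  assumes c: "keys c \<subseteq> fkc n" "keys e \<subseteq> fkc n"
  shows "nf (c - e) - (nf c - nf e) \<in> Nt (W_mod n)"
proof -
  let ?K = "keys c \<union> keys e"
  have K: "finite ?K" "?K \<subseteq> fkc n" using c by auto
  have ce: "keys (c - e) \<subseteq> ?K" by (rule keys_diff)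
  have 1: "nf (c - e) - (\<Sum>b\<in>?K. tn (coef (c - e) b) b) \<in> Nt (W_mod n)"
    by (rule nf_superset[OF K(1) ce K(2)])
  have 2: "nf c - (\<Sum>b\<in>?K. tn (coef c b) b) \<in> Nt (W_mod n)" "nf e - (\<Sum>b\<in>?K. tn (coef e b) b) \<in> Nt (W_mod n)"
    by (rule nf_superset[OF K(1) _ K(2)]; simp)+
  have 3: "(\<Sum>b\<in>?K. tn (coef (c - e) b) b - (tn (coef c b) b - tn (coef e b) b)) \<in> Nt (W_mod n)"
    unfolding lookup_minus by (rule T.N_sum) (use K(2) tn_rels(1) in blast)
  show ?thesis
    using T.N_add[OF T.N_add[OF 1 3] T.N_diff[OF 2(2) 2(1)]] by (simp add: sum_subtractf sum.distrib algebra_simps)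
qed

text \<open>The second factor is replaced by a combination of elements of I with the same class in
  W_{2n}, and its complex coefficients are moved into the first factor.\<close>

private lemma nf_exists:
  assumes I: "I \<subseteq> fkc n" "\<And>w. w \<in> fkc n \<Longrightarrow> \<exists>c. keys c \<subseteq> I \<and> w - lcomb c \<in> U n"
    and z: "z \<in> carrier (tensor_pre D_alg (W_mod n))"
  shows "\<exists>c. keys c \<subseteq> I \<and> z - nf c \<in> Nt (W_mod n)"
proof -
  have "keys z \<subseteq> Dset \<times> carrier (W_mod n)" using z by (simp add: T_ops)
  then show ?thesis
  proof (induction z rule: frag_induction)
    case zero
    then show ?case using T.N_0 by (intro exI[of _ 0]) (simp add: nf_def)
  next
    case (one i)
    then obtain d w where i: "i = (d, H.ccl w)" "d \<in> Dset" "w \<in> fkc n" by (auto simp: W_carrier)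
    obtain c where c: "keys c \<subseteq> I" "w - lcomb c \<in> U n" using I(2)[OF i(3)] by blast
    let ?p = "eta d"
    define e where "e = sm ?p (Poly_Mapping.map Cst c)"
    have e: "coef e b = Cst (coef c b) * ?p" for b by (simp add: e_def coef_sm coef_map mult.commute)
    have ke: "keys e \<subseteq> keys c" by (auto simp: in_keys_iff e)
    have cf: "keys c \<subseteq> fkc n" using c(1) I(1) by blast
    have "H.ccl w = H.ccl (lcomb c)" using c(2) by (simp only: H.ccl_eq)
    then have "frag_of i = tn ?p (\<Sum>b\<in>keys c. sm (coef c b) b)"
      using i(2) by (simp add: i(1) tn_def iot_eta lcomb_def)
    moreover have 1: "tn ?p (\<Sum>b\<in>keys c. sm (coef c b) b) - (\<Sum>b\<in>keys c. tn ?p (sm (coef c b) b)) \<in> Nt (W_mod n)"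
      by (rule tn_sum) (use cf fkc_sm in auto)
    moreover have 2: "(\<Sum>b\<in>keys c. tn ?p (sm (coef c b) b) - tn (coef e b) b) \<in> Nt (W_mod n)"
      unfolding e by (rule T.N_sum) (use cf tn_rels(5) in blast)
    moreover have 3: "nf e - (\<Sum>b\<in>keys c. tn (coef e b) b) \<in> Nt (W_mod n)"
      by (rule nf_superset[OF _ ke cf]) simp
    ultimately have "frag_of i - nf e \<in> Nt (W_mod n)"
      using T.N_diff[OF T.N_add[OF 1 2] 3] by (simp add: sum_subtractf algebra_simps)
    then show ?case using ke c(1) by blast
  next
    case (diff y z)
    then obtain c e where ce: "keys c \<subseteq> I" "y - nf c \<in> Nt (W_mod n)" "keys e \<subseteq> I" "z - nf e \<in> Nt (W_mod n)"
      by blast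
    have "(y - nf c) - (z - nf e) - (nf (c - e) - (nf c - nf e)) \<in> Nt (W_mod n)"
      by (intro T.N_diff nf_diff ce(2,4)) (use ce I(1) in auto)
    then have "y - z - nf (c - e) \<in> Nt (W_mod n)" by (simp add: algebra_simps)
    then show ?case using ce keys_diff[of c e] by (intro exI[of _ "c - e"]) auto
  qed
qed

private lemma unten_nf:
  assumes "keys c \<subseteq> fkc n"
  shows "unten (nf c) - comb c \<in> U n"
proof -
  have "unten (nf c) - comb c = (\<Sum>b\<in>keys c. sm (coef c b) (emb (rep (H.ccl b) - b)))"
    unfolding nf_def comb_def unten_additive tn_def unten_of eta_iot emb_diff sm_diff by (simp only: sum_subtractf)
  also have "\<dots> \<in> U n" using assms rep_ccl(2) by (intro U_sum U_sm emb_U) blast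
  finally show ?thesis .
qed

text \<open>After reduction to a normal form \<open>nf c\<close>, the value of \<open>unten\<close>
  is \<open>comb c\<close> modulo \<open>U n\<close>; independence of I over polynomials then forces
  c = 0.\<close>

private lemma unten_kernel:
  assumes z: "z \<in> carrier (tensor_pre D_alg (W_mod n))" "unten z \<in> U n"
  shows "z \<in> Nt (W_mod n)"
proof -
  obtain I where I: "I \<subseteq> fkc n" and gen: "\<And>w. w \<in> fkc n \<Longrightarrow> \<exists>c. keys c \<subseteq> I \<and> w - lcomb c \<in> U n"
    and ind: "\<And>c. keys c \<subseteq> I \<Longrightarrow> lcomb c \<in> U n \<Longrightarrow> c = 0"
    by (rule basis_mod_U[of n]) blast
  obtain c where c: "keys c \<subseteq> I" "z - nf c \<in> Nt (W_mod n)" using nf_exists[OF I gen z(1)] by blast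
  have 1: "unten z - unten (nf c) \<in> U n" using unten_Nt[OF c(2)] by (simp only: unten_additive)
  have "unten (nf c) - comb c \<in> U n" using c(1) I by (intro unten_nf) auto
  from U_diff[OF U_diff[OF z(2) 1] this] have "comb c \<in> U n" by (simp del: image_iff)
  then have "c = 0" using comb_inj_U[OF ind] c(1) by blast
  then show ?thesis using c(2) by (simp add: nf_def)
qed

private lemma unten_onto:
  assumes x: "x \<in> fkc n"
  shows "\<exists>z\<in>carrier (tensor_pre D_alg (W_mod n)). unten z - x \<in> U n"
proof
  let ?z = "\<Sum>T\<in>keys x. tn (coef x T) (sg T 1)"
  have T: "sg T 1 \<in> fkc n" if "T \<in> keys x" for T using x that by (auto simp: fkc_def)
  have "tn p w \<in> carrier (tensor_pre D_alg (W_mod n))" if "w \<in> fkc n" for p w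
    using that by (auto simp: tn_def T_ops iot_Dset W_carrier)
  then show "?z \<in> carrier (tensor_pre D_alg (W_mod n))" using T by (intro T.C_sum) blast
  have "unten ?z - x = (\<Sum>T\<in>keys x. sm (coef x T) (emb (rep (H.ccl (sg T 1)) - sg T 1)))"
    unfolding emb_diff sm_diff unten_additive tn_def unten_of eta_iot sum_subtractf sum_emb[of x, symmetric] ..
  also have "\<dots> \<in> U n" using T rep_ccl(2) by (intro U_sum U_sm emb_U) blast
  finally show "unten ?z - x \<in> U n" .
qed

lemma DW_iso_Q: "\<exists>\<gamma>. \<gamma> \<in> mod_iso D_alg (DW_mod n) (Q_mod n)"
  and DW_module: "Module.module D_alg (DW_mod n)"
proof -
  have DW: "DW_mod n = T.Q" by (simp add: DW_mod_def tensor_module_def)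
  show "Module.module D_alg (DW_mod n)" unfolding DW by (rule T.module_Q)
  let ?f = "\<lambda>z. Phi (unten z)"
  define \<gamma> where "\<gamma> = induced_map (V_mod n) (Q_sub n) ?f"
  have 1: "?f z \<in> carrier (V_mod n)" if "z \<in> carrier (tensor_pre D_alg (W_mod n))" for z
    unfolding V_ops using unten_fkc[OF that] by (rule Phi_fkc)
  have 2: "?f z \<in> Q_sub n" if "z \<in> Nt (W_mod n)" for z
    unfolding Q_sub_eq using unten_Nt[OF that] by blast
  have 3: "?f (y + z) - (?f y + ?f z) \<in> Q_sub n" for y z
    using Q.N_0 by (simp add: unten_add Fk.Phi_add)
  have 4: "?f (d \<odot>\<^bsub>tensor_pre D_alg (W_mod n)\<^esub> z) - d \<odot>\<^bsub>V_mod n\<^esub> ?f z \<in> Q_sub n" if "d \<in> Dset" for d z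
    using Q.N_0 unfolding T_ops(4) V_ops(4) unten_tsm poly_mult_Phi[OF that] by simp
  have hom: "\<gamma> \<in> mod_hom D_alg T.Q Q.Q"
    unfolding \<gamma>_def by (rule induced_map_hom(2)[OF T.quot_setup_axioms Q.quot_setup_axioms]; rule 1 2 3 4; assumption)
  have ccl: "\<gamma> (T.ccl z) = Q.ccl (?f z)" if "z \<in> carrier (tensor_pre D_alg (W_mod n))" for z
    unfolding \<gamma>_def
    by (rule induced_map_hom(1)[OF T.quot_setup_axioms Q.quot_setup_axioms]; (rule that | rule 1 2 3 4; assumption))
  have "bij_betw \<gamma> (carrier T.Q) (carrier Q.Q)"
    unfolding bij_betw_def
  proof (intro conjI inj_onI)
    fix X Y assume "X \<in> carrier T.Q" "Y \<in> carrier T.Q" and eq: "\<gamma> X = \<gamma> Y"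
    then obtain y z where yz: "y \<in> carrier (tensor_pre D_alg (W_mod n))" "X = T.ccl y"
        "z \<in> carrier (tensor_pre D_alg (W_mod n))" "Y = T.ccl z"
      unfolding T.carrier_Q by blast
    have "Q.ccl (?f y) = Q.ccl (?f z)" using eq yz by (simp only: ccl)
    then have "unten y - unten z \<in> U n" using qcl_eq[OF unten_fkc unten_fkc] yz by simp
    then have "unten (y - z) \<in> U n" by (simp only: unten_additive)
    then have "y - z \<in> Nt (W_mod n)" using T.C_diff yz by (intro unten_kernel)
    then show "X = Y" using yz by (simp only: T.ccl_eq)
  next
    show "\<gamma> ` carrier T.Q = carrier Q.Q"
    proof
      show "\<gamma> ` carrier T.Q \<subseteq> carrier Q.Q" using mod_homD(1)[OF hom] by blast
      show "carrier Q.Q \<subseteq> \<gamma> ` carrier T.Q"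
      proof
        fix X assume "X \<in> carrier Q.Q"
        then obtain v where v: "v \<in> range (sg n)" "X = Q.ccl v" by (auto simp: Q.carrier_Q V_ops)
        obtain x where x: "x \<in> fkc n" "Phi x = v" using Phi_onto[OF v(1)] by blast
        obtain z where z: "z \<in> carrier (tensor_pre D_alg (W_mod n))" "unten z - x \<in> U n"
          using unten_onto[OF x(1)] by blast
        have "\<gamma> (T.ccl z) = X"
          unfolding ccl[OF z(1)] v(2) x(2)[symmetric] using z(2) qcl_eq[OF unten_fkc[OF z(1)] x(1)] by blast
        then show "X \<in> \<gamma> ` carrier T.Q" using z(1) unfolding T.carrier_Q by blast
      qed
    qed
  qed
  then show "\<exists>\<gamma>. \<gamma> \<in> mod_iso D_alg (DW_mod n) (Q_mod n)"
    unfolding mod_iso_def DW Q_mod_def using hom by blast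
qed

end

theorem theorem1:
  fixes m :: int
  assumes "m \<ge> 0"
  shows "free_resolution D_alg (\<lambda>k. Q_mod (m + int k)) (\<lambda>k. Q_map (m + int k)) (A_proj m) (A_mod m)
    \<and> (\<forall>n\<ge>m. mod_iso D_alg (Q_mod n) (DW_mod n) \<noteq> {})
    \<and> (\<exists>\<phi> d \<epsilon>.
         (\<forall>k. \<phi> k \<in> mod_iso D_alg (Q_mod (m + int k)) (DW_mod (m + int k))) \<and>
         (\<forall>k. \<forall>X\<in>carrier (Q_mod (m + int (Suc k))). d k (\<phi> (Suc k) X) = \<phi> k (Q_map (m + int k) X)) \<and>
         (\<forall>X\<in>carrier (Q_mod m). \<epsilon> (\<phi> 0 X) = A_proj m X) \<and>
         free_resolution D_alg (\<lambda>k. DW_mod (m + int k)) d \<epsilon> (A_mod m))"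
proof (intro conjI)
  show res: "free_resolution D_alg (\<lambda>k. Q_mod (m + int k)) (\<lambda>k. Q_map (m + int k)) (A_proj m) (A_mod m)"
    unfolding free_resolution_def using Q_resolution[OF assms] free_Q_mod by blast
  have iso: "\<exists>\<phi>. \<phi> \<in> mod_iso D_alg (Q_mod n) (DW_mod n)" for n
    using DW_iso_Q[of n] mod_iso_inverse[OF _ DW_module] by blast
  then show "\<forall>n\<ge>m. mod_iso D_alg (Q_mod n) (DW_mod n) \<noteq> {}" by blast
  obtain \<phi> where \<phi>: "\<phi> n \<in> mod_iso D_alg (Q_mod n) (DW_mod n)" for n using iso by metis
  \<comment> \<open>The isomorphisms were chosen separately for each n; conjugating with them
    defines the differentials on the tensor side.\<close>
  have "\<exists>d \<epsilon>. (\<forall>k. \<forall>X\<in>carrier (Q_mod (m + int (Suc k))). d k (\<phi> (m + int (Suc k)) X) = \<phi> (m + int k) (Q_map (m + int k) X)) \<and>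
      (\<forall>X\<in>carrier (Q_mod (m + int 0)). \<epsilon> (\<phi> (m + int 0) X) = A_proj m X) \<and>
      free_resolution D_alg (\<lambda>k. DW_mod (m + int k)) d \<epsilon> (A_mod m)"
    by (rule free_resolution_iso[where \<phi> = "\<lambda>k. \<phi> (m + int k)" and P' = "\<lambda>k. DW_mod (m + int k)", OF res \<phi> DW_module])
  then show "\<exists>\<phi> d \<epsilon>.
         (\<forall>k. \<phi> k \<in> mod_iso D_alg (Q_mod (m + int k)) (DW_mod (m + int k))) \<and>
         (\<forall>k. \<forall>X\<in>carrier (Q_mod (m + int (Suc k))). d k (\<phi> (Suc k) X) = \<phi> k (Q_map (m + int k) X)) \<and>
         (\<forall>X\<in>carrier (Q_mod m). \<epsilon> (\<phi> 0 X) = A_proj m X) \<and>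
         free_resolution D_alg (\<lambda>k. DW_mod (m + int k)) d \<epsilon> (A_mod m)"
    using \<phi> by (intro exI[of _ "\<lambda>k. \<phi> (m + int k)"]) simp
qed

end
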